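(* Let $\Omega\subseteq\mathbb R^n$ be a $p$-convex domain ($1\le p\le n$), let $\varphi\in C^2(\Omega)$ be $p$-plurisubharmonic, and let $\psi\in C^2(\Omega)$ be such that $-e^{-\psi}$ is $p$-plurisubharmonic. Let $\alpha\in[0,1)$ be a constant and $f\in L^2_p(\Omega,\mathrm{Loc})$ a closed $p$-form such that $F_\psi^{-1}f$ is defined almost everywhere and $\int_\Omega\langle F_\psi^{-1}f,f\rangle e^{-\varphi+\alpha\psi}<\infty$. Then there exists $u\in L^2_{p-1}(\Omega,\varphi-\alpha\psi)$ with $du=f$ and $$\|u\|^2_{\varphi-\alpha\psi}\le\frac{4}{(1-\alpha)^2}\int_\Omega\langle F_\psi^{-1}f,f\rangle e^{-\varphi+\alpha\psi}.$$
   Context: Euclidean metric on $\mathbb R^n$; summation convention. A symmetric matrix is $p$-positive semi-definite if the sum of any $p$ of its eigenvalues is nonnegative; a $C^2$ function is $p$-plurisubharmonic if its Hessian is $p$-positive semi-definite everywhere; an open set is $p$-convex if it admits a smooth $p$-plurisubharmonic proper exhaustion function. For a $C^2$ function $\psi$, $F_\psi g=\psi_{jk}\,dx^k\wedge(\partial_j\lrcorner g)$ on $p$-forms; $F^{-1}:=(F|_{\mathrm{Im}F})^{-1}$ on $\mathrm{Im}F$ for self-adjoint $F$, so $F_\psi^{-1}f$ is defined at $x$ iff $f(x)\in\mathrm{Im}F_\psi(x)$. $L^2_p(\Omega,\phi)$: $p$-forms with $\|u\|_\phi^2=\int_\Omega|u|^2e^{-\phi}<\infty$; $L^2_p(\Omega,\mathrm{Loc})$: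 locally square integrable; closedness and $du=f$ in the sense of distributions. *)

theory Defs
  imports "HOL-Analysis.Analysis"
begin

definition pd :: "'n::finite \<Rightarrow> (real^'n \<Rightarrow> real) \<Rightarrow> real^'n \<Rightarrow> real" where
  "pd j f x = deriv (\<lambda>t. f (x + t *\<^sub>R axis j 1)) 0"

fun pds :: "'n::finite list \<Rightarrow> (real^'n \<Rightarrow> real) \<Rightarrow> real^'n \<Rightarrow> real" where
  "pds [] f = f"
| "pds (j # js) f = pd j (pds js f)"

definition Ck_on :: "nat \<Rightarrow> (real^'n::finite) set \<Rightarrow> (real^'n \<Rightarrow> real) \<Rightarrow> bool" where
  "Ck_on k \<Omega> f \<longleftrightarrow>
     (\<forall>js. length js \<le> k \<longrightarrow> continuous_on \<Omega> (pds js f)) \<and>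
     (\<forall>js. length js < k \<longrightarrow> (\<forall>x\<in>\<Omega>. \<forall>j.
        (\<lambda>t. pds js f (x + t *\<^sub>R axis j 1)) differentiable (at 0)))"

definition smooth_on :: "(real^'n::finite) set \<Rightarrow> (real^'n \<Rightarrow> real) \<Rightarrow> bool" where
  "smooth_on \<Omega> f \<longleftrightarrow> (\<forall>k. Ck_on k \<Omega> f)"

definition hess :: "(real^'n::finite \<Rightarrow> real) \<Rightarrow> real^'n \<Rightarrow> real^'n^'n" where
  "hess f x = (\<chi> j k. pd j (pd k f) x)"

text \<open>A symmetric matrix is p-positive semi-definite if the sum of any p of its eigenvalues
  (counted with multiplicity) is nonnegative. The eigenvalues with multiplicity of a symmetric
  matrix are the values lambda_i attached to an orthonormal eigenbasis b_i.\<close>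
definition p_psd :: "nat \<Rightarrow> real^'n^'n::finite \<Rightarrow> bool" where
  "p_psd p A \<longleftrightarrow> transpose A = A \<and>
     (\<forall>(b :: 'n \<Rightarrow> real^'n) (lam :: 'n \<Rightarrow> real).
        (\<forall>i j. b i \<bullet> b j = (if i = j then 1 else 0)) \<and> (\<forall>i. A *v b i = lam i *\<^sub>R b i)
        \<longrightarrow> (\<forall>S. card S = p \<longrightarrow> sum lam S \<ge> 0))"

definition p_psh :: "nat \<Rightarrow> (real^'n::finite) set \<Rightarrow> (real^'n \<Rightarrow> real) \<Rightarrow> bool" where
  "p_psh p \<Omega> f \<longleftrightarrow> Ck_on 2 \<Omega> f \<and> (\<forall>x\<in>\<Omega>. p_psd p (hess f x))"

definition p_convex :: "nat \<Rightarrow> (real^'n::finite) set \<Rightarrow> bool" where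
  "p_convex p \<Omega> \<longleftrightarrow> open \<Omega> \<and> (\<exists>\<rho>. smooth_on \<Omega> \<rho> \<and> p_psh p \<Omega> \<rho> \<and>
       (\<forall>c. compact {x\<in>\<Omega>. \<rho> x \<le> c}))"

text \<open>A q-form at a point is represented by its antisymmetric coefficient family
  c :: 'n list \<Rightarrow> real (c [i1,...,iq] is the coefficient u_{i1...iq}), vanishing on lists
  of length different from q.\<close>
definition altform :: "nat \<Rightarrow> ('n list \<Rightarrow> real) \<Rightarrow> bool" where
  "altform q c \<longleftrightarrow> (\<forall>l. length l \<noteq> q \<longrightarrow> c l = 0) \<and>
     (\<forall>l i j. length l = q \<longrightarrow> i < q \<longrightarrow> j < q \<longrightarrow> i \<noteq> j \<longrightarrow>
        c (l[i := l ! j, j := l ! i]) = - c l)"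

text \<open>Pointwise inner product of q-forms (= sum over increasing multi-indices).\<close>
definition finner :: "nat \<Rightarrow> ('n::finite list \<Rightarrow> real) \<Rightarrow> ('n list \<Rightarrow> real) \<Rightarrow> real" where
  "finner q a b = (\<Sum>l\<in>{l. length l = q}. a l * b l) / fact q"

definition fnorm2 :: "nat \<Rightarrow> ('n::finite list \<Rightarrow> real) \<Rightarrow> real" where
  "fnorm2 q a = finner q a a"

text \<open>F_H g = H_jk dx^k \<and> (d_j \<lrcorner> g), in components
  (F_H g)_{i1..ip} = sum_s sum_j H_{i_s j} g_{i1..j..ip} (j in position s).\<close>
definition Fop :: "real^'n^'n::finite \<Rightarrow> ('n list \<Rightarrow> real) \<Rightarrow> ('n list \<Rightarrow> real)" where
  "Fop H c = (\<lambda>l. \<Sum>s<length l. \<Sum>j\<in>UNIV. H $ (l ! s) $ j * c (l[s := j]))"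

definition Fim :: "nat \<Rightarrow> real^'n^'n::finite \<Rightarrow> ('n list \<Rightarrow> real) set" where
  "Fim p H = Fop H ` {c. altform p c}"

text \<open>F^{-1} := (F restricted to Im F)^{-1}, defined on Im F.\<close>
definition Finv :: "nat \<Rightarrow> real^'n^'n::finite \<Rightarrow> ('n list \<Rightarrow> real) \<Rightarrow> ('n list \<Rightarrow> real)" where
  "Finv p H f = (THE g. g \<in> Fim p H \<and> Fop H g = f)"

definition test_fun :: "(real^'n::finite) set \<Rightarrow> (real^'n \<Rightarrow> real) \<Rightarrow> bool" where
  "test_fun \<Omega> g \<longleftrightarrow> smooth_on UNIV g \<and>
     (\<exists>K. compact K \<and> K \<subseteq> \<Omega> \<and> (\<forall>x. x \<notin> K \<longrightarrow> g x = 0))"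

definition measurable_form :: "nat \<Rightarrow> (real^'n::finite) set \<Rightarrow> (real^'n \<Rightarrow> 'n list \<Rightarrow> real) \<Rightarrow> bool" where
  "measurable_form q \<Omega> u \<longleftrightarrow> (\<forall>x\<in>\<Omega>. altform q (u x)) \<and>
     (\<forall>l. (\<lambda>x. u x l) \<in> borel_measurable (lebesgue_on \<Omega>))"

definition L2loc :: "nat \<Rightarrow> (real^'n::finite) set \<Rightarrow> (real^'n \<Rightarrow> 'n list \<Rightarrow> real) \<Rightarrow> bool" where
  "L2loc q \<Omega> u \<longleftrightarrow> measurable_form q \<Omega> u \<and>
     (\<forall>K. compact K \<and> K \<subseteq> \<Omega> \<longrightarrow>
        (\<integral>\<^sup>+ x\<in>K. ennreal (fnorm2 q (u x)) \<partial>lebesgue) < \<infinity>)"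

definition wnorm2 :: "nat \<Rightarrow> (real^'n::finite) set \<Rightarrow> (real^'n \<Rightarrow> real) \<Rightarrow> (real^'n \<Rightarrow> 'n list \<Rightarrow> real) \<Rightarrow> ennreal" where
  "wnorm2 q \<Omega> w u = (\<integral>\<^sup>+ x\<in>\<Omega>. ennreal (fnorm2 q (u x) * exp (- w x)) \<partial>lebesgue)"

definition L2w :: "nat \<Rightarrow> (real^'n::finite) set \<Rightarrow> (real^'n \<Rightarrow> real) \<Rightarrow> (real^'n \<Rightarrow> 'n list \<Rightarrow> real) \<Rightarrow> bool" where
  "L2w q \<Omega> w u \<longleftrightarrow> measurable_form q \<Omega> u \<and> wnorm2 q \<Omega> w u < \<infinity>"

text \<open>du = f in the sense of distributions, u a q-form, f a (q+1)-form, where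
  (du)_{i0..iq} = sum_s (-1)^s d_{i_s} u_{i0..(i_s omitted)..iq}.\<close>
definition weak_d :: "nat \<Rightarrow> (real^'n::finite) set \<Rightarrow> (real^'n \<Rightarrow> 'n list \<Rightarrow> real) \<Rightarrow> (real^'n \<Rightarrow> 'n list \<Rightarrow> real) \<Rightarrow> bool" where
  "weak_d q \<Omega> u f \<longleftrightarrow> (\<forall>g l. test_fun \<Omega> g \<longrightarrow> length l = Suc q \<longrightarrow>
      (LINT x|lebesgue_on \<Omega>. f x l * g x) =
      - (\<Sum>s<Suc q. (-1) ^ s * (LINT x|lebesgue_on \<Omega>. u x (take s l @ drop (Suc s) l) * pd (l ! s) g x)))"

definition weakly_closed :: "nat \<Rightarrow> (real^'n::finite) set \<Rightarrow> (real^'n \<Rightarrow> 'n list \<Rightarrow> real) \<Rightarrow> bool" where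
  "weakly_closed q \<Omega> f \<longleftrightarrow> weak_d q \<Omega> f (\<lambda>x l. 0)"

end

theory Submission
  imports Defs
begin

text \<open>Hoermander's \<open>L\<^sup>2\<close> method with Blocki's trick. On a sublevel set \<open>U\<close> of the exhaustion one adds to the
 weight a convex function of the exhaustion that blows up at the boundary of \<open>U\<close>. Then cut-offs have negligible
 gradients, and the Bochner identity holds for every closed form in the domain of the adjoint, although \<open>U\<close>
 has no regular boundary; duality and the Riesz theorem solve \<open>du = f\<close> on \<open>U\<close>.
 Let \<open>u\<close> be the solution on \<open>U\<close> that is minimal in \<open>L\<^sup>2(\<phi> + b \<psi>)\<close> with \<open>b = (1 - \<alpha>) / 2\<close>, and \<open>c = 1 - b\<close>. Then
 \<open>v = e\<^sup>c\<^sup>\<psi> u\<close> is minimal in \<open>L\<^sup>2(\<phi> + \<psi>)\<close> among the solutions of \<open>dv = e\<^sup>c\<^sup>\<psi> (f + c d\<psi> \<and> u)\<close>. Since the Hessian form of \<open>\<psi>\<close>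
 dominates the square of the contraction with \<open>d\<psi>\<close>, the estimate for \<open>v\<close> reads \<open>\<parallel>u\<parallel> \<le> \<surd>I + c \<parallel>u\<parallel>\<close>, where \<open>I\<close> is the
 integral of \<open>\<langle>F\<^sup>-\<^sup>1 f, f\<rangle>\<close>, and this gives the constant \<open>4 / (1 - \<alpha>)\<^sup>2\<close>.\<close>

subsection \<open>Alternating families and the quadratic form of a matrix\<close>

text \<open>All bounds come from duality with test forms, which decides where the weights enter. The
  weight that blows up at the boundary of \<open>U\<close> is chosen anew for each test form
  \<open>g\<close>: it vanishes on the support of \<open>g\<close>, so neither \<open>g\<close> nor
  its weighted adjoint sees it, while the closed part \<open>g1\<close> of \<open>g\<close>, which
  is only square integrable, can be cut off at its expense, its Hessian absorbing the gradients of
  the cut-offs. On \<Omega> the factor by which solutions are twisted may be unbounded and destroy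
  square integrability; on a relatively compact sublevel set all weights are comparable, so a
  minimal solution exists there and can be twisted. The local solutions are neither glued nor passed
  to a weak limit: every test form on \<Omega> lives in one sublevel set, the local solution bounds
  its pairing with \<open>f\<close> by a constant independent of that set, and Riesz is used once
  more, on \<Omega>. Forms are functions with alternating coefficients at every point, summed over
  all index lists; hence the factors \<open>Suc q\<close> and \<open>fact q\<close>, and hence
  limits that are also taken pointwise along subsequences.\<close>

definition LL :: "nat \<Rightarrow> 'n list set" where
 "LL q = {l. length l = q}"

lemma finite_LL [simp]: "finite (LL q :: 'n::finite list set)"
 using finite_lists_length_eq[of "UNIV :: 'n set" q] by (simp add: LL_def)

text \<open>The sum runs over all index lists and not only over increasing ones, so it is
  \<open>fact q\<close> times \<open>fnorm2 q\<close>.\<close>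

abbreviation nsq :: "nat \<Rightarrow> ('n list \<Rightarrow> real) \<Rightarrow> real" where
 "nsq q g \<equiv> \<Sum>l\<in>LL q. (g l)\<^sup>2"

text \<open>The density is extended by zero: integrals over \<open>U\<close> become integrals over
  the whole space, and the values of \<open>W\<close> outside \<open>U\<close> never enter.\<close>

abbreviation wt :: "'a set \<Rightarrow> ('a \<Rightarrow> real) \<Rightarrow> 'a \<Rightarrow> real" where
 "wt U W x \<equiv> indicator U x * exp (- W x)"

lemma LL_0 [simp]: "LL 0 = {[]}"
 by (auto simp: LL_def)

lemma Cons_LL_iff [simp]: "j # I \<in> LL (Suc q) \<longleftrightarrow> I \<in> LL q"
 by (simp add: LL_def)

lemma sum_LL_Suc:
 fixes F :: "'n::finite list \<Rightarrow> real"
 shows "(\<Sum>l\<in>LL (Suc q). F l) = (\<Sum>j\<in>UNIV. \<Sum>I\<in>LL q. F (j # I))"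
proof -
 have "(\<Sum>l\<in>LL (Suc q). F l) = (\<Sum>l\<in>(\<lambda>(j, I). j # I) ` (UNIV \<times> LL q). F l)"
  by (rule arg_cong[where f = "sum F"]) (auto simp: LL_def length_Suc_conv image_iff)
 also have "\<dots> = (\<Sum>z\<in>UNIV \<times> LL q. F (fst z # snd z))"
  by (subst sum.reindex) (auto simp: inj_on_def case_prod_beta)
 also have "\<dots> = (\<Sum>j\<in>UNIV. \<Sum>I\<in>LL q. F (j # I))"
  by (simp add: sum.cartesian_product case_prod_beta)
 finally show ?thesis .
qed

text \<open>These are the coefficients of the sum over j of dx^j wedge a_j. In the recursion the
  first index is either supplied by its own differential, or it stays in a_k and dx^k moves past it
  with a sign. With a_j the partial derivatives of u this is du; with a_j = psi_j u it is the
  product of d psi and u.\<close>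

fun wdg :: "('n \<Rightarrow> 'n list \<Rightarrow> real) \<Rightarrow> 'n list \<Rightarrow> real" where
 "wdg a [] = 0"
| "wdg a (x # I) = a x I - wdg (\<lambda>k J. a k (x # J)) I"

lemma wdg_eq_sum:
 "wdg a l = (\<Sum>s<length l. (-1) ^ s * a (l ! s) (take s l @ drop (Suc s) l))"
proof (induction l arbitrary: a)
 case (Cons x I)
 show ?case
  unfolding wdg.simps Cons.IH
  by (simp add: sum.lessThan_Suc_shift sum_negf del: sum.lessThan_Suc)
qed simp

text \<open>Exchanges of neighbours suit induction on lists. The length is left free so that fixing
  the first index, as in \<open>\<lambda>J. c (x # J)\<close>, stays inside the class.\<close>

definition alt :: "('n list \<Rightarrow> real) \<Rightarrow> bool" where
 "alt c \<longleftrightarrow> (\<forall>xs x y ys. c (xs @ x # y # ys) = - c (xs @ y # x # ys))"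

lemma altD:
 assumes "alt c" shows "c (xs @ x # y # ys) = - c (xs @ y # x # ys)"
 using assms[unfolded alt_def, THEN spec, of xs, THEN spec, of x, THEN spec, of y, THEN spec, of ys] .

lemma altI: "(\<And>xs x y ys. c (xs @ x # y # ys) = - c (xs @ y # x # ys)) \<Longrightarrow> alt c"
 by (subst alt_def) (intro allI)

lemma altD0: "alt c \<Longrightarrow> c (x # y # ys) = - c (y # x # ys)"
 using altD[of c "[]" x y ys] by simp

lemma alt_zero: "alt (\<lambda>l. 0)"
 by (rule altI) simp

lemma alt_Cons: "alt c \<Longrightarrow> alt (\<lambda>J. c (x # J))"
 by (rule altI) (metis altD append_Cons)

lemma alt_move:
 assumes "alt c"
 shows "c (xs @ a # ys @ zs) = (-1) ^ length ys * c (xs @ ys @ a # zs)"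
proof (induction ys arbitrary: xs)
 case (Cons b ys)
 have "c (xs @ a # (b # ys) @ zs) = - c ((xs @ [b]) @ a # ys @ zs)"
  using altD[OF assms, of xs a b "ys @ zs"] by simp
 then show ?case using Cons.IH[of "xs @ [b]"] by simp
qed simp

lemma alt_swap:
 assumes "alt c"
 shows "c (xs @ a # ys @ b # zs) = - c (xs @ b # ys @ a # zs)"
proof -
 have "c (xs @ a # ys @ b # zs) = (-1) ^ length ys * c (xs @ ys @ a # b # zs)"
  using alt_move[OF assms, of xs a ys "b # zs"] by simp
 also have "\<dots> = - ((-1) ^ length ys * c (xs @ ys @ b # a # zs))"
  using altD[OF assms, of "xs @ ys" a b zs] by simp
 also have "\<dots> = - c (xs @ b # ys @ a # zs)"
  using alt_move[OF assms, of xs b ys "a # zs"] by simp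
 finally show ?thesis .
qed

text \<open>An exchange of two distant entries is an odd number of exchanges of neighbours: the
  signs for crossing the block between them occur twice and cancel, and one exchange
  remains.\<close>

lemma altform_iff: "altform q c \<longleftrightarrow> alt c \<and> (\<forall>l. length l \<noteq> q \<longrightarrow> c l = 0)"
proof
 assume A: "altform q c"
 have "c (xs @ x # y # ys) = - c (xs @ y # x # ys)" for xs x y ys
 proof (cases "length (xs @ x # y # ys) = q")
  case True
  let ?l = "xs @ y # x # ys"
  have "c (?l[length xs := ?l ! Suc (length xs), Suc (length xs) := ?l ! length xs]) = - c ?l"
   using A True unfolding altform_def by (metis add_Suc_right length_Cons length_append less_add_Suc1 less_Suc_eq n_not_Suc_n not_less_eq)
  moreover have n: "?l ! length xs = y" "?l ! Suc (length xs) = x"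
   by (simp_all add: nth_append)
  moreover have "?l[length xs := x, Suc (length xs) := y] = xs @ x # y # ys"
   by (simp add: list_update_append)
  ultimately show ?thesis by metis
 next
  case False
  then show ?thesis using A unfolding altform_def by simp
 qed
 then have "alt c" by (rule altI)
 then show "alt c \<and> (\<forall>l. length l \<noteq> q \<longrightarrow> c l = 0)"
  using A by (simp add: altform_def)
next
 assume A: "alt c \<and> (\<forall>l. length l \<noteq> q \<longrightarrow> c l = 0)"
 have lt: "c (l[i := l ! j, j := l ! i]) = - c l" if "i < j" "j < length l" for l i j
 proof -
  define xs where "xs = take i l"
  define ys where "ys = take (j - Suc i) (drop (Suc i) l)"
  define zs where "zs = drop (Suc j) l"
  have d: "drop (Suc i) l = ys @ l ! j # zs"
  proof -
   have "drop (Suc i) l = ys @ drop (j - Suc i) (drop (Suc i) l)"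
    by (simp only: ys_def append_take_drop_id)
   also have "drop (j - Suc i) (drop (Suc i) l) = drop j l"
    using that by simp
   also have "\<dots> = l ! j # zs"
    using that by (simp add: Cons_nth_drop_Suc zs_def)
   finally show ?thesis .
  qed
  have l: "l = xs @ l ! i # ys @ l ! j # zs"
   using that id_take_nth_drop[of i l] d by (simp add: xs_def)
  have lx: "length xs = i" and ly: "length ys = j - Suc i"
   using that by (auto simp: xs_def ys_def)
  obtain a b where ab: "a = l ! i" "b = l ! j" by blast
  have l': "l = xs @ a # ys @ b # zs" using l ab by simp
  have "l[i := b] = (xs @ b # ys) @ b # zs"
   unfolding l' lx[symmetric] by simp
  moreover have "j = length (xs @ b # ys)"
   using that lx ly by simp
  ultimately have "l[i := b, j := a] = xs @ b # ys @ a # zs"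
   by (simp only: list_update_length) simp
  then have "c (l[i := b, j := a]) = - c l"
   using alt_swap[of c xs b ys a zs] A l' by metis
  then show ?thesis unfolding ab .
 qed
 have "c (l[i := l ! j, j := l ! i]) = - c l"
  if "length l = q" "i < q" "j < q" "i \<noteq> j" for l i j
 proof (cases "i < j")
  case True
  then show ?thesis using lt[of i j l] that(1,3) by blast
 next
  case False
  then have "c (l[j := l ! i, i := l ! j]) = - c l"
   using lt[of j i l] that by (metis linorder_neqE_nat)
  then show ?thesis using list_update_swap[OF that(4), of l "l ! j" "l ! i"] by metis
 qed
 then show "altform q c" using A by (simp add: altform_def)
qed

lemma alt_wdg:
 assumes "\<And>j. alt (a j)"
 shows "alt (wdg a)"
proof -
 have "wdg a (xs @ x # y # ys) = - wdg a (xs @ y # x # ys)" for xs x y ys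
  using assms
 proof (induction xs arbitrary: a)
  case Nil
  have "wdg (\<lambda>k J. a k (x # y # J)) ys = - wdg (\<lambda>k J. a k (y # x # J)) ys"
   unfolding wdg_eq_sum by (simp add: altD0[OF Nil, of _ x y] sum_negf)
  then show ?case by simp
 next
  case (Cons z xs)
  have "wdg (\<lambda>k J. a k (z # J)) (xs @ x # y # ys) = - wdg (\<lambda>k J. a k (z # J)) (xs @ y # x # ys)"
   by (rule Cons.IH) (rule alt_Cons[OF Cons.prems])
  moreover have "a z (xs @ x # y # ys) = - a z (xs @ y # x # ys)"
   by (rule altD[OF Cons.prems])
  ultimately show ?case by simp
 qed
 then show ?thesis by (rule altI)
qed

text \<open>Wedge and contraction are adjoint; \<open>Suc q\<close> counts the positions at which
  the differential can stand, all of which contribute equally. In the induction the terms that keep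
  the first index return after an exchange of the first two indices of \<open>g\<close>, whose sign
  cancels the minus in \<open>wdg\<close>.\<close>

lemma wdg_adjoint:
 fixes g :: "'n::finite list \<Rightarrow> real"
 assumes "alt g"
 shows "(\<Sum>l\<in>LL (Suc q). wdg a l * g l) = Suc q * (\<Sum>j\<in>UNIV. \<Sum>I\<in>LL q. a j I * g (j # I))"
 using assms
proof (induction q arbitrary: a g)
 case 0
 show ?case by (simp add: sum_LL_Suc)
next
 case (Suc q)
 have "(\<Sum>l\<in>LL (Suc (Suc q)). wdg a l * g l)
   = (\<Sum>j\<in>UNIV. \<Sum>I\<in>LL (Suc q). a j I * g (j # I))
    - (\<Sum>j\<in>UNIV. \<Sum>I\<in>LL (Suc q). wdg (\<lambda>k J. a k (j # J)) I * g (j # I))"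
  by (subst sum_LL_Suc) (simp add: left_diff_distrib sum_subtractf)
 also have "(\<Sum>j\<in>UNIV. \<Sum>I\<in>LL (Suc q). wdg (\<lambda>k J. a k (j # J)) I * g (j # I))
   = (\<Sum>j\<in>UNIV. Suc q * (\<Sum>k\<in>UNIV. \<Sum>J\<in>LL q. a k (j # J) * g (j # k # J)))"
  by (intro sum.cong refl) (rule Suc.IH, rule alt_Cons, rule Suc.prems)
 also have "\<dots> = - (Suc q * (\<Sum>k\<in>UNIV. \<Sum>j\<in>UNIV. \<Sum>J\<in>LL q. a k (j # J) * g (k # j # J)))"
 proof -
  have "(\<Sum>j\<in>UNIV. Suc q * (\<Sum>k\<in>UNIV. \<Sum>J\<in>LL q. a k (j # J) * g (j # k # J)))
   = (\<Sum>j\<in>UNIV. \<Sum>k\<in>UNIV. - (Suc q * (\<Sum>J\<in>LL q. a k (j # J) * g (k # j # J))))"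
   unfolding sum_distrib_left sum_negf[symmetric]
  proof (intro sum.cong refl)
   fix j k J
   show "Suc q * (a k (j # J) * g (j # k # J)) = - (Suc q * (a k (j # J) * g (k # j # J)))"
    using altD0[OF Suc.prems, of j k J] by simp
  qed
  also have "\<dots> = (\<Sum>k\<in>UNIV. \<Sum>j\<in>UNIV. - (Suc q * (\<Sum>J\<in>LL q. a k (j # J) * g (k # j # J))))"
   by (rule sum.swap)
  finally show ?thesis by (simp add: sum_distrib_left sum_negf)
 qed
 also have "(\<Sum>k\<in>UNIV. \<Sum>j\<in>UNIV. \<Sum>J\<in>LL q. a k (j # J) * g (k # j # J))
   = (\<Sum>k\<in>UNIV. \<Sum>I\<in>LL (Suc q). a k I * g (k # I))"
  by (simp add: sum_LL_Suc)
 finally show ?case by (simp add: algebra_simps)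
qed

lemma wdg_cong:
 assumes "\<And>j J. a j J = b j J" shows "wdg a l = wdg b l"
 unfolding wdg_eq_sum assms ..

text \<open>This is d d = 0 on the level of coefficients. It will be used with \<open>a j k\<close>
  the second derivatives of a test function times a coefficient of u; symmetric entries cancel in
  pairs.\<close>

lemma wdg_wdg:
 assumes "\<And>j k J. a j k J = a k j J"
 shows "wdg (\<lambda>j. wdg (a j)) l = 0"
 using assms
proof (induction l arbitrary: a)
 case (Cons x I)
 have "wdg (\<lambda>k J. wdg (a k) (x # J)) I
   = wdg (\<lambda>k J. a k x J) I - wdg (\<lambda>k. wdg (\<lambda>m J. a k m (x # J))) I"
  by (simp add: wdg_eq_sum[where l = I] right_diff_distrib sum_subtractf)
 also have "wdg (\<lambda>k. wdg (\<lambda>m J. a k m (x # J))) I = 0"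
  by (rule Cons.IH) (rule Cons.prems)
 also have "wdg (\<lambda>k J. a k x J) I = wdg (a x) I"
  by (rule wdg_cong) (rule Cons.prems)
 finally show ?case by simp
qed simp

text \<open>\<open>eps l\<close> is the constant form dx^{l_1} wedge ... wedge dx^{l_p}. As a
  function of two lists it is the generalised Kronecker symbol: the sign of the permutation that
  carries \<open>l\<close> to \<open>m\<close>, and 0 if there is none or if \<open>l\<close> has a
  repeated entry.\<close>

fun eps :: "'n list \<Rightarrow> 'n list \<Rightarrow> real" where
 "eps [] m = (if m = [] then 1 else 0)"
| "eps (i # l) m = wdg (\<lambda>j J. if j = i then eps l J else 0) m"

lemma alt_eps: "alt (eps l)"
proof (induction l)
 case Nil
 show ?case by (rule altI) simp
next
 case (Cons i l)
 have "eps (i # l) = wdg (\<lambda>j J. if j = i then eps l J else 0)"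
  by (rule ext) simp
 moreover have "alt (\<lambda>J. if j = i then eps l J else 0)" for j
  using Cons by (cases "j = i") (simp_all add: alt_zero)
 ultimately show ?case using alt_wdg[of "\<lambda>j J. if j = i then eps l J else 0"] by simp
qed

lemma eps_length: "length m \<noteq> length l \<Longrightarrow> eps l m = 0"
proof (induction l arbitrary: m)
 case (Cons i l)
 have "(if m ! s = i then eps l (take s m @ drop (Suc s) m) else 0) = 0" if "s < length m" for s
  using Cons.prems that by (auto intro!: Cons.IH)
 then show ?case by (auto simp: wdg_eq_sum)
qed simp

text \<open>Pairing with \<open>eps l\<close> isolates one coefficient. This is how identities
  between pairings of forms are turned into identities for single coefficients.\<close>

lemma eps_pairing:
 fixes c :: "'n::finite list \<Rightarrow> real"
 assumes "alt c"
 shows "(\<Sum>m\<in>LL (length l). eps l m * c m) = fact (length l) * c l"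
 using assms
proof (induction l arbitrary: c)
 case (Cons i l)
 have "(\<Sum>m\<in>LL (length (i # l)). eps (i # l) m * c m)
   = Suc (length l) * (\<Sum>j\<in>UNIV. \<Sum>I\<in>LL (length l). (if j = i then eps l I else 0) * c (j # I))"
  using wdg_adjoint[OF Cons.prems, where q = "length l" and a = "\<lambda>j J. if j = i then eps l J else 0"] by simp
 also have "(\<Sum>j\<in>UNIV. \<Sum>I\<in>LL (length l). (if j = i then eps l I else 0) * c (j # I))
   = (\<Sum>j\<in>UNIV. if j = i then \<Sum>I\<in>LL (length l). eps l I * c (j # I) else 0)"
  by (intro sum.cong refl) auto
 also have "\<dots> = (\<Sum>I\<in>LL (length l). eps l I * c (i # I))"
  by simp
 also have "\<dots> = fact (length l) * c (i # l)"
  using Cons.IH[OF alt_Cons[OF Cons.prems]] by simp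
 finally show ?case by simp
qed simp

text \<open>Adjointness is used twice: to pair \<open>wdg a\<close> with itself, and for the term
  that the recursion of \<open>wdg\<close> then leaves. With \<open>a\<close> a gradient, the cross
  terms are those that integration by parts converts into the square of the adjoint and the Hessian
  of the weight.\<close>

lemma wdg_norm:
 fixes a :: "'n::finite \<Rightarrow> 'n list \<Rightarrow> real"
 assumes "\<And>j. alt (a j)"
 shows "(\<Sum>l\<in>LL (Suc (Suc q)). (wdg a l)\<^sup>2)
  = Suc (Suc q) * ((\<Sum>j\<in>UNIV. \<Sum>I\<in>LL (Suc q). (a j I)\<^sup>2)
    - Suc q * (\<Sum>J\<in>LL q. \<Sum>j\<in>UNIV. \<Sum>k\<in>UNIV. a k (j # J) * a j (k # J)))"
proof -
 have 1: "(\<Sum>I\<in>LL (Suc q). a j I * wdg a (j # I)) = (\<Sum>I\<in>LL (Suc q). (a j I)\<^sup>2)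
   - Suc q * (\<Sum>k\<in>UNIV. \<Sum>J\<in>LL q. a k (j # J) * a j (k # J))" for j
  using wdg_adjoint[where g = "a j" and q = q and a = "\<lambda>k J. a k (j # J)", OF assms]
  by (simp add: right_diff_distrib sum_subtractf power2_eq_square mult.commute)
 have 2: "(\<Sum>j\<in>UNIV. \<Sum>k\<in>UNIV. \<Sum>J\<in>LL q. a k (j # J) * a j (k # J))
  = (\<Sum>J\<in>LL q. \<Sum>j\<in>UNIV. \<Sum>k\<in>UNIV. a k (j # J) * a j (k # J))"
 proof -
  have "(\<Sum>j\<in>UNIV. \<Sum>k\<in>UNIV. \<Sum>J\<in>LL q. a k (j # J) * a j (k # J))
   = (\<Sum>j\<in>UNIV. \<Sum>J\<in>LL q. \<Sum>k\<in>UNIV. a k (j # J) * a j (k # J))"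
   by (rule sum.cong[OF refl], rule sum.swap)
  also have "\<dots> = (\<Sum>J\<in>LL q. \<Sum>j\<in>UNIV. \<Sum>k\<in>UNIV. a k (j # J) * a j (k # J))"
   by (rule sum.swap)
  finally show ?thesis .
 qed
 show ?thesis
  using wdg_adjoint[OF alt_wdg[of a], where q = "Suc q" and a = a] assms
  by (simp add: 1 sum_subtractf sum_distrib_left[symmetric] 2 power2_eq_square del: wdg.simps)
qed

text \<open>Adjointness writes the left side S as a pairing with itself, and 2xy \<le> x^2 + y^2
  leaves S/2 on the right. The constant is crude, but it will only multiply gradients of cut-offs,
  which are made negligible.\<close>

lemma wdg_norm_le:
 fixes a :: "'n::finite \<Rightarrow> 'n list \<Rightarrow> real"
 assumes "\<And>j. alt (a j)"
 shows "(\<Sum>l\<in>LL (Suc q). (wdg a l)\<^sup>2) \<le> (Suc q)\<^sup>2 * (\<Sum>j\<in>UNIV. \<Sum>I\<in>LL q. (a j I)\<^sup>2)"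
proof -
 have am: "x * y \<le> (x\<^sup>2 + y\<^sup>2) / 2" for x y :: real
  using sum_squares_bound[of x y] by simp
 define S where "S = (\<Sum>l\<in>LL (Suc q). (wdg a l)\<^sup>2)"
 define N where "N = (\<Sum>j\<in>UNIV. \<Sum>I\<in>LL q. (a j I)\<^sup>2)"
 have "S = Suc q * (\<Sum>j\<in>UNIV. \<Sum>I\<in>LL q. a j I * wdg a (j # I))"
  using wdg_adjoint[OF alt_wdg[of a], where q = q and a = a] assms
  by (simp add: S_def power2_eq_square)
 also have "\<dots> = (\<Sum>j\<in>UNIV. \<Sum>I\<in>LL q. (Suc q * a j I) * wdg a (j # I))"
  by (simp add: sum_distrib_left mult.assoc)
 also have "\<dots> \<le> (\<Sum>j\<in>UNIV. \<Sum>I\<in>LL q. ((Suc q * a j I)\<^sup>2 + (wdg a (j # I))\<^sup>2) / 2)"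
 proof (intro sum_mono)
  fix j and I :: "'n list"
  show "(Suc q * a j I) * wdg a (j # I) \<le> ((Suc q * a j I)\<^sup>2 + (wdg a (j # I))\<^sup>2) / 2"
   by (rule am)
 qed
 also have "\<dots> = ((\<Sum>j\<in>UNIV. \<Sum>I\<in>LL q. (Suc q * a j I)\<^sup>2) + S) / 2"
  unfolding S_def sum_LL_Suc by (simp only: sum.distrib sum_divide_distrib[symmetric])
 also have "(\<Sum>j\<in>UNIV. \<Sum>I\<in>LL q. (Suc q * a j I)\<^sup>2) = (Suc q)\<^sup>2 * N"
  by (simp only: power_mult_distrib N_def sum_distrib_left of_nat_power)
 finally show ?thesis unfolding S_def N_def by simp
qed

text \<open>Up to a constant this is the pairing of F_H g with g, written by contracting the first
  slot only. It is the shape in which a Hessian appears in the Bochner identity.\<close>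

definition Qf :: "real^'n^'n \<Rightarrow> nat \<Rightarrow> ('n::finite list \<Rightarrow> real) \<Rightarrow> real" where
 "Qf H q g = (\<Sum>I\<in>LL q. \<Sum>j\<in>UNIV. \<Sum>k\<in>UNIV. H $ j $ k * g (j # I) * g (k # I))"

lemma Fop_Nil [simp]: "Fop H c [] = 0"
 by (simp add: Fop_def)

lemma Fop_Cons: "Fop H c (i # l) = (\<Sum>j\<in>UNIV. H $ i $ j * c (j # l)) + Fop H (\<lambda>m. c (i # m)) l"
 by (simp add: Fop_def sum.lessThan_Suc_shift del: sum.lessThan_Suc)

lemma Qf_Suc:
 assumes "alt g"
 shows "(\<Sum>i\<in>UNIV. Qf H q (\<lambda>m. g (i # m))) = Qf H (Suc q) g"
proof -
 have "Qf H q (\<lambda>m. g (i # m)) = (\<Sum>I\<in>LL q. \<Sum>j\<in>UNIV. \<Sum>k\<in>UNIV. H $ j $ k * g (j # i # I) * g (k # i # I))" for i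
  unfolding Qf_def
 proof (intro sum.cong refl)
  fix j k I
  show "H $ j $ k * g (i # j # I) * g (i # k # I) = H $ j $ k * g (j # i # I) * g (k # i # I)"
   using altD0[OF assms, of i j I] altD0[OF assms, of i k I] by simp
 qed
 then show ?thesis by (simp add: Qf_def sum_LL_Suc)
qed

text \<open>F_H acts on each of the \<open>Suc q\<close> slots in turn; since \<open>g\<close>
  alternates, every slot can be moved to the front and contributes the same amount.\<close>

lemma Fop_Qf:
 assumes "alt g"
 shows "(\<Sum>l\<in>LL (Suc q). Fop H g l * g l) = Suc q * Qf H q g"
 using assms
proof (induction q arbitrary: g)
 case 0
 have "(\<Sum>i\<in>UNIV. (\<Sum>j\<in>UNIV. H $ i $ j * g [j]) * g [i])
   = (\<Sum>i\<in>UNIV. \<Sum>j\<in>UNIV. H $ i $ j * g [i] * g [j])"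
  by (intro sum.cong refl) (simp add: sum_distrib_left sum_distrib_right mult_ac)
 then show ?case by (simp add: sum_LL_Suc Qf_def Fop_Cons)
next
 case (Suc q)
 have "(\<Sum>l\<in>LL (Suc (Suc q)). Fop H g l * g l)
   = (\<Sum>i\<in>UNIV. \<Sum>l\<in>LL (Suc q). (\<Sum>j\<in>UNIV. H $ i $ j * g (j # l)) * g (i # l))
    + (\<Sum>i\<in>UNIV. \<Sum>l\<in>LL (Suc q). Fop H (\<lambda>m. g (i # m)) l * g (i # l))"
  by (subst sum_LL_Suc) (simp add: Fop_Cons distrib_right sum.distrib)
 also have "(\<Sum>i\<in>UNIV. \<Sum>l\<in>LL (Suc q). Fop H (\<lambda>m. g (i # m)) l * g (i # l))
   = (\<Sum>i\<in>UNIV. Suc q * Qf H q (\<lambda>m. g (i # m)))"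
  by (intro sum.cong refl) (rule Suc.IH, rule alt_Cons, rule Suc.prems)
 also have "\<dots> = Suc q * Qf H (Suc q) g"
  by (simp only: sum_distrib_left[symmetric] Qf_Suc[OF Suc.prems])
 also have "(\<Sum>i\<in>UNIV. \<Sum>l\<in>LL (Suc q). (\<Sum>j\<in>UNIV. H $ i $ j * g (j # l)) * g (i # l))
   = Qf H (Suc q) g"
  unfolding Qf_def
  by (subst sum.swap) (intro sum.cong refl, simp add: sum_distrib_left sum_distrib_right mult_ac)
 finally show ?case by (simp add: algebra_simps)
qed

section \<open>Spectral theorem for symmetric matrices\<close>

lemma symmetric_matrix_inner:
 fixes A :: "real^'n^'n"
 assumes "transpose A = A"
 shows "x \<bullet> (A *v y) = (A *v x) \<bullet> y"
 by (metis assms dot_lmul_matrix transpose_matrix_vector)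

text \<open>A maximum point of the Rayleigh quotient on the unit sphere of \<open>S\<close> is an
  eigenvector, and its orthogonal complement in \<open>S\<close> is again invariant. Stating this
  for invariant subspaces lets the induction run on the dimension.\<close>

lemma spectral_subspace:
 fixes A :: "real^'n^'n"
 assumes sym: "transpose A = A"
  and "subspace S" "\<And>x. x \<in> S \<Longrightarrow> A *v x \<in> S"
 shows "\<exists>B\<subseteq>S. finite B \<and> card B = dim S \<and> pairwise orthogonal B \<and>
     (\<forall>x\<in>B. norm x = 1 \<and> (\<exists>l. A *v x = l *\<^sub>R x))"
 using assms(2,3)
proof (induction "dim S" arbitrary: S)
 case 0
 then show ?case by (intro exI[of _ "{}"]) auto
next
 case (Suc m)
 let ?K = "S \<inter> sphere 0 1"
 have "compact ?K"
  using closed_subspace[OF Suc.prems(1)] by (simp add: closed_Int_compact)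
 moreover have "?K \<noteq> {}"
 proof -
  have "\<not> S \<subseteq> {0}" using Suc(2) by (metis dim_eq_0 nat.distinct(1))
  then obtain x where "x \<in> S" "x \<noteq> 0" by blast
  then have "(1 / norm x) *\<^sub>R x \<in> ?K"
   using Suc.prems(1) by (auto simp: subspace_scale)
  then show ?thesis by blast
 qed
 moreover have "continuous_on ?K (\<lambda>x. x \<bullet> (A *v x))"
  by (intro continuous_on_inner continuous_on_id linear_continuous_on matrix_vector_mul_bounded_linear)
 ultimately have "\<exists>x\<in>?K. \<forall>y\<in>?K. y \<bullet> (A *v y) \<le> x \<bullet> (A *v x)"
  by (rule continuous_attains_sup)
 then obtain x where x: "x \<in> ?K" and mx: "\<And>y. y \<in> ?K \<Longrightarrow> y \<bullet> (A *v y) \<le> x \<bullet> (A *v x)"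
  by blast
 define l where "l = x \<bullet> (A *v x)"
 have xS: "x \<in> S" and nx: "norm x = 1" using x by auto
 have ray: "y \<bullet> (A *v y) \<le> l * (y \<bullet> y)" if "y \<in> S" for y
 proof (cases "y = 0")
  case False
  let ?z = "(1 / norm y) *\<^sub>R y"
  have "?z \<in> ?K" using that False Suc.prems(1) by (auto simp: subspace_scale)
  from mx[OF this] have "(1 / norm y) * ((1 / norm y) * (y \<bullet> (A *v y))) \<le> l"
   by (simp add: l_def matrix_vector_mult_scaleR)
  then show ?thesis using False
   by (simp add: field_simps power2_eq_square dot_square_norm)
 qed simp
 \<comment> \<open>First variation: moving the maximum point \<open>x\<close> in the direction
   \<open>y\<close> cannot increase the quotient, so the term linear in \<open>t\<close> must
   vanish.\<close>
 have orth: "y \<bullet> (A *v x - l *\<^sub>R x) = 0" if "y \<in> S" for y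
 proof -
  define c where "c = y \<bullet> (A *v x - l *\<^sub>R x)"
  define d where "d = l * (y \<bullet> y) - y \<bullet> (A *v y)"
  have "2 * t * c \<le> t\<^sup>2 * d" for t
  proof -
   have "x + t *\<^sub>R y \<in> S" using that xS Suc.prems(1) by (simp add: subspace_add subspace_scale)
   from ray[OF this] have "x \<bullet> (A *v x) + t * (x \<bullet> (A *v y)) + t * (y \<bullet> (A *v x)) + t * (t * (y \<bullet> (A *v y)))
     \<le> l * (x \<bullet> x + t * (x \<bullet> y) + t * (y \<bullet> x) + t * (t * (y \<bullet> y)))"
    by (simp add: matrix_vector_right_distrib matrix_vector_mult_scaleR inner_add_left inner_add_right algebra_simps)
   moreover have "x \<bullet> (A *v y) = y \<bullet> (A *v x)"
    using symmetric_matrix_inner[OF sym, of x y] by (simp add: inner_commute)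
   moreover have "x \<bullet> x = 1" using nx by (simp add: dot_square_norm)
   ultimately show ?thesis
    unfolding c_def d_def l_def[symmetric]
    by (simp add: inner_diff_right inner_commute[of x y] power2_eq_square algebra_simps)
  qed
  note h = this
  have "c = 0"
  proof (rule ccontr)
   assume "c \<noteq> 0"
   have d0: "0 \<le> d" using ray[OF that] by (simp add: d_def)
   \<comment> \<open>With this choice the inequality for t = s becomes 2 s^2 (d + 1) \<le> s^2 d,
     which forces s = 0. The 1 in the denominator covers the case d = 0.\<close>
   define s where "s = c / (d + 1)"
   have cs: "c = s * (d + 1)" using d0 by (simp add: s_def)
   then have "0 < s\<^sup>2" using \<open>c \<noteq> 0\<close> by auto
   then have "0 < s\<^sup>2 * (d + 2)" using d0 by (intro mult_pos_pos) auto
   moreover have "2 * s * c \<le> s\<^sup>2 * d" by (rule h)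
   then have "s\<^sup>2 * (d + 2) \<le> 0" unfolding cs by (simp add: algebra_simps power2_eq_square)
   ultimately show False by linarith
  qed
  then show ?thesis by (simp add: c_def)
 qed
 have "A *v x - l *\<^sub>R x \<in> S"
  using Suc.prems xS by (simp add: subspace_diff subspace_scale)
 from orth[OF this] have eig: "A *v x = l *\<^sub>R x" by simp
 define S' where "S' = {y \<in> S. x \<bullet> y = 0}"
 have S': "S' = {y \<in> S. \<forall>z\<in>span {x}. orthogonal z y}"
  by (auto simp: S'_def orthogonal_def span_singleton)
 have "dim S' + dim (span {x}) = dim S"
  unfolding S' using xS Suc.prems(1)
  by (intro dim_subspace_orthogonal_to_vectors) (auto simp: span_minimal)
 moreover have "dim (span {x}) = 1"
 proof -
  have "x \<noteq> 0" using nx by auto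
  then have "independent {x}" by simp
  then show ?thesis by (simp only: dim_span dim_eq_card_independent) simp
 qed
 ultimately have dS': "dim S = Suc (dim S')" by simp
 have sub': "subspace S'"
  using Suc.prems(1) unfolding S'_def subspace_def by (auto simp: inner_add_right)
 have inv': "A *v y \<in> S'" if "y \<in> S'" for y
  using that Suc.prems(2) symmetric_matrix_inner[OF sym, of x y] eig by (auto simp: S'_def)
 have "\<exists>B\<subseteq>S'. finite B \<and> card B = dim S' \<and> pairwise orthogonal B \<and>
     (\<forall>x\<in>B. norm x = 1 \<and> (\<exists>l. A *v x = l *\<^sub>R x))"
  by (rule Suc.hyps(1)) (use Suc(2) dS' sub' inv' in auto)
 then obtain B where B: "B \<subseteq> S'" "finite B" "card B = dim S'" "pairwise orthogonal B"
  "\<forall>x\<in>B. norm x = 1 \<and> (\<exists>l. A *v x = l *\<^sub>R x)" by blast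
 have "x \<notin> B" using B(1) nx by (auto simp: S'_def)
 moreover have "\<forall>y\<in>B. orthogonal x y" using B(1) by (auto simp: S'_def orthogonal_def)
 ultimately have "insert x B \<subseteq> S \<and> finite (insert x B) \<and> card (insert x B) = dim S \<and>
   pairwise orthogonal (insert x B) \<and> (\<forall>x\<in>insert x B. norm x = 1 \<and> (\<exists>l. A *v x = l *\<^sub>R x))"
  using B xS nx eig dS'
  by (auto simp: S'_def pairwise_insert orthogonal_commute)
 then show ?case by blast
qed

definition eigenbasis :: "real^'n^'n \<Rightarrow> ('n::finite \<Rightarrow> real^'n) \<Rightarrow> ('n \<Rightarrow> real) \<Rightarrow> bool" where
 "eigenbasis A b lam \<longleftrightarrow> (\<forall>i j. b i \<bullet> b j = (if i = j then 1 else 0)) \<and> (\<forall>i. A *v b i = lam i *\<^sub>R b i)"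

lemma eigenbasisD:
 assumes "eigenbasis A b lam"
 shows "b i \<bullet> b j = (if i = j then 1 else 0)" "A *v b i = lam i *\<^sub>R b i"
 using assms unfolding eigenbasis_def by (metis, metis)

lemma spectral_theorem:
 fixes A :: "real^'n^'n"
 assumes "transpose A = A"
 shows "\<exists>b lam. eigenbasis A b lam"
proof -
 obtain B :: "(real^'n) set" where B: "finite B" "card B = CARD('n)" "pairwise orthogonal B"
  "\<forall>x\<in>B. norm x = 1 \<and> (\<exists>l. A *v x = l *\<^sub>R x)"
  using spectral_subspace[OF assms, of UNIV] by auto
 obtain b where b: "bij_betw b (UNIV :: 'n set) B"
  using finite_same_card_bij[of "UNIV :: 'n set" B] B by auto
 have bB: "b i \<in> B" for i using b by (auto simp: bij_betw_def)
 have "\<forall>i. \<exists>l. A *v b i = l *\<^sub>R b i" using B(4) bB by blast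
 from choice[OF this] obtain lam where lam: "\<And>i. A *v b i = lam i *\<^sub>R b i" by blast
 have "b i \<bullet> b j = (if i = j then 1 else 0)" for i j
 proof (cases "i = j")
  case True
  then show ?thesis using B(4) bB[of i] by (simp add: dot_square_norm)
 next
  case False
  then have "b i \<noteq> b j" using b by (auto simp: bij_betw_def inj_def)
  then show ?thesis using B(3) bB False by (auto simp: pairwise_def orthogonal_def)
 qed
 then have "eigenbasis A b lam" using lam unfolding eigenbasis_def by (intro conjI allI)
 then show ?thesis by blast
qed

text \<open>For a square matrix a right inverse is also a left inverse, so orthonormal rows have
  orthonormal columns.\<close>

lemma orthonormal_columns:
 fixes b :: "'n::finite \<Rightarrow> real^'n"
 assumes "\<And>i j. b i \<bullet> b j = (if i = j then 1 else 0)"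
 shows "(\<Sum>i\<in>UNIV. b i $ j * b i $ k) = (if j = k then 1 else 0)"
proof -
 define M :: "real^'n^'n" where "M = (\<chi> i j. b i $ j)"
 have "M ** transpose M = mat 1"
  by (auto simp: vec_eq_iff M_def matrix_matrix_mult_def transpose_def mat_def
    assms[unfolded inner_vec_def, simplified])
 then have "transpose M ** M = mat 1" by (simp add: matrix_left_right_inverse)
 then have "(transpose M ** M) $ j $ k = mat 1 $ j $ k" by simp
 then show ?thesis by (simp add: M_def matrix_matrix_mult_def transpose_def mat_def)
qed

text \<open>\<open>tr b g [i1,...,ip]\<close> is g evaluated on the vectors b_i1, ..., b_ip, that
  is, the coefficient of the form in the frame \<open>b\<close>.\<close>

fun tr :: "('n::finite \<Rightarrow> real^'n) \<Rightarrow> ('n list \<Rightarrow> real) \<Rightarrow> 'n list \<Rightarrow> real" where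
 "tr b g [] = g []"
| "tr b g (i # L) = (\<Sum>j\<in>UNIV. b i $ j * tr b (\<lambda>l. g (j # l)) L)"

lemma tr_add: "tr b (\<lambda>l. g l + h l) L = tr b g L + tr b h L"
 by (induction L arbitrary: g h) (simp_all add: distrib_left sum.distrib)

lemma tr_cmult: "tr b (\<lambda>l. r * g l) L = r * tr b g L"
 by (induction L arbitrary: g) (simp_all add: sum_distrib_left mult_ac)

lemma tr_zero: "tr b (\<lambda>l. 0) L = 0"
 using tr_cmult[of b 0 "\<lambda>l. 0" L] by simp

lemma tr_sum: "finite S \<Longrightarrow> tr b (\<lambda>l. \<Sum>s\<in>S. g s l) L = (\<Sum>s\<in>S. tr b (g s) L)"
 by (induction S rule: finite_induct) (simp_all add: tr_add tr_zero)

lemma tr_parseval: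
 assumes on: "\<And>i j. b i \<bullet> b j = (if i = j then 1 else 0)"
 shows "(\<Sum>L\<in>LL q. tr b g L * tr b h L) = (\<Sum>l\<in>LL q. g l * h l)"
proof (induction q arbitrary: g h)
 case (Suc q)
 have "(\<Sum>L\<in>LL (Suc q). tr b g L * tr b h L)
   = (\<Sum>i\<in>UNIV. \<Sum>L\<in>LL q. \<Sum>j\<in>UNIV. \<Sum>k\<in>UNIV. (b i $ j * b i $ k) *
      (tr b (\<lambda>l. g (j # l)) L * tr b (\<lambda>l. h (k # l)) L))"
  by (simp add: sum_LL_Suc sum_product mult_ac)
 also have "\<dots> = (\<Sum>L\<in>LL q. \<Sum>j\<in>UNIV. \<Sum>k\<in>UNIV. \<Sum>i\<in>UNIV. (b i $ j * b i $ k) *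
      (tr b (\<lambda>l. g (j # l)) L * tr b (\<lambda>l. h (k # l)) L))"
  by (subst sum.swap, rule sum.cong[OF refl], subst sum.swap, rule sum.cong[OF refl], rule sum.swap)
 also have "\<dots> = (\<Sum>L\<in>LL q. \<Sum>j\<in>UNIV. \<Sum>k\<in>UNIV. (if j = k then 1 else 0) *
      (tr b (\<lambda>l. g (j # l)) L * tr b (\<lambda>l. h (k # l)) L))"
  by (simp only: sum_distrib_right[symmetric] orthonormal_columns[OF on])
 also have "\<dots> = (\<Sum>L\<in>LL q. \<Sum>j\<in>UNIV. tr b (\<lambda>l. g (j # l)) L * tr b (\<lambda>l. h (j # l)) L)"
  by (simp add: if_distrib[of "\<lambda>x. x * _"] cong: if_cong)
 also have "\<dots> = (\<Sum>j\<in>UNIV. \<Sum>l\<in>LL q. g (j # l) * h (j # l))"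
  by (subst sum.swap) (simp add: Suc.IH)
 also have "\<dots> = (\<Sum>l\<in>LL (Suc q). g l * h l)"
  by (simp add: sum_LL_Suc)
 finally show ?case .
qed simp

lemma alt_tr: 
 assumes "alt g" shows "alt (tr b g)"
proof -
 have "tr b g (xs @ x # y # ys) = - tr b g (xs @ y # x # ys)" for xs x y ys
  using assms
 proof (induction xs arbitrary: g)
  case Nil
  have "tr b g (x # y # ys) = (\<Sum>j\<in>UNIV. \<Sum>k\<in>UNIV. b x $ j * b y $ k * tr b (\<lambda>l. g (j # k # l)) ys)"
   by (simp add: sum_distrib_left mult_ac)
  also have "\<dots> = (\<Sum>j\<in>UNIV. \<Sum>k\<in>UNIV. - (b y $ k * b x $ j * tr b (\<lambda>l. g (k # j # l)) ys))"
  proof (intro sum.cong refl)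
   fix j k
   have "tr b (\<lambda>l. g (j # k # l)) ys = tr b (\<lambda>l. (-1) * g (k # j # l)) ys"
   proof -
    have "(\<lambda>l. g (j # k # l)) = (\<lambda>l. (-1) * g (k # j # l))"
    proof
     fix l
     show "g (j # k # l) = (-1) * g (k # j # l)" using altD0[OF Nil, of j k l] by simp
    qed
    then show ?thesis by simp
   qed
   then show "b x $ j * b y $ k * tr b (\<lambda>l. g (j # k # l)) ys
     = - (b y $ k * b x $ j * tr b (\<lambda>l. g (k # j # l)) ys)"
    unfolding tr_cmult by simp
  qed
  also have "\<dots> = (\<Sum>k\<in>UNIV. \<Sum>j\<in>UNIV. - (b y $ k * b x $ j * tr b (\<lambda>l. g (k # j # l)) ys))"
   by (rule sum.swap)
  also have "\<dots> = - tr b g (y # x # ys)"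
   by (simp add: sum_distrib_left mult_ac sum_negf)
  finally show ?case by simp
 next
  case (Cons z xs)
  have "tr b (\<lambda>l. g (j # l)) (xs @ x # y # ys) = - tr b (\<lambda>l. g (j # l)) (xs @ y # x # ys)" for j
   by (rule Cons.IH) (rule alt_Cons[OF Cons.prems])
  then show ?case by (simp add: sum_negf)
 qed
 then show ?thesis by (rule altI)
qed

text \<open>In an eigenframe of \<open>H\<close> the operator F_H is diagonal, and its eigenvalue at
  an index list is the sum of the eigenvalues of \<open>H\<close> over the list. This is the link
  between p-positivity of \<open>H\<close> and positivity of F_H on p-forms.\<close>

lemma tr_Fop:
 fixes H :: "real^'n^'n"
 assumes sym: "transpose H = H" and eig: "\<And>i. H *v b i = lam i *\<^sub>R b i"
 shows "tr b (Fop H g) L = (sum_list (map lam L)) * tr b g L"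
proof (induction L arbitrary: g)
 case (Cons i L)
 have col: "(\<Sum>j\<in>UNIV. b i $ j * H $ j $ k) = lam i * b i $ k" for k
 proof -
  have "(\<Sum>j\<in>UNIV. b i $ j * H $ j $ k) = (\<Sum>j\<in>UNIV. H $ k $ j * b i $ j)"
  proof (intro sum.cong refl)
   fix j
   have "H $ j $ k = transpose H $ k $ j" by (simp add: transpose_def)
   then show "b i $ j * H $ j $ k = H $ k $ j * b i $ j" by (simp add: sym)
  qed
  also have "\<dots> = (H *v b i) $ k" by (simp add: matrix_vector_mult_def)
  finally show ?thesis by (simp add: eig)
 qed
 have "tr b (Fop H g) (i # L)
   = (\<Sum>j\<in>UNIV. b i $ j * (\<Sum>k\<in>UNIV. H $ j $ k * tr b (\<lambda>l. g (k # l)) L))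
    + (\<Sum>j\<in>UNIV. b i $ j * tr b (Fop H (\<lambda>m. g (j # m))) L)"
  by (simp add: Fop_Cons tr_add tr_sum tr_cmult distrib_left sum.distrib)
 also have "(\<Sum>j\<in>UNIV. b i $ j * tr b (Fop H (\<lambda>m. g (j # m))) L) = sum_list (map lam L) * tr b g (i # L)"
  by (simp add: Cons.IH sum_distrib_left mult_ac)
 also have "(\<Sum>j\<in>UNIV. b i $ j * (\<Sum>k\<in>UNIV. H $ j $ k * tr b (\<lambda>l. g (k # l)) L))
   = (\<Sum>k\<in>UNIV. (\<Sum>j\<in>UNIV. b i $ j * H $ j $ k) * tr b (\<lambda>l. g (k # l)) L)"
  unfolding sum_distrib_left sum_distrib_right
  by (subst sum.swap) (simp add: mult_ac)
 also have "\<dots> = lam i * tr b g (i # L)"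
  by (simp add: col sum_distrib_left mult_ac)
 finally show ?case by (simp add: algebra_simps)
qed simp

text \<open>The second frame is given by the transposed matrix, and the transpose of an orthogonal
  matrix is its inverse.\<close>

lemma tr_inverse:
 assumes on: "\<And>i j. b i \<bullet> b j = (if i = j then 1 else 0)"
 shows "tr (\<lambda>j. \<chi> i. b i $ j) (tr b g) l = g l"
proof (induction l arbitrary: g)
 case (Cons j l)
 let ?b = "\<lambda>j. \<chi> i. b i $ j"
 have "tr ?b (tr b g) (j # l) = (\<Sum>i\<in>UNIV. b i $ j * (\<Sum>k\<in>UNIV. b i $ k * g (k # l)))"
  by (simp add: tr_sum tr_cmult Cons.IH)
 also have "\<dots> = (\<Sum>k\<in>UNIV. (\<Sum>i\<in>UNIV. b i $ j * b i $ k) * g (k # l))"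
  unfolding sum_distrib_left sum_distrib_right
  by (subst sum.swap) (simp add: mult_ac)
 also have "\<dots> = g (j # l)"
  by (simp add: orthonormal_columns[OF on] if_distrib[of "\<lambda>x. x * _"] cong: if_cong)
 finally show ?case .
qed simp

lemma alt_not_distinct:
 assumes "alt c" "\<not> distinct L" shows "c L = 0"
proof -
 obtain xs ys zs y where "L = xs @ [y] @ ys @ [y] @ zs"
  using not_distinct_decomp[OF assms(2)] by blast
 then have L: "L = xs @ y # ys @ y # zs" by simp
 have "c L = - c L" using alt_swap[OF assms(1), of xs y ys y zs] unfolding L .
 then show ?thesis by simp
qed

lemma tr_length:
 assumes "\<And>m. length m \<noteq> p \<Longrightarrow> g m = 0" "length L \<noteq> p"
 shows "tr b g L = 0"
 using assms
proof (induction L arbitrary: g p)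
 case (Cons i L)
 have "tr b (\<lambda>l. g (j # l)) L = 0" for j
 proof (cases p)
  case 0
  then have "(\<lambda>l. g (j # l)) = (\<lambda>l. 0)" using Cons.prems(1) by auto
  then show ?thesis by (simp add: tr_zero)
 next
  case (Suc p')
  show ?thesis
   by (rule Cons.IH[where p = p']) (use Cons.prems Suc in auto)
 qed
 then show ?case by simp
qed simp

section \<open>p-positive matrices as quadratic forms on p-forms, and the inverse of F on its
  image\<close>

lemma p_psd_spectral:
 fixes H :: "real^'n^'n"
 assumes "p_psd p H"
 shows "\<exists>b lam. eigenbasis H b lam \<and> (\<forall>L\<in>LL p. distinct L \<longrightarrow> 0 \<le> sum_list (map lam L))"
proof -
 have sym: "transpose H = H" using assms by (simp add: p_psd_def)
 obtain b lam where e: "eigenbasis H b lam"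
  using spectral_theorem[OF sym] by blast
 note bl = eigenbasisD[OF e]
 have "0 \<le> sum_list (map lam L)" if "L \<in> LL p" "distinct L" for L
 proof -
  have "card (set L) = p" using that by (simp add: LL_def distinct_card)
  moreover have "\<forall>S. card S = p \<longrightarrow> 0 \<le> sum lam S"
   by (rule mp[OF assms[unfolded p_psd_def, THEN conjunct2, THEN spec, of b, THEN spec, of lam]])
    (rule e[unfolded eigenbasis_def])
  ultimately have "0 \<le> sum lam (set L)" by blast
  then show ?thesis using that by (simp add: sum_list_distinct_conv_sum_set)
 qed
 then show ?thesis using e by blast
qed

lemma p_psd_transpose: "p_psd p H \<Longrightarrow> transpose H = H"
 by (simp add: p_psd_def)

lemma weighted_Cauchy_Schwarz:
 fixes w x y :: "'a \<Rightarrow> real"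
 assumes "\<And>i. i \<in> A \<Longrightarrow> 0 \<le> w i"
 shows "(\<Sum>i\<in>A. w i * x i * y i)\<^sup>2 \<le> (\<Sum>i\<in>A. w i * x i * x i) * (\<Sum>i\<in>A. w i * y i * y i)"
proof -
 have "(\<Sum>i\<in>A. (sqrt (w i) * x i) * (sqrt (w i) * y i))\<^sup>2
   \<le> (\<Sum>i\<in>A. (sqrt (w i) * x i)\<^sup>2) * (\<Sum>i\<in>A. (sqrt (w i) * y i)\<^sup>2)"
  by (rule Cauchy_Schwarz_ineq_sum)
 moreover have "sqrt (w i) * u * (sqrt (w i) * v) = w i * u * v" if "i \<in> A" for i u v
  using assms[OF that] by (metis mult.assoc mult.left_commute real_sqrt_mult_self abs_of_nonneg)
 ultimately show ?thesis by (simp add: power2_eq_square cong: sum.cong)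
qed

lemma p_psd_form:
 fixes H :: "real^'n^'n"
 assumes "p_psd p H" "alt g" "alt h"
 shows "0 \<le> (\<Sum>l\<in>LL p. Fop H g l * g l)"
  and "(\<Sum>l\<in>LL p. Fop H h l * g l)\<^sup>2 \<le> (\<Sum>l\<in>LL p. Fop H h l * h l) * (\<Sum>l\<in>LL p. Fop H g l * g l)"
proof -
 obtain b lam where e: "eigenbasis H b lam" and pos: "\<forall>L\<in>LL p. distinct L \<longrightarrow> 0 \<le> sum_list (map lam L)"
  using p_psd_spectral[OF assms(1)] by blast
 note bl = eigenbasisD[OF e]
 \<comment> \<open>p-positivity controls only sums over distinct indices. On lists with a repetition
   alternating coefficients vanish, so the multiplier may be set to 0 there, which makes all weights
   nonnegative.\<close>
 define w where "w L = (if distinct L then sum_list (map lam L) else 0)" for L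
 have w: "0 \<le> w L" if "L \<in> LL p" for L using pos that by (simp add: w_def)
 have diag: "(\<Sum>l\<in>LL p. Fop H u l * v l) = (\<Sum>L\<in>LL p. w L * tr b u L * tr b v L)" if "alt u" for u v
 proof -
  have "(\<Sum>l\<in>LL p. Fop H u l * v l) = (\<Sum>L\<in>LL p. tr b (Fop H u) L * tr b v L)"
   by (rule tr_parseval[symmetric]) (rule bl(1))
  also have "\<dots> = (\<Sum>L\<in>LL p. w L * tr b u L * tr b v L)"
  proof (rule sum.cong[OF refl])
   fix L
   show "tr b (Fop H u) L * tr b v L = w L * tr b u L * tr b v L"
    using alt_not_distinct[OF alt_tr[OF that], of L]
    by (simp add: tr_Fop[OF p_psd_transpose[OF assms(1)] bl(2)] w_def)
  qed
  finally show ?thesis .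
 qed
 show "0 \<le> (\<Sum>l\<in>LL p. Fop H g l * g l)"
  unfolding diag[OF assms(2)] using w by (intro sum_nonneg) (simp add: mult.assoc)
 show "(\<Sum>l\<in>LL p. Fop H h l * g l)\<^sup>2 \<le> (\<Sum>l\<in>LL p. Fop H h l * h l) * (\<Sum>l\<in>LL p. Fop H g l * g l)"
  unfolding diag[OF assms(2)] diag[OF assms(3)] by (rule weighted_Cauchy_Schwarz) (rule w)
qed

lemma Qf_nonneg:
 fixes H :: "real^'n^'n"
 assumes "p_psd (Suc q) H" "alt g"
 shows "0 \<le> Qf H q g"
 using p_psd_form(1)[OF assms assms(2)] unfolding Fop_Qf[OF assms(2)]
 by (simp add: zero_le_mult_iff)

text \<open>In an eigenframe F_H multiplies by a sum that does not depend on the order of the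
  indices, so alternation is visible there; the transposed frame carries it back.\<close>

lemma alt_Fop:
 fixes H :: "real^'n^'n"
 assumes "transpose H = H" "alt g"
 shows "alt (Fop H g)"
proof -
 obtain b lam where e: "eigenbasis H b lam"
  using spectral_theorem[OF assms(1)] by blast
 note bl = eigenbasisD[OF e]
 have "alt (tr b (Fop H g))"
 proof (rule altI)
  fix xs x y ys
  show "tr b (Fop H g) (xs @ x # y # ys) = - tr b (Fop H g) (xs @ y # x # ys)"
   unfolding tr_Fop[OF assms(1) bl(2)] altD[OF alt_tr[OF assms(2)], of b xs x y ys]
   by simp
 qed
 then have "alt (tr (\<lambda>j. \<chi> i. b i $ j) (tr b (Fop H g)))" by (rule alt_tr)
 moreover have "tr (\<lambda>j. \<chi> i. b i $ j) (tr b (Fop H g)) = Fop H g"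
  by (rule ext) (rule tr_inverse, rule bl(1))
 ultimately show ?thesis by simp
qed

text \<open>In an eigenframe the inverse on the image divides by the nonzero eigenvalues. The
  description by \<open>THE\<close> makes sense because two elements of the image with equal images
  under F agree wherever the eigenvalue is nonzero, and both vanish where it is zero.\<close>

lemma Finv_properties:
 fixes H :: "real^'n^'n"
 assumes sym: "transpose H = H" and f: "f \<in> Fim p H"
 shows "Fop H (Finv p H f) = f" "alt (Finv p H f)"
proof -
 obtain b lam where e: "eigenbasis H b lam"
  using spectral_theorem[OF sym] by blast
 note bl = eigenbasisD[OF e]
 note trF = tr_Fop[OF sym bl(2)]
 let ?b = "\<lambda>j. \<chi> i. b i $ j"
 have inj: "g = h" if "\<And>L. tr b g L = tr b h L" for g h
 proof (rule ext)
  fix l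
  have "tr ?b (tr b g) l = tr ?b (tr b h) l" using that by (metis ext)
  then show "g l = h l" by (simp add: tr_inverse[OF bl(1)])
 qed
 obtain c where c: "altform p c" "f = Fop H c" using f by (auto simp: Fim_def)
 then have ac: "alt c" and lc: "\<And>l. length l \<noteq> p \<Longrightarrow> c l = 0" by (auto simp: altform_iff)
 define w where "w L = sum_list (map lam L)" for L
 \<comment> \<open>With f = F c, the inverse image of f lying in the image of F is F h, where h is c
   divided once by the eigenvalue; components with eigenvalue 0 are dropped, since F c does not have
   them.\<close>
 define h' where "h' L = (if w L = 0 then 0 else tr b c L / w L)" for L
 have "alt h'"
 proof (rule altI)
  fix xs x y ys
  have "w (xs @ x # y # ys) = w (xs @ y # x # ys)" by (simp add: w_def)
  then show "h' (xs @ x # y # ys) = - h' (xs @ y # x # ys)"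
   using altD[OF alt_tr[OF ac], of b xs x y ys] by (simp add: h'_def)
 qed
 define h where "h = tr ?b h'"
 have on': "?b i \<bullet> ?b j = (if i = j then 1 else 0)" for i j
  using orthonormal_columns[OF bl(1), of i j] by (simp add: inner_vec_def)
 have bb: "(\<lambda>j. \<chi> i. ?b i $ j) = b" by (simp add: fun_eq_iff vec_eq_iff)
 have trh: "tr b h L = h' L" for L
  using tr_inverse[OF on', of h' L] unfolding bb h_def .
 have "h' L = 0" if "length L \<noteq> p" for L
  using tr_length[of p c L b] lc that by (simp add: h'_def)
 then have "h L = 0" if "length L \<noteq> p" for L
  using tr_length[of p h' L] that by (simp add: h_def)
 then have ah: "altform p h"
  using alt_tr[OF \<open>alt h'\<close>] by (simp add: altform_iff h_def)
 have ex: "Fop H (Fop H h) = f"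
 proof (rule inj)
  fix L
  show "tr b (Fop H (Fop H h)) L = tr b f L"
   unfolding trF c(2) trh w_def[symmetric] h'_def by simp
 qed
 have un: "g = g'" if im: "g \<in> Fim p H" "g' \<in> Fim p H" and eq: "Fop H g = Fop H g'" for g g'
 proof -
  obtain k k' where k: "g = Fop H k" "g' = Fop H k'" using im unfolding Fim_def by blast
  show ?thesis
  proof (rule inj)
   fix L
   have "tr b (Fop H g) L = tr b (Fop H g') L" using eq by simp
   then show "tr b g L = tr b g' L" unfolding trF k by auto
  qed
 qed
 have "Finv p H f = Fop H h"
  unfolding Finv_def
 proof (rule the_equality)
  show "Fop H h \<in> Fim p H \<and> Fop H (Fop H h) = f" using ah ex by (auto simp: Fim_def)
  then show "g = Fop H h" if "g \<in> Fim p H \<and> Fop H g = f" for g using un that by metis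
 qed
 then show "Fop H (Finv p H f) = f" "alt (Finv p H f)"
  using ex ah alt_Fop[OF sym] by (auto simp: altform_iff)
qed

text \<open>Cauchy-Schwarz for the semidefinite form of F, applied to k = F^{-1} f and g: since f =
  F k, the factor at k is the pairing of F^{-1} f with f. This pointwise inequality is the only way
  in which F^{-1} enters the estimates. The factorial undoes the normalisation in
  \<open>finner\<close>.\<close>

lemma Finv_bound:
 fixes H :: "real^'n^'n"
 assumes H: "p_psd (Suc q) H" and f: "f \<in> Fim (Suc q) H" and g: "alt g"
 shows "0 \<le> finner (Suc q) (Finv (Suc q) H f) f"
  and "(\<Sum>l\<in>LL (Suc q). f l * g l)\<^sup>2 \<le>
   fact (Suc q) * finner (Suc q) (Finv (Suc q) H f) f * (Suc q * Qf H q g)"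
proof -
 define k where "k = Finv (Suc q) H f"
 have k: "Fop H k = f" "alt k"
  using Finv_properties[OF p_psd_transpose[OF H] f] by (auto simp: k_def)
 have e: "(\<Sum>l\<in>LL (Suc q). f l * k l) = fact (Suc q) * finner (Suc q) k f"
  by (simp add: finner_def LL_def mult.commute)
 have "0 \<le> fact (Suc q) * finner (Suc q) k f"
  using p_psd_form(1)[OF H k(2) g] unfolding k(1) e .
 then show "0 \<le> finner (Suc q) (Finv (Suc q) H f) f"
  unfolding k_def[symmetric] by (metis fact_gt_zero zero_le_mult_iff not_less)
 show "(\<Sum>l\<in>LL (Suc q). f l * g l)\<^sup>2 \<le>
   fact (Suc q) * finner (Suc q) (Finv (Suc q) H f) f * (Suc q * Qf H q g)"
  using p_psd_form(2)[OF H g k(2)] unfolding k(1) e Fop_Qf[OF g] k_def[symmetric] .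
qed

lemma Qf_add: "Qf (H + K) q g = Qf H q g + Qf K q g"
 by (simp add: Qf_def distrib_right sum.distrib)

lemma Qf_scale: "Qf (r *\<^sub>R H) q g = r * Qf H q g"
 by (simp add: Qf_def sum_distrib_left mult.assoc)

lemma Qf_rank1: "Qf (\<chi> j k. v j * v k) q g = (\<Sum>I\<in>LL q. (\<Sum>j\<in>UNIV. v j * g (j # I))\<^sup>2)"
 by (simp add: Qf_def power2_eq_square sum_product mult_ac)

lemma Qf_mat: "Qf (mat r) q g = r * (nsq (Suc q) g)"
proof -
 have "Qf (mat r) q g = (\<Sum>I\<in>LL q. \<Sum>j\<in>UNIV. r * (g (j # I))\<^sup>2)"
  by (simp add: Qf_def mat_def if_distrib[of "\<lambda>x. x * _"] power2_eq_square mult.assoc cong: if_cong)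
 then show ?thesis
  by (subst (asm) sum.swap) (simp add: sum_LL_Suc sum_distrib_left)
qed

subsection \<open>Functions with continuous partial derivatives\<close>

text \<open>The function \<open>pd\<close> returns some value even where the derivative fails to
  exist; this relation also records existence, and the calculus rules are proved for it.\<close>

definition hpd :: "'n::finite \<Rightarrow> (real^'n \<Rightarrow> real) \<Rightarrow> real \<Rightarrow> real^'n \<Rightarrow> bool" where
 "hpd j f D x \<longleftrightarrow> ((\<lambda>t. f (x + t *\<^sub>R axis j 1)) has_real_derivative D) (at 0)"

lemma hpd_pd: "hpd j f D x \<Longrightarrow> pd j f x = D"
 unfolding hpd_def pd_def by (rule DERIV_imp_deriv)

lemma hpd_const [simp]: "hpd j (\<lambda>x. c) 0 x"
 by (simp add: hpd_def)

lemma hpd_add: "hpd j f D x \<Longrightarrow> hpd j g E x \<Longrightarrow> hpd j (\<lambda>x. f x + g x) (D + E) x"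
 unfolding hpd_def by (rule DERIV_add)

lemma hpd_mult: "hpd j f D x \<Longrightarrow> hpd j g E x \<Longrightarrow> hpd j (\<lambda>x. f x * g x) (D * g x + f x * E) x"
 unfolding hpd_def by (auto dest: DERIV_mult simp: algebra_simps)

lemma hpd_cmult: "hpd j f D x \<Longrightarrow> hpd j (\<lambda>x. c * f x) (c * D) x"
 unfolding hpd_def by (rule DERIV_cmult)

lemma hpd_sum: "(\<And>i. i \<in> S \<Longrightarrow> hpd j (f i) (D i) x) \<Longrightarrow> hpd j (\<lambda>x. \<Sum>i\<in>S. f i x) (\<Sum>i\<in>S. D i) x"
 unfolding hpd_def by (rule DERIV_sum)

lemma hpd_compose:
 assumes "hpd j f D x" "(F has_real_derivative E) (at (f x))"
 shows "hpd j (\<lambda>x. F (f x)) (E * D) x"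
 using DERIV_chain2[of F E "\<lambda>t. f (x + t *\<^sub>R axis j 1)" 0 D UNIV] assms
 unfolding hpd_def by simp

lemma hpd_coord: "hpd i (\<lambda>x. x $ j) (if i = j then 1 else 0) x"
proof -
 have "((\<lambda>t. x $ j + t * (if i = j then 1 else 0)) has_real_derivative (if i = j then 1 else 0)) (at 0)"
  by (auto intro!: derivative_eq_intros)
 then show ?thesis by (simp add: hpd_def axis_def eq_commute[of j i])
qed

lemma open_line: "open U \<Longrightarrow> open {t. x + t *\<^sub>R (v :: real^'n) \<in> U}"
 using continuous_open_vimage[of U "\<lambda>t. x + t *\<^sub>R v"]
 by (simp add: vimage_def continuous_intros)

lemma hpd_cong_open:
 assumes "hpd j f D x" "open U" "x \<in> U" "\<And>y. y \<in> U \<Longrightarrow> f y = g y"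
 shows "hpd j g D x"
 using has_field_derivative_transform_within_open[OF assms(1)[unfolded hpd_def] open_line[OF assms(2)],
   of x "axis j 1" "\<lambda>t. g (x + t *\<^sub>R axis j 1)"]
  assms(3,4) unfolding hpd_def by simp

lemma hpd_at:
 assumes "hpd j f D (x + s *\<^sub>R axis j 1)"
 shows "((\<lambda>t. f (x + t *\<^sub>R axis j 1)) has_real_derivative D) (at s)"
proof -
 have "((\<lambda>t. f ((x + s *\<^sub>R axis j 1) + t *\<^sub>R axis j 1)) has_real_derivative D) (at 0)"
  using assms by (simp add: hpd_def)
 then have "((\<lambda>t. f (x + (s + t) *\<^sub>R axis j 1)) has_real_derivative D) (at 0)"
  by (simp add: algebra_simps)
 then show ?thesis
  using DERIV_shift[of "\<lambda>t. f (x + t *\<^sub>R axis j 1)" D 0 s] by (simp add: add.commute)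
qed

definition C1_on :: "(real^'n::finite) set \<Rightarrow> (real^'n \<Rightarrow> real) \<Rightarrow> bool" where
 "C1_on U f \<longleftrightarrow> continuous_on U f \<and> (\<forall>j. continuous_on U (pd j f)) \<and> (\<forall>x\<in>U. \<forall>j. hpd j f (pd j f x) x)"

definition C2_on :: "(real^'n::finite) set \<Rightarrow> (real^'n \<Rightarrow> real) \<Rightarrow> bool" where
 "C2_on U f \<longleftrightarrow> C1_on U f \<and> (\<forall>j. C1_on U (pd j f))"

text \<open>The test functions are C^1 and not smooth, because the class must be stable under
  multiplication by exponentials of the weights, which are only known to be C^2 on
  \<open>U\<close>.\<close>

definition C1c :: "(real^'n::finite) set \<Rightarrow> (real^'n \<Rightarrow> real) \<Rightarrow> bool" where
 "C1c U f \<longleftrightarrow> C1_on UNIV f \<and> (\<exists>K. compact K \<and> K \<subseteq> U \<and> (\<forall>x. x \<notin> K \<longrightarrow> f x = 0))"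

lemma C1_onD:
 assumes "C1_on U f"
 shows "continuous_on U f" "continuous_on U (pd j f)" "x \<in> U \<Longrightarrow> hpd j f (pd j f x) x"
 using assms by (auto simp: C1_on_def)

lemma C1_onI:
 assumes "continuous_on U f" "\<And>j. continuous_on U (D j)" "\<And>j x. x \<in> U \<Longrightarrow> hpd j f (D j x) x"
 shows "C1_on U f"
proof -
 have "pd j f x = D j x" if "x \<in> U" for j x using assms(3) that by (simp add: hpd_pd)
 then show ?thesis using assms by (simp add: C1_on_def cong: continuous_on_cong)
qed

lemma C1_on_subset: "C1_on U f \<Longrightarrow> V \<subseteq> U \<Longrightarrow> C1_on V f"
 unfolding C1_on_def by (blast intro: continuous_on_subset)

lemma C2_on_subset: "C2_on U f \<Longrightarrow> V \<subseteq> U \<Longrightarrow> C2_on V f"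
 unfolding C2_on_def by (blast intro: C1_on_subset)

lemma C1_on_const [simp]: "C1_on U (\<lambda>x. c)"
 by (rule C1_onI[where D = "\<lambda>j x. 0"]) auto

lemma C1_on_add: "C1_on U f \<Longrightarrow> C1_on U g \<Longrightarrow> C1_on U (\<lambda>x. f x + g x)"
 by (rule C1_onI[where D = "\<lambda>j x. pd j f x + pd j g x"])
  (auto intro!: continuous_intros hpd_add dest: C1_onD)

lemma C1_on_mult: "C1_on U f \<Longrightarrow> C1_on U g \<Longrightarrow> C1_on U (\<lambda>x. f x * g x)"
 by (rule C1_onI[where D = "\<lambda>j x. pd j f x * g x + f x * pd j g x"])
  (auto intro!: continuous_intros hpd_mult dest: C1_onD)

lemma C1_on_cmult: "C1_on U f \<Longrightarrow> C1_on U (\<lambda>x. c * f x)"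
 by (intro C1_on_mult C1_on_const)

lemma C1_on_sum: "finite S \<Longrightarrow> (\<And>i. i \<in> S \<Longrightarrow> C1_on U (f i)) \<Longrightarrow> C1_on U (\<lambda>x. \<Sum>i\<in>S. f i x)"
 by (induction S rule: finite_induct) (auto intro: C1_on_add)

lemma C1_on_coord: "C1_on U (\<lambda>x. x $ j)"
 by (rule C1_onI[where D = "\<lambda>i x. if i = j then 1 else 0"]) (auto intro!: continuous_intros hpd_coord simp: hpd_coord)

lemma C1_on_compose:
 assumes "C1_on U f" "\<And>x. x \<in> U \<Longrightarrow> (F has_real_derivative F' (f x)) (at (f x))"
  "continuous_on (f ` U) F'"
 shows "C1_on U (\<lambda>x. F (f x))"
proof (rule C1_onI[where D = "\<lambda>j x. F' (f x) * pd j f x"])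
 have "continuous_on (f ` U) F"
  using assms(2) by (intro continuous_at_imp_continuous_on ballI) (auto intro: DERIV_isCont)
 then show "continuous_on U (\<lambda>x. F (f x))"
  using C1_onD(1)[OF assms(1)] continuous_on_compose2 by blast
 show "continuous_on U (\<lambda>x. F' (f x) * pd j f x)" for j
  using C1_onD[OF assms(1)] continuous_on_compose2[OF assms(3), of U f] by (intro continuous_on_mult) auto
 show "hpd j (\<lambda>x. F (f x)) (F' (f x) * pd j f x) x" if "x \<in> U" for j x
  using assms that by (intro hpd_compose) (auto dest: C1_onD)
qed

lemma C1_on_cong:
 assumes "C1_on U f" "open U" "\<And>x. x \<in> U \<Longrightarrow> f x = g x"
 shows "C1_on U g"
proof (rule C1_onI[where D = "\<lambda>j. pd j f"])
 show "continuous_on U g" using C1_onD(1)[OF assms(1)] assms(3) by (simp cong: continuous_on_cong)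
 show "continuous_on U (pd j f)" for j using C1_onD(2)[OF assms(1)] .
 show "hpd j g (pd j f x) x" if "x \<in> U" for j x
  by (rule hpd_cong_open[OF C1_onD(3)[OF assms(1) that] assms(2) that assms(3)])
qed

lemma pd_cong_open:
 assumes "C1_on U f" "open U" "\<And>x. x \<in> U \<Longrightarrow> f x = g x" "x \<in> U"
 shows "pd j g x = pd j f x"
 by (rule hpd_pd, rule hpd_cong_open[OF C1_onD(3)[OF assms(1,4)] assms(2,4,3)])

lemma C1_on_Un:
 assumes "C1_on U f" "C1_on V f" "open U" "open V"
 shows "C1_on (U \<union> V) f"
 using assms unfolding C1_on_def by (auto intro: continuous_on_open_Un)

text \<open>\<open>U\<close> and the complement of \<open>K\<close> are open and cover the space,
  and on the second of them the function is zero.\<close>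

lemma C1c_extend:
 assumes "C1_on U f" "open U" "compact K" "K \<subseteq> U" "\<And>x. x \<notin> K \<Longrightarrow> f x = 0"
 shows "C1c U f"
proof -
 have "C1_on (- K) f"
  by (rule C1_on_cong[of _ "\<lambda>x. 0"]) (use assms in \<open>auto simp: compact_imp_closed\<close>)
 then have "C1_on (U \<union> - K) f"
  by (intro C1_on_Un) (use assms in \<open>auto simp: compact_imp_closed\<close>)
 moreover have "U \<union> - K = UNIV" using assms by auto
 ultimately show ?thesis using assms by (auto simp: C1c_def)
qed

lemma C1c_support:
 assumes "C1c U f"
 obtains K where "compact K" "K \<subseteq> U" "\<And>x. x \<notin> K \<Longrightarrow> f x = 0" "\<And>x j. x \<notin> K \<Longrightarrow> pd j f x = 0"
proof -
 obtain K where K: "compact K" "K \<subseteq> U" "\<And>x. x \<notin> K \<Longrightarrow> f x = 0" using assms by (auto simp: C1c_def)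
 have "pd j f x = 0" if "x \<notin> K" for x j
 proof -
  have "hpd j f 0 x"
   by (rule hpd_cong_open[OF hpd_const[of j 0 x], of "- K"]) (use K that in \<open>auto simp: compact_imp_closed\<close>)
  then show ?thesis by (rule hpd_pd)
 qed
 then show ?thesis using that K by blast
qed

lemma C1c_mono: "C1c U f \<Longrightarrow> U \<subseteq> V \<Longrightarrow> C1c V f"
 unfolding C1c_def by blast

lemma C1c_mult:
 assumes "C1_on U h" "C1c U f" "open U"
 shows "C1c U (\<lambda>x. h x * f x)"
proof -
 obtain K where K: "compact K" "K \<subseteq> U" "\<And>x. x \<notin> K \<Longrightarrow> f x = 0" using assms by (auto simp: C1c_def)
 have "C1_on U f" using assms(2) C1_on_subset by (auto simp: C1c_def)
 then show ?thesis by (intro C1c_extend[OF C1_on_mult[OF assms(1)] assms(3) K(1,2)]) (use K in auto)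
qed

lemma C1c_zero: "C1c U (\<lambda>x. 0)"
 unfolding C1c_def by (auto intro: exI[of _ "{}"])

lemma C1c_cmult: "C1c U f \<Longrightarrow> C1c U (\<lambda>x. c * f x)"
 unfolding C1c_def by (auto intro!: C1_on_mult)

lemma C1c_add:
 assumes "C1c U f" "C1c U g" shows "C1c U (\<lambda>x. f x + g x)"
proof -
 obtain K L where "compact K" "K \<subseteq> U" "\<And>x. x \<notin> K \<Longrightarrow> f x = 0"
  "compact L" "L \<subseteq> U" "\<And>x. x \<notin> L \<Longrightarrow> g x = 0" using assms unfolding C1c_def by metis
 then show ?thesis using assms unfolding C1c_def
  by (auto intro!: C1_on_add exI[of _ "K \<union> L"])
qed

lemma C1_on_UNIV_mult_C1c: "C1_on UNIV h \<Longrightarrow> C1c U f \<Longrightarrow> C1c U (\<lambda>x. h x * f x)"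
 unfolding C1c_def by (auto intro!: C1_on_mult)

lemma C1c_C1_on: "C1c U f \<Longrightarrow> C1_on V f"
 unfolding C1c_def using C1_on_subset by blast

lemma pd_mult:
 assumes "C1_on U f" "C1_on U g" "x \<in> U"
 shows "pd j (\<lambda>x. f x * g x) x = pd j f x * g x + f x * pd j g x"
 by (rule hpd_pd, rule hpd_mult) (use assms in \<open>auto dest: C1_onD\<close>)

lemma pd_add:
 assumes "C1_on U f" "C1_on U g" "x \<in> U"
 shows "pd j (\<lambda>x. f x + g x) x = pd j f x + pd j g x"
 by (rule hpd_pd, rule hpd_add) (use assms in \<open>auto dest: C1_onD\<close>)

lemma pd_cmult:
 assumes "C1_on U f" "x \<in> U"
 shows "pd j (\<lambda>x. c * f x) x = c * pd j f x"
 by (rule hpd_pd, rule hpd_cmult) (use assms in \<open>auto dest: C1_onD\<close>)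

lemma pd_compose:
 assumes "C1_on U f" "x \<in> U" "(F has_real_derivative E) (at (f x))"
 shows "pd j (\<lambda>x. F (f x)) x = E * pd j f x"
 by (rule hpd_pd, rule hpd_compose) (use assms in \<open>auto dest: C1_onD\<close>)

lemma Ck_on_2_C2_on:
 assumes "Ck_on 2 U f" shows "C2_on U f"
proof -
 have c: "\<And>js. length js \<le> 2 \<Longrightarrow> continuous_on U (pds js f)"
  and d: "\<And>js x j. length js < 2 \<Longrightarrow> x \<in> U \<Longrightarrow> (\<lambda>t. pds js f (x + t *\<^sub>R axis j 1)) differentiable (at 0)"
  using assms by (auto simp: Ck_on_def)
 have h: "hpd j (pds js f) (pd j (pds js f) x) x" if "length js < 2" "x \<in> U" for js j x
  using d[OF that, of j] unfolding hpd_def pd_def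
  by (simp add: DERIV_deriv_iff_real_differentiable)
 show ?thesis
  unfolding C2_on_def C1_on_def
  using c[of "[]"] c[of "[_]"] c[of "[_, _]"] h[of "[]"] h[of "[_]"] by simp
qed

section \<open>Integrals of partial derivatives\<close>

lemma continuous_compact_integrable:
 fixes f :: "real^'n \<Rightarrow> real"
 assumes "continuous_on UNIV f" "compact K" "\<And>x. x \<notin> K \<Longrightarrow> f x = 0"
 shows "integrable lborel f"
proof -
 have "integrable lborel (\<lambda>x. indicator K x *\<^sub>R f x)"
  by (rule borel_integrable_compact[OF assms(2)]) (use assms(1) continuous_on_subset in blast)
 moreover have "(\<lambda>x. indicator K x *\<^sub>R f x) = f"
  using assms(3) by (auto simp: fun_eq_iff indicator_def)
 ultimately show ?thesis by simp
qed

lemma integral_translate: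
 fixes f :: "real^'n \<Rightarrow> real"
 assumes "f \<in> borel_measurable borel"
 shows "(LBINT x. f (x + c)) = (LBINT x. f x)"
proof -
 have "(LBINT x. f x) = (\<integral>x. f x \<partial>distr lborel borel ((+) c))"
  by (simp add: lborel_distr_plus)
 also have "\<dots> = (LBINT x. f (c + x))"
  by (rule integral_distr) (use assms in auto)
 finally show ?thesis by (simp add: add.commute)
qed

text \<open>By translation invariance every difference quotient has integral 0; the mean value
  theorem bounds the quotients by the maximum of the derivative, and dominated convergence gives the
  limit.\<close>

lemma integral_pd_zero:
 fixes f :: "real^'n \<Rightarrow> real"
 assumes "C1c UNIV f"
 shows "(LBINT x. pd j f x) = 0"
proof -
 have C1: "C1_on UNIV f" using assms by (simp add: C1c_def)
 obtain K where K: "compact K" "\<And>x. x \<notin> K \<Longrightarrow> f x = 0" "\<And>x j. x \<notin> K \<Longrightarrow> pd j f x = 0"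
  using C1c_support[OF assms] by metis
 have cf: "continuous_on UNIV f" and cd: "continuous_on UNIV (pd j f)" using C1 by (auto dest: C1_onD)
 have intf: "integrable lborel f" by (rule continuous_compact_integrable[OF cf K(1,2)])
 have bm: "f \<in> borel_measurable borel" using cf by (simp add: borel_measurable_continuous_onI)
 have "compact (pd j f ` K)" using compact_continuous_image continuous_on_subset[OF cd] K(1) by blast
 then obtain B where B: "\<And>x. x \<in> K \<Longrightarrow> \<bar>pd j f x\<bar> \<le> B"
  using compact_imp_bounded bounded_iff by (metis imageI real_norm_def)
 have B': "\<bar>pd j f x\<bar> \<le> \<bar>B\<bar>" for x using B[of x] K(3)[of x j] by (cases "x \<in> K") auto
 define e :: "real^'n" where "e = axis j 1"
 \<comment> \<open>The step lengths are at most 1, so all difference quotients live in the ball of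
   radius R + 1, which provides the integrable majorant.\<close>
 define h where "h n = 1 / real (Suc n)" for n
 have h: "0 < h n" "h n \<le> 1" for n by (auto simp: h_def)
 have h0: "h \<longlonglongrightarrow> 0" unfolding h_def by (rule lim_const_over_n[of 1, THEN LIMSEQ_Suc])
 define q where "q n x = (f (x + h n *\<^sub>R e) - f x) / h n" for n x
 obtain R where R: "\<And>x. x \<in> K \<Longrightarrow> norm x \<le> R" using compact_imp_bounded[OF K(1)] bounded_iff by metis
 have qb: "norm (q n x) \<le> indicator (cball 0 (R + 1)) x * \<bar>B\<bar>" for n x
 proof (cases "x \<in> cball 0 (R + 1)")
  case True
  have "\<exists>z. z > 0 \<and> z < h n \<and> f (x + h n *\<^sub>R e) - f (x + 0 *\<^sub>R e) = (h n - 0) * pd j f (x + z *\<^sub>R e)"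
   unfolding e_def by (rule MVT2[OF h(1)]) (rule hpd_at, rule C1_onD(3)[OF C1], simp)
  then obtain z where "f (x + h n *\<^sub>R e) - f x = h n * pd j f (x + z *\<^sub>R e)" by auto
  then have "q n x = pd j f (x + z *\<^sub>R e)" using h(1)[of n] by (simp add: q_def)
  then show ?thesis using True B' by simp
 next
  case False
  then have "R + 1 < norm x" by simp
  moreover have "norm x \<le> norm (x + h n *\<^sub>R e) + h n"
   using norm_triangle_ineq4[of "x + h n *\<^sub>R e" "h n *\<^sub>R e"] h(1)[of n] by (simp add: e_def)
  ultimately have "R < norm (x + h n *\<^sub>R e)" "R < norm x" using h(2)[of n] by auto
  then have "x + h n *\<^sub>R e \<notin> K" "x \<notin> K" using R by (meson not_less)+
  then show ?thesis using K(2) False by (simp add: q_def)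
 qed
 have qlim: "(\<lambda>n. q n x) \<longlonglongrightarrow> pd j f x" for x
 proof -
  have "hpd j f (pd j f x) x" using C1_onD(3)[OF C1] by simp
  then have "((\<lambda>t. (f (x + t *\<^sub>R e) - f x) / t) \<longlongrightarrow> pd j f x) (at 0)"
   unfolding hpd_def has_field_derivative_iff e_def by simp
  moreover have "filterlim h (at 0) sequentially"
   using h0 by (auto simp: filterlim_at h_def intro!: always_eventually)
  ultimately show ?thesis unfolding q_def by (rule filterlim_compose)
 qed
 have "(\<lambda>n. LBINT x. q n x) \<longlonglongrightarrow> (LBINT x. pd j f x)"
 proof (rule integral_dominated_convergence[where w = "\<lambda>x. indicator (cball 0 (R + 1)) x * \<bar>B\<bar>"])
  show "pd j f \<in> borel_measurable lborel" using cd by (simp add: borel_measurable_continuous_onI)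
  show "q n \<in> borel_measurable lborel" for n unfolding q_def using bm by measurable
  have "emeasure lborel (cball (0::real^'n) (R + 1)) < \<infinity>"
   by (rule emeasure_bounded_finite) simp
  then show "integrable lborel (\<lambda>x::real^'n. indicator (cball 0 (R + 1)) x * \<bar>B\<bar>)"
   by (intro integrable_mult_left integrable_real_indicator) auto
 qed (use qlim qb in auto)
 moreover have "(LBINT x. q n x) = 0" for n
 proof -
  have "integrable lborel (\<lambda>x. f (x + h n *\<^sub>R e))"
  proof -
   have "integrable (distr lborel borel ((+) (h n *\<^sub>R e))) f" using intf by (simp add: lborel_distr_plus)
   then have "integrable lborel (\<lambda>x. f (h n *\<^sub>R e + x))"
    by (subst (asm) integrable_distr_eq) (use bm in auto)
   then show ?thesis by (simp add: add.commute)
  qed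
  then have "(LBINT x. q n x) = ((LBINT x. f (x + h n *\<^sub>R e)) - (LBINT x. f x)) / h n"
   unfolding q_def using intf by (simp add: integral_diff)
  then show ?thesis using integral_translate[OF bm] by simp
 qed
 ultimately show ?thesis by (simp add: LIMSEQ_const_iff)
qed

subsection \<open>Mollification\<close>

text \<open>The powers of t in the denominator make the span of these functions closed under
  differentiation, and all of them are flat at 0.\<close>

definition ek :: "nat \<Rightarrow> real \<Rightarrow> real" where
 "ek k t = (if t > 0 then exp (- (1 / t)) / t ^ k else 0)"

lemma ek_tendsto_0: "(ek k \<longlongrightarrow> 0) (at 0)"
proof -
 have "((\<lambda>t. inverse t ^ k / exp (inverse t)) \<longlongrightarrow> 0) (at_right (0::real))"
  by (rule filterlim_compose[OF tendsto_power_div_exp_0 filterlim_inverse_at_top_right])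
 moreover have "eventually (\<lambda>t. inverse t ^ k / exp (inverse t) = ek k t) (at_right 0)"
  by (rule eventually_at_right_less[of 0, THEN eventually_mono])
   (simp add: ek_def exp_minus field_simps)
 ultimately have "(ek k \<longlongrightarrow> 0) (at_right 0)" by (rule Lim_transform_eventually)
 moreover have "(ek k \<longlongrightarrow> 0) (at_left 0)"
 proof (rule Lim_transform_eventually)
  show "((\<lambda>t. 0) \<longlongrightarrow> 0) (at_left (0::real))" by simp
  show "eventually (\<lambda>t. 0 = ek k t) (at_left 0)"
   by (simp add: eventually_at_left_field ek_def) (metis lt_ex)
 qed
 ultimately show ?thesis by (simp add: filterlim_split_at)
qed

lemma ek_deriv: "(ek k has_real_derivative (ek (k + 2) t - k * ek (k + 1) t)) (at t)"
proof -
 consider "t > 0" | "t < 0" | "t = 0" by linarith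
 then show ?thesis
 proof cases
  case 1
  have "((\<lambda>t. exp (- (1 / t)) / t ^ k) has_real_derivative (ek (k + 2) t - k * ek (k + 1) t)) (at t)"
  proof (cases k)
   case 0
   then show ?thesis using 1
    by (auto intro!: derivative_eq_intros simp: ek_def field_simps power2_eq_square)
  next
   case (Suc m)
   have e: "((\<lambda>t. exp (- (1 / t))) has_real_derivative exp (- (1 / t)) * (1 / t\<^sup>2)) (at t)"
    using 1 by (auto intro!: derivative_eq_intros simp: power2_eq_square)
   have p: "((\<lambda>t. t ^ Suc m) has_real_derivative Suc m * t ^ m) (at t)"
    using DERIV_pow[of "Suc m" t UNIV] by simp
   show ?thesis unfolding Suc
    by (rule DERIV_cong[OF DERIV_divide[OF e p]]) (use 1 in \<open>auto simp: ek_def field_simps power2_eq_square\<close>)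
  qed
  then show ?thesis
   by (rule has_field_derivative_transform_within_open[where S = "{0<..}"]) (use 1 in \<open>auto simp: ek_def\<close>)
 next
  case 2
  have "((\<lambda>t. 0) has_real_derivative 0) (at t)" by simp
  then have "(ek k has_real_derivative 0) (at t)"
   by (rule has_field_derivative_transform_within_open[where S = "{..<0}"]) (use 2 in \<open>auto simp: ek_def\<close>)
  then show ?thesis using 2 by (simp add: ek_def)
 next
  \<comment> \<open>At 0 the difference quotient of \<open>ek k\<close> is exactly
    \<open>ek (Suc k)\<close>, so differentiability is the limit already shown, one index
    higher.\<close>
  case 3
  have "(\<lambda>h. (ek k (0 + h) - ek k 0) / h) = ek (Suc k)"
   by (auto simp: ek_def fun_eq_iff)
  then have "(ek k has_real_derivative 0) (at 0)"
   unfolding DERIV_def using ek_tendsto_0[of "Suc k"] by simp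
  then show ?thesis using 3 by (simp add: ek_def)
 qed
qed

text \<open>A space of functions vanishing outside (-1, 1) that contains a bump and is closed under
  differentiation. Derivatives of all orders of the bump are then obtained by choosing in this
  space, without formulas for them.\<close>

inductive_set bspan :: "(real \<Rightarrow> real) set" where
 base: "(\<lambda>t. ek i (1 + t) * ek j (1 - t)) \<in> bspan"
| add: "f \<in> bspan \<Longrightarrow> g \<in> bspan \<Longrightarrow> (\<lambda>t. f t + g t) \<in> bspan"
| scale: "f \<in> bspan \<Longrightarrow> (\<lambda>t. c * f t) \<in> bspan"

lemma bspan_deriv:
 "f \<in> bspan \<Longrightarrow> \<exists>g\<in>bspan. \<forall>t. (f has_real_derivative g t) (at t)"
proof (induction rule: bspan.induct)
 case (base i j)
 let ?g = "\<lambda>t. (ek (i + 2) (1 + t) * ek j (1 - t) + (- real i) * (ek (i + 1) (1 + t) * ek j (1 - t)))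
   + ((-1) * (ek i (1 + t) * ek (j + 2) (1 - t)) + real j * (ek i (1 + t) * ek (j + 1) (1 - t)))"
 have "?g \<in> bspan" by (intro bspan.intros)
 moreover have "((\<lambda>t. ek i (1 + t) * ek j (1 - t)) has_real_derivative ?g t) (at t)" for t
 proof -
  have 1: "((\<lambda>t. ek i (1 + t)) has_real_derivative (ek (i + 2) (1 + t) - i * ek (i + 1) (1 + t)) * 1) (at t)"
   by (rule DERIV_chain2[OF ek_deriv]) (auto intro!: derivative_eq_intros)
  have 2: "((\<lambda>t. ek j (1 - t)) has_real_derivative (ek (j + 2) (1 - t) - j * ek (j + 1) (1 - t)) * (-1)) (at t)"
   by (rule DERIV_chain2[OF ek_deriv]) (auto intro!: derivative_eq_intros)
  show ?thesis
   by (rule DERIV_cong[OF DERIV_mult[OF 1 2]]) (simp add: algebra_simps)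
 qed
 ultimately show ?case by (intro bexI[of _ ?g] allI)
next
 case (add f g)
 then obtain f' g' where "f' \<in> bspan" "\<forall>t. (f has_real_derivative f' t) (at t)"
  "g' \<in> bspan" "\<forall>t. (g has_real_derivative g' t) (at t)" by blast
 then show ?case by (intro bexI[of _ "\<lambda>t. f' t + g' t"] allI DERIV_add bspan.add) auto
next
 case (scale f c)
 then obtain f' where "f' \<in> bspan" "\<forall>t. (f has_real_derivative f' t) (at t)" by blast
 then show ?case by (intro bexI[of _ "\<lambda>t. c * f' t"] allI DERIV_cmult bspan.scale) auto
qed

lemma bspan_zero: "f \<in> bspan \<Longrightarrow> 1 \<le> \<bar>t\<bar> \<Longrightarrow> f t = 0"
 by (induction rule: bspan.induct) (auto simp: ek_def abs_if split: if_splits)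

fun bd :: "nat \<Rightarrow> real \<Rightarrow> real" where
 "bd 0 = (\<lambda>t. ek 0 (1 + t) * ek 0 (1 - t))"
| "bd (Suc n) = (SOME g. g \<in> bspan \<and> (\<forall>t. (bd n has_real_derivative g t) (at t)))"

lemma bd_bspan: "bd n \<in> bspan"
proof (induction n)
 case (Suc n)
 from someI_ex[OF bspan_deriv[OF Suc, unfolded Bex_def]] show ?case by simp
qed (simp add: bspan.base)

lemma bd_deriv: "(bd n has_real_derivative bd (Suc n) t) (at t)"
 using someI_ex[OF bspan_deriv[OF bd_bspan[of n], unfolded Bex_def]] by simp

lemma bd_zero: "1 \<le> \<bar>t\<bar> \<Longrightarrow> bd n t = 0"
 by (rule bspan_zero[OF bd_bspan])

lemma bd_0_nonneg: "0 \<le> bd 0 t"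
 by (simp add: ek_def)

lemma bd_0_pos: "\<bar>t\<bar> < 1 \<Longrightarrow> 0 < bd 0 t"
 by (simp add: ek_def abs_if split: if_splits)

text \<open>\<open>c\<close> records how often each coordinate has been differentiated, so that a
  partial derivative of a bump is, up to the factor \<open>m\<close>, again a bump. All derivatives
  of the mollifier are handled by statements about this one family.\<close>

definition bump :: "('n::finite \<Rightarrow> nat) \<Rightarrow> real \<Rightarrow> real^'n \<Rightarrow> real" where
 "bump c m x = (\<Prod>i\<in>UNIV. bd (c i) (m * x $ i))"

lemma continuous_bd: "continuous_on S (bd n)"
 using bd_deriv by (meson DERIV_isCont continuous_at_imp_continuous_on)

lemma continuous_bump: "continuous_on UNIV (bump c m)"
 unfolding bump_def
 by (intro continuous_on_prod continuous_on_compose2[OF continuous_bd[of UNIV]] continuous_intros) auto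

lemma hpd_bump: "hpd j (bump c m) (m * bump (c(j := Suc (c j))) m x) x"
proof -
 let ?P = "\<Prod>i\<in>UNIV - {j}. bd (c i) (m * x $ i)"
 have split: "bump c' m y = bd (c' j) (m * y $ j) * (\<Prod>i\<in>UNIV - {j}. bd (c' i) (m * y $ i))" for c' y
  unfolding bump_def by (rule prod.remove) auto
 have 1: "(\<lambda>t. bump c m (x + t *\<^sub>R axis j 1)) = (\<lambda>t. bd (c j) (m * (x $ j + t)) * ?P)"
 proof
  fix t
  have "(\<Prod>i\<in>UNIV - {j}. bd (c i) (m * (x + t *\<^sub>R axis j 1) $ i)) = ?P"
   by (rule prod.cong) (auto simp: axis_def)
  then show "bump c m (x + t *\<^sub>R axis j 1) = bd (c j) (m * (x $ j + t)) * ?P"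
   by (simp add: split axis_def)
 qed
 have "((\<lambda>t. bd (c j) (m * (x $ j + t))) has_real_derivative bd (Suc (c j)) (m * (x $ j + 0)) * m) (at 0)"
  by (rule DERIV_chain2[OF bd_deriv]) (auto intro!: derivative_eq_intros)
 then have "((\<lambda>t. bd (c j) (m * (x $ j + t)) * ?P) has_real_derivative
   (bd (Suc (c j)) (m * (x $ j + 0)) * m) * ?P) (at 0)"
  by (rule DERIV_cmult_right)
 moreover have "bump (c(j := Suc (c j))) m x = bd (Suc (c j)) (m * x $ j) * ?P"
 proof -
  have "(\<Prod>i\<in>UNIV - {j}. bd ((c(j := Suc (c j))) i) (m * x $ i)) = ?P"
   by (rule prod.cong) auto
  then show ?thesis by (simp add: split)
 qed
 ultimately show ?thesis unfolding hpd_def 1 by (simp add: mult_ac)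
qed

text \<open>The support lies in a cube of half side 1/m, and the norm is at most the sum of the
  absolute values of the coordinates.\<close>

lemma bump_zero:
 assumes "0 < m" "CARD('n) / m \<le> norm x"
 shows "bump c m (x :: real^'n::finite) = 0"
proof -
 have "\<exists>i. 1 \<le> \<bar>m * x $ i\<bar>"
 proof (rule ccontr)
  assume "\<nexists>i. 1 \<le> \<bar>m * x $ i\<bar>"
  then have "\<bar>x $ i\<bar> < 1 / m" for i
   using assms(1) by (simp add: abs_mult field_simps not_le)
  then have "(\<Sum>i\<in>UNIV. \<bar>x $ i\<bar>) < (\<Sum>i\<in>(UNIV::'n set). 1 / m)"
   by (intro sum_strict_mono) auto
  then have "norm x < CARD('n) / m" using norm_le_l1_cart[of x] by simp
  then show False using assms(2) by simp
 qed
 then show ?thesis unfolding bump_def by (auto intro!: prod_zero bd_zero)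
qed

lemma bump_bounded:
 assumes "0 < m"
 shows "\<exists>B. \<forall>x :: real^'n::finite. \<bar>bump c m x\<bar> \<le> B"
proof -
 have "compact (bump c m ` cball (0::real^'n) (CARD('n) / m))"
  by (intro compact_continuous_image continuous_on_subset[OF continuous_bump]) auto
 then obtain B where B: "\<And>x. x \<in> cball (0::real^'n) (CARD('n) / m) \<Longrightarrow> \<bar>bump c m x\<bar> \<le> B"
  using compact_imp_bounded bounded_iff by (metis imageI real_norm_def)
 have "\<bar>bump c m x\<bar> \<le> \<bar>B\<bar>" for x :: "real^'n"
  using B[of x] bump_zero[OF assms, of x c] by (cases "norm x \<le> CARD('n) / m") auto
 then show ?thesis by blast
qed

lemma C1_on_bump: "C1_on UNIV (bump c m)"
 by (rule C1_onI[where D = "\<lambda>j x. m * bump (c(j := Suc (c j))) m x"])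
  (auto intro!: continuous_bump continuous_intros continuous_on_subset[OF continuous_bump] hpd_bump)

lemma pd_bump: "pd j (bump c m) = (\<lambda>x. m * bump (c(j := Suc (c j))) m x)"
 by (rule ext) (rule hpd_pd[OF hpd_bump])

section \<open>Convolution with bumps\<close>

definition conv :: "(real^'n::finite \<Rightarrow> real) \<Rightarrow> (real^'n \<Rightarrow> real) \<Rightarrow> real^'n \<Rightarrow> real" where
 "conv a k x = (LBINT y. a y * k (x - y))"

lemma conv_integrable:
 fixes a k :: "real^'n::finite \<Rightarrow> real"
 assumes "integrable lborel a" "continuous_on UNIV k" "\<And>x. \<bar>k x\<bar> \<le> B"
 shows "integrable lborel (\<lambda>y. a y * k (x - y))"
proof (rule Bochner_Integration.integrable_bound)
 show "integrable lborel (\<lambda>y. B * \<bar>a y\<bar>)" using assms(1) by simp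
 have [measurable]: "k \<in> borel_measurable borel" using assms(2) by (rule borel_measurable_continuous_onI)
 have [measurable]: "a \<in> borel_measurable borel" using assms(1) by auto
 show "(\<lambda>y. a y * k (x - y)) \<in> borel_measurable lborel" by measurable
 have "0 \<le> B" using assms(3)[of 0] by linarith
 moreover have "\<bar>a y\<bar> * \<bar>k (x - y)\<bar> \<le> \<bar>a y\<bar> * B" for y
  by (rule mult_left_mono[OF assms(3)]) simp
 ultimately show "AE y in lborel. norm (a y * k (x - y)) \<le> norm (B * \<bar>a y\<bar>)"
  by (intro AE_I2) (simp add: abs_mult mult.commute)
qed

lemma continuous_conv:
 fixes a k :: "real^'n::finite \<Rightarrow> real"
 assumes a: "integrable lborel a" and k: "continuous_on UNIV k" and B: "\<And>x. \<bar>k x\<bar> \<le> B"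
 shows "continuous_on UNIV (conv a k)"
proof -
 have [measurable]: "k \<in> borel_measurable borel" using k by (rule borel_measurable_continuous_onI)
 have [measurable]: "a \<in> borel_measurable borel" using a by auto
 have B0: "0 \<le> B" using B[of 0] by linarith
 have "(\<lambda>n. conv a k (s n)) \<longlonglongrightarrow> conv a k x" if "s \<longlonglongrightarrow> x" for s x
  unfolding conv_def
 proof (rule integral_dominated_convergence[where w = "\<lambda>y. B * \<bar>a y\<bar>"])
  have "(\<lambda>n. k (s n - y)) \<longlonglongrightarrow> k (x - y)" for y
   using continuous_on_tendsto_compose[OF k, of "\<lambda>n. s n - y" "x - y" sequentially] that
   by (simp add: tendsto_diff)
  then show "AE y in lborel. (\<lambda>n. a y * k (s n - y)) \<longlonglongrightarrow> a y * k (x - y)"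
   by (intro AE_I2 tendsto_mult_left)
  have "\<bar>a y\<bar> * \<bar>k z\<bar> \<le> \<bar>a y\<bar> * B" for y z
   by (rule mult_left_mono[OF B]) simp
  then show "AE y in lborel. norm (a y * k (s n - y)) \<le> B * \<bar>a y\<bar>" for n
   by (intro AE_I2) (simp add: abs_mult mult.commute)
 qed (use a in auto)
 then show ?thesis by (simp add: continuous_on_sequentially o_def)
qed

text \<open>The derivative falls on the kernel only. The mean value theorem bounds its difference
  quotients by \<open>B'\<close>, so that \<open>B'\<close> times the modulus of \<open>a\<close>
  dominates.\<close>

lemma hpd_conv:
 fixes a k :: "real^'n::finite \<Rightarrow> real"
 assumes a: "integrable lborel a" and k: "C1_on UNIV k"
  and B: "\<And>x. \<bar>k x\<bar> \<le> B" and B': "\<And>x. \<bar>pd j k x\<bar> \<le> B'"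
 shows "hpd j (conv a k) (conv a (pd j k) x) x"
proof -
 note kc = C1_onD(1)[OF k] and kd = C1_onD(2)[OF k, of j]
 have [measurable]: "k \<in> borel_measurable borel" using kc by (rule borel_measurable_continuous_onI)
 have [measurable]: "pd j k \<in> borel_measurable borel" using kd by (rule borel_measurable_continuous_onI)
 have [measurable]: "a \<in> borel_measurable borel" using a by auto
 have B0: "0 \<le> B'" using B'[of 0] by linarith
 let ?e = "axis j 1 :: real^'n"
 have quot: "\<bar>(k (z + h *\<^sub>R ?e) - k z) / h\<bar> \<le> B'" if "h \<noteq> 0" for z h
 proof -
  have der: "((\<lambda>t. k (z + t *\<^sub>R ?e)) has_real_derivative pd j k (z + s *\<^sub>R ?e)) (at s)" for s
   by (rule hpd_at, rule C1_onD(3)[OF k], simp)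
  have "\<exists>s. k (z + h *\<^sub>R ?e) - k z = h * pd j k (z + s *\<^sub>R ?e)"
  proof (cases "h > 0")
   case True
   have "\<exists>s>0. s < h \<and> k (z + h *\<^sub>R ?e) - k (z + 0 *\<^sub>R ?e) = (h - 0) * pd j k (z + s *\<^sub>R ?e)"
    by (rule MVT2[OF True]) (rule der)
   then show ?thesis by auto
  next
   case False
   then have "h < 0" using that by simp
   have "\<exists>s>h. s < 0 \<and> k (z + 0 *\<^sub>R ?e) - k (z + h *\<^sub>R ?e) = (0 - h) * pd j k (z + s *\<^sub>R ?e)"
    by (rule MVT2[OF \<open>h < 0\<close>]) (rule der)
   then obtain s where "k z - k (z + h *\<^sub>R ?e) = - h * pd j k (z + s *\<^sub>R ?e)" by auto
   then have "k (z + h *\<^sub>R ?e) - k z = h * pd j k (z + s *\<^sub>R ?e)" by linarith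
   then show ?thesis by blast
  qed
  then obtain s where "k (z + h *\<^sub>R ?e) - k z = h * pd j k (z + s *\<^sub>R ?e)" by blast
  then have "(k (z + h *\<^sub>R ?e) - k z) / h = pd j k (z + s *\<^sub>R ?e)" using that by simp
  then show ?thesis using B' by simp
 qed
 have "((\<lambda>h. (conv a k (x + h *\<^sub>R ?e) - conv a k x) / h) \<longlongrightarrow> conv a (pd j k) x) (at 0)"
  unfolding tendsto_at_iff_sequentially
 proof (intro allI impI)
  fix h :: "nat \<Rightarrow> real"
  assume "\<forall>i. h i \<in> UNIV - {0}" and h: "h \<longlonglongrightarrow> 0"
  then have hn: "h i \<noteq> 0" for i by auto
  have hf: "filterlim h (at 0) sequentially" using h hn by (simp add: filterlim_at)
  have "(\<lambda>n. LBINT y. a y * ((k ((x - y) + h n *\<^sub>R ?e) - k (x - y)) / h n)) \<longlonglongrightarrow> conv a (pd j k) x"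
   unfolding conv_def
  proof (rule integral_dominated_convergence[where w = "\<lambda>y. B' * \<bar>a y\<bar>"])
   have "(\<lambda>n. (k ((x - y) + h n *\<^sub>R ?e) - k (x - y)) / h n) \<longlonglongrightarrow> pd j k (x - y)" for y
   proof -
    have "((\<lambda>t. (k ((x - y) + t *\<^sub>R ?e) - k (x - y)) / t) \<longlongrightarrow> pd j k (x - y)) (at 0)"
     using C1_onD(3)[OF k, of "x - y" j] unfolding hpd_def has_field_derivative_iff by simp
    then show ?thesis using hf by (rule filterlim_compose)
   qed
   then show "AE y in lborel. (\<lambda>n. a y * ((k ((x - y) + h n *\<^sub>R ?e) - k (x - y)) / h n)) \<longlonglongrightarrow> a y * pd j k (x - y)"
    by (intro AE_I2 tendsto_mult_left)
   show "AE y in lborel. norm (a y * ((k ((x - y) + h n *\<^sub>R ?e) - k (x - y)) / h n)) \<le> B' * \<bar>a y\<bar>" for n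
    unfolding real_norm_def abs_mult
    by (intro AE_I2, subst mult.commute) (rule mult_right_mono[OF quot[OF hn]], simp)
  qed (use a in auto)
  moreover have "(LBINT y. a y * ((k ((x - y) + h n *\<^sub>R ?e) - k (x - y)) / h n))
    = (conv a k (x + h n *\<^sub>R ?e) - conv a k x) / h n" for n
  proof -
   have "(conv a k (x + h n *\<^sub>R ?e) - conv a k x) / h n
     = (LBINT y. (a y * k (x + h n *\<^sub>R ?e - y) - a y * k (x - y)) / h n)"
    unfolding conv_def using conv_integrable[OF a kc B] by simp
   also have "\<dots> = (LBINT y. a y * ((k ((x - y) + h n *\<^sub>R ?e) - k (x - y)) / h n))"
    by (intro Bochner_Integration.integral_cong refl) (simp add: algebra_simps diff_divide_distrib)
   finally show ?thesis by (rule sym)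
  qed
  ultimately show "((\<lambda>h. (conv a k (x + h *\<^sub>R ?e) - conv a k x) / h) \<circ> h) \<longlonglongrightarrow> conv a (pd j k) x"
   by (simp only: o_def)
 qed
 then show ?thesis unfolding hpd_def has_field_derivative_iff by simp
qed

lemma conv_cmult: "conv a (\<lambda>x. r * k x) x = r * conv a k x"
proof -
 have "(\<lambda>y. a y * (r * k (x - y))) = (\<lambda>y. r * (a y * k (x - y)))" by (simp add: mult_ac)
 then show ?thesis unfolding conv_def by simp
qed

lemma hpd_conv_bump:
 fixes a :: "real^'n::finite \<Rightarrow> real"
 assumes "integrable lborel a" "0 < m"
 shows "hpd j (conv a (bump c m)) (m * conv a (bump (c(j := Suc (c j))) m) x) x"
proof -
 obtain B where B: "\<And>x::real^'n. \<bar>bump c m x\<bar> \<le> B" using bump_bounded[OF assms(2)] by blast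
 obtain B' where B': "\<And>x::real^'n. \<bar>bump (c(j := Suc (c j))) m x\<bar> \<le> B'" using bump_bounded[OF assms(2)] by blast
 have "hpd j (conv a (bump c m)) (conv a (pd j (bump c m)) x) x"
  by (rule hpd_conv[OF assms(1) C1_on_bump B, where B' = "m * B'"])
   (use B' assms(2) in \<open>simp add: pd_bump abs_mult\<close>)
 then show ?thesis by (simp add: pd_bump conv_cmult)
qed

lemma continuous_conv_bump:
 fixes a :: "real^'n::finite \<Rightarrow> real"
 assumes "integrable lborel a" "0 < m"
 shows "continuous_on UNIV (conv a (bump c m))"
 using bump_bounded[OF assms(2), of c] continuous_conv[OF assms(1) continuous_bump] by blast

text \<open>A list of differentiations matters only through the number of occurrences of each
  index.\<close>

fun cadd :: "'n list \<Rightarrow> ('n \<Rightarrow> nat) \<Rightarrow> 'n \<Rightarrow> nat" where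
 "cadd [] c = c"
| "cadd (j # js) c = (cadd js c)(j := Suc (cadd js c j))"

lemma pds_conv_bump:
 fixes a :: "real^'n::finite \<Rightarrow> real"
 assumes "integrable lborel a" "0 < m"
 shows "pds js (\<lambda>x. r * conv a (bump c m) x) = (\<lambda>x. r * m ^ length js * conv a (bump (cadd js c) m) x)"
proof (induction js)
 case (Cons j js)
 show ?case
  unfolding pds.simps Cons.IH
  by (rule ext, rule hpd_pd)
   (use hpd_cmult[OF hpd_conv_bump[OF assms, of j "cadd js c"], of "r * m ^ length js"]
    in \<open>simp add: mult_ac fun_upd_def\<close>)
qed simp

lemma smooth_conv_bump:
 fixes a :: "real^'n::finite \<Rightarrow> real"
 assumes "integrable lborel a" "0 < m"
 shows "smooth_on UNIV (\<lambda>x. r * conv a (bump c m) x)"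
 unfolding smooth_on_def Ck_on_def pds_conv_bump[OF assms]
proof (intro allI conjI impI ballI)
 fix js :: "'n list"
 show "continuous_on UNIV (\<lambda>x. r * m ^ length js * conv a (bump (cadd js c) m) x)"
  by (intro continuous_intros continuous_conv_bump assms)
 fix x :: "real^'n" and j
 have "hpd j (\<lambda>x. r * m ^ length js * conv a (bump (cadd js c) m) x)
  (r * m ^ length js * (m * conv a (bump ((cadd js c)(j := Suc (cadd js c j))) m) x)) x"
  by (rule hpd_cmult[OF hpd_conv_bump[OF assms]])
 then show "(\<lambda>t. r * m ^ length js * conv a (bump (cadd js c) m) (x + t *\<^sub>R axis j 1)) differentiable (at 0)"
  unfolding hpd_def by (auto simp: real_differentiable_def)
qed

section \<open>Normalised mollifiers; \<open>rad\<close> bounds the radius of their supports, the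
  type argument carrying the dimension\<close>

definition rad :: "'n::finite itself \<Rightarrow> nat \<Rightarrow> real" where
 "rad _ n = CARD('n) / Suc n"

lemma rad_tendsto_0: "rad TYPE('n::finite) \<longlonglongrightarrow> 0"
 unfolding rad_def by (rule lim_const_over_n[THEN LIMSEQ_Suc])

definition mc :: "'n::finite itself \<Rightarrow> nat \<Rightarrow> real" where
 "mc _ n = 1 / (LBINT x. bump (\<lambda>i::'n. 0) (Suc n) x)"

definition mk :: "nat \<Rightarrow> real^'n::finite \<Rightarrow> real" where
 "mk n x = mc TYPE('n) n * bump (\<lambda>i. 0) (Suc n) x"

definition Mo :: "nat \<Rightarrow> (real^'n::finite \<Rightarrow> real) \<Rightarrow> real^'n \<Rightarrow> real" where
 "Mo n a = conv a (mk n)"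

lemma Mo_eq: "Mo n (a :: real^'n::finite \<Rightarrow> real) = (\<lambda>x. mc TYPE('n) n * conv a (bump (\<lambda>i. 0) (Suc n)) x)"
 unfolding Mo_def mk_def[abs_def] by (rule ext) (rule conv_cmult)

lemma bump_integrable: "0 < m \<Longrightarrow> integrable lborel (bump c m :: real^'n::finite \<Rightarrow> real)"
 by (rule continuous_compact_integrable[OF continuous_bump, of "cball 0 (CARD('n) / m)"])
  (auto intro: bump_zero)

lemma bump_0_nonneg: "0 \<le> bump (\<lambda>i. 0) m x"
 unfolding bump_def by (intro prod_nonneg) (metis bd_0_nonneg)

lemma bump_integral_pos:
 assumes "0 < m" shows "0 < (LBINT x. bump (\<lambda>i::'n::finite. 0) m x)"
proof (rule ccontr)
 let ?b = "bump (\<lambda>i::'n. 0) m"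
 assume "\<not> 0 < (LBINT x. ?b x)"
 moreover have "0 \<le> (LBINT x. ?b x)" by (simp add: bump_0_nonneg)
 ultimately have "(LBINT x. ?b x) = 0" by linarith
 then have "AE x in lborel. ?b x = 0"
  by (subst (asm) integral_nonneg_eq_0_iff_AE) (auto intro: bump_integrable assms simp: bump_0_nonneg)
 moreover have "?b x \<noteq> 0" if "x \<in> ball 0 (1 / m)" for x
 proof -
  have "\<bar>x $ i\<bar> < 1 / m" for i using component_le_norm_cart[of x i] that by simp
  then have "\<bar>m * x $ i\<bar> < 1" for i using assms by (simp add: abs_mult field_simps)
  then have "0 < ?b x" unfolding bump_def by (intro prod_pos) (metis bd_0_pos)
  then show ?thesis by simp
 qed
 ultimately have "AE x in lborel. x \<notin> ball (0::real^'n) (1 / m)" by (auto elim!: eventually_mono)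
 then have "ball (0::real^'n) (1 / m) \<in> null_sets lborel"
  by (subst (asm) AE_iff_null_sets[symmetric]) auto
 then have "negligible (ball (0::real^'n) (1 / m))"
  by (simp add: negligible_iff_null_sets null_sets_completionI)
 then show False using assms open_not_negligible[of "ball (0::real^'n) (1 / m)"] by simp
qed

lemma mc_pos: "0 < mc TYPE('n::finite) n"
 unfolding mc_def by (simp add: bump_integral_pos)

lemma mk_nonneg: "0 \<le> mk n x"
 unfolding mk_def using mc_pos less_imp_le by (intro mult_nonneg_nonneg bump_0_nonneg) blast

lemma mk_zero: "rad TYPE('n::finite) n \<le> norm x \<Longrightarrow> mk n (x :: real^'n) = 0"
 unfolding mk_def rad_def by (simp add: bump_zero)

lemma mk_integrable: "integrable lborel (mk n :: real^'n::finite \<Rightarrow> real)"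
 unfolding mk_def[abs_def] by (intro integrable_mult_right bump_integrable) simp

lemma mk_integral: "(LBINT x. mk n (x :: real^'n::finite)) = 1"
 unfolding mk_def mc_def using bump_integral_pos[where 'n = 'n, of "Suc n"] by simp

lemma C1_on_mk: "C1_on UNIV (mk n)"
 unfolding mk_def[abs_def] by (intro C1_on_cmult C1_on_bump)

lemma mk_bounded: "\<exists>B. \<forall>x :: real^'n::finite. \<bar>mk n x\<bar> \<le> B"
proof -
 obtain B where "\<And>x :: real^'n. \<bar>bump (\<lambda>i. 0) (Suc n) x\<bar> \<le> B"
  using bump_bounded[of "Suc n"] by (metis of_nat_0_less_iff zero_less_Suc)
 then have "\<bar>mk n x\<bar> \<le> mc TYPE('n) n * B" for x :: "real^'n"
  unfolding mk_def using mc_pos[where 'n = 'n, of n] by (simp add: abs_mult)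
 then show ?thesis by blast
qed

lemma Mo_zero:
 fixes a :: "real^'n::finite \<Rightarrow> real"
 assumes "\<And>y. y \<notin> K \<Longrightarrow> a y = 0" "\<And>y. y \<in> K \<Longrightarrow> rad TYPE('n) n \<le> dist x y"
 shows "Mo n a x = 0"
proof -
 have "a y * mk n (x - y) = 0" for y
  using assms mk_zero[of n "x - y"] by (cases "y \<in> K") (auto simp: dist_norm)
 then show ?thesis unfolding Mo_def conv_def by (simp only:) simp
qed

lemma smooth_Mo: "integrable lborel a \<Longrightarrow> smooth_on UNIV (Mo n a)"
 unfolding Mo_eq by (rule smooth_conv_bump) auto

lemma smooth_on_C2: "smooth_on U f \<Longrightarrow> C2_on U f"
 unfolding smooth_on_def using Ck_on_2_C2_on by blast

text \<open>Both orders of differentiation lead to the same derivative counts, hence to convolution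
  with the same bump.\<close>

lemma pd_Mo_commute:
 fixes a :: "real^'n::finite \<Rightarrow> real"
 assumes "integrable lborel a"
 shows "pd j (pd k (Mo n a)) x = pd k (pd j (Mo n a)) x"
proof -
 have e: "pds js (Mo n a) = (\<lambda>x. mc TYPE('n) n * Suc n ^ length js * conv a (bump (cadd js (\<lambda>i. 0)) (Suc n)) x)" for js
  unfolding Mo_eq using pds_conv_bump[OF assms, of "real (Suc n)"] by simp
 have "cadd [j, k] (\<lambda>i. 0) = cadd [k, j] (\<lambda>i. 0)" by (auto simp: fun_eq_iff)
 then have "pds [j, k] (Mo n a) x = pds [k, j] (Mo n a) x"
  unfolding e by (simp only: list.size)
 then show ?thesis by (simp only: pds.simps)
qed

text \<open>\<open>L\<close> and \<open>N\<close> depend on \<open>K\<close> only and not on the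
  function, so all coefficients of a form are mollified inside one compact subset of
  \<open>U\<close>.\<close>

lemma Mo_support:
 fixes K U :: "(real^'n::finite) set"
 assumes "compact K" "K \<subseteq> U" "open U"
 obtains L N where "compact L" "K \<subseteq> L" "L \<subseteq> U"
  "\<And>a n x. N \<le> n \<Longrightarrow> (\<And>y. y \<notin> K \<Longrightarrow> a y = 0) \<Longrightarrow> x \<notin> L \<Longrightarrow> Mo n a x = 0"
proof -
 have "\<exists>e>0. (\<Union>x\<in>K. cball x e) \<subseteq> U" 
  using compact_subset_open_imp_cball_epsilon_subset[OF assms(1,3,2)] by metis
 then obtain e where e: "0 < e" "(\<Union>x\<in>K. cball x e) \<subseteq> U" by blast
 define L where "L = {x + y | x y. x \<in> K \<and> y \<in> cball 0 e}"
 have L: "compact L" unfolding L_def by (intro compact_sums assms) auto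
 have Le: "L = (\<Union>x\<in>K. cball x e)"
 proof (intro set_eqI iffI)
  fix z assume "z \<in> (\<Union>x\<in>K. cball x e)"
  then obtain x where "x \<in> K" "dist x z \<le> e" by auto
  then show "z \<in> L" unfolding L_def
   by (intro CollectI exI[of _ x] exI[of _ "z - x"]) (auto simp: dist_norm norm_minus_commute)
 next
  fix z assume "z \<in> L"
  then obtain x y where "z = x + y" "x \<in> K" "norm y \<le> e" by (auto simp: L_def)
  then show "z \<in> (\<Union>x\<in>K. cball x e)" by (intro UN_I[of x]) (auto simp: dist_norm)
 qed
 obtain N where N: "\<And>n. N \<le> n \<Longrightarrow> rad TYPE('n) n < e"
  using order_tendstoD(2)[OF rad_tendsto_0 e(1)] unfolding eventually_sequentially by blast
 have "Mo n a x = 0" if "N \<le> n" "\<And>y. y \<notin> K \<Longrightarrow> a y = 0" "x \<notin> L" for a n x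
 proof (rule Mo_zero[OF that(2)])
  fix y assume "y \<in> K"
  then have "e < dist y x" using that(3) unfolding Le by auto
  then show "rad TYPE('n) n \<le> dist x y" using N[OF that(1)] by (simp add: dist_commute)
 qed
 note zero = this
 have "K \<subseteq> L" unfolding Le using e(1) by auto
 moreover have "L \<subseteq> U" unfolding Le by (rule e(2))
 ultimately show ?thesis by (rule that[OF L _ _ zero])
qed

subsection \<open>Square integrable families\<close>

definition sqi :: "'a measure \<Rightarrow> ('a \<Rightarrow> real) \<Rightarrow> bool" where
 "sqi M f \<longleftrightarrow> f \<in> borel_measurable M \<and> integrable M (\<lambda>x. (f x)\<^sup>2)"

lemma sqiD: "sqi M f \<Longrightarrow> f \<in> borel_measurable M" "sqi M f \<Longrightarrow> integrable M (\<lambda>x. (f x)\<^sup>2)"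
 by (auto simp: sqi_def)

lemma sqi_mult_integrable:
 assumes "sqi M f" "sqi M g" shows "integrable M (\<lambda>x. f x * g x)"
proof (rule Bochner_Integration.integrable_bound)
 note [measurable] = sqiD(1)[OF assms(1)] sqiD(1)[OF assms(2)]
 show "integrable M (\<lambda>x. (f x)\<^sup>2 + (g x)\<^sup>2)" using assms by (simp add: sqi_def)
 show "(\<lambda>x. f x * g x) \<in> borel_measurable M" by measurable
 have "\<bar>y * z\<bar> \<le> y\<^sup>2 + z\<^sup>2" for y z :: real
 proof -
  have "2 * (\<bar>y\<bar> * \<bar>z\<bar>) \<le> y\<^sup>2 + z\<^sup>2" using sum_squares_bound[of "\<bar>y\<bar>" "\<bar>z\<bar>"] by simp
  moreover have "0 \<le> \<bar>y\<bar> * \<bar>z\<bar>" by simp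
  ultimately show ?thesis unfolding abs_mult by linarith
 qed
 then show "AE x in M. norm (f x * g x) \<le> norm ((f x)\<^sup>2 + (g x)\<^sup>2)" by simp
qed

lemma sqi_add:
 assumes "sqi M f" "sqi M g" shows "sqi M (\<lambda>x. f x + g x)"
proof -
 note [measurable] = sqiD(1)[OF assms(1)] sqiD(1)[OF assms(2)]
 have "integrable M (\<lambda>x. (f x)\<^sup>2 + (g x)\<^sup>2 + 2 * (f x * g x))"
  using assms sqi_mult_integrable[OF assms] by (simp add: sqi_def)
 then show ?thesis by (simp add: sqi_def power2_sum mult.assoc)
qed

lemma sqi_cmult: "sqi M f \<Longrightarrow> sqi M (\<lambda>x. c * f x)"
 by (auto simp: sqi_def power_mult_distrib)

lemma sqi_zero: "sqi M (\<lambda>x. 0)"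
 by (simp add: sqi_def)

lemma sqi_diff: "sqi M f \<Longrightarrow> sqi M g \<Longrightarrow> sqi M (\<lambda>x. f x - g x)"
 using sqi_add[of M f "\<lambda>x. (-1) * g x"] sqi_cmult[of M g "-1"] by simp

lemma sqi_sum: "finite S \<Longrightarrow> (\<And>i. i \<in> S \<Longrightarrow> sqi M (f i)) \<Longrightarrow> sqi M (\<lambda>x. \<Sum>i\<in>S. f i x)"
 by (induction S rule: finite_induct) (auto intro: sqi_add sqi_zero)

section \<open>Finite families of square integrable functions and completeness\<close>

definition L2F :: "'b set \<Rightarrow> 'a measure \<Rightarrow> ('a \<Rightarrow> 'b \<Rightarrow> real) \<Rightarrow> bool" where
 "L2F I M u \<longleftrightarrow> (\<forall>l\<in>I. sqi M (\<lambda>x. u x l))"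

definition ip :: "'b set \<Rightarrow> 'a measure \<Rightarrow> ('a \<Rightarrow> 'b \<Rightarrow> real) \<Rightarrow> ('a \<Rightarrow> 'b \<Rightarrow> real) \<Rightarrow> real" where
 "ip I M u v = (\<Sum>l\<in>I. \<integral>x. u x l * v x l \<partial>M)"

abbreviation nrm2 :: "'b set \<Rightarrow> 'a measure \<Rightarrow> ('a \<Rightarrow> 'b \<Rightarrow> real) \<Rightarrow> real" where
 "nrm2 I M u \<equiv> ip I M u u"

lemma L2FD: "L2F I M u \<Longrightarrow> l \<in> I \<Longrightarrow> sqi M (\<lambda>x. u x l)"
 by (simp add: L2F_def)

lemma L2F_add: "L2F I M u \<Longrightarrow> L2F I M v \<Longrightarrow> L2F I M (\<lambda>x l. u x l + v x l)"
 by (simp add: L2F_def sqi_add)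

lemma L2F_diff: "L2F I M u \<Longrightarrow> L2F I M v \<Longrightarrow> L2F I M (\<lambda>x l. u x l - v x l)"
 by (simp add: L2F_def sqi_diff)

lemma L2F_cmult: "L2F I M u \<Longrightarrow> L2F I M (\<lambda>x l. c * u x l)"
 by (simp add: L2F_def sqi_cmult)

lemma ip_commute: "ip I M u v = ip I M v u"
 by (simp add: ip_def mult.commute)

lemma ip_nonneg: "0 \<le> nrm2 I M u"
 unfolding ip_def by (intro sum_nonneg integral_nonneg_AE) simp

lemma ip_add_left:
 assumes "L2F I M u" "L2F I M v" "L2F I M w"
 shows "ip I M (\<lambda>x l. u x l + v x l) w = ip I M u w + ip I M v w"
 unfolding ip_def sum.distrib[symmetric]
 by (rule sum.cong[OF refl]) (simp add: distrib_right sqi_mult_integrable L2FD[OF assms(1)] L2FD[OF assms(2)] L2FD[OF assms(3)])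

lemma ip_cmult_left: "ip I M (\<lambda>x l. c * u x l) w = c * ip I M u w"
 by (simp add: ip_def sum_distrib_left mult.assoc)

lemma ip_diff_left:
 assumes "L2F I M u" "L2F I M v" "L2F I M w"
 shows "ip I M (\<lambda>x l. u x l - v x l) w = ip I M u w - ip I M v w"
 using ip_add_left[OF assms(1) L2F_cmult[OF assms(2), of "-1"] assms(3)] ip_cmult_left[of I M "-1" v w]
 by simp

lemma nrm2_add_scaled:
 assumes "L2F I M u" "L2F I M v"
 shows "nrm2 I M (\<lambda>x l. u x l + t * v x l) = nrm2 I M u + 2 * t * ip I M u v + t\<^sup>2 * nrm2 I M v"
proof -
 let ?w = "\<lambda>x l. u x l + t * v x l"
 have w: "L2F I M ?w" by (intro L2F_add L2F_cmult assms)
 have "ip I M v ?w = ip I M u v + t * nrm2 I M v"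
  by (subst ip_commute)
   (simp add: ip_add_left[OF assms(1) L2F_cmult[OF assms(2)] assms(2)] ip_cmult_left)
 moreover have "ip I M u ?w = nrm2 I M u + t * ip I M u v"
  by (subst ip_commute)
   (simp add: ip_add_left[OF assms(1) L2F_cmult[OF assms(2)] assms(1)] ip_cmult_left ip_commute[of I M v u])
 ultimately show ?thesis
  by (simp add: ip_add_left[OF assms(1) L2F_cmult[OF assms(2)] w] ip_cmult_left power2_eq_square algebra_simps)
qed

lemma nrm2_diff:
 assumes "L2F I M u" "L2F I M v"
 shows "nrm2 I M (\<lambda>x l. u x l - v x l) = nrm2 I M u - 2 * ip I M u v + nrm2 I M v"
 using nrm2_add_scaled[OF assms, of "-1"] by simp

lemma quadratic_nonneg_discr:
 fixes A B C :: real
 assumes "\<And>t. 0 \<le> A + 2 * t * B + t\<^sup>2 * C" "0 \<le> C"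
 shows "B\<^sup>2 \<le> A * C"
proof (cases "C = 0")
 case True
 have "B = 0"
 proof (rule ccontr)
  assume "B \<noteq> 0"
  then show False using assms(1)[of "- (A + 1) / (2 * B)"] True by (simp add: field_simps)
 qed
 then show ?thesis using True by simp
next
 case False
 then have "0 < C" using assms(2) by simp
 have "0 \<le> A + 2 * (- B / C) * B + (- B / C)\<^sup>2 * C" by (rule assms(1))
 also have "\<dots> = A - B\<^sup>2 / C" using \<open>0 < C\<close> by (simp add: field_simps power2_eq_square)
 finally show ?thesis using \<open>0 < C\<close> by (simp add: field_simps)
qed

lemma ip_Cauchy_Schwarz:
 assumes "L2F I M u" "L2F I M v"
 shows "(ip I M u v)\<^sup>2 \<le> nrm2 I M u * nrm2 I M v"
 by (rule quadratic_nonneg_discr) (auto simp: nrm2_add_scaled[OF assms, symmetric] ip_nonneg)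

lemma ip_Cauchy_Schwarz_sqrt:
 assumes "L2F I M u" "L2F I M v"
 shows "\<bar>ip I M u v\<bar> \<le> sqrt (nrm2 I M u) * sqrt (nrm2 I M v)"
 using real_sqrt_le_mono[OF ip_Cauchy_Schwarz[OF assms]] by (simp add: real_sqrt_mult)

lemma component_le_nrm2:
 assumes "finite I" "l \<in> I"
 shows "(\<integral>x. (u x l)\<^sup>2 \<partial>M) \<le> nrm2 I M u"
 unfolding ip_def power2_eq_square
 by (rule member_le_sum[OF assms(2)]) (auto intro!: integral_nonneg_AE assms)

text \<open>A finite sum with weights 2^k bounds the increments by a constant times 2^(-k/2), which
  is summable. The weight fits increments whose squared L2 norms are below 4^(-k): then 2^k 4^(-k) =
  2^(-k) still sums.\<close>

lemma geometric_Cauchy: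
 fixes s :: "nat \<Rightarrow> real"
 assumes "(\<Sum>k. ennreal (2 ^ k * (s (Suc k) - s k)\<^sup>2)) < \<infinity>"
 shows "Cauchy s"
proof -
 have "summable (\<lambda>k. 2 ^ k * (s (Suc k) - s k)\<^sup>2)"
  by (rule summable_suminf_not_top) (use assms in auto)
 then have "(\<lambda>k. 2 ^ k * (s (Suc k) - s k)\<^sup>2) \<longlonglongrightarrow> 0" by (rule summable_LIMSEQ_zero)
 then obtain C where C: "\<And>k. \<bar>2 ^ k * (s (Suc k) - s k)\<^sup>2\<bar> \<le> C"
  using convergent_imp_Bseq[of "\<lambda>k. 2 ^ k * (s (Suc k) - s k)\<^sup>2"]
  unfolding Bseq_def convergent_def by auto
 have b: "norm (s (Suc k) - s k) \<le> sqrt C * (1 / sqrt 2) ^ k" for k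
 proof -
  have "2 ^ k * (s (Suc k) - s k)\<^sup>2 \<le> C" using C[of k] by simp
  then have "(s (Suc k) - s k)\<^sup>2 \<le> C * (1 / 2) ^ k" by (simp add: field_simps power_divide)
  then have "\<bar>s (Suc k) - s k\<bar> \<le> sqrt (C * (1 / 2) ^ k)" using real_sqrt_le_mono by fastforce
  also have "\<dots> = sqrt C * (1 / sqrt 2) ^ k"
   by (simp add: real_sqrt_mult real_sqrt_power real_sqrt_divide)
  finally show ?thesis by simp
 qed
 have "summable (\<lambda>k. s (Suc k) - s k)"
  by (rule summable_comparison_test'[OF summable_mult[OF summable_geometric] b])
   (simp add: real_less_rsqrt)
 then have "convergent (\<lambda>n. \<Sum>k<n. s (Suc k) - s k)" by (rule summable_iff_convergent[THEN iffD1])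
 then have "convergent (\<lambda>n. s n - s 0)" by (simp add: sum_lessThan_telescope)
 then have "convergent (\<lambda>n. (s n - s 0) + s 0)" by (rule convergent_add) (rule convergent_const)
 then show ?thesis by (simp add: Cauchy_convergent_iff)
qed

lemma nn_integral_sq_component:
 assumes "L2F I M u" "finite I" "l \<in> I"
 shows "(\<integral>\<^sup>+x. ennreal ((u x l)\<^sup>2) \<partial>M) \<le> ennreal (nrm2 I M u)"
proof -
 have "(\<integral>\<^sup>+x. ennreal ((u x l)\<^sup>2) \<partial>M) = ennreal (\<integral>x. (u x l)\<^sup>2 \<partial>M)"
  by (rule nn_integral_eq_integral) (use assms in \<open>auto dest: L2FD sqiD(2)\<close>)
 then show ?thesis using component_le_nrm2[OF assms(2,3), of M u] by (simp add: ennreal_leI)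
qed

text \<open>The last clause says more than convergence in norm: at every point the limit is either 0
  or the limit of one fixed subsequence. Through it algebraic identities such as alternation survive
  at every point and not only almost everywhere.\<close>

lemma L2F_complete:
 fixes a :: "nat \<Rightarrow> 'a \<Rightarrow> 'b \<Rightarrow> real"
 assumes fin: "finite I" and a: "\<And>n. L2F I M (a n)"
  and Cau: "\<And>e. 0 < e \<Longrightarrow> \<exists>N. \<forall>m\<ge>N. \<forall>n\<ge>N. nrm2 I M (\<lambda>x l. a m x l - a n x l) < e"
 shows "\<exists>u r. L2F I M u \<and> (\<lambda>n. nrm2 I M (\<lambda>x l. a n x l - u x l)) \<longlonglongrightarrow> 0 \<and>
  (\<forall>x. (\<forall>l. u x l = 0) \<or> ((\<forall>l\<in>I. (\<lambda>n. a (r n) x l) \<longlonglongrightarrow> u x l) \<and> (\<forall>l. l \<notin> I \<longrightarrow> u x l = 0)))"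
proof -
 have am: "(\<lambda>x. a n x l) \<in> borel_measurable M" if "l \<in> I" for n l
  using a that by (auto dest: L2FD sqiD(1))
 have "\<forall>k. \<exists>N. \<forall>m\<ge>N. \<forall>n\<ge>N. nrm2 I M (\<lambda>x l. a m x l - a n x l) < (1/4) ^ k"
  by (intro allI Cau) simp
 from choice[OF this] obtain N :: "nat \<Rightarrow> nat" where
  N': "\<forall>k. \<forall>m\<ge>N k. \<forall>n\<ge>N k. nrm2 I M (\<lambda>x l. a m x l - a n x l) < (1/4) ^ k" ..
 have N: "nrm2 I M (\<lambda>x l. a m x l - a n x l) < (1/4) ^ k" if "N k \<le> m" "N k \<le> n" for k m n
  using N'[rule_format, OF that] .
 \<comment> \<open>The partial sums make \<open>r\<close> strictly increasing and at least
   \<open>N k\<close> at \<open>k\<close>, so consecutive terms of the subsequence are closer than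
   4^(-k) in squared norm.\<close>
 define r where "r k = (\<Sum>i\<le>k. N i) + k" for k
 have rN: "N k \<le> r k" for k unfolding r_def by (simp add: member_le_sum trans_le_add1)
 have rS: "r k < r (Suc k)" for k by (simp add: r_def)
 have sm: "strict_mono r" using rS by (simp add: strict_mono_Suc_iff)
 have step: "nrm2 I M (\<lambda>x l. a (r (Suc k)) x l - a (r k) x l) < (1/4) ^ k" for k
  by (rule N) (use rN[of k] rS[of k] in auto)
 define S where "S = {x \<in> space M. \<forall>l\<in>I. Cauchy (\<lambda>k. a (r k) x l)}"
 have SM: "S \<in> sets M"
 proof -
  have "S = space M \<inter> (\<Inter>l\<in>I. {x \<in> space M. Cauchy (\<lambda>k. a (r k) x l)})" by (auto simp: S_def)
  moreover have "{x \<in> space M. Cauchy (\<lambda>k. a (r k) x l)} \<in> sets M" if "l \<in> I" for l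
   using am[OF that] by (intro sets_Collect_Cauchy)
  ultimately show ?thesis using fin by (cases "I = {}") (auto intro!: sets.Int sets.finite_INT)
 qed
 \<comment> \<open>The value 0 off the set of convergence is one alternative of the last clause of
   the statement.\<close>
 define u where "u x l = (if x \<in> S \<and> l \<in> I then lim (\<lambda>k. a (r k) x l) else 0)" for x l
 have ulim: "(\<lambda>k. a (r k) x l) \<longlonglongrightarrow> u x l" if "x \<in> S" "l \<in> I" for x l
 proof -
  have "convergent (\<lambda>k. a (r k) x l)" using that by (simp add: S_def Cauchy_convergent_iff)
  then show ?thesis using that by (simp add: u_def convergent_LIMSEQ_iff)
 qed
 have um[measurable]: "(\<lambda>x. u x l) \<in> borel_measurable M" if "l \<in> I" for l
 proof -
  have "(\<lambda>x. lim (\<lambda>k. a (r k) x l)) \<in> borel_measurable M"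
   using am[OF that] by (intro borel_measurable_lim_metric)
  moreover have "(\<lambda>x. u x l) = (\<lambda>x. if x \<in> S then lim (\<lambda>k. a (r k) x l) else 0)"
   using that by (auto simp: u_def)
  ultimately show ?thesis using SM by (simp add: measurable_If_set)
 qed
 have AES: "AE x in M. x \<in> S"
 proof -
  have "AE x in M. Cauchy (\<lambda>k. a (r k) x l)" if l: "l \<in> I" for l
  proof -
   let ?d = "\<lambda>k x. a (r (Suc k)) x l - a (r k) x l"
   have dm: "(\<lambda>x. ennreal (2 ^ k * (?d k x)\<^sup>2)) \<in> borel_measurable M" for k
    using am[OF l] by measurable
   have "(\<integral>\<^sup>+x. (\<Sum>k. ennreal (2 ^ k * (?d k x)\<^sup>2)) \<partial>M) = (\<Sum>k. \<integral>\<^sup>+x. ennreal (2 ^ k * (?d k x)\<^sup>2) \<partial>M)"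
    by (rule nn_integral_suminf) (rule dm)
   also have "\<dots> \<le> (\<Sum>k. ennreal ((1/2) ^ k))"
   proof (rule suminf_le)
    fix k
    have m2: "(\<lambda>x. ennreal ((?d k x)\<^sup>2)) \<in> borel_measurable M"
     using am[OF l] by measurable
    have "(\<integral>\<^sup>+x. ennreal (2 ^ k * (?d k x)\<^sup>2) \<partial>M) = (\<integral>\<^sup>+x. ennreal (2 ^ k) * ennreal ((?d k x)\<^sup>2) \<partial>M)"
     by (simp add: ennreal_mult)
    also have "\<dots> = ennreal (2 ^ k) * (\<integral>\<^sup>+x. ennreal ((?d k x)\<^sup>2) \<partial>M)"
     by (rule nn_integral_cmult[OF m2])
    also have "\<dots> \<le> ennreal (2 ^ k) * ennreal (nrm2 I M (\<lambda>x l. a (r (Suc k)) x l - a (r k) x l))"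
     using nn_integral_sq_component[OF L2F_diff[OF a a] fin l, of "r (Suc k)" "r k"]
     by (intro mult_left_mono) auto
    also have "\<dots> \<le> ennreal (2 ^ k) * ennreal ((1/4) ^ k)"
     using step[of k] by (intro mult_left_mono ennreal_leI) auto
    also have "\<dots> = ennreal ((1/2) ^ k)"
     by (simp add: ennreal_mult[symmetric] power_mult_distrib[symmetric])
    finally show "(\<integral>\<^sup>+x. ennreal (2 ^ k * (?d k x)\<^sup>2) \<partial>M) \<le> ennreal ((1/2) ^ k)" .
   qed auto
   also have "\<dots> = ennreal (\<Sum>k. (1/2) ^ k)"
    by (rule suminf_ennreal2) (auto intro: summable_geometric)
   also have "\<dots> < \<infinity>" by simp
   finally have "(\<integral>\<^sup>+x. (\<Sum>k. ennreal (2 ^ k * (?d k x)\<^sup>2)) \<partial>M) \<noteq> \<infinity>" by simp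
   then have "AE x in M. (\<Sum>k. ennreal (2 ^ k * (?d k x)\<^sup>2)) \<noteq> \<infinity>"
    by (rule nn_integral_PInf_AE[rotated]) (use dm in measurable)
   then show ?thesis
    by (rule eventually_mono) (rule geometric_Cauchy, simp add: less_top)
  qed
  then have "AE x in M. \<forall>l\<in>I. Cauchy (\<lambda>k. a (r k) x l)"
   using fin by (simp add: AE_finite_all)
  then show ?thesis by (auto simp: S_def)
 qed
 \<comment> \<open>Fatou along the subsequence: the distance to the pointwise limit is at most the
   lower limit of the distances to its terms.\<close>
 have small: "\<exists>N. \<forall>n\<ge>N. \<forall>l\<in>I. (\<integral>\<^sup>+x. ennreal ((a n x l - u x l)\<^sup>2) \<partial>M) \<le> ennreal e" if e0: "0 < e" for e
 proof -
  obtain N1 where N1: "\<And>m n. N1 \<le> m \<Longrightarrow> N1 \<le> n \<Longrightarrow> nrm2 I M (\<lambda>x l. a m x l - a n x l) < e"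
   using Cau[OF e0] by blast
  have "(\<integral>\<^sup>+x. ennreal ((a n x l - u x l)\<^sup>2) \<partial>M) \<le> ennreal e" if "N1 \<le> n" "l \<in> I" for n l
  proof -
   note [measurable] = am[OF that(2)]
   have "(\<integral>\<^sup>+x. ennreal ((a n x l - u x l)\<^sup>2) \<partial>M)
     = (\<integral>\<^sup>+x. liminf (\<lambda>k. ennreal ((a n x l - a (r k) x l)\<^sup>2)) \<partial>M)"
   proof (rule nn_integral_cong_AE, rule AE_mp[OF AES], rule AE_I2, rule impI)
    fix x assume "x \<in> S"
    have "(\<lambda>k. ennreal ((a n x l - a (r k) x l)\<^sup>2)) \<longlonglongrightarrow> ennreal ((a n x l - u x l)\<^sup>2)"
     by (intro tendsto_ennrealI tendsto_intros ulim \<open>x \<in> S\<close> that)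
    then show "ennreal ((a n x l - u x l)\<^sup>2) = liminf (\<lambda>k. ennreal ((a n x l - a (r k) x l)\<^sup>2))"
     by (rule lim_imp_Liminf[symmetric, rotated]) simp
   qed
   also have "\<dots> \<le> liminf (\<lambda>k. \<integral>\<^sup>+x. ennreal ((a n x l - a (r k) x l)\<^sup>2) \<partial>M)"
    by (rule nn_integral_liminf) measurable
   also have "\<dots> \<le> liminf (\<lambda>k::nat. ennreal e)"
   proof (rule Liminf_mono)
    have "(\<integral>\<^sup>+x. ennreal ((a n x l - a (r k) x l)\<^sup>2) \<partial>M) \<le> ennreal e" if "N1 \<le> k" for k
    proof -
     have "N1 \<le> r k" using that strict_mono_imp_increasing[OF sm, of k] by linarith
     then have "nrm2 I M (\<lambda>x l. a n x l - a (r k) x l) \<le> e" using N1[OF \<open>N1 \<le> n\<close>] less_imp_le by blast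
     then show ?thesis
      using nn_integral_sq_component[OF L2F_diff[OF a a] fin \<open>l \<in> I\<close>, of n "r k"]
      by (meson ennreal_leI order_trans)
    qed
    then show "\<forall>\<^sub>F k in sequentially. (\<integral>\<^sup>+x. ennreal ((a n x l - a (r k) x l)\<^sup>2) \<partial>M) \<le> ennreal e"
     by (auto simp: eventually_sequentially)
   qed
   also have "\<dots> = ennreal e" by (simp add: Liminf_const)
   finally show ?thesis .
  qed
  then show ?thesis by blast
 qed
 have sq: "\<exists>N. \<forall>n\<ge>N. \<forall>l\<in>I. sqi M (\<lambda>x. a n x l - u x l) \<and> (\<integral>x. (a n x l - u x l)\<^sup>2 \<partial>M) \<le> e" if e0: "0 < e" for e
 proof -
  obtain N2 where N2: "\<forall>n\<ge>N2. \<forall>l\<in>I. (\<integral>\<^sup>+x. ennreal ((a n x l - u x l)\<^sup>2) \<partial>M) \<le> ennreal e"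
   using small[OF e0] by blast
  have "sqi M (\<lambda>x. a n x l - u x l) \<and> (\<integral>x. (a n x l - u x l)\<^sup>2 \<partial>M) \<le> e" if "N2 \<le> n" "l \<in> I" for n l
  proof -
   note [measurable] = am[OF that(2)] um[OF that(2)]
   have b: "(\<integral>\<^sup>+x. ennreal ((a n x l - u x l)\<^sup>2) \<partial>M) \<le> ennreal e" using N2 that by blast
   have i: "integrable M (\<lambda>x. (a n x l - u x l)\<^sup>2)"
    by (rule integrableI_bounded) (use b in \<open>auto simp: less_top[symmetric] top_unique\<close>)
   have "ennreal (\<integral>x. (a n x l - u x l)\<^sup>2 \<partial>M) \<le> ennreal e"
    using b by (subst (asm) nn_integral_eq_integral[OF i]) auto
   then show ?thesis using i e0 by (simp add: sqi_def ennreal_le_iff)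
  qed
  then show ?thesis by blast
 qed
 obtain n0 where n0: "\<forall>l\<in>I. sqi M (\<lambda>x. a n0 x l - u x l)" using sq[of 1] by auto
 have uL: "L2F I M u"
  unfolding L2F_def
 proof
  fix l assume l: "l \<in> I"
  have "sqi M (\<lambda>x. a n0 x l - (a n0 x l - u x l))"
   by (rule sqi_diff[OF L2FD[OF a l] n0[rule_format, OF l]])
  then show "sqi M (\<lambda>x. u x l)" by simp
 qed
 have "(\<lambda>n. nrm2 I M (\<lambda>x l. a n x l - u x l)) \<longlonglongrightarrow> 0"
 proof (rule LIMSEQ_I)
  fix e :: real assume "0 < e"
  then have "0 < e / (card I + 1)" by simp
  from sq[OF this] obtain N3 where
   N3: "\<forall>n\<ge>N3. \<forall>l\<in>I. (\<integral>x. (a n x l - u x l)\<^sup>2 \<partial>M) \<le> e / (card I + 1)" by blast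
  have "norm (nrm2 I M (\<lambda>x l. a n x l - u x l) - 0) < e" if "N3 \<le> n" for n
  proof -
   have "nrm2 I M (\<lambda>x l. a n x l - u x l) \<le> (\<Sum>l\<in>I. e / (card I + 1))"
    unfolding ip_def power2_eq_square[symmetric] using N3 that by (intro sum_mono) blast
   also have "\<dots> = e * (card I / (card I + 1))" by simp
   also have "\<dots> < e * 1" using \<open>0 < e\<close> by (intro mult_strict_left_mono) auto
   finally show ?thesis using ip_nonneg[of I M "\<lambda>x l. a n x l - u x l"] by simp
  qed
  then show "\<exists>no. \<forall>n\<ge>no. norm (nrm2 I M (\<lambda>x l. a n x l - u x l) - 0) < e" by blast
 qed
 moreover have "(\<forall>l. u x l = 0) \<or> ((\<forall>l\<in>I. (\<lambda>n. a (r n) x l) \<longlonglongrightarrow> u x l) \<and> (\<forall>l. l \<notin> I \<longrightarrow> u x l = 0))" for x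
  using ulim by (cases "x \<in> S") (auto simp: u_def)
 ultimately show ?thesis using uL by blast
qed

text \<open>The functional is given by its graph \<open>P\<close>, a linear set of pairs (vector,
  value); the bound already makes the value depend only on the class of the vector. The representing
  element is found by minimisation and is therefore a norm limit of vectors occurring in
  \<open>P\<close>, which later shows that closedness and alternation pass to it.\<close>

lemma Riesz_pairs:
 fixes P :: "(('a \<Rightarrow> 'b \<Rightarrow> real) \<times> real) set"
 assumes fin: "finite I" and ne: "P \<noteq> {}"
  and L: "\<And>a t. (a, t) \<in> P \<Longrightarrow> L2F I M a"
  and add: "\<And>a s b t. (a, s) \<in> P \<Longrightarrow> (b, t) \<in> P \<Longrightarrow> (\<lambda>x l. a x l + b x l, s + t) \<in> P"
  and scale: "\<And>a s c. (a, s) \<in> P \<Longrightarrow> (\<lambda>x l. c * a x l, c * s) \<in> P"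
  and bound: "\<And>a t. (a, t) \<in> P \<Longrightarrow> \<bar>t\<bar> \<le> C * sqrt (nrm2 I M a)" and C: "0 \<le> C"
 shows "\<exists>u a. L2F I M u \<and> nrm2 I M u \<le> C\<^sup>2 \<and> (\<forall>b s. (b, s) \<in> P \<longrightarrow> ip I M u b = s) \<and>
  (\<forall>n. \<exists>t. (a n, t) \<in> P) \<and> (\<lambda>n. nrm2 I M (\<lambda>x l. a n x l - u x l)) \<longlonglongrightarrow> 0 \<and>
  (\<forall>x. (\<forall>l. u x l = 0) \<or> (\<exists>r. (\<forall>l\<in>I. (\<lambda>n. a (r n) x l) \<longlonglongrightarrow> u x l) \<and> (\<forall>l. l \<notin> I \<longrightarrow> u x l = 0)))"
proof -
 \<comment> \<open>If u represents the functional then J at (a, t) equals the squared distance from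
   a to u minus the squared norm of u, so minimising J means approaching u. The bound gives J \<ge>
   -C^2.\<close>
 define J where "J z = nrm2 I M (fst z) - 2 * snd z" for z
 have Jlow: "- (C\<^sup>2) \<le> J z" if "z \<in> P" for z
 proof -
  obtain a t where z: "z = (a, t)" by (cases z)
  have "t \<le> C * sqrt (nrm2 I M a)" using bound that z by fastforce
  moreover have "2 * (C * sqrt (nrm2 I M a)) \<le> C\<^sup>2 + (sqrt (nrm2 I M a))\<^sup>2"
   using sum_squares_bound[of C "sqrt (nrm2 I M a)"] by simp
  ultimately show ?thesis by (simp add: J_def z ip_nonneg)
 qed
 define m where "m = (INF z\<in>P. J z)"
 have bdd: "bdd_below (J ` P)" using Jlow by (auto intro!: bdd_belowI)
 have mJ: "m \<le> J z" if "z \<in> P" for z unfolding m_def using bdd that by (rule cINF_lower)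
 have "\<exists>z\<in>P. J z < m + 1 / real (Suc n)" for n
  using cINF_less_iff[OF ne bdd, of "m + 1 / real (Suc n)"] by (simp add: m_def)
 then obtain z where z: "\<And>n. z n \<in> P" "\<And>n. J (z n) < m + 1 / real (Suc n)" by metis
 define a where "a n = fst (z n)" for n
 define t where "t n = snd (z n)" for n
 have zP: "(a n, t n) \<in> P" for n using z(1)[of n] by (simp add: a_def t_def)
 have aL: "L2F I M (a n)" for n using L[OF zP] .
 have Jz: "nrm2 I M (a n) - 2 * t n < m + 1 / real (Suc n)" for n
  using z(2)[of n] by (simp add: J_def a_def t_def)
 \<comment> \<open>Parallelogram law: the midpoint of two almost minimal pairs is again in
   \<open>P\<close> and has J at least \<open>m\<close>, so the two vectors are close.\<close>
 have close: "nrm2 I M (\<lambda>x l. a i x l - a j x l) \<le> 2 / real (Suc i) + 2 / real (Suc j)" for i j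
 proof -
  have ar: "4 * v \<le> X - 4 * T" if "v \<le> 1/4 * X - T" for v X T :: real using that by simp
  have half: "2 * (1 / 2 * (t i + t j)) = t i + t j" by simp
  have "(\<lambda>x l. (1/2) * (a i x l + a j x l), (1/2) * (t i + t j)) \<in> P"
   by (intro scale add zP)
  from mJ[OF this] have "m \<le> nrm2 I M (\<lambda>x l. (1/2) * (a i x l + a j x l)) - (t i + t j)"
   unfolding J_def fst_conv snd_conv half .
  also have "nrm2 I M (\<lambda>x l. (1/2) * (a i x l + a j x l)) = (1/4) * nrm2 I M (\<lambda>x l. a i x l + 1 * a j x l)"
   using ip_cmult_left[of I M "1/2" "\<lambda>x l. a i x l + a j x l" "\<lambda>x l. (1/2) * (a i x l + a j x l)"]
    ip_cmult_left[of I M "1/2" "\<lambda>x l. a i x l + a j x l" "\<lambda>x l. a i x l + a j x l"]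
    ip_commute[of I M "\<lambda>x l. a i x l + a j x l" "\<lambda>x l. (1/2) * (a i x l + a j x l)"]
   by simp
  also have "nrm2 I M (\<lambda>x l. a i x l + 1 * a j x l) = nrm2 I M (a i) + 2 * ip I M (a i) (a j) + nrm2 I M (a j)"
   using nrm2_add_scaled[OF aL aL, of i 1 j] by simp
  finally have "4 * m \<le> nrm2 I M (a i) + 2 * ip I M (a i) (a j) + nrm2 I M (a j) - 4 * (t i + t j)"
   by (rule ar)
  moreover have "nrm2 I M (\<lambda>x l. a i x l - a j x l) = nrm2 I M (a i) - 2 * ip I M (a i) (a j) + nrm2 I M (a j)"
   by (rule nrm2_diff[OF aL aL])
  ultimately show ?thesis using Jz[of i] Jz[of j] by simp
 qed
 have Cau: "\<exists>N. \<forall>i\<ge>N. \<forall>j\<ge>N. nrm2 I M (\<lambda>x l. a i x l - a j x l) < e" if e0: "0 < e" for e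
 proof -
  obtain N where N: "4 / e < real (Suc N)" 
  proof -
   obtain N where "4 / e < real N" using reals_Archimedean2 by blast
   then have "4 / e < real (Suc N)" by simp
   then show ?thesis using that by blast
  qed
  have inv: "2 / real (Suc i) < e / 2" if "N \<le> i" for i
  proof -
   have "4 / e < real (Suc i)" using N that by simp
   then show ?thesis using e0 by (simp add: field_simps)
  qed
  have "nrm2 I M (\<lambda>x l. a i x l - a j x l) < e" if "N \<le> i" "N \<le> j" for i j
   using close[of i j] inv[OF that(1)] inv[OF that(2)] by linarith
  then show ?thesis by blast
 qed
 obtain u r where u: "L2F I M u" "(\<lambda>n. nrm2 I M (\<lambda>x l. a n x l - u x l)) \<longlonglongrightarrow> 0"
  "\<forall>x. (\<forall>l. u x l = 0) \<or> ((\<forall>l\<in>I. (\<lambda>n. a (r n) x l) \<longlonglongrightarrow> u x l) \<and> (\<forall>l. l \<notin> I \<longrightarrow> u x l = 0))"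
  using L2F_complete[OF fin aL Cau] by blast
 have iplim: "(\<lambda>n. ip I M (a n) b) \<longlonglongrightarrow> ip I M u b" if "L2F I M b" for b
 proof -
  have "(\<lambda>n. sqrt (nrm2 I M (\<lambda>x l. a n x l - u x l)) * sqrt (nrm2 I M b)) \<longlonglongrightarrow> sqrt 0 * sqrt (nrm2 I M b)"
   by (intro tendsto_intros u)
  then have g0: "(\<lambda>n. sqrt (nrm2 I M (\<lambda>x l. a n x l - u x l)) * sqrt (nrm2 I M b)) \<longlonglongrightarrow> 0"
   by simp
  have bd: "norm (ip I M (a n) b - ip I M u b)
     \<le> sqrt (nrm2 I M (\<lambda>x l. a n x l - u x l)) * sqrt (nrm2 I M b)" for n
   using ip_Cauchy_Schwarz_sqrt[OF L2F_diff[OF aL u(1)] that, of n] ip_diff_left[OF aL u(1) that, of n]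
   by (simp only: real_norm_def)
  have "(\<lambda>n. ip I M (a n) b - ip I M u b) \<longlonglongrightarrow> 0"
   by (rule Lim_null_comparison[OF always_eventually[OF allI[OF bd]] g0])
  then show ?thesis by (simp add: LIM_zero_iff)
 qed
 \<comment> \<open>J stays above \<open>m\<close> on the whole line through the n-th almost
   minimiser in the direction of \<open>(b, s)\<close>; the discriminant of this quadratic
   polynomial bounds the defect in the representing identity.\<close>
 have stat: "(ip I M (a n) b - s)\<^sup>2 \<le> (1 / real (Suc n)) * nrm2 I M b" if "(b, s) \<in> P" for b s n
 proof (rule order_trans[OF quadratic_nonneg_discr])
  let ?A = "J (a n, t n) - m"
  show "0 \<le> ?A + 2 * c * (ip I M (a n) b - s) + c\<^sup>2 * nrm2 I M b" for c
  proof -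
   have "(\<lambda>x l. a n x l + c * b x l, t n + c * s) \<in> P" by (intro add scale zP that)
   from mJ[OF this] show ?thesis
    using nrm2_add_scaled[OF aL L[OF that], of n c] by (simp add: J_def algebra_simps)
  qed
  show "0 \<le> nrm2 I M b" by (rule ip_nonneg)
  have "?A \<le> 1 / real (Suc n)" using Jz[of n] by (simp add: J_def)
  then show "?A * nrm2 I M b \<le> 1 / real (Suc n) * nrm2 I M b"
   by (rule mult_right_mono) (rule ip_nonneg)
 qed
 have ub: "ip I M u b = s" if "(b, s) \<in> P" for b s
 proof -
  have "(\<lambda>n. (ip I M (a n) b - s)\<^sup>2) \<longlonglongrightarrow> (ip I M u b - s)\<^sup>2"
   by (intro tendsto_intros iplim L[OF that])
  moreover have "(\<lambda>n. (1 / real (Suc n)) * nrm2 I M b) \<longlonglongrightarrow> 0 * nrm2 I M b"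
   by (intro tendsto_intros lim_const_over_n[of 1, THEN LIMSEQ_Suc])
  ultimately have "(ip I M u b - s)\<^sup>2 \<le> 0 * nrm2 I M b"
   by (rule LIMSEQ_le) (use stat[OF that] in blast)
  then show ?thesis by simp
 qed
 \<comment> \<open>Testing the identity with the almost minimisers themselves shows that their
   values tend to the squared norm of u, so the bound on the functional passes to the limit.\<close>
 have "nrm2 I M u \<le> C\<^sup>2"
 proof -
  have "(\<lambda>n. ip I M (a n) u) \<longlonglongrightarrow> nrm2 I M u" by (rule iplim[OF u(1)])
  moreover have "ip I M (a n) u = t n" for n using ub[OF zP] by (simp add: ip_commute)
  ultimately have tl: "t \<longlonglongrightarrow> nrm2 I M u" by simp
  have nl: "(\<lambda>n. nrm2 I M (a n)) \<longlonglongrightarrow> nrm2 I M u"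
  proof -
   have "(\<lambda>n. nrm2 I M (\<lambda>x l. a n x l - u x l) + 2 * ip I M (a n) u - nrm2 I M u)
     \<longlonglongrightarrow> 0 + 2 * nrm2 I M u - nrm2 I M u"
    by (intro tendsto_intros u(2) iplim[OF u(1)])
   then show ?thesis by (simp add: nrm2_diff[OF aL u(1)])
  qed
  have "nrm2 I M u \<le> C * sqrt (nrm2 I M u)"
  proof (rule LIMSEQ_le[OF tl])
   show "(\<lambda>n. C * sqrt (nrm2 I M (a n))) \<longlonglongrightarrow> C * sqrt (nrm2 I M u)" by (intro tendsto_intros nl)
   show "\<exists>N. \<forall>n\<ge>N. t n \<le> C * sqrt (nrm2 I M (a n))" using bound[OF zP] by (meson abs_le_D1)
  qed
  then have "sqrt (nrm2 I M u) * sqrt (nrm2 I M u) \<le> C * sqrt (nrm2 I M u)"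
   by (simp add: ip_nonneg)
  then have "sqrt (nrm2 I M u) \<le> C"
  proof (cases "nrm2 I M u = 0")
   case False
   then have "0 < sqrt (nrm2 I M u)" using ip_nonneg[of I M u] by simp
   then show ?thesis
    using \<open>sqrt (nrm2 I M u) * sqrt (nrm2 I M u) \<le> C * sqrt (nrm2 I M u)\<close> by (rule mult_right_le_imp_le[rotated])
  qed (use C in simp)
  then have "(sqrt (nrm2 I M u))\<^sup>2 \<le> C\<^sup>2" by (intro power_mono) (auto simp: ip_nonneg)
  then show ?thesis by (simp add: ip_nonneg)
 qed
 then show ?thesis using u ub zP by blast
qed

section \<open>L2 convergence of products and of mollifications\<close>

lemma scalar_Cauchy_Schwarz:
 assumes "sqi M f" "sqi M g"
 shows "(\<integral>x. f x * g x \<partial>M)\<^sup>2 \<le> (\<integral>x. (f x)\<^sup>2 \<partial>M) * (\<integral>x. (g x)\<^sup>2 \<partial>M)"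
 using ip_Cauchy_Schwarz[of "{()}" M "\<lambda>x _. f x" "\<lambda>x _. g x"] assms
 by (simp add: L2F_def ip_def power2_eq_square)

lemma scalar_Cauchy_Schwarz_sqrt:
 assumes "sqi M f" "sqi M g"
 shows "\<bar>\<integral>x. f x * g x \<partial>M\<bar> \<le> sqrt (\<integral>x. (f x)\<^sup>2 \<partial>M) * sqrt (\<integral>x. (g x)\<^sup>2 \<partial>M)"
 using real_sqrt_le_mono[OF scalar_Cauchy_Schwarz[OF assms]] by (simp add: real_sqrt_mult)

lemma sqi_mult_bounded:
 assumes "sqi M f" "b \<in> borel_measurable M" "\<And>x. \<bar>b x\<bar> \<le> B"
 shows "sqi M (\<lambda>x. b x * f x)" "(\<integral>x. (b x * f x)\<^sup>2 \<partial>M) \<le> B\<^sup>2 * (\<integral>x. (f x)\<^sup>2 \<partial>M)"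
proof -
 note [measurable] = sqiD(1)[OF assms(1)] assms(2)
 have le: "(b x * f x)\<^sup>2 \<le> B\<^sup>2 * (f x)\<^sup>2" for x
  using assms(3)[of x] by (simp add: power_mult_distrib abs_le_square_iff[symmetric] mult_right_mono)
 have i: "integrable M (\<lambda>x. B\<^sup>2 * (f x)\<^sup>2)" using sqiD(2)[OF assms(1)] by simp
 have j: "integrable M (\<lambda>x. (b x * f x)\<^sup>2)"
  by (rule Bochner_Integration.integrable_bound[OF i]) (use le in auto)
 show "sqi M (\<lambda>x. b x * f x)" using j by (simp add: sqi_def)
 have "(\<integral>x. (b x * f x)\<^sup>2 \<partial>M) \<le> (\<integral>x. B\<^sup>2 * (f x)\<^sup>2 \<partial>M)"
  by (rule integral_mono[OF j i le])
 then show "(\<integral>x. (b x * f x)\<^sup>2 \<partial>M) \<le> B\<^sup>2 * (\<integral>x. (f x)\<^sup>2 \<partial>M)" by simp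
qed

lemma integral_sq_add_le:
 assumes "sqi M f" "sqi M g"
 shows "(\<integral>x. (f x + g x)\<^sup>2 \<partial>M) \<le> 2 * (\<integral>x. (f x)\<^sup>2 \<partial>M) + 2 * (\<integral>x. (g x)\<^sup>2 \<partial>M)"
proof -
 have "(\<integral>x. (f x + g x)\<^sup>2 \<partial>M) \<le> (\<integral>x. 2 * (f x)\<^sup>2 + 2 * (g x)\<^sup>2 \<partial>M)"
 proof (rule integral_mono)
  show "integrable M (\<lambda>x. (f x + g x)\<^sup>2)" using sqi_add[OF assms] by (simp add: sqi_def)
  show "integrable M (\<lambda>x. 2 * (f x)\<^sup>2 + 2 * (g x)\<^sup>2)" using assms by (simp add: sqi_def)
  show "(f x + g x)\<^sup>2 \<le> 2 * (f x)\<^sup>2 + 2 * (g x)\<^sup>2" for x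
   using sum_squares_bound[of "f x" "g x"] by (simp add: power2_sum)
 qed
 also have "\<dots> = 2 * (\<integral>x. (f x)\<^sup>2 \<partial>M) + 2 * (\<integral>x. (g x)\<^sup>2 \<partial>M)"
  using assms by (simp add: sqi_def)
 finally show ?thesis .
qed

definition L2lim :: "(nat \<Rightarrow> 'a::euclidean_space \<Rightarrow> real) \<Rightarrow> ('a \<Rightarrow> real) \<Rightarrow> bool" where
 "L2lim F f \<longleftrightarrow> (\<forall>n. sqi lborel (F n)) \<and> sqi lborel f \<and> (\<lambda>n. LBINT x. (F n x - f x)\<^sup>2) \<longlonglongrightarrow> 0"

lemma L2limD: "L2lim F f \<Longrightarrow> sqi lborel (F n)" "L2lim F f \<Longrightarrow> sqi lborel f"
 "L2lim F f \<Longrightarrow> (\<lambda>n. LBINT x. (F n x - f x)\<^sup>2) \<longlonglongrightarrow> 0"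
 by (auto simp: L2lim_def)

lemma L2lim_squeeze:
 assumes "\<And>n. sqi lborel (F n)" "sqi lborel f"
  "\<And>n. (LBINT x. (F n x - f x)\<^sup>2) \<le> d n" "d \<longlonglongrightarrow> 0"
 shows "L2lim F f"
proof -
 have bd: "norm (LBINT x. (F n x - f x)\<^sup>2) \<le> d n" for n
  using assms(3)[of n] by (simp add: integral_nonneg_AE)
 have "(\<lambda>n. LBINT x. (F n x - f x)\<^sup>2) \<longlonglongrightarrow> 0"
  by (rule Lim_null_comparison[OF always_eventually[OF allI[OF bd]] assms(4)])
 then show ?thesis using assms by (simp add: L2lim_def)
qed

lemma L2lim_const: "sqi lborel f \<Longrightarrow> L2lim (\<lambda>n. f) f"
 by (simp add: L2lim_def)

lemma L2lim_add:
 assumes "L2lim F f" "L2lim G g" shows "L2lim (\<lambda>n x. F n x + G n x) (\<lambda>x. f x + g x)"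
proof (rule L2lim_squeeze)
 show "(\<lambda>n. 2 * (LBINT x. (F n x - f x)\<^sup>2) + 2 * (LBINT x. (G n x - g x)\<^sup>2)) \<longlonglongrightarrow> 0"
  using tendsto_add[OF tendsto_mult_left[OF L2limD(3)[OF assms(1)], of 2] tendsto_mult_left[OF L2limD(3)[OF assms(2)], of 2]]
  by simp
 show "(LBINT x. (F n x + G n x - (f x + g x))\<^sup>2)
   \<le> 2 * (LBINT x. (F n x - f x)\<^sup>2) + 2 * (LBINT x. (G n x - g x)\<^sup>2)" for n
 proof -
  have "F n x + G n x - (f x + g x) = (F n x - f x) + (G n x - g x)" for x by simp
  then show ?thesis
   using integral_sq_add_le[OF sqi_diff[OF L2limD(1,2)[OF assms(1)]] sqi_diff[OF L2limD(1,2)[OF assms(2)]], of n n]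
   by (simp only:)
 qed
qed (use assms in \<open>auto intro!: sqi_add dest: L2limD\<close>)

lemma L2lim_mult_bounded:
 assumes "L2lim F f" "b \<in> borel_measurable borel" "\<And>x. \<bar>b x\<bar> \<le> B"
 shows "L2lim (\<lambda>n x. b x * F n x) (\<lambda>x. b x * f x)"
proof (rule L2lim_squeeze)
 have bm: "b \<in> borel_measurable lborel" using assms(2) by simp
 show "(\<lambda>n. B\<^sup>2 * (LBINT x. (F n x - f x)\<^sup>2)) \<longlonglongrightarrow> 0"
  using tendsto_mult_left[OF L2limD(3)[OF assms(1)], of "B\<^sup>2"] by simp
 show "(LBINT x. (b x * F n x - b x * f x)\<^sup>2) \<le> B\<^sup>2 * (LBINT x. (F n x - f x)\<^sup>2)" for n
  using sqi_mult_bounded(2)[OF sqi_diff[OF L2limD(1,2)[OF assms(1)]] bm assms(3), of n]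
  by (simp add: right_diff_distrib)
 show "sqi lborel (\<lambda>x. b x * F n x)" for n
  by (rule sqi_mult_bounded(1)[OF L2limD(1)[OF assms(1)] bm assms(3)])
 show "sqi lborel (\<lambda>x. b x * f x)"
  by (rule sqi_mult_bounded(1)[OF L2limD(2)[OF assms(1)] bm assms(3)])
qed

lemma L2lim_sum:
 assumes "finite S" "\<And>i. i \<in> S \<Longrightarrow> L2lim (F i) (f i)"
 shows "L2lim (\<lambda>n x. \<Sum>i\<in>S. F i n x) (\<lambda>x. \<Sum>i\<in>S. f i x)"
 using assms
proof (induction S rule: finite_induct)
 case empty
 then show ?case using L2lim_const[OF sqi_zero] by simp
next
 case (insert i S)
 then show ?case using L2lim_add[of "F i" "f i"] by simp
qed

lemma L2lim_shift: "L2lim F f \<Longrightarrow> L2lim (\<lambda>n. F (n + N)) f"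
 unfolding L2lim_def using LIMSEQ_ignore_initial_segment[of "\<lambda>n. LBINT x. (F n x - f x)\<^sup>2" 0 N] by auto

lemma L2lim_inner:
 assumes F: "L2lim F f" and G: "L2lim G g"
 shows "(\<lambda>n. LBINT x. F n x * G n x) \<longlonglongrightarrow> (LBINT x. f x * g x)"
proof -
 note sF = L2limD(1)[OF F] and sf = L2limD(2)[OF F] and sG = L2limD(1)[OF G] and sg = L2limD(2)[OF G]
 let ?a = "\<lambda>n. sqrt (LBINT x. (F n x - f x)\<^sup>2)"
 let ?b = "\<lambda>n. sqrt (LBINT x. (G n x - g x)\<^sup>2)"
 let ?d = "\<lambda>n. ?a n * ?b n + ?a n * sqrt (LBINT x. (g x)\<^sup>2) + sqrt (LBINT x. (f x)\<^sup>2) * ?b n"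
 have "?d \<longlonglongrightarrow> sqrt 0 * sqrt 0 + sqrt 0 * sqrt (LBINT x. (g x)\<^sup>2) + sqrt (LBINT x. (f x)\<^sup>2) * sqrt 0"
  by (intro tendsto_intros L2limD(3)[OF F] L2limD(3)[OF G])
 then have d0: "?d \<longlonglongrightarrow> 0" by simp
 have bd: "norm ((LBINT x. F n x * G n x) - (LBINT x. f x * g x)) \<le> ?d n" for n
 proof -
  have "F n x * G n x = (F n x - f x) * (G n x - g x) + (F n x - f x) * g x + f x * (G n x - g x) + f x * g x" for x
   by (simp add: algebra_simps)
  then have "(LBINT x. F n x * G n x) = (LBINT x. (F n x - f x) * (G n x - g x))
    + (LBINT x. (F n x - f x) * g x) + (LBINT x. f x * (G n x - g x)) + (LBINT x. f x * g x)"
   using sqi_mult_integrable[OF sqi_diff[OF sF sf] sqi_diff[OF sG sg], of n n]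
    sqi_mult_integrable[OF sqi_diff[OF sF sf] sg, of n] sqi_mult_integrable[OF sf sqi_diff[OF sG sg], of n]
    sqi_mult_integrable[OF sf sg]
   by (simp only: Bochner_Integration.integral_add Bochner_Integration.integrable_add)
  then show ?thesis
   using scalar_Cauchy_Schwarz_sqrt[OF sqi_diff[OF sF sf] sqi_diff[OF sG sg], of n n]
    scalar_Cauchy_Schwarz_sqrt[OF sqi_diff[OF sF sf] sg, of n]
    scalar_Cauchy_Schwarz_sqrt[OF sf sqi_diff[OF sG sg], of n]
   unfolding real_norm_def by linarith
 qed
 have "(\<lambda>n. (LBINT x. F n x * G n x) - (LBINT x. f x * g x)) \<longlonglongrightarrow> 0"
  by (rule Lim_null_comparison[OF always_eventually[OF allI[OF bd]] d0])
 then show ?thesis by (simp add: LIM_zero_iff)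
qed

lemma lborel_reflect: "distr lborel borel (\<lambda>y. x - y) = (lborel :: (real^'n) measure)"
proof -
 have "(lborel :: (real^'n) measure) = density (distr lborel borel (\<lambda>y. x + (-1) *\<^sub>R y)) (\<lambda>_. ennreal (\<bar>-1\<bar> ^ DIM(real^'n)))"
  by (rule lborel_affine) simp
 then show ?thesis by (simp add: density_1)
qed

lemma nn_integral_reflect:
 fixes k :: "real^'n \<Rightarrow> ennreal"
 assumes "k \<in> borel_measurable borel"
 shows "(\<integral>\<^sup>+y. k (x - y) \<partial>lborel) = (\<integral>\<^sup>+y. k y \<partial>lborel)"
 using nn_integral_distr[of "\<lambda>y. x - y" lborel borel k] assms by (simp add: lborel_reflect)

lemma nn_integral_shift:
 fixes k :: "real^'n \<Rightarrow> ennreal"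
 assumes "k \<in> borel_measurable borel"
 shows "(\<integral>\<^sup>+x. k (x - y) \<partial>lborel) = (\<integral>\<^sup>+x. k x \<partial>lborel)"
proof -
 have "(\<integral>\<^sup>+x. k x \<partial>lborel) = (\<integral>\<^sup>+x. k x \<partial>distr lborel borel ((+) (- y)))" by (simp add: lborel_distr_plus)
 also have "\<dots> = (\<integral>\<^sup>+x. k (- y + x) \<partial>lborel)" by (rule nn_integral_distr) (use assms in auto)
 finally show ?thesis by simp
qed

lemma mk_measurable [measurable]: "mk n \<in> borel_measurable borel"
 using C1_onD(1)[OF C1_on_mk] by (rule borel_measurable_continuous_onI)

lemma mk_nn_integral: "(\<integral>\<^sup>+x. ennreal (mk n (x :: real^'n)) \<partial>lborel) = 1"
 using nn_integral_eq_integral[OF mk_integrable] by (simp add: mk_nonneg mk_integral)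

lemma mk_reflect_integrable: "integrable lborel (\<lambda>y. mk n (x - y :: real^'n))"
 and mk_reflect_integral: "(LBINT y. mk n (x - y :: real^'n)) = 1"
proof -
 have "(\<integral>\<^sup>+y. ennreal (mk n (x - y)) \<partial>lborel) = 1"
  using nn_integral_reflect[of "\<lambda>y. ennreal (mk n y)" x] by (simp add: mk_nn_integral)
 then show i: "integrable lborel (\<lambda>y. mk n (x - y :: real^'n))"
  by (intro integrableI_nonneg) (auto simp: mk_nonneg)
 show "(LBINT y. mk n (x - y :: real^'n)) = 1"
  using \<open>(\<integral>\<^sup>+y. ennreal (mk n (x - y)) \<partial>lborel) = 1\<close>
  by (subst integral_eq_nn_integral) (auto simp: mk_nonneg)
qed

lemma sqi_compact_integrable:
 fixes a :: "real^'n \<Rightarrow> real"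
 assumes "sqi lborel a" "compact K" "\<And>x. x \<notin> K \<Longrightarrow> a x = 0"
 shows "integrable lborel a"
proof -
 have "emeasure lborel K < \<infinity>" using assms(2) by (intro emeasure_bounded_finite compact_imp_bounded)
 moreover have "K \<in> sets borel" using assms(2) by (simp add: borel_closed compact_imp_closed)
 ultimately have "sqi lborel (\<lambda>x. indicator K x :: real)"
  by (simp add: sqi_def power2_eq_square flip: indicator_inter_arith)
 from sqi_mult_integrable[OF assms(1) this] have "integrable lborel (\<lambda>x. a x * indicator K x)" .
 moreover have "(\<lambda>x. a x * indicator K x) = a" using assms(3) by (auto simp: indicator_def fun_eq_iff)
 ultimately show ?thesis by simp
qed

lemma Mo_measurable:
 fixes a :: "real^'n \<Rightarrow> real"
 assumes "integrable lborel a" shows "Mo n a \<in> borel_measurable borel"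
proof -
 obtain B where "\<And>x :: real^'n. \<bar>mk n x\<bar> \<le> B" using mk_bounded by blast
 then have "continuous_on UNIV (Mo n a)"
  unfolding Mo_def by (rule continuous_conv[OF assms C1_onD(1)[OF C1_on_mk]])
 then show ?thesis by (rule borel_measurable_continuous_onI)
qed

text \<open>Cauchy-Schwarz for the probability density \<open>\<lambda>y. mk n (x - y)\<close>,
  split into two square roots, bounds the squared convolution by the convolution of the square;
  exchanging the integrals removes the kernel.\<close>

lemma Mo_contraction:
 fixes a :: "real^'n \<Rightarrow> real"
 assumes a: "sqi lborel a" and i: "integrable lborel a"
 shows "sqi lborel (Mo n a)" "(LBINT x. (Mo n a x)\<^sup>2) \<le> (LBINT x. (a x)\<^sup>2)"
proof -
 have am [measurable]: "a \<in> borel_measurable borel" using i by auto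
 have Mm [measurable]: "Mo n a \<in> borel_measurable borel" by (rule Mo_measurable[OF i])
 obtain B where B: "\<And>x :: real^'n. \<bar>mk n x\<bar> \<le> B" using mk_bounded by blast
 have i2: "integrable lborel (\<lambda>y. (a y)\<^sup>2 * mk n (x - y))" for x
  using conv_integrable[OF sqiD(2)[OF a] C1_onD(1)[OF C1_on_mk] B] .
 have pt: "ennreal ((Mo n a x)\<^sup>2) \<le> (\<integral>\<^sup>+y. ennreal ((a y)\<^sup>2 * mk n (x - y)) \<partial>lborel)" for x
 proof -
  let ?f = "\<lambda>y. a y * sqrt (mk n (x - y))" and ?g = "\<lambda>y. sqrt (mk n (x - y))"
  have sf: "sqi lborel ?f" using i2[of x] by (simp add: sqi_def power_mult_distrib mk_nonneg)
  have sg: "sqi lborel ?g" using mk_reflect_integrable[of n x] by (simp add: sqi_def mk_nonneg)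
  have "(LBINT y. ?f y * ?g y)\<^sup>2 \<le> (LBINT y. (?f y)\<^sup>2) * (LBINT y. (?g y)\<^sup>2)"
   by (rule scalar_Cauchy_Schwarz[OF sf sg])
  then have "(Mo n a x)\<^sup>2 \<le> (LBINT y. (a y)\<^sup>2 * mk n (x - y))"
   by (simp add: Mo_def conv_def power_mult_distrib mk_nonneg mk_reflect_integral mult.assoc)
  also have "ennreal \<dots> = (\<integral>\<^sup>+y. ennreal ((a y)\<^sup>2 * mk n (x - y)) \<partial>lborel)"
   by (rule nn_integral_eq_integral[symmetric, OF i2]) (simp add: mk_nonneg)
  finally show ?thesis using ennreal_leI by blast
 qed
 have "(\<integral>\<^sup>+x. ennreal ((Mo n a x)\<^sup>2) \<partial>lborel) \<le> (\<integral>\<^sup>+x. \<integral>\<^sup>+y. ennreal ((a y)\<^sup>2 * mk n (x - y)) \<partial>lborel \<partial>lborel)"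
  by (rule nn_integral_mono) (rule pt)
 also have "\<dots> = (\<integral>\<^sup>+y. \<integral>\<^sup>+x. ennreal ((a y)\<^sup>2 * mk n (x - y)) \<partial>lborel \<partial>lborel)"
  by (rule lborel_pair.Fubini'[symmetric]) (simp add: case_prod_unfold)
 also have "\<dots> = (\<integral>\<^sup>+y. ennreal ((a y)\<^sup>2) \<partial>lborel)"
 proof (rule nn_integral_cong)
  fix y
  have "(\<integral>\<^sup>+x. ennreal ((a y)\<^sup>2 * mk n (x - y)) \<partial>lborel) = (\<integral>\<^sup>+x. ennreal ((a y)\<^sup>2) * ennreal (mk n (x - y)) \<partial>lborel)"
   by (simp add: ennreal_mult mk_nonneg)
  also have "\<dots> = ennreal ((a y)\<^sup>2) * (\<integral>\<^sup>+x. ennreal (mk n (x - y)) \<partial>lborel)"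
   by (rule nn_integral_cmult) simp
  also have "(\<integral>\<^sup>+x. ennreal (mk n (x - y)) \<partial>lborel) = 1"
   using nn_integral_shift[of "\<lambda>x. ennreal (mk n x)" y] by (simp add: mk_nn_integral)
  finally show "(\<integral>\<^sup>+x. ennreal ((a y)\<^sup>2 * mk n (x - y)) \<partial>lborel) = ennreal ((a y)\<^sup>2)" by simp
 qed
 also have "\<dots> = ennreal (LBINT x. (a x)\<^sup>2)"
  by (rule nn_integral_eq_integral[OF sqiD(2)[OF a]]) simp
 finally have le: "(\<integral>\<^sup>+x. ennreal ((Mo n a x)\<^sup>2) \<partial>lborel) \<le> ennreal (LBINT x. (a x)\<^sup>2)" .
 have int: "integrable lborel (\<lambda>x. (Mo n a x)\<^sup>2)"
  by (rule integrableI_nonneg) (use le in \<open>auto simp: le_less_trans[OF _ ennreal_less_top]\<close>)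
 then show "sqi lborel (Mo n a)" by (simp add: sqi_def)
 have "ennreal (LBINT x. (Mo n a x)\<^sup>2) \<le> ennreal (LBINT x. (a x)\<^sup>2)"
  using le by (subst (asm) nn_integral_eq_integral[OF int]) auto
 then show "(LBINT x. (Mo n a x)\<^sup>2) \<le> (LBINT x. (a x)\<^sup>2)"
  by (simp add: ennreal_le_iff integral_nonneg_AE)
qed

lemma Mo_add:
 fixes a b :: "real^'n \<Rightarrow> real"
 assumes "integrable lborel a" "integrable lborel b"
 shows "Mo n (\<lambda>x. a x + b x) x = Mo n a x + Mo n b x"
proof -
 obtain B where B: "\<And>x :: real^'n. \<bar>mk n x\<bar> \<le> B" using mk_bounded by blast
 note i = conv_integrable[OF assms(1) C1_onD(1)[OF C1_on_mk] B] conv_integrable[OF assms(2) C1_onD(1)[OF C1_on_mk] B]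
 show ?thesis unfolding Mo_def conv_def
  by (simp add: distrib_right Bochner_Integration.integral_add[OF i])
qed

lemma Mo_cmult: "Mo n (\<lambda>x. c * a x) x = c * Mo n a x"
 unfolding Mo_def conv_def by (simp add: mult.assoc)

text \<open>A continuous function with compact support is uniformly continuous, so its
  mollifications converge uniformly, and all of them live in a common ball from some index
  on.\<close>

lemma Mo_L2lim_continuous:
 fixes b :: "real^'n \<Rightarrow> real"
 assumes b: "continuous_on UNIV b" and K: "compact K" "\<And>x. x \<notin> K \<Longrightarrow> b x = 0"
 shows "L2lim (\<lambda>n. Mo n b) b"
proof -
 have ib: "integrable lborel b" by (rule continuous_compact_integrable[OF b K])
 have sb: "sqi lborel b"
 proof -
  have "integrable lborel (\<lambda>x. (b x)\<^sup>2)"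
   by (rule continuous_compact_integrable[of _ K]) (use b K in \<open>auto intro!: continuous_intros\<close>)
  then show ?thesis using ib by (auto simp: sqi_def)
 qed
 obtain R where R: "\<And>x. x \<in> K \<Longrightarrow> norm x \<le> R" using compact_imp_bounded[OF K(1)] bounded_iff by metis
 define L where "L = cball (0::real^'n) (R + 2)"
 have Lfin: "emeasure lborel L < \<infinity>" unfolding L_def by (rule emeasure_bounded_finite) simp
 have uc: "uniformly_continuous_on L b"
  unfolding L_def by (rule compact_uniformly_continuous) (use b continuous_on_subset in auto)
 have main: "\<exists>N. \<forall>n\<ge>N. (LBINT x. (Mo n b x - b x)\<^sup>2) < e" if "0 < e" for e
 proof -
  \<comment> \<open>A uniform error \<open>s\<close> costs s^2 times the measure of
    \<open>L\<close>; the added 1 makes the result strictly smaller than \<open>e\<close> and avoids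
    a zero denominator.\<close>
  define s where "s = sqrt (e / (measure lborel L + 1))"
  have m0: "0 < measure lborel L + 1" by (simp add: add_nonneg_pos)
  have s0: "0 < s" using that m0 by (simp add: s_def)
  obtain d where d: "0 < d" "\<And>x y. x \<in> L \<Longrightarrow> y \<in> L \<Longrightarrow> dist x y < d \<Longrightarrow> dist (b x) (b y) < s"
   using uc s0 unfolding uniformly_continuous_on_def by metis
  obtain N where N: "\<And>n. N \<le> n \<Longrightarrow> rad TYPE('n) n < min d 1"
   using order_tendstoD(2)[OF rad_tendsto_0, of "min d 1"] d(1) unfolding eventually_sequentially by auto
  have "(LBINT x. (Mo n b x - b x)\<^sup>2) < e" if n: "N \<le> n" for n
  proof -
   have close: "\<bar>b y - b x\<bar> \<le> s" if "dist x y < min d 1" for x y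
   proof (cases "x \<in> L \<and> y \<in> L")
    case True
    then show ?thesis using d(2)[of x y] that by (auto simp: dist_real_def)
   next
    case False
    have "norm x \<le> norm y + dist x y" "norm y \<le> norm x + dist x y"
     using norm_triangle_sub[of x y] norm_triangle_sub[of y x] by (auto simp: dist_norm norm_minus_commute)
    then have "R < norm x" "R < norm y" using False that by (auto simp: L_def)
    then have "x \<notin> K" "y \<notin> K" using R by (meson not_less)+
    then show ?thesis using K(2) s0 by simp
   qed
   obtain B where B: "\<And>x :: real^'n. \<bar>mk n x\<bar> \<le> B" using mk_bounded by blast
   have pt: "\<bar>Mo n b x - b x\<bar> \<le> s" for x
   proof -
    have ii: "integrable lborel (\<lambda>y. b y * mk n (x - y))"
     by (rule conv_integrable[OF ib C1_onD(1)[OF C1_on_mk] B])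
    have "Mo n b x - b x = (LBINT y. b y * mk n (x - y)) - (LBINT y. b x * mk n (x - y))"
     by (simp add: Mo_def conv_def mk_reflect_integral)
    also have "\<dots> = (LBINT y. b y * mk n (x - y) - b x * mk n (x - y))"
     using ii mk_reflect_integrable[of n x] by (intro Bochner_Integration.integral_diff[symmetric]) auto
    also have "\<bar>\<dots>\<bar> \<le> (LBINT y. s * mk n (x - y))"
    proof (rule integral_abs_bound[THEN order_trans], rule integral_mono)
     show "integrable lborel (\<lambda>y. \<bar>b y * mk n (x - y) - b x * mk n (x - y)\<bar>)"
      using ii mk_reflect_integrable[of n x] by (intro integrable_abs Bochner_Integration.integrable_diff) auto
     show "integrable lborel (\<lambda>y. s * mk n (x - y))" using mk_reflect_integrable[of n x] by simp
     fix y
     have "\<bar>b y * mk n (x - y) - b x * mk n (x - y)\<bar> = \<bar>b y - b x\<bar> * mk n (x - y)"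
      by (simp add: left_diff_distrib[symmetric] abs_mult mk_nonneg)
     also have "\<dots> \<le> s * mk n (x - y)"
     proof (cases "dist x y < min d 1")
      case True
      then show ?thesis by (intro mult_right_mono close mk_nonneg)
     next
      case False
      then have "mk n (x - y) = 0" using N[OF n] by (intro mk_zero) (auto simp: dist_norm)
      then show ?thesis by simp
     qed
     finally show "\<bar>b y * mk n (x - y) - b x * mk n (x - y)\<bar> \<le> s * mk n (x - y)" .
    qed
    also have "\<dots> = s" by (simp add: mk_reflect_integral)
    finally show ?thesis .
   qed
   have zero: "Mo n b x - b x = 0" if "x \<notin> L" for x
   proof -
    have "R + 2 < norm x" using that by (simp add: L_def)
    have "Mo n b x = 0"
    proof (rule Mo_zero[OF K(2)])
     fix y assume "y \<in> K"
     then have "norm y \<le> R" by (rule R)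
     moreover have "norm x \<le> norm y + dist x y" using norm_triangle_sub[of x y] by (simp add: dist_norm)
     ultimately show "rad TYPE('n) n \<le> dist x y" using \<open>R + 2 < norm x\<close> N[OF n] by auto
    qed
    moreover have "x \<notin> K" using R[of x] \<open>R + 2 < norm x\<close> by auto
    ultimately show ?thesis using K(2) by simp
   qed
   have Lm: "L \<in> sets lborel" by (simp add: L_def)
   have "(LBINT x. (Mo n b x - b x)\<^sup>2) \<le> (LBINT x. s\<^sup>2 * indicator L x)"
   proof (rule integral_mono)
    show "integrable lborel (\<lambda>x. (Mo n b x - b x)\<^sup>2)"
     using sqi_diff[OF Mo_contraction(1)[OF sb ib] sb] by (simp add: sqi_def)
    show "integrable lborel (\<lambda>x. s\<^sup>2 * indicator L x)" using Lfin Lm by simp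
    show "(Mo n b x - b x)\<^sup>2 \<le> s\<^sup>2 * indicator L x" for x
     using pt[of x] zero[of x] s0 by (cases "x \<in> L") (auto simp: abs_le_square_iff[symmetric])
   qed
   also have "\<dots> = s\<^sup>2 * measure lborel L" using Lm by simp
   also have "\<dots> < s\<^sup>2 * (measure lborel L + 1)" using s0 by (intro mult_strict_left_mono) auto
   also have "\<dots> = e" using that m0 \<open>0 < e\<close> by (simp add: s_def)
   finally show ?thesis .
  qed
  then show ?thesis by blast
 qed
 have "(\<lambda>n. LBINT x. (Mo n b x - b x)\<^sup>2) \<longlonglongrightarrow> 0"
 proof (rule LIMSEQ_I)
  fix e :: real assume "0 < e"
  from main[OF this] show "\<exists>no. \<forall>n\<ge>no. norm ((LBINT x. (Mo n b x - b x)\<^sup>2) - 0) < e"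
   by (simp add: integral_nonneg_AE)
 qed
 then show ?thesis using sb Mo_contraction(1)[OF sb ib] by (simp add: L2lim_def)
qed

text \<open>Bounded truncations approximate \<open>a\<close> in L2; a bounded measurable function is
  in turn an almost everywhere limit of continuous functions, which are made to converge in L2 by
  domination.\<close>

lemma L2_dense_continuous:
 fixes a :: "real^'n \<Rightarrow> real"
 assumes a: "sqi lborel a" and K: "compact K" "\<And>x. x \<notin> K \<Longrightarrow> a x = 0"
  and e: "0 < e"
 shows "\<exists>b L. continuous_on UNIV b \<and> compact L \<and> (\<forall>x. x \<notin> L \<longrightarrow> b x = 0) \<and> (LBINT x. (b x - a x)\<^sup>2) < e"
proof -
 have am [measurable]: "a \<in> borel_measurable borel" using sqiD(1)[OF a] by simp
 obtain R where R: "\<And>x. x \<in> K \<Longrightarrow> norm x \<le> R" using compact_imp_bounded[OF K(1)] bounded_iff by metis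
 define T where "T n t = max (- real n) (min (real n) t)" for n t
 have Tabs: "\<bar>T n t\<bar> \<le> real n" "\<bar>T n t - t\<bar> \<le> \<bar>t\<bar>" for n t by (auto simp: T_def max_def min_def)
 have Tc: "continuous_on UNIV (T n)" for n unfolding T_def by (intro continuous_intros)
 have Tm [measurable]: "T n \<in> borel_measurable borel" for n using Tc by (rule borel_measurable_continuous_onI)
 have "(\<lambda>n. LBINT x. (T n (a x) - a x)\<^sup>2) \<longlonglongrightarrow> (\<integral>x. 0 \<partial>(lborel :: (real^'n) measure))"
 proof (rule integral_dominated_convergence[where w = "\<lambda>x. (a x)\<^sup>2"])
  have "(\<lambda>n. (T n t - t)\<^sup>2) \<longlonglongrightarrow> 0" for t
  proof (rule tendsto_eventually)
   obtain N :: nat where "\<bar>t\<bar> \<le> real N" using real_arch_simple by blast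
   then have "(T n t - t)\<^sup>2 = 0" if "N \<le> n" for n using that by (auto simp: T_def max_def min_def)
   then show "\<forall>\<^sub>F n in sequentially. (T n t - t)\<^sup>2 = 0" unfolding eventually_sequentially by blast
  qed
  then show "AE x in lborel. (\<lambda>n. (T n (a x) - a x)\<^sup>2) \<longlonglongrightarrow> 0" by simp
  show "AE x in lborel. norm ((T n (a x) - a x)\<^sup>2) \<le> (a x)\<^sup>2" for n
   using Tabs(2)[of n] by (intro AE_I2) (simp add: abs_le_square_iff[symmetric])
 qed (use sqiD(2)[OF a] in auto)
 then have "(\<lambda>n. LBINT x. (T n (a x) - a x)\<^sup>2) \<longlonglongrightarrow> 0" by simp
 then obtain m where m: "(LBINT x. (T m (a x) - a x)\<^sup>2) < e / 4"
  using order_tendstoD(2)[of _ 0 sequentially "e / 4"] e unfolding eventually_sequentially by auto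
 have "(\<lambda>x. T m (a x)) \<in> borel_measurable lebesgue" by (intro measurable_completion) measurable
 from lebesgue_measurable_imp_measurable_on[OF this, of UNIV]
 obtain S g where S: "negligible S" and g: "\<And>n. continuous_on UNIV (g n)"
  "\<And>x. x \<notin> S \<Longrightarrow> (\<lambda>n. g n x) \<longlonglongrightarrow> T m (a x)" unfolding measurable_on_def by auto
 \<comment> \<open>The continuous approximants \<open>g n\<close> converge only almost everywhere.
   Truncating them at height \<open>m\<close> and cutting off between the radii R and R + 1 gives a
   common integrable bound and does not change the limit, which vanishes off \<open>K\<close> and is
   bounded by \<open>m\<close>.\<close>
 define cut where "cut x = max 0 (min 1 (R + 1 - norm x))" for x :: "real^'n"
 have cutc: "continuous_on UNIV cut" unfolding cut_def by (intro continuous_intros)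
 define b where "b n x = cut x * T m (g n x)" for n x
 have bc: "continuous_on UNIV (b n)" for n
  unfolding b_def by (intro continuous_intros cutc continuous_on_compose2[OF Tc g(1)]) auto
 have b0: "b n x = 0" if "x \<notin> cball 0 (R + 1)" for n x using that by (simp add: b_def cut_def)
 have ba: "\<bar>b n x\<bar> \<le> real m" for n x
 proof -
  have "\<bar>cut x\<bar> \<le> 1" by (simp add: cut_def)
  then have "\<bar>cut x\<bar> * \<bar>T m (g n x)\<bar> \<le> 1 * real m" using Tabs(1) by (intro mult_mono) auto
  then show ?thesis by (simp add: b_def abs_mult)
 qed
 have T0: "T m 0 = 0" by (simp add: T_def)
 have bl: "(\<lambda>n. b n x) \<longlonglongrightarrow> T m (a x)" if "x \<notin> S" for x
 proof -
  have "(\<lambda>n. T m (g n x)) \<longlonglongrightarrow> T m (T m (a x))"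
   by (rule continuous_on_tendsto_compose[OF Tc g(2)[OF that]]) auto
  moreover have "T m (T m (a x)) = T m (a x)" by (auto simp: T_def max_def min_def)
  ultimately have "(\<lambda>n. cut x * T m (g n x)) \<longlonglongrightarrow> cut x * T m (a x)" by (intro tendsto_mult_left) simp
  moreover have "cut x * T m (a x) = T m (a x)"
  proof (cases "x \<in> K")
   case True
   then have "cut x = 1" using R[of x] by (simp add: cut_def)
   then show ?thesis by simp
  qed (simp add: K(2) T0)
  ultimately show ?thesis by (simp add: b_def)
 qed
 have [measurable]: "b n \<in> borel_measurable borel" for n using bc by (rule borel_measurable_continuous_onI)
 define w where "w x = (2 * real m)\<^sup>2 * indicator (cball 0 (R + 1)) x" for x :: "real^'n"
 have "(\<lambda>n. \<integral>x. (b n x - T m (a x))\<^sup>2 \<partial>lebesgue) \<longlonglongrightarrow> (\<integral>x. 0 \<partial>(lebesgue :: (real^'n) measure))"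
 proof (rule integral_dominated_convergence[where w = w])
  have "AE x in lebesgue. x \<notin> S" using S by (simp add: negligible_iff_null_sets AE_not_in)
  then show "AE x in lebesgue. (\<lambda>n. (b n x - T m (a x))\<^sup>2) \<longlonglongrightarrow> 0"
  proof (rule eventually_mono)
   fix x assume "x \<notin> S"
   then have "(\<lambda>n. (b n x - T m (a x))\<^sup>2) \<longlonglongrightarrow> (T m (a x) - T m (a x))\<^sup>2" by (intro tendsto_intros bl)
   then show "(\<lambda>n. (b n x - T m (a x))\<^sup>2) \<longlonglongrightarrow> 0" by simp
  qed
  show "AE x in lebesgue. norm ((b n x - T m (a x))\<^sup>2) \<le> w x" for n
  proof (rule AE_I2)
   fix x
   show "norm ((b n x - T m (a x))\<^sup>2) \<le> w x"
   proof (cases "x \<in> cball 0 (R + 1)")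
    case True
    have "\<bar>b n x - T m (a x)\<bar> \<le> 2 * real m" using ba[of n x] Tabs(1)[of m "a x"] by linarith
    then have "\<bar>b n x - T m (a x)\<bar> \<le> \<bar>2 * real m\<bar>" by simp
    then have "(b n x - T m (a x))\<^sup>2 \<le> (2 * real m)\<^sup>2" by (simp only: abs_le_square_iff)
    then show ?thesis using True by (simp add: w_def)
   next
    case False
    then have "x \<notin> K" using R[of x] by auto
    then show ?thesis using False b0[OF False] by (simp add: K(2) T0 w_def)
   qed
  qed
  have "emeasure lborel (cball (0::real^'n) (R + 1)) < \<infinity>" by (rule emeasure_bounded_finite) simp
  then have "integrable lborel w" unfolding w_def by simp
  then show "integrable lebesgue w" by (subst integrable_completion) (auto simp: w_def)
  show "(\<lambda>x. (b n x - T m (a x))\<^sup>2) \<in> borel_measurable lebesgue" for n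
   by (intro measurable_completion) measurable
 qed simp
 then have "(\<lambda>n. LBINT x. (b n x - T m (a x))\<^sup>2) \<longlonglongrightarrow> 0"
  by (simp add: integral_completion)
 then obtain n where n: "(LBINT x. (b n x - T m (a x))\<^sup>2) < e / 4"
  using order_tendstoD(2)[of _ 0 sequentially "e / 4"] e unfolding eventually_sequentially by auto
 have sT: "sqi lborel (\<lambda>x. T m (a x))"
 proof -
  have "integrable lborel (\<lambda>x. (T m (a x))\<^sup>2)"
  proof (rule Bochner_Integration.integrable_bound[OF sqiD(2)[OF a]])
   have "\<bar>T m t\<bar> \<le> \<bar>t\<bar>" for t by (auto simp: T_def max_def min_def)
   then show "AE x in lborel. norm ((T m (a x))\<^sup>2) \<le> norm ((a x)\<^sup>2)"
    by (intro AE_I2) (simp add: abs_le_square_iff[symmetric])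
  qed simp
  then show ?thesis by (simp add: sqi_def)
 qed
 have sb: "sqi lborel (b n)"
 proof -
  have "integrable lborel (\<lambda>x. (b n x)\<^sup>2)"
   by (rule continuous_compact_integrable[of _ "cball 0 (R + 1)"]) (use bc b0 in \<open>auto intro!: continuous_intros\<close>)
  then show ?thesis by (simp add: sqi_def)
 qed
 have "(LBINT x. (b n x - a x)\<^sup>2) < e"
  using integral_sq_add_le[OF sqi_diff[OF sb sT] sqi_diff[OF sT a]] m n by simp
 then show ?thesis using bc[of n] b0[of _ n] by (intro exI[of _ "b n"] exI[of _ "cball 0 (R + 1)"]) auto
qed

text \<open>Density of continuous functions, together with the fact that mollification does not
  increase the norm of the difference.\<close>

lemma Mo_L2lim:
 fixes a :: "real^'n \<Rightarrow> real"
 assumes a: "sqi lborel a" and K: "compact K" "\<And>x. x \<notin> K \<Longrightarrow> a x = 0"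
 shows "L2lim (\<lambda>n. Mo n a) a"
proof -
 have ia: "integrable lborel a" by (rule sqi_compact_integrable[OF a K])
 have "(\<lambda>n. LBINT x. (Mo n a x - a x)\<^sup>2) \<longlonglongrightarrow> 0"
 proof (rule LIMSEQ_I)
  fix e :: real assume e: "0 < e"
  \<comment> \<open>Splitting the error twice by (x + y)^2 \<le> 2 x^2 + 2 y^2 gives the weights 2 +
    4 + 4 = 10.\<close>
  obtain b L where b: "continuous_on UNIV b" "compact L" "\<And>x. x \<notin> L \<Longrightarrow> b x = 0"
   "(LBINT x. (b x - a x)\<^sup>2) < e / 10"
   using L2_dense_continuous[OF a K, of "e / 10"] e by auto
  have lb: "L2lim (\<lambda>n. Mo n b) b" by (rule Mo_L2lim_continuous[OF b(1-3)])
  have sb: "sqi lborel b" by (rule L2limD(2)[OF lb])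
  have ib: "integrable lborel b" by (rule continuous_compact_integrable[OF b(1-3)])
  obtain N where N: "\<And>n. N \<le> n \<Longrightarrow> (LBINT x. (Mo n b x - b x)\<^sup>2) < e / 10"
   using order_tendstoD(2)[OF L2limD(3)[OF lb], of "e / 10"] e unfolding eventually_sequentially by auto
  have "norm ((LBINT x. (Mo n a x - a x)\<^sup>2) - 0) < e" if "N \<le> n" for n
  proof -
   define c where "c x = a x + (-1) * b x" for x
   have sc: "sqi lborel c" unfolding c_def using sqi_diff[OF a sb] by simp
   have ic: "integrable lborel c" unfolding c_def using ia ib by simp
   have Mc: "Mo n c x = Mo n a x - Mo n b x" for x
    unfolding c_def[abs_def] using Mo_add[OF ia, of "\<lambda>x. (-1) * b x" n x] ib Mo_cmult[of n "-1" b x] by simp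
   have cc: "(LBINT x. (c x)\<^sup>2) < e / 10"
    using b(4) by (simp add: c_def power2_commute)
   have sM: "sqi lborel (Mo n c)" "(LBINT x. (Mo n c x)\<^sup>2) \<le> (LBINT x. (c x)\<^sup>2)"
    using Mo_contraction[OF sc ic] by auto
   have "Mo n a x - a x = Mo n c x + ((Mo n b x - b x) + (b x - a x))" for x by (simp add: Mc)
   then have 1: "(LBINT x. (Mo n a x - a x)\<^sup>2)
     \<le> 2 * (LBINT x. (Mo n c x)\<^sup>2) + 2 * (LBINT x. ((Mo n b x - b x) + (b x - a x))\<^sup>2)"
    using integral_sq_add_le[OF sM(1) sqi_add[OF sqi_diff[OF L2limD(1)[OF lb] sb] sqi_diff[OF sb a]], of n]
    by (simp only:)
   have 2: "(LBINT x. ((Mo n b x - b x) + (b x - a x))\<^sup>2)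
     \<le> 2 * (LBINT x. (Mo n b x - b x)\<^sup>2) + 2 * (LBINT x. (b x - a x)\<^sup>2)"
    by (rule integral_sq_add_le[OF sqi_diff[OF L2limD(1)[OF lb] sb] sqi_diff[OF sb a]])
   have ar: "t < e" if "t \<le> 2 * x + 2 * z" "z \<le> 2 * v + 2 * w" "x \<le> y" "y < e / 10" "v < e / 10" "w < e / 10"
    for t x y z v w :: real
    using that by linarith
   have "(LBINT x. (Mo n a x - a x)\<^sup>2) < e"
    by (rule ar[OF 1 2 sM(2) cc N[OF that] b(4)])
   then show ?thesis by (simp add: integral_nonneg_AE)
  qed
  then show "\<exists>no. \<forall>n\<ge>no. norm ((LBINT x. (Mo n a x - a x)\<^sup>2) - 0) < e" by blast
 qed
 then show ?thesis using a Mo_contraction(1)[OF a ia] by (simp add: L2lim_def)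
qed

subsection \<open>Weak divergence and the Bochner inequality\<close>

definition Cc :: "(real^'n::finite) set \<Rightarrow> (real^'n \<Rightarrow> real) \<Rightarrow> bool" where
 "Cc U f \<longleftrightarrow> continuous_on U f \<and> (\<exists>K. compact K \<and> K \<subseteq> U \<and> (\<forall>x. x \<notin> K \<longrightarrow> f x = 0))"

lemma Cc_mult: "continuous_on U h \<Longrightarrow> Cc U f \<Longrightarrow> Cc U (\<lambda>x. h x * f x)"
 unfolding Cc_def by (auto intro!: continuous_intros)

lemma Cc_mult_right: "continuous_on U h \<Longrightarrow> Cc U f \<Longrightarrow> Cc U (\<lambda>x. f x * h x)"
 unfolding Cc_def by (auto intro!: continuous_intros)

lemma Cc_Cc_mult: "Cc U f \<Longrightarrow> Cc U g \<Longrightarrow> Cc U (\<lambda>x. f x * g x)"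
 using Cc_mult[of U f g] by (auto simp: Cc_def)

lemma Cc_continuous: "Cc U f \<Longrightarrow> continuous_on U f"
 by (simp add: Cc_def)

lemma Cc_add:
 assumes "Cc U f" "Cc U g" shows "Cc U (\<lambda>x. f x + g x)"
proof -
 obtain K where K: "compact K" "K \<subseteq> U" "\<forall>x. x \<notin> K \<longrightarrow> f x = 0" using assms(1) unfolding Cc_def by blast
 obtain L where L: "compact L" "L \<subseteq> U" "\<forall>x. x \<notin> L \<longrightarrow> g x = 0" using assms(2) unfolding Cc_def by blast
 have "compact (K \<union> L)" "K \<union> L \<subseteq> U" "\<forall>x. x \<notin> K \<union> L \<longrightarrow> f x + g x = 0" using K L by auto
 then show ?thesis using assms unfolding Cc_def by (blast intro: continuous_on_add)
qed

lemma Cc_zero: "Cc U (\<lambda>x. 0)"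
 unfolding Cc_def by (auto intro: exI[of _ "{}"])

lemma Cc_cmult: "Cc U f \<Longrightarrow> Cc U (\<lambda>x. c * f x)"
 by (rule Cc_mult) auto

lemma Cc_minus: "Cc U f \<Longrightarrow> Cc U (\<lambda>x. - f x)"
 using Cc_cmult[of U f "-1"] by simp

lemma Cc_diff: "Cc U f \<Longrightarrow> Cc U g \<Longrightarrow> Cc U (\<lambda>x. f x - g x)"
 using Cc_add[of U f "\<lambda>x. - g x"] Cc_minus[of U g] by simp

lemma Cc_sum: "finite S \<Longrightarrow> (\<And>i. i \<in> S \<Longrightarrow> Cc U (f i)) \<Longrightarrow> Cc U (\<lambda>x. \<Sum>i\<in>S. f i x)"
 by (induction S rule: finite_induct) (auto intro: Cc_add Cc_zero)

lemma Cc_continuous_UNIV: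
 assumes "Cc U f" "open U" shows "continuous_on UNIV f"
proof -
 obtain K where K: "compact K" "K \<subseteq> U" "\<And>x. x \<notin> K \<Longrightarrow> f x = 0" using assms by (auto simp: Cc_def)
 have "continuous_on (- K) f"
  using K(3) continuous_on_cong[of "- K" "- K" f "\<lambda>x. 0"] by simp
 then have "continuous_on (U \<union> - K) f"
  by (intro continuous_on_open_Un) (use assms K in \<open>auto simp: compact_imp_closed Cc_def\<close>)
 moreover have "U \<union> - K = UNIV" using K by auto
 ultimately show ?thesis by simp
qed

lemma Cc_integrable:
 fixes f :: "real^'n \<Rightarrow> real"
 assumes "Cc U f" "open U" shows "integrable lborel f"
proof -
 obtain K where "compact K" "\<And>x. x \<notin> K \<Longrightarrow> f x = 0" using assms by (auto simp: Cc_def)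
 then show ?thesis using continuous_compact_integrable[OF Cc_continuous_UNIV[OF assms]] by blast
qed

lemma Cc_sqi:
 fixes f :: "real^'n \<Rightarrow> real"
 assumes "Cc U f" "open U" shows "sqi lborel f"
 using Cc_integrable[OF Cc_Cc_mult[OF assms(1) assms(1)] assms(2)] Cc_integrable[OF assms]
 by (auto simp: sqi_def power2_eq_square)

lemma C1c_Cc: "C1c U f \<Longrightarrow> Cc U f"
 unfolding C1c_def Cc_def C1_on_def by (auto intro: continuous_on_subset)

lemma C1c_pd_Cc:
 assumes "C1c U f" shows "Cc U (pd j f)"
proof -
 obtain K where K: "compact K" "K \<subseteq> U" "\<And>x j. x \<notin> K \<Longrightarrow> pd j f x = 0"
  using C1c_support[OF assms] by metis
 have "continuous_on U (pd j f)" using C1_onD(2)[OF C1c_C1_on[OF assms]] .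
 then show ?thesis using K unfolding Cc_def by blast
qed

lemma integral_by_parts:
 fixes h f :: "real^'n \<Rightarrow> real"
 assumes f: "C1c U f" and h: "C1_on U h" and U: "open U"
 shows "(LBINT x. h x * pd j f x) = - (LBINT x. pd j h x * f x)"
proof -
 obtain K where K: "compact K" "K \<subseteq> U" "\<And>x. x \<notin> K \<Longrightarrow> f x = 0" "\<And>x j. x \<notin> K \<Longrightarrow> pd j f x = 0"
  using C1c_support[OF f] by metis
 have hf: "C1c U (\<lambda>x. h x * f x)" by (rule C1c_mult[OF h f U])
 have eq: "pd j (\<lambda>x. h x * f x) x = h x * pd j f x + pd j h x * f x" for x
 proof (cases "x \<in> U")
  case True
  then show ?thesis using pd_mult[OF h C1c_C1_on[OF f] True] by simp
 next
  case False
  then have x: "x \<in> - K" using K by auto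
  have "hpd j (\<lambda>x. h x * f x) 0 x"
   by (rule hpd_cong_open[OF hpd_const[of j 0 x], of "- K"]) (use K x in \<open>auto simp: compact_imp_closed\<close>)
  then show ?thesis using x K by (simp add: hpd_pd)
 qed
 have "(LBINT x. h x * pd j f x + pd j h x * f x) = 0"
  using integral_pd_zero[OF C1c_mono[OF hf subset_UNIV], of j] by (simp add: eq)
 moreover have "integrable lborel (\<lambda>x. h x * pd j f x)" "integrable lborel (\<lambda>x. pd j h x * f x)"
  by (rule Cc_integrable[OF Cc_mult[OF C1_onD(1)[OF h] C1c_pd_Cc[OF f]] U],
    rule Cc_integrable[OF Cc_mult[OF C1_onD(2)[OF h] C1c_Cc[OF f]] U])
 ultimately show ?thesis by simp
qed

section \<open>Weak divergences of locally square integrable fields\<close>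

definition loc2 :: "(real^'n::finite) set \<Rightarrow> (real^'n \<Rightarrow> real) \<Rightarrow> bool" where
 "loc2 U a \<longleftrightarrow> a \<in> borel_measurable borel \<and>
  (\<forall>K. compact K \<and> K \<subseteq> U \<longrightarrow> integrable lborel (\<lambda>x. indicator K x * (a x)\<^sup>2))"

lemma loc2_sqi:
 assumes "loc2 U a" "compact K" "K \<subseteq> U"
 shows "sqi lborel (\<lambda>x. indicator K x * a x)"
proof -
 have [measurable]: "a \<in> borel_measurable borel" "K \<in> sets borel"
  using assms by (auto simp: loc2_def borel_closed compact_imp_closed)
 have "(indicator K x * a x)\<^sup>2 = indicator K x * (a x)\<^sup>2" for x by (simp add: indicator_def)
 then show ?thesis using assms by (simp add: sqi_def loc2_def)
qed

lemma loc2_integrable: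
 fixes a f :: "real^'n \<Rightarrow> real"
 assumes a: "loc2 U a" and f: "Cc U f" and U: "open U"
 shows "integrable lborel (\<lambda>x. a x * f x)"
proof -
 obtain K where K: "compact K" "K \<subseteq> U" "\<And>x. x \<notin> K \<Longrightarrow> f x = 0" using f by (auto simp: Cc_def)
 have "integrable lborel (\<lambda>x. (indicator K x * a x) * f x)"
  by (rule sqi_mult_integrable[OF loc2_sqi[OF a K(1,2)] Cc_sqi[OF f U]])
 moreover have "(\<lambda>x. (indicator K x * a x) * f x) = (\<lambda>x. a x * f x)"
  using K(3) by (auto simp: indicator_def fun_eq_iff)
 ultimately show ?thesis by simp
qed

lemma loc2_zero: "loc2 U (\<lambda>x. 0)"
 by (simp add: loc2_def)

lemma loc2I:
 assumes "a \<in> borel_measurable borel" "\<And>K. compact K \<Longrightarrow> K \<subseteq> U \<Longrightarrow> sqi lborel (\<lambda>x. indicator K x * a x)"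
 shows "loc2 U a"
proof -
 have "(indicator K x * a x)\<^sup>2 = indicator K x * (a x)\<^sup>2" for x K by (simp add: indicator_def)
 then show ?thesis using assms by (simp add: loc2_def sqi_def)
qed

lemma loc2_add: "loc2 U a \<Longrightarrow> loc2 U b \<Longrightarrow> loc2 U (\<lambda>x. a x + b x)"
 using sqi_add[OF loc2_sqi[of U a] loc2_sqi[of U b]]
 by (intro loc2I) (auto simp: distrib_left loc2_def)

lemma loc2_cmult: "loc2 U a \<Longrightarrow> loc2 U (\<lambda>x. c * a x)"
 using sqi_cmult[OF loc2_sqi[of U a], of _ c]
 by (intro loc2I) (auto simp: mult.left_commute loc2_def)

lemma loc2_sum: "finite S \<Longrightarrow> (\<And>i. i \<in> S \<Longrightarrow> loc2 U (f i)) \<Longrightarrow> loc2 U (\<lambda>x. \<Sum>i\<in>S. f i x)"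
 by (induction S rule: finite_induct) (auto intro: loc2_add loc2_zero)

lemma indicator_compact_bounded:
 fixes f :: "real^'n \<Rightarrow> real"
 assumes "continuous_on U f" "compact K" "K \<subseteq> U"
 shows "(\<lambda>x. indicator K x * f x) \<in> borel_measurable borel" "\<exists>B. \<forall>x. \<bar>indicator K x * f x\<bar> \<le> B"
proof -
 have c: "continuous_on K f" using assms continuous_on_subset by blast
 have "(\<lambda>x. indicator K x *\<^sub>R f x) \<in> borel_measurable borel"
  by (rule borel_measurable_continuous_on_indicator) (use assms c in \<open>auto simp: borel_closed compact_imp_closed\<close>)
 then show "(\<lambda>x. indicator K x * f x) \<in> borel_measurable borel" by simp
 have "compact (f ` K)" using c assms(2) by (rule compact_continuous_image)
 then obtain B where B: "\<And>x. x \<in> K \<Longrightarrow> \<bar>f x\<bar> \<le> B"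
  using compact_imp_bounded bounded_iff by (metis imageI real_norm_def)
 have "\<bar>indicator K x * f x\<bar> \<le> \<bar>B\<bar>" for x using B[of x] by (cases "x \<in> K") auto
 then show "\<exists>B. \<forall>x. \<bar>indicator K x * f x\<bar> \<le> B" by blast
qed

definition wdiv :: "(real^'n::finite) set \<Rightarrow> ('n \<Rightarrow> real^'n \<Rightarrow> real) \<Rightarrow> (real^'n \<Rightarrow> real) \<Rightarrow> bool" where
 "wdiv U A B \<longleftrightarrow> (\<forall>f. C1c U f \<longrightarrow>
  (\<Sum>j\<in>UNIV. LBINT x. A j x * pd j f x) = - (LBINT x. B x * f x))"

text \<open>Here the test functions need no compact support; this is the version for fields that
  have been cut off. Its purpose is to admit the mollifier as a test function of the integration
  variable for every base point x.\<close>

definition gdiv :: "('n::finite \<Rightarrow> real^'n \<Rightarrow> real) \<Rightarrow> (real^'n \<Rightarrow> real) \<Rightarrow> bool" where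
 "gdiv A B \<longleftrightarrow> (\<forall>f. C1_on UNIV f \<longrightarrow>
  (\<Sum>j\<in>UNIV. LBINT x. A j x * pd j f x) = - (LBINT x. B x * f x))"

lemma wdivD:
 "wdiv U A B \<Longrightarrow> C1c U f \<Longrightarrow> (\<Sum>j\<in>UNIV. LBINT x. A j x * pd j f x) = - (LBINT x. B x * f x)"
 by (simp add: wdiv_def)

lemma hpd_reflect:
 assumes "hpd j k D (x - y)" shows "hpd j (\<lambda>y. k (x - y)) (- D) y"
proof -
 have "((\<lambda>t. k ((x - y) + t *\<^sub>R axis j 1)) has_real_derivative D) (at (- 0))"
  using assms by (simp add: hpd_def)
 then have "((\<lambda>t. k ((x - y) + (- t) *\<^sub>R axis j 1)) has_real_derivative D * (- 1)) (at 0)"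
  by (intro DERIV_chain2[where f = "\<lambda>t. k ((x - y) + t *\<^sub>R axis j 1)"]) (auto intro!: derivative_eq_intros)
 then show ?thesis by (simp add: hpd_def algebra_simps)
qed

lemma C1_on_reflect: "C1_on UNIV k \<Longrightarrow> C1_on UNIV (\<lambda>y. k (x - y))"
 by (rule C1_onI[where D = "\<lambda>j y. - pd j k (x - y)"])
  (auto intro!: continuous_intros hpd_reflect continuous_on_compose2[OF C1_onD(1), of UNIV]
    continuous_on_compose2[OF C1_onD(2), of UNIV] dest: C1_onD)

lemma pd_reflect: "C1_on UNIV k \<Longrightarrow> pd j (\<lambda>y. k (x - y)) y = - pd j k (x - y)"
 by (rule hpd_pd, rule hpd_reflect) (auto dest: C1_onD)

lemma pd_mk_bounded: "\<exists>B. \<forall>x :: real^'n::finite. \<bar>pd j (mk n) x\<bar> \<le> B"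
proof -
 have Sn: "0 < real (Suc n)" by simp
 obtain B where B: "\<And>x :: real^'n. \<bar>bump ((\<lambda>i. 0)(j := Suc 0)) (real (Suc n)) x\<bar> \<le> B"
  using bump_bounded[OF Sn] by blast
 have "pd j (mk n) x = mc TYPE('n) n * (real (Suc n) * bump ((\<lambda>i. 0)(j := Suc 0)) (real (Suc n)) x)" for x
  unfolding mk_def[abs_def]
  using pd_cmult[OF C1_on_bump, where c = "mc TYPE('n) n"] by (simp add: pd_bump)
 then have "\<bar>pd j (mk n) x\<bar> \<le> mc TYPE('n) n * (real (Suc n) * B)" for x
  using B[of x] mc_pos[where 'n = 'n, of n] by (simp add: abs_mult mult_left_mono)
 then show ?thesis by blast
qed

lemma pd_Mo_conv:
 fixes a :: "real^'n \<Rightarrow> real"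
 assumes "integrable lborel a"
 shows "pd j (Mo n a) x = (LBINT y. a y * pd j (mk n) (x - y))"
proof -
 obtain B B' where "\<And>x :: real^'n. \<bar>mk n x\<bar> \<le> B" "\<And>x :: real^'n. \<bar>pd j (mk n) x\<bar> \<le> B'"
  using mk_bounded pd_mk_bounded by metis
 from hpd_conv[OF assms C1_on_mk this] show ?thesis
  unfolding Mo_def by (simp add: hpd_pd conv_def)
qed

lemma pd_Mo:
 fixes f :: "real^'n \<Rightarrow> real"
 assumes "C1c UNIV f" shows "pd j (Mo n f) x = Mo n (pd j f) x"
proof -
 have "(LBINT y. mk n (x - y) * pd j f y) = - (LBINT y. pd j (\<lambda>y. mk n (x - y)) y * f y)"
  by (rule integral_by_parts[OF assms C1_on_reflect[OF C1_on_mk] open_UNIV])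
 then show ?thesis
  using pd_Mo_conv[OF Cc_integrable[OF C1c_Cc[OF assms] open_UNIV], of j n x]
  by (simp add: pd_reflect[OF C1_on_mk] Mo_def conv_def mult.commute)
qed

text \<open>The reflected kernel \<open>\<lambda>y. mk n (x - y)\<close> is an admissible test
  function at every \<open>x\<close>, so the divergence commutes with mollification everywhere, with
  no loss near a boundary.\<close>

lemma gdiv_Mo:
 fixes A :: "'n::finite \<Rightarrow> real^'n \<Rightarrow> real"
 assumes "gdiv A B" "\<And>j. integrable lborel (A j)"
 shows "(\<Sum>j\<in>UNIV. pd j (Mo n (A j)) x) = Mo n B x"
proof -
 have "(\<Sum>j\<in>UNIV. LBINT y. A j y * pd j (\<lambda>y. mk n (x - y)) y) = - (LBINT y. B y * mk n (x - y))"
  using assms(1) C1_on_reflect[OF C1_on_mk] unfolding gdiv_def by blast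
 then show ?thesis
  unfolding pd_Mo_conv[OF assms(2)] unfolding Mo_def conv_def
  by (simp add: pd_reflect[OF C1_on_mk] sum_negf)
qed

lemma Mo_C1c:
 fixes a :: "real^'n \<Rightarrow> real"
 assumes "integrable lborel a" "compact L" "L \<subseteq> U" "\<And>x. x \<notin> L \<Longrightarrow> Mo n a x = 0"
 shows "C1c U (Mo n a)" "C1c U (pd j (Mo n a))" "test_fun U (Mo n a)"
proof -
 have C2: "C2_on UNIV (Mo n a)" by (rule smooth_on_C2[OF smooth_Mo[OF assms(1)]])
 then show 1: "C1c U (Mo n a)" using assms by (auto simp: C1c_def C2_on_def)
 have "pd j (Mo n a) x = 0" if "x \<notin> L" for x
 proof -
  have "hpd j (Mo n a) 0 x"
   by (rule hpd_cong_open[OF hpd_const[of j 0 x], of "- L"]) (use assms that in \<open>auto simp: compact_imp_closed\<close>)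
  then show ?thesis by (rule hpd_pd)
 qed
 then show "C1c U (pd j (Mo n a))" using C2 assms by (auto simp: C1c_def C2_on_def)
 show "test_fun U (Mo n a)" using smooth_Mo[OF assms(1)] assms by (auto simp: test_fun_def)
qed

text \<open>Mollifying a C^1 test function gives smooth ones whose derivatives are the mollified
  derivatives, and both sides converge. The premise may therefore use smooth test functions with
  commuting second derivatives, as in the distributional definition.\<close>

lemma wdivI_test:
 fixes A :: "'n::finite \<Rightarrow> real^'n \<Rightarrow> real"
 assumes U: "open U" and A: "\<And>j. loc2 U (A j)" and B: "loc2 U B"
  and test: "\<And>f. test_fun U f \<Longrightarrow> C1c U f \<Longrightarrow> (\<And>k. C1c U (pd k f)) \<Longrightarrow> (\<And>j k x. pd j (pd k f) x = pd k (pd j f) x) \<Longrightarrow>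
   (\<Sum>j\<in>UNIV. LBINT x. A j x * pd j f x) = - (LBINT x. B x * f x)"
 shows "wdiv U A B"
 unfolding wdiv_def
proof (intro allI impI)
 fix f assume f: "C1c U f"
 obtain K where K: "compact K" "K \<subseteq> U" "\<And>x. x \<notin> K \<Longrightarrow> f x = 0" "\<And>x j. x \<notin> K \<Longrightarrow> pd j f x = 0"
  using C1c_support[OF f] by metis
 obtain L N where L: "compact L" "K \<subseteq> L" "L \<subseteq> U" and
  LM: "\<And>a n x. N \<le> n \<Longrightarrow> (\<And>y. y \<notin> K \<Longrightarrow> a y = 0) \<Longrightarrow> x \<notin> L \<Longrightarrow> Mo n a x = 0"
  using Mo_support[OF K(1,2) U] by metis
 have fi: "integrable lborel f" by (rule Cc_integrable[OF C1c_Cc[OF f] U])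
 have fU: "C1c UNIV f" by (rule C1c_mono[OF f subset_UNIV])
 let ?f = "\<lambda>n. Mo (n + N) f"
 have z: "?f n x = 0" if "x \<notin> L" for n x by (rule LM[OF _ K(3) that]) auto
 have lim: "(\<lambda>n. LBINT x. a x * Mo (n + N) g x) \<longlonglongrightarrow> (LBINT x. a x * g x)"
  if a: "loc2 U a" and g: "Cc U g" and gK: "\<And>x. x \<notin> K \<Longrightarrow> g x = 0" for a g
 proof -
  have "L2lim (\<lambda>n. Mo (n + N) g) g"
   by (rule L2lim_shift[OF Mo_L2lim[OF Cc_sqi[OF g U] K(1) gK]])
  from L2lim_inner[OF L2lim_const[OF loc2_sqi[OF a L(1,3)]] this]
  have "(\<lambda>n. LBINT x. indicator L x * a x * Mo (n + N) g x) \<longlonglongrightarrow> (LBINT x. indicator L x * a x * g x)" .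
  moreover have "indicator L x * a x * Mo (n + N) g x = a x * Mo (n + N) g x" for x n
   using LM[of "n + N" g x] gK by (cases "x \<in> L") auto
  moreover have "indicator L x * a x * g x = a x * g x" for x
   using gK[of x] L(2) by (cases "x \<in> L") auto
  ultimately show ?thesis by simp
 qed
 have "(\<lambda>n. \<Sum>j\<in>UNIV. LBINT x. A j x * Mo (n + N) (pd j f) x) \<longlonglongrightarrow> (\<Sum>j\<in>UNIV. LBINT x. A j x * pd j f x)"
  by (intro tendsto_sum lim A C1c_pd_Cc f K(4))
 moreover have "(\<Sum>j\<in>UNIV. LBINT x. A j x * Mo (n + N) (pd j f) x) = - (LBINT x. B x * ?f n x)" for n
  using test[OF Mo_C1c(3)[OF fi L(1,3) z] Mo_C1c(1)[OF fi L(1,3) z] Mo_C1c(2)[OF fi L(1,3) z] pd_Mo_commute[OF fi]]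
  by (simp add: pd_Mo[OF fU])
 moreover have "(\<lambda>n. - (LBINT x. B x * ?f n x)) \<longlonglongrightarrow> - (LBINT x. B x * f x)"
  by (intro tendsto_minus lim B C1c_Cc f K(3))
 ultimately show "(\<Sum>j\<in>UNIV. LBINT x. A j x * pd j f x) = - (LBINT x. B x * f x)"
  using LIMSEQ_unique by simp
qed

lemma wdiv_mult:
 fixes A :: "'n::finite \<Rightarrow> real^'n \<Rightarrow> real"
 assumes w: "wdiv U A B" and U: "open U" and A: "\<And>j. loc2 U (A j)" and B: "loc2 U B"
  and h: "C1_on U h" and f: "C1c U f"
 shows "(\<Sum>j\<in>UNIV. LBINT x. (h x * A j x) * pd j f x)
  = - (LBINT x. (h x * B x + (\<Sum>j\<in>UNIV. pd j h x * A j x)) * f x)"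
proof -
 obtain K where K: "compact K" "K \<subseteq> U" "\<And>x. x \<notin> K \<Longrightarrow> f x = 0" "\<And>x j. x \<notin> K \<Longrightarrow> pd j f x = 0"
  using C1c_support[OF f] by metis
 have hf: "C1c U (\<lambda>x. h x * f x)" by (rule C1c_mult[OF h f U])
 have eq: "pd j (\<lambda>x. h x * f x) x = h x * pd j f x + pd j h x * f x" for x j
 proof (cases "x \<in> U")
  case True
  then show ?thesis using pd_mult[OF h C1c_C1_on[OF f] True] by simp
 next
  case False
  then have x: "x \<in> - K" using K by auto
  have "hpd j (\<lambda>x. h x * f x) 0 x"
   by (rule hpd_cong_open[OF hpd_const[of j 0 x], of "- K"]) (use K x in \<open>auto simp: compact_imp_closed\<close>)
  then show ?thesis using x K by (simp add: hpd_pd)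
 qed
 have i1: "integrable lborel (\<lambda>x. A j x * (h x * pd j f x))" for j
  by (intro loc2_integrable[OF A _ U] Cc_mult C1_onD(1)[OF h] C1c_pd_Cc f)
 have i2: "integrable lborel (\<lambda>x. A j x * (pd j h x * f x))" for j
  by (intro loc2_integrable[OF A _ U] Cc_mult C1_onD(2)[OF h] C1c_Cc f)
 have i3: "integrable lborel (\<lambda>x. B x * (h x * f x))"
  by (intro loc2_integrable[OF B _ U] Cc_mult C1_onD(1)[OF h] C1c_Cc f)
 have "(\<Sum>j\<in>UNIV. LBINT x. A j x * (h x * pd j f x)) + (\<Sum>j\<in>UNIV. LBINT x. A j x * (pd j h x * f x))
   = - (LBINT x. B x * (h x * f x))"
  using wdivD[OF w hf] i1 i2 by (simp add: eq distrib_left sum.distrib)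
 moreover have "(LBINT x. (h x * B x + (\<Sum>j\<in>UNIV. pd j h x * A j x)) * f x)
   = (LBINT x. B x * (h x * f x) + (\<Sum>j\<in>UNIV. A j x * (pd j h x * f x)))"
  by (intro Bochner_Integration.integral_cong refl) (simp add: distrib_left distrib_right sum_distrib_left sum_distrib_right mult_ac)
 moreover have "\<dots> = (LBINT x. B x * (h x * f x)) + (\<Sum>j\<in>UNIV. LBINT x. A j x * (pd j h x * f x))"
  using i2 i3 by simp
 moreover have "(LBINT x. (h x * A j x) * pd j f x) = (LBINT x. A j x * (h x * pd j f x))" for j
  by (intro Bochner_Integration.integral_cong refl) (simp add: mult_ac)
 ultimately show ?thesis by simp
qed

text \<open>The Leibniz rule with a compactly supported factor turns a local weak divergence into a
  global one: \<open>h\<close> times any C^1 function on the whole space is a test function in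
  \<open>U\<close>.\<close>

lemma wdiv_cutoff:
 fixes A :: "'n::finite \<Rightarrow> real^'n \<Rightarrow> real"
 assumes w: "wdiv U A B" and U: "open U" and A: "\<And>j. loc2 U (A j)" and B: "loc2 U B"
  and h: "C1c U h"
 shows "gdiv (\<lambda>j x. h x * A j x) (\<lambda>x. h x * B x + (\<Sum>j\<in>UNIV. pd j h x * A j x))"
 unfolding gdiv_def
proof (intro allI impI)
 fix f :: "real^'n \<Rightarrow> real" assume f: "C1_on UNIV f"
 have hU: "C1_on UNIV h" by (rule C1c_C1_on[OF h])
 have hf: "C1c U (\<lambda>x. f x * h x)" by (rule C1_on_UNIV_mult_C1c[OF f h])
 have eq: "pd j (\<lambda>x. f x * h x) x = h x * pd j f x + f x * pd j h x" for x j
  using pd_mult[OF f hU, of x j] by simp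
 have fc: "continuous_on U f" "continuous_on U (pd j f)" for j
  using C1_onD(1,2)[OF f] continuous_on_subset by blast+
 have i1: "integrable lborel (\<lambda>x. A j x * (h x * pd j f x))" for j
  by (intro loc2_integrable[OF A _ U] Cc_mult_right fc C1c_Cc h)
 have i2: "integrable lborel (\<lambda>x. A j x * (f x * pd j h x))" for j
  by (intro loc2_integrable[OF A _ U] Cc_mult fc C1c_pd_Cc h)
 have i3: "integrable lborel (\<lambda>x. B x * (f x * h x))"
  by (intro loc2_integrable[OF B _ U] Cc_mult fc C1c_Cc h)
 have "(\<Sum>j\<in>UNIV. LBINT x. A j x * (h x * pd j f x)) + (\<Sum>j\<in>UNIV. LBINT x. A j x * (f x * pd j h x))
   = - (LBINT x. B x * (f x * h x))"
  using wdivD[OF w hf] i1 i2 by (simp add: eq distrib_left sum.distrib)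
 moreover have "(LBINT x. (h x * B x + (\<Sum>j\<in>UNIV. pd j h x * A j x)) * f x)
   = (LBINT x. B x * (f x * h x) + (\<Sum>j\<in>UNIV. A j x * (f x * pd j h x)))"
  by (intro Bochner_Integration.integral_cong refl) (simp add: distrib_left distrib_right sum_distrib_left sum_distrib_right mult_ac)
 moreover have "\<dots> = (LBINT x. B x * (f x * h x)) + (\<Sum>j\<in>UNIV. LBINT x. A j x * (f x * pd j h x))"
  using i2 i3 by simp
 moreover have "(LBINT x. (h x * A j x) * pd j f x) = (LBINT x. A j x * (h x * pd j f x))" for j
  by (intro Bochner_Integration.integral_cong refl) (simp add: mult_ac)
 ultimately show "(\<Sum>j\<in>UNIV. LBINT x. (h x * A j x) * pd j f x)
   = - (LBINT x. (h x * B x + (\<Sum>j\<in>UNIV. pd j h x * A j x)) * f x)" by simp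
qed

text \<open>In L2 with weight exp(-V) the adjoint of -d/dx_j is d/dx_j - V_j; this is integration by
  parts for the product \<open>a u\<close> against exp(-V).\<close>

lemma weighted_adjoint:
 fixes a u V :: "real^'n \<Rightarrow> real"
 assumes a: "C1c U a" and u: "C1c U u" and V: "C1_on U V" and U: "open U"
 shows "(LBINT x. (pd j a x - pd j V x * a x) * u x * exp (- V x))
  = - (LBINT x. a x * pd j u x * exp (- V x))"
proof -
 let ?e = "\<lambda>x. exp (- V x)"
 have e1: "C1_on U ?e"
  by (rule C1_on_compose[OF V, where F = "\<lambda>t. exp (- t)" and F' = "\<lambda>t. - exp (- t)"])
   (auto intro!: derivative_eq_intros continuous_intros)
 have e2: "pd j ?e x = - ?e x * pd j V x" if "x \<in> U" for x
  by (rule pd_compose[OF V that]) (auto intro!: derivative_eq_intros)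
 have au: "C1c U (\<lambda>x. a x * u x)" by (rule C1_on_UNIV_mult_C1c[OF C1c_C1_on[OF a] u])
 obtain K where K: "K \<subseteq> U" "\<And>x. x \<notin> K \<Longrightarrow> a x = 0" using C1c_support[OF a] by metis
 have eq: "pd j (\<lambda>x. a x * u x) x = pd j a x * u x + a x * pd j u x" for x
  using pd_mult[OF C1c_C1_on[OF a, of UNIV] C1c_C1_on[OF u, of UNIV], of x j] by simp
 have ce: "continuous_on U ?e" by (rule C1_onD(1)[OF e1])
 have i1: "integrable lborel (\<lambda>x. ?e x * (pd j a x * u x))"
  by (intro Cc_integrable[OF _ U] Cc_mult ce Cc_Cc_mult C1c_pd_Cc C1c_Cc a u)
 have i2: "integrable lborel (\<lambda>x. ?e x * (a x * pd j u x))"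
  by (intro Cc_integrable[OF _ U] Cc_mult ce Cc_Cc_mult C1c_pd_Cc C1c_Cc a u)
 have i3: "integrable lborel (\<lambda>x. ?e x * (pd j V x * (a x * u x)))"
  by (intro Cc_integrable[OF _ U] Cc_mult ce Cc_Cc_mult C1c_Cc a u C1_onD(2)[OF V])
 have "(LBINT x. ?e x * (pd j a x * u x) + ?e x * (a x * pd j u x)) = - (LBINT x. pd j ?e x * (a x * u x))"
  using integral_by_parts[OF au e1 U, of j] by (simp add: eq distrib_left)
 also have "(LBINT x. pd j ?e x * (a x * u x)) = (LBINT x. - (?e x * (pd j V x * (a x * u x))))"
 proof (intro Bochner_Integration.integral_cong refl)
  fix x show "pd j ?e x * (a x * u x) = - (?e x * (pd j V x * (a x * u x)))"
  proof (cases "x \<in> U")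
   case True
   then show ?thesis by (simp add: e2)
  next
   case False
   then have "a x = 0" using K by auto
   then show ?thesis by simp
  qed
 qed
 finally have "(LBINT x. ?e x * (pd j a x * u x)) + (LBINT x. ?e x * (a x * pd j u x))
   = (LBINT x. ?e x * (pd j V x * (a x * u x)))"
  using i1 i2 by simp
 moreover have "(LBINT x. (pd j a x - pd j V x * a x) * u x * ?e x)
   = (LBINT x. ?e x * (pd j a x * u x) - ?e x * (pd j V x * (a x * u x)))"
  by (intro Bochner_Integration.integral_cong refl) (simp add: algebra_simps)
 moreover have "\<dots> = (LBINT x. ?e x * (pd j a x * u x)) - (LBINT x. ?e x * (pd j V x * (a x * u x)))"
  using i1 i3 by simp
 moreover have "(LBINT x. a x * pd j u x * ?e x) = (LBINT x. ?e x * (a x * pd j u x))"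
  by (simp add: mult_ac)
 ultimately show ?thesis by simp
qed

text \<open>Both operators are moved to the other side by parts. Commuting d/dx_j with d/dx_k - V_k
  leaves minus the multiplication by V_jk, and this is the source of the Hessian of the weight in
  all estimates.\<close>

lemma commutation:
 fixes a b V :: "real^'n \<Rightarrow> real"
 assumes a: "C1c U a" and b: "C1c U b" "\<And>i. C1c U (pd i b)"
  and comm: "\<And>x. pd j (pd k b) x = pd k (pd j b) x"
  and V: "C2_on U V" and U: "open U"
 shows "(LBINT x. (pd j a x - pd j V x * a x) * (pd k b x - pd k V x * b x) * exp (- V x))
  = (LBINT x. pd k a x * pd j b x * exp (- V x))
   + (LBINT x. pd j (pd k V) x * a x * b x * exp (- V x))"
proof -
 have V1: "C1_on U V" and V2: "C1_on U (pd k V)" using V by (auto simp: C2_on_def)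
 have ce: "continuous_on U (\<lambda>x. exp (- V x))" using C1_onD(1)[OF V1] by (intro continuous_intros)
 have Vb: "C1c U (\<lambda>x. pd k V x * b x)" by (rule C1c_mult[OF V2 b(1) U])
 have u: "C1c U (\<lambda>x. pd k b x - pd k V x * b x)"
  using C1c_add[OF b(2)[of k] C1c_cmult[OF Vb, of "-1"]] by simp
 have eqU: "pd j (\<lambda>x. pd k b x - pd k V x * b x) x
   = pd k (pd j b) x - pd k V x * pd j b x - pd j (pd k V) x * b x" if "x \<in> U" for x
 proof -
  have "pd j (\<lambda>x. pd k b x + (-1) * (pd k V x * b x)) x
    = pd j (pd k b) x + pd j (\<lambda>x. (-1) * (pd k V x * b x)) x"
   by (rule pd_add[OF C1c_C1_on[OF b(2)] C1c_C1_on[OF C1c_cmult[OF Vb]] that])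
  also have "pd j (\<lambda>x. (-1) * (pd k V x * b x)) x = (-1) * pd j (\<lambda>x. pd k V x * b x) x"
   by (rule pd_cmult[OF C1c_C1_on[OF Vb] that])
  also have "pd j (\<lambda>x. pd k V x * b x) x = pd j (pd k V) x * b x + pd k V x * pd j b x"
   by (rule pd_mult[OF V2 C1c_C1_on[OF b(1)] that])
  finally show ?thesis by (simp add: comm)
 qed
 obtain K where K: "K \<subseteq> U" "\<And>x. x \<notin> K \<Longrightarrow> a x = 0" using C1c_support[OF a] by metis
 have i1: "integrable lborel (\<lambda>x. a x * pd k (pd j b) x * exp (- V x))"
  by (intro Cc_integrable[OF _ U] Cc_mult_right ce Cc_Cc_mult C1c_pd_Cc C1c_Cc a b)
 have i2: "integrable lborel (\<lambda>x. a x * (pd k V x * pd j b x) * exp (- V x))"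
  by (intro Cc_integrable[OF _ U] Cc_mult_right ce Cc_Cc_mult Cc_mult C1c_pd_Cc C1c_Cc a b C1_onD(1)[OF V2])
 have i3: "integrable lborel (\<lambda>x. pd j (pd k V) x * a x * b x * exp (- V x))"
  by (intro Cc_integrable[OF _ U] Cc_mult_right ce Cc_Cc_mult Cc_mult C1c_Cc a b C1_onD(2)[OF V2])
 have i4: "integrable lborel (\<lambda>x. pd k a x * pd j b x * exp (- V x))"
  by (intro Cc_integrable[OF _ U] Cc_mult_right ce Cc_Cc_mult C1c_pd_Cc a b)
 have i5: "integrable lborel (\<lambda>x. pd k V x * a x * pd j b x * exp (- V x))"
  by (intro Cc_integrable[OF _ U] Cc_mult_right ce Cc_Cc_mult Cc_mult C1c_pd_Cc C1c_Cc a b C1_onD(1)[OF V2])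
 have "(LBINT x. (pd j a x - pd j V x * a x) * (pd k b x - pd k V x * b x) * exp (- V x))
   = - (LBINT x. a x * pd j (\<lambda>x. pd k b x - pd k V x * b x) x * exp (- V x))"
  by (rule weighted_adjoint[OF a u V1 U])
 also have "(LBINT x. a x * pd j (\<lambda>x. pd k b x - pd k V x * b x) x * exp (- V x))
   = (LBINT x. a x * pd k (pd j b) x * exp (- V x) - a x * (pd k V x * pd j b x) * exp (- V x)
     - pd j (pd k V) x * a x * b x * exp (- V x))"
 proof (intro Bochner_Integration.integral_cong refl)
  fix x show "a x * pd j (\<lambda>x. pd k b x - pd k V x * b x) x * exp (- V x)
   = a x * pd k (pd j b) x * exp (- V x) - a x * (pd k V x * pd j b x) * exp (- V x)
     - pd j (pd k V) x * a x * b x * exp (- V x)"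
  proof (cases "x \<in> U")
   case True
   show ?thesis unfolding eqU[OF True] by (simp add: algebra_simps)
  next
   case False
   then have "a x = 0" using K by auto
   then show ?thesis by simp
  qed
 qed
 also have "\<dots> = (LBINT x. a x * pd k (pd j b) x * exp (- V x))
   - (LBINT x. a x * (pd k V x * pd j b x) * exp (- V x))
   - (LBINT x. pd j (pd k V) x * a x * b x * exp (- V x))"
  using i1 i2 i3 by simp
 finally have 1: "(LBINT x. (pd j a x - pd j V x * a x) * (pd k b x - pd k V x * b x) * exp (- V x))
   = - (LBINT x. a x * pd k (pd j b) x * exp (- V x))
   + (LBINT x. a x * (pd k V x * pd j b x) * exp (- V x))
   + (LBINT x. pd j (pd k V) x * a x * b x * exp (- V x))" by simp
 have "(LBINT x. (pd k a x - pd k V x * a x) * pd j b x * exp (- V x))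
   = - (LBINT x. a x * pd k (pd j b) x * exp (- V x))"
  by (rule weighted_adjoint[OF a b(2) V1 U])
 moreover have "(LBINT x. (pd k a x - pd k V x * a x) * pd j b x * exp (- V x))
   = (LBINT x. pd k a x * pd j b x * exp (- V x) - pd k V x * a x * pd j b x * exp (- V x))"
  by (intro Bochner_Integration.integral_cong refl) (simp add: algebra_simps)
 moreover have "\<dots> = (LBINT x. pd k a x * pd j b x * exp (- V x)) - (LBINT x. pd k V x * a x * pd j b x * exp (- V x))"
  using i4 i5 by simp
 moreover have "(LBINT x. pd k V x * a x * pd j b x * exp (- V x)) = (LBINT x. a x * (pd k V x * pd j b x) * exp (- V x))"
  by (simp add: mult_ac)
 ultimately show ?thesis using 1 by linarith
qed

text \<open>For a fixed index list \<open>l\<close> the coefficient (du)_l is the divergence of the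
  field \<open>dA u l\<close>. In this way closedness and the equation for the weighted adjoint are
  both weak divergences, and the same Leibniz rule and mollification argument serve for
  both.\<close>

definition dA :: "(real^'n \<Rightarrow> 'n list \<Rightarrow> real) \<Rightarrow> 'n list \<Rightarrow> 'n::finite \<Rightarrow> real^'n \<Rightarrow> real" where
 "dA u l j x = (\<Sum>s<length l. if l ! s = j then (-1) ^ s * u x (take s l @ drop (Suc s) l) else 0)"

lemma sum_dA:
 fixes a :: "'n::finite \<Rightarrow> 'n list \<Rightarrow> real"
 shows "(\<Sum>j\<in>UNIV. \<Sum>s<length l. if l ! s = j then (-1) ^ s * a j (take s l @ drop (Suc s) l) else 0) = wdg a l"
 by (subst sum.swap) (simp add: wdg_eq_sum)

lemma dA_wdg: "(\<Sum>j\<in>UNIV. c j * dA u l j x) = wdg (\<lambda>j J. c j * u x J) l"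
proof -
 have "(\<Sum>j\<in>UNIV. c j * dA u l j x)
   = (\<Sum>j\<in>UNIV. \<Sum>s<length l. if l ! s = j then (-1) ^ s * (c j * u x (take s l @ drop (Suc s) l)) else 0)"
  unfolding dA_def sum_distrib_left by (intro sum.cong refl) auto
 then show ?thesis using sum_dA[of l "\<lambda>j J. c j * u x J"] by simp
qed

lemma alt_pd:
 fixes u :: "real^'n \<Rightarrow> 'n list \<Rightarrow> real"
 assumes "\<And>y. alt (u y)" "\<And>l. C1_on UNIV (\<lambda>y. u y l)"
 shows "alt (\<lambda>l. pd j (\<lambda>y. u y l) x)"
proof (rule altI)
 fix xs a b ys
 have "(\<lambda>y. u y (xs @ a # b # ys)) = (\<lambda>y. (-1) * u y (xs @ b # a # ys))"
  using altD[OF assms(1), of _ xs a b ys] by simp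
 then show "pd j (\<lambda>y. u y (xs @ a # b # ys)) x = - pd j (\<lambda>y. u y (xs @ b # a # ys)) x"
  using pd_cmult[OF assms(2), of x j "-1" "xs @ b # a # ys"] by simp
qed

text \<open>Let A, S, W be the squared gradient, the cross terms and the squared norm of
  \<open>wdg a\<close>. By \<open>wdg_norm\<close>, W = (q + 2) (A - (q + 1) S), so a negative S is
  compensated by W because A \<ge> 0. The factor in front of W is not optimised: for cut-offs of
  closed forms W consists of gradients of the cut-off.\<close>

lemma wdg_norm_lower:
 fixes a :: "'n::finite \<Rightarrow> 'n list \<Rightarrow> real"
 assumes "\<And>j. alt (a j)"
 shows "0 \<le> (\<Sum>J\<in>LL q. \<Sum>j\<in>UNIV. \<Sum>k\<in>UNIV. a k (j # J) * a j (k # J)) + (\<Sum>l\<in>LL (Suc (Suc q)). (wdg a l)\<^sup>2)"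
proof -
 define S where "S = (\<Sum>J\<in>LL q. \<Sum>j\<in>UNIV. \<Sum>k\<in>UNIV. a k (j # J) * a j (k # J))"
 define W where "W = (\<Sum>l\<in>LL (Suc (Suc q)). (wdg a l)\<^sup>2)"
 define A where "A = (\<Sum>j\<in>UNIV. \<Sum>I\<in>LL (Suc q). (a j I)\<^sup>2)"
 have W: "W = real (Suc (Suc q)) * (A - real (Suc q) * S)"
  unfolding W_def A_def S_def using wdg_norm[OF assms, where q = q] by simp
 have A0: "0 \<le> A" unfolding A_def by (intro sum_nonneg) simp
 have W0: "0 \<le> W" unfolding W_def by (intro sum_nonneg) simp
 have "0 \<le> S + W"
 proof (cases "0 \<le> S")
  case False
  then have "real (Suc q) * S \<le> 1 * S" by (intro mult_right_mono_neg) auto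
  then have "- S \<le> A - real (Suc q) * S" using A0 by linarith
  also have "\<dots> = 1 * (A - real (Suc q) * S)" by simp
  also have "\<dots> \<le> real (Suc (Suc q)) * (A - real (Suc q) * S)"
   using \<open>- S \<le> A - real (Suc q) * S\<close> False by (intro mult_right_mono) auto
  finally show ?thesis unfolding W by linarith
 qed (use W0 in simp)
 then show ?thesis unfolding S_def W_def .
qed

text \<open>Expanding the square of the weighted adjoint and commuting gives the Hessian term plus
  the cross terms of the gradient; the latter are bounded below by minus the squared norm of
  du.\<close>

lemma Bochner_smooth:
 fixes u :: "real^'n \<Rightarrow> 'n list \<Rightarrow> real" and V :: "real^'n \<Rightarrow> real"
 assumes U: "open U" and V: "C2_on U V"
  and u: "\<And>l. C1c U (\<lambda>x. u x l)" and du: "\<And>j l. C1c U (pd j (\<lambda>x. u x l))"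
  and comm: "\<And>j k l x. pd j (pd k (\<lambda>x. u x l)) x = pd k (pd j (\<lambda>x. u x l)) x"
  and alt: "\<And>x. alt (u x)"
 shows "(\<Sum>I\<in>LL q. \<Sum>j\<in>UNIV. \<Sum>k\<in>UNIV. LBINT x. pd j (pd k V) x * u x (j # I) * u x (k # I) * exp (- V x))
  \<le> (\<Sum>I\<in>LL q. LBINT x. (\<Sum>j\<in>UNIV. pd j (\<lambda>x. u x (j # I)) x - pd j V x * u x (j # I))\<^sup>2 * exp (- V x))
  + (\<Sum>l\<in>LL (Suc (Suc q)). LBINT x. (wdg (\<lambda>j L. pd j (\<lambda>x. u x L) x) l)\<^sup>2 * exp (- V x))"
proof -
 have V1: "C1_on U V" using V by (simp add: C2_on_def)
 have ce: "continuous_on U (\<lambda>x. exp (- V x))" using C1_onD(1)[OF V1] by (intro continuous_intros)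
 define d where "d j I x = pd j (\<lambda>x. u x (j # I)) x - pd j V x * u x (j # I)" for j I x
 have cd: "Cc U (d j I)" for j I
  unfolding d_def by (intro Cc_diff C1c_pd_Cc u Cc_mult C1_onD(2)[OF V1] C1c_Cc[OF u])
 have id: "integrable lborel (\<lambda>x. d j I x * d k I x * exp (- V x))" for j k I
  by (intro Cc_integrable[OF _ U] Cc_mult_right ce Cc_Cc_mult cd)
 have ip: "integrable lborel (\<lambda>x. pd k (\<lambda>x. u x l) x * pd j (\<lambda>x. u x m) x * exp (- V x))" for j k l m
  by (intro Cc_integrable[OF _ U] Cc_mult_right ce Cc_Cc_mult C1c_pd_Cc u)
 have sq: "(LBINT x. (\<Sum>j\<in>UNIV. d j I x)\<^sup>2 * exp (- V x))
   = (\<Sum>j\<in>UNIV. \<Sum>k\<in>UNIV. LBINT x. d j I x * d k I x * exp (- V x))" for I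
 proof -
  have "(LBINT x. (\<Sum>j\<in>UNIV. d j I x)\<^sup>2 * exp (- V x))
    = (LBINT x. (\<Sum>j\<in>UNIV. \<Sum>k\<in>UNIV. d j I x * d k I x * exp (- V x)))"
   by (intro Bochner_Integration.integral_cong refl, subst power2_eq_square, subst sum_product)
    (simp only: sum_distrib_right)
  then show ?thesis using id by simp
 qed
 have cm: "(LBINT x. d j I x * d k I x * exp (- V x))
   = (LBINT x. pd k (\<lambda>x. u x (j # I)) x * pd j (\<lambda>x. u x (k # I)) x * exp (- V x))
   + (LBINT x. pd j (pd k V) x * u x (j # I) * u x (k # I) * exp (- V x))" for j k I
  unfolding d_def by (rule commutation[OF u u du comm V U])
 define S where "S x = (\<Sum>J\<in>LL q. \<Sum>j\<in>UNIV. \<Sum>k\<in>UNIV. pd k (\<lambda>x. u x (j # J)) x * pd j (\<lambda>x. u x (k # J)) x)" for x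
 define w where "w l x = wdg (\<lambda>j L. pd j (\<lambda>x. u x L) x) l" for l x
 have wC: "Cc U (w l)" for l
  unfolding w_def wdg_eq_sum by (intro Cc_sum Cc_cmult C1c_pd_Cc u) auto
 have iw: "integrable lborel (\<lambda>x. (w l x)\<^sup>2 * exp (- V x))" for l
  unfolding power2_eq_square by (intro Cc_integrable[OF _ U] Cc_mult_right ce Cc_Cc_mult wC)
 have "0 \<le> (LBINT x. S x * exp (- V x) + (\<Sum>l\<in>LL (Suc (Suc q)). (w l x)\<^sup>2 * exp (- V x)))"
 proof (rule integral_nonneg_AE, rule AE_I2)
  fix x
  have "0 \<le> S x + (\<Sum>l\<in>LL (Suc (Suc q)). (w l x)\<^sup>2)"
   unfolding S_def w_def
   by (rule wdg_norm_lower) (rule alt_pd[OF alt C1c_C1_on[OF u]])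
  then have "0 \<le> (S x + (\<Sum>l\<in>LL (Suc (Suc q)). (w l x)\<^sup>2)) * exp (- V x)" by simp
  then show "0 \<le> S x * exp (- V x) + (\<Sum>l\<in>LL (Suc (Suc q)). (w l x)\<^sup>2 * exp (- V x))"
   by (simp add: distrib_right sum_distrib_right)
 qed
 also have "\<dots> = (LBINT x. S x * exp (- V x)) + (\<Sum>l\<in>LL (Suc (Suc q)). LBINT x. (w l x)\<^sup>2 * exp (- V x))"
  using iw ip by (simp add: S_def sum_distrib_right)
 also have "(LBINT x. S x * exp (- V x))
   = (\<Sum>J\<in>LL q. \<Sum>j\<in>UNIV. \<Sum>k\<in>UNIV. LBINT x. pd k (\<lambda>x. u x (j # J)) x * pd j (\<lambda>x. u x (k # J)) x * exp (- V x))"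
  using ip by (simp add: S_def sum_distrib_right)
 finally show ?thesis
  unfolding d_def[symmetric] w_def[symmetric] sq cm sum.distrib by linarith
qed

lemma L2lim_quad:
 assumes "L2lim F f" "L2lim G g" "b \<in> borel_measurable borel" "\<exists>B. \<forall>x. \<bar>b x\<bar> \<le> B"
 shows "(\<lambda>n. LBINT x. b x * F n x * G n x) \<longlonglongrightarrow> (LBINT x. b x * f x * g x)"
proof -
 obtain B where "\<And>x. \<bar>b x\<bar> \<le> B" using assms(4) by blast
 from L2lim_inner[OF L2lim_mult_bounded[OF assms(1,3) this] assms(2)] show ?thesis by simp
qed

lemma Mo_zero_fun: "Mo n (\<lambda>x. 0) x = 0"
 by (simp add: Mo_def conv_def)

lemma Mo_dA:
 fixes h :: "real^'n \<Rightarrow> 'n list \<Rightarrow> real"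
 assumes "\<And>l. integrable lborel (\<lambda>x. h x l)"
 shows "Mo n (dA h l j) x = dA (\<lambda>x L. Mo n (\<lambda>y. h y L) x) l j x"
proof -
 have "Mo n (\<lambda>x. \<Sum>s\<in>S. if l ! s = j then c s * h x (m s) else 0) x
   = (\<Sum>s\<in>S. if l ! s = j then c s * Mo n (\<lambda>y. h y (m s)) x else 0)" if "finite S" for S :: "nat set" and c m
  using that
 proof (induction S rule: finite_induct)
  case empty
  then show ?case by (simp add: Mo_zero_fun)
 next
  case (insert s S)
  have "Mo n (\<lambda>x. if l ! s = j then c s * h x (m s) else 0) x = (if l ! s = j then c s * Mo n (\<lambda>y. h y (m s)) x else 0)"
   by (simp add: Mo_cmult Mo_zero_fun)
  moreover have "integrable lborel (\<lambda>x. if l ! s = j then c s * h x (m s) else 0)" for s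
   using assms by (cases "l ! s = j") auto
  ultimately show ?case using insert by (simp add: Mo_add)
 qed
 from this[of "{..<length l}" "\<lambda>s. (-1) ^ s" "\<lambda>s. take s l @ drop (Suc s) l"] show ?thesis
  unfolding dA_def[abs_def] by simp
qed

lemma integrable_dA:
 assumes "\<And>l. integrable lborel (\<lambda>x. h x l)"
 shows "integrable lborel (dA h l j)"
proof -
 have "integrable lborel (\<lambda>x. if l ! s = j then (-1) ^ s * h x m else 0)" for s m
  using assms by (cases "l ! s = j") auto
 then show ?thesis unfolding dA_def[abs_def] by (intro Bochner_Integration.integrable_sum)
qed

lemma pd_dA:
 fixes u :: "real^'n \<Rightarrow> 'n list \<Rightarrow> real"
 assumes "\<And>l. C1_on UNIV (\<lambda>x. u x l)"
 shows "pd i (dA u l j) x = (\<Sum>s<length l. if l ! s = j then (-1) ^ s * pd i (\<lambda>x. u x (take s l @ drop (Suc s) l)) x else 0)"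
 unfolding dA_def[abs_def]
proof (rule hpd_pd, rule hpd_sum)
 fix s
 show "hpd i (\<lambda>x. if l ! s = j then (-1) ^ s * u x (take s l @ drop (Suc s) l) else 0)
  (if l ! s = j then (-1) ^ s * pd i (\<lambda>x. u x (take s l @ drop (Suc s) l)) x else 0) x"
  using hpd_cmult[OF C1_onD(3)[OF assms UNIV_I]] by (cases "l ! s = j") auto
qed

text \<open>\<open>s\<close> is minus the divergence without weight, so the weighted adjoint is
  \<open>s\<close> plus a term of order zero. Divergence and exterior derivative have constant
  coefficients and commute with mollification exactly; the term of order zero has coefficients
  bounded on a compact set and converges in L2. Thus no commutator of the mollifier with a variable
  coefficient has to be estimated.\<close>

lemma Bochner_weak:
 fixes h s b :: "real^'n \<Rightarrow> 'n list \<Rightarrow> real" and V :: "real^'n \<Rightarrow> real"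
 assumes U: "open U" and V: "C2_on U V" and alt: "\<And>x. alt (h x)"
  and K: "compact K" "K \<subseteq> U"
  and h: "\<And>l. sqi lborel (\<lambda>x. h x l)" "\<And>x l. x \<notin> K \<Longrightarrow> h x l = 0"
  and s: "\<And>I. sqi lborel (\<lambda>x. s x I)" "\<And>x I. x \<notin> K \<Longrightarrow> s x I = 0"
  and b: "\<And>l. sqi lborel (\<lambda>x. b x l)" "\<And>x l. x \<notin> K \<Longrightarrow> b x l = 0"
  and dv: "\<And>I. I \<in> LL q \<Longrightarrow> gdiv (\<lambda>j x. h x (j # I)) (\<lambda>x. - s x I)"
  and cl: "\<And>l. l \<in> LL (Suc (Suc q)) \<Longrightarrow> gdiv (dA h l) (\<lambda>x. b x l)"
 shows "(\<Sum>I\<in>LL q. \<Sum>j\<in>UNIV. \<Sum>k\<in>UNIV. LBINT x. pd j (pd k V) x * h x (j # I) * h x (k # I) * exp (- V x))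
  \<le> (\<Sum>I\<in>LL q. LBINT x. (s x I + (\<Sum>j\<in>UNIV. pd j V x * h x (j # I)))\<^sup>2 * exp (- V x))
  + (\<Sum>l\<in>LL (Suc (Suc q)). LBINT x. (b x l)\<^sup>2 * exp (- V x))"
proof -
 have V1: "C1_on U V" and V2: "\<And>k. C1_on U (pd k V)" using V by (auto simp: C2_on_def)
 obtain L N where L: "compact L" "K \<subseteq> L" "L \<subseteq> U" and
  LM: "\<And>a n x. N \<le> n \<Longrightarrow> (\<And>y. y \<notin> K \<Longrightarrow> a y = 0) \<Longrightarrow> x \<notin> L \<Longrightarrow> Mo n a x = 0"
  using Mo_support[OF K U] by metis
 have hi: "integrable lborel (\<lambda>x. h x l)" for l by (rule sqi_compact_integrable[OF h(1) K(1) h(2)])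
 define u where "u n x l = Mo (n + N) (\<lambda>y. h y l) x" for n x l
 have uz: "u n x l = 0" if "x \<notin> L" for n x l
  unfolding u_def by (rule LM[OF _ h(2) that]) auto
 have ue: "(\<lambda>x. u n x l) = Mo (n + N) (\<lambda>y. h y l)" for n l by (simp add: u_def fun_eq_iff)
 have uC: "C1c U (\<lambda>x. u n x l)" for n l
  unfolding ue by (rule Mo_C1c(1)[OF hi L(1,3)]) (use uz in \<open>simp add: u_def\<close>)
 have uD: "C1c U (pd j (\<lambda>x. u n x l))" for n l j
  unfolding ue by (rule Mo_C1c(2)[OF hi L(1,3)]) (use uz in \<open>simp add: u_def\<close>)
 have ucomm: "pd j (pd k (\<lambda>x. u n x l)) x = pd k (pd j (\<lambda>x. u n x l)) x" for j k n l x
  unfolding ue by (rule pd_Mo_commute[OF hi])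
 have ualt: "alt (u n x)" for n x
 proof (rule altI)
  fix xs a c ys
  have "(\<lambda>y. h y (xs @ a # c # ys)) = (\<lambda>y. (-1) * h y (xs @ c # a # ys))"
   using altD[OF alt, of _ xs a c ys] by simp
  then have "Mo (n + N) (\<lambda>y. h y (xs @ a # c # ys)) x = Mo (n + N) (\<lambda>y. (-1) * h y (xs @ c # a # ys)) x"
   by (simp only:)
  also have "\<dots> = (-1) * Mo (n + N) (\<lambda>y. h y (xs @ c # a # ys)) x" by (rule Mo_cmult)
  finally show "u n x (xs @ a # c # ys) = - u n x (xs @ c # a # ys)" by (simp add: u_def)
 qed
 have uL: "L2lim (\<lambda>n x. u n x l) (\<lambda>x. h x l)" for l
  unfolding u_def by (rule L2lim_shift[OF Mo_L2lim[OF h(1) K(1) h(2)]])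
 have sL: "L2lim (\<lambda>n. Mo (n + N) (\<lambda>x. s x I)) (\<lambda>x. s x I)" for I
  by (rule L2lim_shift[OF Mo_L2lim[OF s(1) K(1) s(2)]])
 have bL: "L2lim (\<lambda>n. Mo (n + N) (\<lambda>x. b x l)) (\<lambda>x. b x l)" for l
  by (rule L2lim_shift[OF Mo_L2lim[OF b(1) K(1) b(2)]])
 have ce: "continuous_on U (\<lambda>x. exp (- V x))" using C1_onD(1)[OF V1] by (intro continuous_intros)
 \<comment> \<open>The weight and its derivatives may be unbounded on \<open>U\<close>. Restricting
   them to \<open>L\<close>, which contains the supports of all mollified forms, makes them bounded
   multipliers without changing an integral.\<close>
 define e where "e x = indicator L x * exp (- V x)" for x
 have e: "e \<in> borel_measurable borel" "\<exists>B. \<forall>x. \<bar>e x\<bar> \<le> B"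
  unfolding e_def[abs_def] using indicator_compact_bounded[OF ce L(1,3)] by auto
 define Vj where "Vj j x = indicator L x * pd j V x" for j x
 have Vj: "Vj j \<in> borel_measurable borel" "\<exists>B. \<forall>x. \<bar>Vj j x\<bar> \<le> B" for j
  unfolding Vj_def[abs_def] using indicator_compact_bounded[OF C1_onD(2)[OF V1] L(1,3)] by auto
 define Hjk where "Hjk j k x = indicator L x * (pd j (pd k V) x * exp (- V x))" for j k x
 have Hjk: "Hjk j k \<in> borel_measurable borel" "\<exists>B. \<forall>x. \<bar>Hjk j k x\<bar> \<le> B" for j k
  unfolding Hjk_def[abs_def]
  using indicator_compact_bounded[OF continuous_on_mult[OF C1_onD(2)[OF V2] ce] L(1,3)] by auto
 define T where "T n I x = Mo (n + N) (\<lambda>x. s x I) x + (\<Sum>j\<in>UNIV. Vj j x * u n x (j # I))" for n I x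
 define T' where "T' I x = s x I + (\<Sum>j\<in>UNIV. Vj j x * h x (j # I))" for I x
 have TL: "L2lim (\<lambda>n. T n I) (T' I)" for I
 proof -
  have "L2lim (\<lambda>n x. Vj j x * u n x (j # I)) (\<lambda>x. Vj j x * h x (j # I))" for j
   using L2lim_mult_bounded[OF uL Vj(1)] Vj(2)[of j] by blast
  then show ?thesis unfolding T_def T'_def by (intro L2lim_add sL L2lim_sum) auto
 qed
 have hz: "h x l = 0" if "x \<notin> L" for x l using that L(2) h(2) by blast
 have lhs_n: "(LBINT x. pd j (pd k V) x * u n x l * u n x m * exp (- V x)) = (LBINT x. Hjk j k x * u n x l * u n x m)" for n j k l m
  by (intro Bochner_Integration.integral_cong refl) (use uz in \<open>auto simp: Hjk_def indicator_def\<close>)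
 have lhs: "(LBINT x. pd j (pd k V) x * h x l * h x m * exp (- V x)) = (LBINT x. Hjk j k x * h x l * h x m)" for j k l m
  by (intro Bochner_Integration.integral_cong refl) (use hz in \<open>auto simp: Hjk_def indicator_def\<close>)
 have rhs1_n: "(LBINT x. (\<Sum>j\<in>UNIV. pd j (\<lambda>x. u n x (j # I)) x - pd j V x * u n x (j # I))\<^sup>2 * exp (- V x))
   = (LBINT x. e x * T n I x * T n I x)" if I: "I \<in> LL q" for n I
 proof (intro Bochner_Integration.integral_cong refl)
  fix x
  have "(\<Sum>j\<in>UNIV. pd j (\<lambda>x. u n x (j # I)) x) = Mo (n + N) (\<lambda>x. - s x I) x"
   unfolding ue by (rule gdiv_Mo[OF dv[OF I] hi])
  also have "\<dots> = - Mo (n + N) (\<lambda>x. s x I) x"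
   using Mo_cmult[of "n + N" "-1" "\<lambda>x. s x I" x] by simp
  finally have "(\<Sum>j\<in>UNIV. pd j (\<lambda>x. u n x (j # I)) x - pd j V x * u n x (j # I))
    = - (Mo (n + N) (\<lambda>x. s x I) x + (\<Sum>j\<in>UNIV. pd j V x * u n x (j # I)))"
   by (simp add: sum_subtractf)
  then have eq: "(\<Sum>j\<in>UNIV. pd j (\<lambda>x. u n x (j # I)) x - pd j V x * u n x (j # I))\<^sup>2
    = (Mo (n + N) (\<lambda>x. s x I) x + (\<Sum>j\<in>UNIV. pd j V x * u n x (j # I)))\<^sup>2"
   by (simp only: power2_minus)
  show "(\<Sum>j\<in>UNIV. pd j (\<lambda>x. u n x (j # I)) x - pd j V x * u n x (j # I))\<^sup>2 * exp (- V x) = e x * T n I x * T n I x"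
  proof (cases "x \<in> L")
   case True
   then show ?thesis unfolding eq by (simp add: e_def T_def Vj_def power2_eq_square)
  next
   case False
   have "Mo (n + N) (\<lambda>x. s x I) x = 0" by (rule LM[OF _ s(2) False]) auto
   then show ?thesis unfolding eq using False by (simp add: e_def uz[OF False])
  qed
 qed
 have rhs1: "(LBINT x. (s x I + (\<Sum>j\<in>UNIV. pd j V x * h x (j # I)))\<^sup>2 * exp (- V x))
   = (LBINT x. e x * T' I x * T' I x)" for I
 proof (intro Bochner_Integration.integral_cong refl)
  fix x
  show "(s x I + (\<Sum>j\<in>UNIV. pd j V x * h x (j # I)))\<^sup>2 * exp (- V x) = e x * T' I x * T' I x"
  proof (cases "x \<in> L")
   case True
   then show ?thesis by (simp add: e_def T'_def Vj_def power2_eq_square)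
  next
   case False
   then have "s x I = 0" using L(2) s(2) by blast
   then show ?thesis using False by (simp add: e_def hz[OF False])
  qed
 qed
 have rhs2_n: "(LBINT x. (wdg (\<lambda>j m. pd j (\<lambda>x. u n x m) x) l)\<^sup>2 * exp (- V x))
   = (LBINT x. e x * Mo (n + N) (\<lambda>x. b x l) x * Mo (n + N) (\<lambda>x. b x l) x)"
  if l: "l \<in> LL (Suc (Suc q))" for n l
 proof (intro Bochner_Integration.integral_cong refl)
  fix x
  have "Mo (n + N) (dA h l j) = dA (u n) l j" for j
   unfolding u_def[abs_def] by (rule ext) (rule Mo_dA[OF hi])
  then have "(\<Sum>j\<in>UNIV. pd j (dA (u n) l j) x) = Mo (n + N) (\<lambda>x. b x l) x"
   using gdiv_Mo[OF cl[OF l] integrable_dA[OF hi], of "n + N" x] by simp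
  then have "wdg (\<lambda>j m. pd j (\<lambda>x. u n x m) x) l = Mo (n + N) (\<lambda>x. b x l) x"
   unfolding pd_dA[OF C1c_C1_on[OF uC]] sum_dA[of l "\<lambda>j m. pd j (\<lambda>x. u n x m) x"] .
  moreover have "Mo (n + N) (\<lambda>x. b x l) x = 0" if "x \<notin> L" by (rule LM[OF _ b(2) that]) auto
  ultimately show "(wdg (\<lambda>j m. pd j (\<lambda>x. u n x m) x) l)\<^sup>2 * exp (- V x)
    = e x * Mo (n + N) (\<lambda>x. b x l) x * Mo (n + N) (\<lambda>x. b x l) x"
   by (cases "x \<in> L") (auto simp: e_def power2_eq_square)
 qed
 have rhs2: "(LBINT x. (b x l)\<^sup>2 * exp (- V x)) = (LBINT x. e x * b x l * b x l)" for l
 proof (intro Bochner_Integration.integral_cong refl)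
  fix x
  have "b x l = 0" if "x \<notin> L" using that L(2) b(2) by blast
  then show "(b x l)\<^sup>2 * exp (- V x) = e x * b x l * b x l"
   by (cases "x \<in> L") (auto simp: e_def power2_eq_square)
 qed
 show ?thesis
 proof (rule LIMSEQ_le)
  show "(\<lambda>n. \<Sum>I\<in>LL q. \<Sum>j\<in>UNIV. \<Sum>k\<in>UNIV. LBINT x. pd j (pd k V) x * u n x (j # I) * u n x (k # I) * exp (- V x))
   \<longlonglongrightarrow> (\<Sum>I\<in>LL q. \<Sum>j\<in>UNIV. \<Sum>k\<in>UNIV. LBINT x. pd j (pd k V) x * h x (j # I) * h x (k # I) * exp (- V x))"
   unfolding lhs lhs_n by (intro tendsto_sum L2lim_quad uL Hjk)
  have "(\<lambda>n. (\<Sum>I\<in>LL q. LBINT x. e x * T n I x * T n I x)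
    + (\<Sum>l\<in>LL (Suc (Suc q)). LBINT x. e x * Mo (n + N) (\<lambda>x. b x l) x * Mo (n + N) (\<lambda>x. b x l) x))
   \<longlonglongrightarrow> (\<Sum>I\<in>LL q. LBINT x. e x * T' I x * T' I x) + (\<Sum>l\<in>LL (Suc (Suc q)). LBINT x. e x * b x l * b x l)"
   by (intro tendsto_add tendsto_sum L2lim_quad TL bL e)
  then show "(\<lambda>n. (\<Sum>I\<in>LL q. LBINT x. e x * T n I x * T n I x)
    + (\<Sum>l\<in>LL (Suc (Suc q)). LBINT x. e x * Mo (n + N) (\<lambda>x. b x l) x * Mo (n + N) (\<lambda>x. b x l) x))
   \<longlonglongrightarrow> (\<Sum>I\<in>LL q. LBINT x. (s x I + (\<Sum>j\<in>UNIV. pd j V x * h x (j # I)))\<^sup>2 * exp (- V x))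
    + (\<Sum>l\<in>LL (Suc (Suc q)). LBINT x. (b x l)\<^sup>2 * exp (- V x))"
   unfolding rhs1 rhs2 .
  show "\<exists>M. \<forall>n\<ge>M. (\<Sum>I\<in>LL q. \<Sum>j\<in>UNIV. \<Sum>k\<in>UNIV. LBINT x. pd j (pd k V) x * u n x (j # I) * u n x (k # I) * exp (- V x))
   \<le> (\<Sum>I\<in>LL q. LBINT x. e x * T n I x * T n I x)
    + (\<Sum>l\<in>LL (Suc (Suc q)). LBINT x. e x * Mo (n + N) (\<lambda>x. b x l) x * Mo (n + N) (\<lambda>x. b x l) x)"
  proof (intro exI allI impI)
   fix n
   have 1: "(\<Sum>I\<in>LL q. LBINT x. (\<Sum>j\<in>UNIV. pd j (\<lambda>x. u n x (j # I)) x - pd j V x * u n x (j # I))\<^sup>2 * exp (- V x))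
     = (\<Sum>I\<in>LL q. LBINT x. e x * T n I x * T n I x)"
    by (rule sum.cong[OF refl]) (rule rhs1_n)
   have 2: "(\<Sum>l\<in>LL (Suc (Suc q)). LBINT x. (wdg (\<lambda>j m. pd j (\<lambda>x. u n x m) x) l)\<^sup>2 * exp (- V x))
     = (\<Sum>l\<in>LL (Suc (Suc q)). LBINT x. e x * Mo (n + N) (\<lambda>x. b x l) x * Mo (n + N) (\<lambda>x. b x l) x)"
    by (rule sum.cong[OF refl]) (rule rhs2_n)
   show "(\<Sum>I\<in>LL q. \<Sum>j\<in>UNIV. \<Sum>k\<in>UNIV. LBINT x. pd j (pd k V) x * u n x (j # I) * u n x (k # I) * exp (- V x))
    \<le> (\<Sum>I\<in>LL q. LBINT x. e x * T n I x * T n I x)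
     + (\<Sum>l\<in>LL (Suc (Suc q)). LBINT x. e x * Mo (n + N) (\<lambda>x. b x l) x * Mo (n + N) (\<lambda>x. b x l) x)"
    using Bochner_smooth[OF U V uC uD ucomm ualt, of n q] unfolding 1 2 .
  qed
 qed
qed

subsection \<open>Weighted spaces of forms\<close>

definition wm :: "(real^'n::finite) set \<Rightarrow> (real^'n \<Rightarrow> real) \<Rightarrow> (real^'n) measure" where
 "wm U W = density lborel (\<lambda>x. ennreal (wt U W x))"

lemma sets_wm [simp, measurable_cong]: "sets (wm U W) = sets borel"
 by (simp add: wm_def)

lemma space_wm [simp]: "space (wm U W) = UNIV"
 by (simp add: wm_def)

lemma continuous_on_exp_uminus:
 fixes W :: "'a::topological_space \<Rightarrow> real"
 shows "continuous_on U W \<Longrightarrow> continuous_on U (\<lambda>x. exp (- W x))"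
 by (intro continuous_on_exp continuous_on_minus)

lemma weight_measurable:
 fixes U :: "(real^'n) set" and W :: "real^'n \<Rightarrow> real"
 assumes "open U" "continuous_on U W"
 shows "(\<lambda>x. wt U W x) \<in> borel_measurable borel"
proof -
 have "(\<lambda>x. indicator U x *\<^sub>R exp (- W x)) \<in> borel_measurable borel"
  by (rule borel_measurable_continuous_on_indicator) (use assms continuous_on_exp_uminus in auto)
 then show ?thesis by simp
qed

lemma wm_integral:
 fixes f :: "real^'n \<Rightarrow> real"
 assumes "open U" "continuous_on U W" "f \<in> borel_measurable borel"
 shows "(\<integral>x. f x \<partial>wm U W) = (LBINT x. wt U W x * f x)"
 unfolding wm_def using weight_measurable[OF assms(1,2)] assms(3)
 by (subst integral_density) auto

lemma wm_integrable:
 fixes f :: "real^'n \<Rightarrow> real"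
 assumes "open U" "continuous_on U W" "f \<in> borel_measurable borel"
 shows "integrable (wm U W) f \<longleftrightarrow> integrable lborel (\<lambda>x. wt U W x * f x)"
 unfolding wm_def using weight_measurable[OF assms(1,2)] assms(3)
 by (subst integrable_density) auto

lemma sqi_wm_borel: "sqi (wm U W) f \<Longrightarrow> f \<in> borel_measurable borel"
 by (auto simp: sqi_def cong: measurable_cong_sets)

lemma compact_lower_bound:
 fixes f :: "real^'n \<Rightarrow> real"
 assumes "continuous_on U f" "compact K" "K \<subseteq> U" "\<And>x. x \<in> U \<Longrightarrow> 0 < f x"
 obtains c where "0 < c" "\<And>x. x \<in> K \<Longrightarrow> c \<le> f x"
proof (cases "K = {}")
 case True
 then show ?thesis using that[of 1] by simp
next
 case False
 have "\<exists>x\<in>K. \<forall>y\<in>K. f x \<le> f y"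
  by (rule continuous_attains_inf[OF assms(2) False]) (use assms continuous_on_subset in blast)
 then obtain x where "x \<in> K" "\<forall>y\<in>K. f x \<le> f y" by blast
 then show ?thesis using that[of "f x"] assms by blast
qed

lemma sqi_wm_loc2:
 fixes a :: "real^'n \<Rightarrow> real"
 assumes U: "open U" and W: "continuous_on U W" and a: "sqi (wm U W) a"
 shows "loc2 U a"
proof -
 have am [measurable]: "a \<in> borel_measurable borel" by (rule sqi_wm_borel[OF a])
 have ia: "integrable lborel (\<lambda>x. wt U W x * (a x)\<^sup>2)"
  using sqiD(2)[OF a] wm_integrable[OF U W, of "\<lambda>x. (a x)\<^sup>2"] by simp
 show ?thesis
  unfolding loc2_def
 proof (intro conjI allI impI am)
  fix K assume K: "compact K \<and> K \<subseteq> U"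
  have Kb [measurable]: "K \<in> sets borel" using K by (simp add: borel_closed compact_imp_closed)
  obtain c where c: "0 < c" "\<And>x. x \<in> K \<Longrightarrow> c \<le> exp (- W x)"
   using compact_lower_bound[OF continuous_on_exp_uminus[OF W], of K] K by auto
  show "integrable lborel (\<lambda>x. indicator K x * (a x)\<^sup>2)"
  proof (rule Bochner_Integration.integrable_bound)
   show "integrable lborel (\<lambda>x. (1 / c) * (wt U W x * (a x)\<^sup>2))" using ia by simp
   show "(\<lambda>x. indicator K x * (a x)\<^sup>2) \<in> borel_measurable lborel" by measurable
   show "AE x in lborel. norm (indicator K x * (a x)\<^sup>2) \<le> norm ((1 / c) * (wt U W x * (a x)\<^sup>2))"
   proof (rule AE_I2)
    fix x
    show "norm (indicator K x * (a x)\<^sup>2) \<le> norm ((1 / c) * (wt U W x * (a x)\<^sup>2))"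
    proof (cases "x \<in> K")
     case True
     then have "x \<in> U" using K by blast
     have "c * (a x)\<^sup>2 \<le> exp (- W x) * (a x)\<^sup>2" by (intro mult_right_mono c True) simp
     then show ?thesis using True \<open>x \<in> U\<close> c(1) by (simp add: field_simps abs_mult)
    qed simp
   qed
  qed
 qed
qed

lemma Cc_sqi_wm:
 fixes f :: "real^'n \<Rightarrow> real"
 assumes U: "open U" and W: "continuous_on U W" and f: "Cc U f"
 shows "sqi (wm U W) f"
proof -
 have fm: "f \<in> borel_measurable borel"
  using Cc_continuous_UNIV[OF f U] by (rule borel_measurable_continuous_onI)
 have "Cc U (\<lambda>x. exp (- W x) * (f x * f x))"
  by (intro Cc_mult Cc_Cc_mult f continuous_intros W)
 from Cc_integrable[OF this U] have "integrable lborel (\<lambda>x. exp (- W x) * (f x * f x))" .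
 moreover have "(\<lambda>x. exp (- W x) * (f x * f x)) = (\<lambda>x. wt U W x * (f x)\<^sup>2)"
  using f by (auto simp: Cc_def fun_eq_iff indicator_def power2_eq_square)
 ultimately show ?thesis
  using fm wm_integrable[OF U W, of "\<lambda>x. (f x)\<^sup>2"] by (simp add: sqi_def)
qed

lemma wm_integral_Cc:
 fixes a f :: "real^'n \<Rightarrow> real"
 assumes U: "open U" and W: "continuous_on U W" and f: "Cc U f" and a: "a \<in> borel_measurable borel"
 shows "(\<integral>x. a x * f x \<partial>wm U W) = (LBINT x. a x * f x * exp (- W x))"
proof -
 have fm [measurable]: "f \<in> borel_measurable borel"
  using Cc_continuous_UNIV[OF f U] by (rule borel_measurable_continuous_onI)
 note [measurable] = a
 have "(\<integral>x. a x * f x \<partial>wm U W) = (LBINT x. wt U W x * (a x * f x))"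
  by (rule wm_integral[OF U W]) measurable
 also have "\<dots> = (LBINT x. a x * f x * exp (- W x))"
  using f by (intro Bochner_Integration.integral_cong refl) (auto simp: Cc_def indicator_def)
 finally show ?thesis .
qed

lemma L2_tendsto_pairing:
 fixes a :: "nat \<Rightarrow> real^'n \<Rightarrow> 'b \<Rightarrow> real"
 assumes U: "open U" and W: "continuous_on U W" and fin: "finite I" and l: "l \<in> I"
  and a: "\<And>n. L2F I (wm U W) (a n)" and u: "L2F I (wm U W) u"
  and lim: "(\<lambda>n. nrm2 I (wm U W) (\<lambda>x l. a n x l - u x l)) \<longlonglongrightarrow> 0" and f: "Cc U f"
 shows "(\<lambda>n. LBINT x. a n x l * f x) \<longlonglongrightarrow> (LBINT x. u x l * f x)"
proof -
 let ?M = "wm U W"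
 \<comment> \<open>The factor exp W undoes the density, so an unweighted pairing becomes an inner
   product in the weighted space.\<close>
 let ?g = "\<lambda>x. exp (W x) * f x"
 have g: "Cc U ?g" by (intro Cc_mult f continuous_intros W)
 have sg: "sqi ?M ?g" by (rule Cc_sqi_wm[OF U W g])
 have conv: "(LBINT x. v x * f x) = (\<integral>x. v x * ?g x \<partial>?M)" if "sqi ?M v" for v
  using wm_integral_Cc[OF U W g sqi_wm_borel[OF that]] by (simp add: mult.assoc exp_minus field_simps)
 have "(\<lambda>n. (LBINT x. a n x l * f x) - (LBINT x. u x l * f x)) \<longlonglongrightarrow> 0"
 proof (rule Lim_null_comparison[OF always_eventually[OF allI]])
  show "(\<lambda>n. sqrt (nrm2 I ?M (\<lambda>x l. a n x l - u x l)) * sqrt (\<integral>x. (?g x)\<^sup>2 \<partial>?M)) \<longlonglongrightarrow> 0"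
   using tendsto_mult[OF tendsto_real_sqrt[OF lim] tendsto_const[of "sqrt (\<integral>x. (?g x)\<^sup>2 \<partial>?M)"]] by simp
  fix n
  have sd: "sqi ?M (\<lambda>x. a n x l - u x l)" by (intro sqi_diff L2FD[OF a l] L2FD[OF u l])
  have "(LBINT x. a n x l * f x) - (LBINT x. u x l * f x) = (\<integral>x. (a n x l - u x l) * ?g x \<partial>?M)"
   unfolding conv[OF L2FD[OF a l]] conv[OF L2FD[OF u l]]
   using sqi_mult_integrable[OF L2FD[OF a l] sg] sqi_mult_integrable[OF L2FD[OF u l] sg]
   by (simp add: left_diff_distrib)
  also have "\<bar>\<dots>\<bar> \<le> sqrt (\<integral>x. (a n x l - u x l)\<^sup>2 \<partial>?M) * sqrt (\<integral>x. (?g x)\<^sup>2 \<partial>?M)"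
   by (rule scalar_Cauchy_Schwarz_sqrt[OF sd sg])
  also have "\<dots> \<le> sqrt (nrm2 I ?M (\<lambda>x l. a n x l - u x l)) * sqrt (\<integral>x. (?g x)\<^sup>2 \<partial>?M)"
   by (intro mult_right_mono real_sqrt_le_mono component_le_nrm2[OF fin l, of ?M "\<lambda>x l. a n x l - u x l"])
    (simp add: integral_nonneg_AE)
  finally show "norm ((LBINT x. a n x l * f x) - (LBINT x. u x l * f x))
    \<le> sqrt (nrm2 I ?M (\<lambda>x l. a n x l - u x l)) * sqrt (\<integral>x. (?g x)\<^sup>2 \<partial>?M)"
   by (simp only: real_norm_def)
 qed
 then show ?thesis by (simp add: LIM_zero_iff)
qed

section \<open>The weak exterior derivative, its weighted adjoint, and their pairing\<close>

definition wd :: "nat \<Rightarrow> (real^'n::finite) set \<Rightarrow> (real^'n \<Rightarrow> 'n list \<Rightarrow> real) \<Rightarrow> (real^'n \<Rightarrow> 'n list \<Rightarrow> real) \<Rightarrow> bool" where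
 "wd q U u f \<longleftrightarrow> (\<forall>l\<in>LL (Suc q). wdiv U (dA u l) (\<lambda>x. f x l))"

definition testform :: "nat \<Rightarrow> (real^'n::finite) set \<Rightarrow> (real^'n \<Rightarrow> 'n list \<Rightarrow> real) \<Rightarrow> bool" where
 "testform p U g \<longleftrightarrow> (\<forall>x. altform p (g x)) \<and> (\<forall>l. C1c U (\<lambda>x. g x l))"

text \<open>The formal adjoint of d for the weight exp(-W). As inner products are sums over all
  lists, the pairing of du with g is \<open>Suc q\<close> times that of u with
  \<open>dst W g\<close>.\<close>

definition dst :: "(real^'n \<Rightarrow> real) \<Rightarrow> (real^'n \<Rightarrow> 'n list \<Rightarrow> real) \<Rightarrow> real^'n \<Rightarrow> 'n::finite list \<Rightarrow> real" where
 "dst W g x I = - (\<Sum>j\<in>UNIV. pd j (\<lambda>x. g x (j # I)) x - pd j W x * g x (j # I))"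

lemma altform_alt: "altform p c \<Longrightarrow> alt c"
 by (simp add: altform_iff)

lemma loc2_dA:
 assumes "\<And>l. loc2 U (\<lambda>x. u x l)" shows "loc2 U (dA u l j)"
proof -
 have "loc2 U (\<lambda>x. if l ! s = j then (-1) ^ s * u x m else 0)" for s m
  using assms loc2_zero by (cases "l ! s = j") (auto intro: loc2_cmult)
 then show ?thesis unfolding dA_def[abs_def] by (intro loc2_sum) auto
qed

text \<open>For each direction \<open>k\<close> this is adjointness of the wedge with the single
  differential dx^k and the contraction with it; the forms \<open>G k\<close> may vary with the
  direction and later become partial derivatives.\<close>

lemma dA_pairing:
 fixes u :: "real^'n \<Rightarrow> 'n list \<Rightarrow> real"
 assumes "\<And>k. alt (G k)"
 shows "(\<Sum>l\<in>LL (Suc q). \<Sum>k\<in>UNIV. dA u l k x * G k l)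
  = Suc q * (\<Sum>I\<in>LL q. \<Sum>k\<in>UNIV. u x I * G k (k # I))"
proof -
 have "dA u l k x = wdg (\<lambda>j J. if j = k then u x J else 0) l" for l k
 proof -
  have "dA u l k x = (\<Sum>j\<in>UNIV. (if j = k then 1 else 0) * dA u l j x)"
   by (simp add: if_distrib[of "\<lambda>x. x * _"] cong: if_cong)
  also have "\<dots> = wdg (\<lambda>j J. (if j = k then 1 else 0) * u x J) l" by (rule dA_wdg)
  also have "\<dots> = wdg (\<lambda>j J. if j = k then u x J else 0) l" by (rule wdg_cong) simp
  finally show ?thesis .
 qed
 then have "(\<Sum>l\<in>LL (Suc q). \<Sum>k\<in>UNIV. dA u l k x * G k l)
   = (\<Sum>k\<in>UNIV. \<Sum>l\<in>LL (Suc q). wdg (\<lambda>j J. if j = k then u x J else 0) l * G k l)"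
  by (simp only:) (rule sum.swap)
 also have "\<dots> = (\<Sum>k\<in>UNIV. Suc q * (\<Sum>j\<in>UNIV. \<Sum>I\<in>LL q. (if j = k then u x I else 0) * G k (j # I)))"
  by (intro sum.cong refl wdg_adjoint assms)
 also have "\<dots> = (\<Sum>k\<in>UNIV. Suc q * (\<Sum>I\<in>LL q. u x I * G k (k # I)))"
 proof (intro sum.cong refl arg_cong[where f = "\<lambda>z. real (Suc q) * z"])
  fix k
  have "(\<Sum>j\<in>UNIV. \<Sum>I\<in>LL q. (if j = k then u x I else 0) * G k (j # I))
    = (\<Sum>j\<in>UNIV. if j = k then \<Sum>I\<in>LL q. u x I * G k (j # I) else 0)"
   by (intro sum.cong refl) auto
  then show "(\<Sum>j\<in>UNIV. \<Sum>I\<in>LL q. (if j = k then u x I else 0) * G k (j # I)) = (\<Sum>I\<in>LL q. u x I * G k (k # I))"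
   by simp
 qed
 also have "\<dots> = Suc q * (\<Sum>k\<in>UNIV. \<Sum>I\<in>LL q. u x I * G k (k # I))"
  by (rule sum_distrib_left[symmetric])
 also have "(\<Sum>k\<in>UNIV. \<Sum>I\<in>LL q. u x I * G k (k # I)) = (\<Sum>I\<in>LL q. \<Sum>k\<in>UNIV. u x I * G k (k # I))"
  by (rule sum.swap)
 finally show ?thesis .
qed

lemma testform_weighted:
 fixes W :: "real^'n \<Rightarrow> real"
 assumes U: "open U" and W: "C1_on U W" and g: "testform p U g"
 shows "C1c U (\<lambda>x. exp (- W x) * g x l)"
  "pd j (\<lambda>x. exp (- W x) * g x l) x = (pd j (\<lambda>x. g x l) x - pd j W x * g x l) * exp (- W x)"
  "alt (\<lambda>l. pd j (\<lambda>x. exp (- W x) * g x l) x)"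
proof -
 have gC: "C1c U (\<lambda>x. g x l)" for l using g by (simp add: testform_def)
 have e1: "C1_on U (\<lambda>x. exp (- W x))"
  by (rule C1_on_compose[OF W, where F = "\<lambda>t. exp (- t)" and F' = "\<lambda>t. - exp (- t)"])
   (auto intro!: derivative_eq_intros continuous_intros)
 show C: "C1c U (\<lambda>x. exp (- W x) * g x l)" for l by (rule C1c_mult[OF e1 gC U])
 obtain K where K: "compact K" "K \<subseteq> U" "\<And>x. x \<notin> K \<Longrightarrow> g x l = 0" "\<And>x j. x \<notin> K \<Longrightarrow> pd j (\<lambda>x. g x l) x = 0"
  using C1c_support[OF gC[of l]] by metis
 show "pd j (\<lambda>x. exp (- W x) * g x l) x = (pd j (\<lambda>x. g x l) x - pd j W x * g x l) * exp (- W x)"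
 proof (cases "x \<in> U")
  case True
  have "pd j (\<lambda>x. exp (- W x)) x = - exp (- W x) * pd j W x"
   by (rule pd_compose[OF W True]) (auto intro!: derivative_eq_intros)
  then show ?thesis using pd_mult[OF e1 C1c_C1_on[OF gC] True, of j l] by (simp add: algebra_simps)
 next
  case False
  then have x: "x \<in> - K" using K by auto
  have "hpd j (\<lambda>x. exp (- W x) * g x l) 0 x"
   by (rule hpd_cong_open[OF hpd_const[of j 0 x], of "- K"]) (use K x in \<open>auto simp: compact_imp_closed\<close>)
  then show ?thesis using x K by (simp add: hpd_pd)
 qed
 have "alt (\<lambda>l. exp (- W y) * g y l)" for y
 proof (rule altI)
  fix xs a b ys
  have "alt (g y)" using g unfolding testform_def by (blast intro: altform_alt)
  from altD[OF this, of xs a b ys]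
  show "exp (- W y) * g y (xs @ a # b # ys) = - (exp (- W y) * g y (xs @ b # a # ys))" by simp
 qed
 then show "alt (\<lambda>l. pd j (\<lambda>x. exp (- W x) * g x l) x)"
  by (rule alt_pd) (rule C1c_C1_on[OF C])
qed

lemma wd_pairing:
 fixes u f g :: "real^'n \<Rightarrow> 'n list \<Rightarrow> real"
 assumes U: "open U" and W: "C1_on U W" and g: "testform (Suc q) U g"
  and u: "\<And>l. loc2 U (\<lambda>x. u x l)" and wd: "wd q U u f"
 shows "(\<Sum>l\<in>LL (Suc q). LBINT x. f x l * g x l * exp (- W x))
  = Suc q * (\<Sum>I\<in>LL q. LBINT x. u x I * dst W g x I * exp (- W x))"
proof -
 note tw = testform_weighted[OF U W g]
 let ?f = "\<lambda>l x. exp (- W x) * g x l"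
 have i1: "integrable lborel (\<lambda>x. dA u l j x * pd j (?f l) x)" for l j
  by (intro loc2_integrable[OF loc2_dA[OF u] _ U] C1c_pd_Cc tw)
 have i2: "integrable lborel (\<lambda>x. u x I * pd k (?f (k # I)) x)" for k I
  by (intro loc2_integrable[OF u _ U] C1c_pd_Cc tw)
 have "(\<Sum>l\<in>LL (Suc q). LBINT x. f x l * ?f l x)
   = (\<Sum>l\<in>LL (Suc q). - (\<Sum>j\<in>UNIV. LBINT x. dA u l j x * pd j (?f l) x))"
 proof (intro sum.cong refl)
  fix l :: "'n list" assume "l \<in> LL (Suc q)"
  then have "wdiv U (dA u l) (\<lambda>x. f x l)" using wd by (simp add: wd_def)
  from wdivD[OF this tw(1)[of l]]
  show "(LBINT x. f x l * ?f l x) = - (\<Sum>j\<in>UNIV. LBINT x. dA u l j x * pd j (?f l) x)" by simp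
 qed
 also have "\<dots> = - (LBINT x. (\<Sum>l\<in>LL (Suc q). \<Sum>j\<in>UNIV. dA u l j x * pd j (?f l) x))"
  using i1 by (simp add: sum_negf)
 also have "(LBINT x. (\<Sum>l\<in>LL (Suc q). \<Sum>j\<in>UNIV. dA u l j x * pd j (?f l) x))
   = (LBINT x. Suc q * (\<Sum>I\<in>LL q. \<Sum>k\<in>UNIV. u x I * pd k (?f (k # I)) x))"
  by (intro Bochner_Integration.integral_cong refl dA_pairing tw(3))
 also have "\<dots> = Suc q * (\<Sum>I\<in>LL q. LBINT x. (\<Sum>k\<in>UNIV. u x I * pd k (?f (k # I)) x))"
  using i2 by simp
 also have "(\<Sum>I\<in>LL q. LBINT x. (\<Sum>k\<in>UNIV. u x I * pd k (?f (k # I)) x))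
   = - (\<Sum>I\<in>LL q. LBINT x. u x I * dst W g x I * exp (- W x))"
  unfolding sum_negf[symmetric]
 proof (intro sum.cong refl)
  fix I
  have "(\<Sum>k\<in>UNIV. u x I * pd k (?f (k # I)) x) = - (u x I * dst W g x I * exp (- W x))" for x
   unfolding tw(2) dst_def by (simp add: sum_distrib_left sum_distrib_right mult.assoc)
  then show "(LBINT x. (\<Sum>k\<in>UNIV. u x I * pd k (?f (k # I)) x)) = - (LBINT x. u x I * dst W g x I * exp (- W x))"
   by simp
 qed
 finally show ?thesis by (simp add: mult_ac)
qed

lemma Cc_dst:
 assumes W: "C1_on U W" and g: "testform p U g" shows "Cc U (\<lambda>x. dst W g x I)"
proof -
 have gC: "C1c U (\<lambda>x. g x l)" for l using g by (simp add: testform_def)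
 show ?thesis unfolding dst_def
  by (intro Cc_minus Cc_sum Cc_diff C1c_pd_Cc gC Cc_mult C1_onD(2)[OF W] C1c_Cc[OF gC]) auto
qed

lemma altform_dst:
 assumes g: "testform (Suc q) U g" shows "altform q (dst W g x)"
proof -
 have gC: "C1c U (\<lambda>x. g x l)" for l using g by (simp add: testform_def)
 have ag: "alt (g x)" for x using g unfolding testform_def by (blast intro: altform_alt)
 have gz: "g y l = 0" if "length l \<noteq> Suc q" for l y using g that by (simp add: testform_def altform_iff)
 have "alt (dst W g x)"
 proof (rule altI)
  fix xs a b ys
  have "pd j (\<lambda>x. g x (j # xs @ a # b # ys)) x = - pd j (\<lambda>x. g x (j # xs @ b # a # ys)) x" for j
   using altD[OF alt_pd[OF ag C1c_C1_on[OF gC], of j x], of "j # xs" a b ys] by simp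
  moreover have "g x (j # xs @ a # b # ys) = - g x (j # xs @ b # a # ys)" for j
   using altD[OF ag, of x "j # xs" a b ys] by simp
  ultimately show "dst W g x (xs @ a # b # ys) = - dst W g x (xs @ b # a # ys)"
   unfolding dst_def by (simp add: sum_subtractf sum_negf)
 qed
 moreover have "dst W g x I = 0" if "length I \<noteq> q" for I
 proof -
  have "(\<lambda>x. g x (j # I)) = (\<lambda>x. 0)" for j using gz[of "j # I"] that by auto
  then have "pd j (\<lambda>x. g x (j # I)) x = 0" "g x (j # I) = 0" for j
   using hpd_pd[OF hpd_const[of j 0 x]] by (simp_all add: fun_eq_iff)
  then show ?thesis by (simp add: dst_def)
 qed
 ultimately show ?thesis by (simp add: altform_iff)
qed

lemma eps_testform:
 assumes "C1c U f" "l \<in> LL p"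
 shows "testform p U (\<lambda>x m. f x * eps l m)"
proof -
 have "altform p (\<lambda>m. f x * eps l m)" for x
 proof -
  have "f x * eps l (xs @ a # b # ys) = - (f x * eps l (xs @ b # a # ys))" for xs a b ys
   using altD[OF alt_eps[of l], of xs a b ys] by simp
  then have "alt (\<lambda>m. f x * eps l m)" by (rule altI)
  then show ?thesis using eps_length[of _ l] assms(2) by (simp add: altform_iff LL_def)
 qed
 moreover have "C1c U (\<lambda>x. f x * eps l m)" for m
  using C1c_cmult[OF assms(1), of "eps l m"] by (simp add: mult.commute)
 ultimately show ?thesis by (simp add: testform_def)
qed

text \<open>The converse of \<open>wd_pairing\<close>: the identity tested against all compactly
  supported forms recovers the weak equation coefficient by coefficient, because the forms h dx^l
  are among the test forms.\<close>

lemma pairing_wd: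
 fixes u f :: "real^'n \<Rightarrow> 'n list \<Rightarrow> real"
 assumes U: "open U" and W: "C1_on U W" and au: "\<And>x. alt (u x)" and af: "\<And>x. alt (f x)"
  and u: "\<And>l. loc2 U (\<lambda>x. u x l)" and f: "\<And>l. loc2 U (\<lambda>x. f x l)"
  and pair: "\<And>g. testform (Suc q) U g \<Longrightarrow>
   (\<Sum>l\<in>LL (Suc q). LBINT x. f x l * g x l * exp (- W x))
   = Suc q * (\<Sum>I\<in>LL q. LBINT x. u x I * dst W g x I * exp (- W x))"
 shows "wd q U u f"
 unfolding wd_def wdiv_def
proof (intro ballI allI impI)
 fix l :: "'n list" and h assume l: "l \<in> LL (Suc q)" and h: "C1c U h"
 have ll: "length l = Suc q" using l by (simp add: LL_def)
 have e1: "C1_on U (\<lambda>x. exp (W x))"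
  by (rule C1_on_compose[OF W]) (auto intro!: derivative_eq_intros continuous_intros)
 have hW: "C1c U (\<lambda>x. exp (W x) * h x)" by (rule C1c_mult[OF e1 h U])
 \<comment> \<open>The factor exp W cancels the weight, also under the derivatives in
   \<open>dst\<close>, and \<open>eps l\<close> isolates the coefficient \<open>l\<close>; both
   sides acquire the same factor \<open>fact (Suc q)\<close>.\<close>
 define g where "g x m = exp (W x) * h x * eps l m" for x m
 have g: "testform (Suc q) U g" unfolding g_def[abs_def] by (rule eps_testform[OF hW l])
 have gC: "C1c U (\<lambda>x. g x m)" for m using g by (simp add: testform_def)
 have eg: "exp (- W x) * g x m = h x * eps l m" for x m
  by (simp add: g_def exp_minus)
 have dg: "(pd j (\<lambda>x. g x m) x - pd j W x * g x m) * exp (- W x) = pd j h x * eps l m" for j x m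
 proof -
  have "(pd j (\<lambda>x. g x m) x - pd j W x * g x m) * exp (- W x) = pd j (\<lambda>x. exp (- W x) * g x m) x"
   by (rule testform_weighted(2)[OF U W g, symmetric])
  also have "(\<lambda>x. exp (- W x) * g x m) = (\<lambda>x. eps l m * h x)"
   by (rule ext, subst eg) (rule mult.commute)
  also have "pd j (\<lambda>x. eps l m * h x) x = eps l m * pd j h x" by (rule pd_cmult[OF C1c_C1_on[OF h, of UNIV]]) simp
  finally show ?thesis by simp
 qed
 have "(\<Sum>m\<in>LL (Suc q). LBINT x. f x m * g x m * exp (- W x))
   = (LBINT x. (\<Sum>m\<in>LL (Suc q). f x m * (h x * eps l m)))"
 proof -
  have i: "integrable lborel (\<lambda>x. f x m * (h x * eps l m))" for m
   by (intro loc2_integrable[OF f _ U] Cc_mult_right C1c_Cc[OF h]) auto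
  have e2: "f x m * g x m * exp (- W x) = f x m * (h x * eps l m)" for x m
   using eg[of x m] by (simp add: mult_ac)
  show ?thesis unfolding e2 using i by simp
 qed
 also have "\<dots> = (LBINT x. fact (Suc q) * (f x l * h x))"
 proof (intro Bochner_Integration.integral_cong refl)
  fix x
  have "(\<Sum>m\<in>LL (Suc q). f x m * (h x * eps l m)) = h x * (\<Sum>m\<in>LL (length l). eps l m * f x m)"
   by (simp add: ll sum_distrib_left mult_ac)
  also have "\<dots> = h x * (fact (length l) * f x l)" by (simp only: eps_pairing[OF af])
  finally show "(\<Sum>m\<in>LL (Suc q). f x m * (h x * eps l m)) = fact (Suc q) * (f x l * h x)"
   by (simp only: ll mult_ac)
 qed
 finally have 1: "(\<Sum>m\<in>LL (Suc q). LBINT x. f x m * g x m * exp (- W x))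
   = fact (Suc q) * (LBINT x. f x l * h x)" by simp
 have i3: "integrable lborel (\<lambda>x. u x I * (\<Sum>j\<in>UNIV. pd j h x * eps l (j # I)))" for I
  by (intro loc2_integrable[OF u _ U] Cc_sum Cc_mult_right C1c_pd_Cc h) auto
 have i4: "integrable lborel (\<lambda>x. dA u l j x * pd j h x)" for j
  by (intro loc2_integrable[OF loc2_dA[OF u] _ U] C1c_pd_Cc h)
 have "Suc q * (\<Sum>I\<in>LL q. LBINT x. u x I * dst W g x I * exp (- W x))
   = Suc q * (\<Sum>I\<in>LL q. - (LBINT x. u x I * (\<Sum>j\<in>UNIV. pd j h x * eps l (j # I))))"
 proof -
  have "dst W g x I * exp (- W x) = - (\<Sum>j\<in>UNIV. pd j h x * eps l (j # I))" for x I
   unfolding dst_def by (simp only: mult_minus_left sum_distrib_right dg)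
  then have "u x I * dst W g x I * exp (- W x) = - (u x I * (\<Sum>j\<in>UNIV. pd j h x * eps l (j # I)))" for x I
   by (simp only: mult.assoc mult_minus_right)
  then show ?thesis by simp
 qed
 also have "\<dots> = - (LBINT x. Suc q * (\<Sum>I\<in>LL q. u x I * (\<Sum>j\<in>UNIV. pd j h x * eps l (j # I))))"
  using i3 by (simp add: sum_negf)
 also have "(LBINT x. Suc q * (\<Sum>I\<in>LL q. u x I * (\<Sum>j\<in>UNIV. pd j h x * eps l (j # I))))
   = (LBINT x. fact (Suc q) * (\<Sum>j\<in>UNIV. dA u l j x * pd j h x))"
 proof (intro Bochner_Integration.integral_cong refl)
  fix x
  have "(\<Sum>I\<in>LL q. u x I * (\<Sum>j\<in>UNIV. pd j h x * eps l (j # I)))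
    = (\<Sum>j\<in>UNIV. \<Sum>I\<in>LL q. (pd j h x * u x I) * eps l (j # I))"
   unfolding sum_distrib_left by (subst sum.swap) (simp add: mult_ac)
  then have "Suc q * (\<Sum>I\<in>LL q. u x I * (\<Sum>j\<in>UNIV. pd j h x * eps l (j # I)))
    = (\<Sum>m\<in>LL (length l). eps l m * wdg (\<lambda>j J. pd j h x * u x J) m)"
   using wdg_adjoint[OF alt_eps[of l], where a = "\<lambda>j J. pd j h x * u x J" and q = q]
   by (simp add: ll mult.commute)
  also have "\<dots> = fact (length l) * wdg (\<lambda>j J. pd j h x * u x J) l"
  proof (rule eps_pairing, rule alt_wdg, rule altI)
   fix j xs a b ys
   show "pd j h x * u x (xs @ a # b # ys) = - (pd j h x * u x (xs @ b # a # ys))"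
    using altD[OF au, of x xs a b ys] by simp
  qed
  also have "wdg (\<lambda>j J. pd j h x * u x J) l = (\<Sum>j\<in>UNIV. pd j h x * dA u l j x)" by (rule dA_wdg[symmetric])
  finally show "Suc q * (\<Sum>I\<in>LL q. u x I * (\<Sum>j\<in>UNIV. pd j h x * eps l (j # I)))
    = fact (Suc q) * (\<Sum>j\<in>UNIV. dA u l j x * pd j h x)"
   by (simp add: ll mult.commute)
 qed
 finally have 2: "Suc q * (\<Sum>I\<in>LL q. LBINT x. u x I * dst W g x I * exp (- W x))
   = - (fact (Suc q) * (\<Sum>j\<in>UNIV. LBINT x. dA u l j x * pd j h x))"
  using i4 by simp
 have "fact (Suc q) * (LBINT x. f x l * h x) = - (fact (Suc q) * (\<Sum>j\<in>UNIV. LBINT x. dA u l j x * pd j h x))"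
  using pair[OF g] unfolding 1 2 .
 then have "fact (Suc q) * ((LBINT x. f x l * h x) + (\<Sum>j\<in>UNIV. LBINT x. dA u l j x * pd j h x)) = 0"
  by (simp only: distrib_left)
 then have "(LBINT x. f x l * h x) + (\<Sum>j\<in>UNIV. LBINT x. dA u l j x * pd j h x) = 0"
  by (simp only: mult_eq_0_iff fact_nonzero simp_thms)
 then show "(\<Sum>j\<in>UNIV. LBINT x. dA u l j x * pd j h x) = - (LBINT x. f x l * h x)"
  by linarith
qed

text \<open>Smooth test functions suffice. Using the equation for u with the partial derivatives of
  a test function as test functions produces the wedge of its Hessian with u, which vanishes by
  symmetry.\<close>

lemma wd_dd:
 fixes u f :: "real^'n \<Rightarrow> 'n list \<Rightarrow> real"
 assumes U: "open U" and u: "\<And>l. loc2 U (\<lambda>x. u x l)" and f: "\<And>l. loc2 U (\<lambda>x. f x l)" and wd: "wd q U u f"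
 shows "wd (Suc q) U f (\<lambda>x l. 0)"
 unfolding wd_def
proof
 fix l :: "'n list" assume l: "l \<in> LL (Suc (Suc q))"
 have ll: "length l = Suc (Suc q)" using l by (simp add: LL_def)
 let ?del = "\<lambda>s. take s l @ drop (Suc s) l"
 show "wdiv U (dA f l) (\<lambda>x. 0)"
 proof (rule wdivI_test[OF U loc2_dA[OF f] loc2_zero])
  have key: "wdg (\<lambda>j J. c j * u x J) m = (\<Sum>j\<in>UNIV. dA u m j x * c j)" for c m x
   by (subst dA_wdg[of c u m x, symmetric]) (intro sum.cong refl mult.commute)
  fix h assume h: "C1c U h" "\<And>k. C1c U (pd k h)" "\<And>j k x. pd j (pd k h) x = pd k (pd j h) x"
  have comp: "(LBINT x. f x (?del s) * pd k h x) = - (\<Sum>j\<in>UNIV. LBINT x. dA u (?del s) j x * pd j (pd k h) x)"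
   if "s < length l" for s k
  proof -
   have "?del s \<in> LL (Suc q)" using that ll by (simp add: LL_def)
   then have "wdiv U (dA u (?del s)) (\<lambda>x. f x (?del s))" using wd by (simp add: wd_def)
   from wdivD[OF this h(2)[of k]] show ?thesis by simp
  qed
  have if1: "integrable lborel (\<lambda>x. (if l ! s = j then (-1) ^ s * f x m else 0) * pd j h x)" for s j m
   using loc2_integrable[OF f C1c_pd_Cc[OF h(1)] U, of m j] by (cases "l ! s = j") (auto simp: mult.assoc)
  have iu: "integrable lborel (\<lambda>x. dA u m j x * pd j (pd k h) x)" for m j k
   by (intro loc2_integrable[OF loc2_dA[OF u] _ U] C1c_pd_Cc h)
  have "(\<Sum>j\<in>UNIV. LBINT x. dA f l j x * pd j h x)
    = (\<Sum>j\<in>UNIV. \<Sum>s<length l. LBINT x. (if l ! s = j then (-1) ^ s * f x (?del s) else 0) * pd j h x)"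
   unfolding dA_def sum_distrib_right using if1 by simp
  also have "\<dots> = (\<Sum>s<length l. \<Sum>j\<in>UNIV. if l ! s = j then (-1) ^ s * (LBINT x. f x (?del s) * pd j h x) else 0)"
   by (subst sum.swap, intro sum.cong refl) (auto simp: mult.assoc)
  also have "\<dots> = (\<Sum>s<length l. (-1) ^ s * (LBINT x. f x (?del s) * pd (l ! s) h x))"
   by simp
  also have "\<dots> = (\<Sum>s<length l. (-1) ^ s * - (\<Sum>j\<in>UNIV. LBINT x. dA u (?del s) j x * pd j (pd (l ! s) h) x))"
   using comp by (intro sum.cong refl) simp
  also have "\<dots> = - (LBINT x. (\<Sum>s<length l. (-1) ^ s * (\<Sum>j\<in>UNIV. dA u (?del s) j x * pd j (pd (l ! s) h) x)))"
   using iu by (simp add: sum_negf)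
  also have "(\<lambda>x. \<Sum>s<length l. (-1) ^ s * (\<Sum>j\<in>UNIV. dA u (?del s) j x * pd j (pd (l ! s) h) x)) = (\<lambda>x. 0)"
  proof
   fix x
   have "(\<Sum>s<length l. (-1) ^ s * (\<Sum>j\<in>UNIV. dA u (?del s) j x * pd j (pd (l ! s) h) x))
     = (\<Sum>s<length l. (-1) ^ s * wdg (\<lambda>j J. pd j (pd (l ! s) h) x * u x J) (?del s))"
    by (simp only: key)
   also have "\<dots> = wdg (\<lambda>k. wdg (\<lambda>j J. pd j (pd k h) x * u x J)) l"
    by (simp add: wdg_eq_sum[of "\<lambda>k. wdg (\<lambda>j J. pd j (pd k h) x * u x J)" l])
   also have "\<dots> = 0" by (rule wdg_wdg) (simp add: h(3)[of _ _ x])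
   finally show "(\<Sum>s<length l. (-1) ^ s * (\<Sum>j\<in>UNIV. dA u (?del s) j x * pd j (pd (l ! s) h) x)) = 0" .
  qed
  finally show "(\<Sum>j\<in>UNIV. LBINT x. dA f l j x * pd j h x) = - (LBINT x. 0 * h x)" by simp
 qed
qed

text \<open>Elements are Borel functions, alternating at every point and not classes modulo null
  sets. The pointwise algebra can thus be applied to them directly; only limits need care.\<close>

definition formL2 :: "(real^'n::finite) set \<Rightarrow> (real^'n \<Rightarrow> real) \<Rightarrow> nat \<Rightarrow> (real^'n \<Rightarrow> 'n list \<Rightarrow> real) \<Rightarrow> bool" where
 "formL2 U V p k \<longleftrightarrow> (\<forall>x. altform p (k x)) \<and> (\<forall>l. (\<lambda>x. k x l) \<in> borel_measurable borel) \<and> L2F (LL p) (wm U V) k"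

lemma formL2D:
 assumes "formL2 U V p k"
 shows "altform p (k x)" "alt (k x)" "(\<lambda>x. k x l) \<in> borel_measurable borel" "L2F (LL p) (wm U V) k"
  "l \<notin> LL p \<Longrightarrow> k x l = 0"
 using assms by (auto simp: formL2_def LL_def altform_iff)

lemma formL2_loc2:
 assumes "open U" "continuous_on U V" "formL2 U V p k"
 shows "loc2 U (\<lambda>x. k x l)"
proof (cases "l \<in> LL p")
 case True
 then show ?thesis using sqi_wm_loc2[OF assms(1,2)] L2FD[OF formL2D(4)[OF assms(3)]] by blast
next
 case False
 then have "(\<lambda>x. k x l) = (\<lambda>x. 0)" using formL2D(5)[OF assms(3)] by blast
 then show ?thesis by (simp add: loc2_zero)
qed

lemma alt_lincomb:
 assumes "alt u" "alt v" shows "alt (\<lambda>l. u l + c * v l)"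
proof (rule altI)
 fix xs x y ys
 show "u (xs @ x # y # ys) + c * v (xs @ x # y # ys) = - (u (xs @ y # x # ys) + c * v (xs @ y # x # ys))"
  using altD[OF assms(1), of xs x y ys] altD[OF assms(2), of xs x y ys] by simp
qed

lemma altform_lincomb: "altform p u \<Longrightarrow> altform p v \<Longrightarrow> altform p (\<lambda>l. u l + c * v l)"
 by (simp add: altform_iff alt_lincomb)

lemma altform_zero: "altform p (\<lambda>l. 0)"
 by (simp add: altform_iff alt_zero)

lemma formL2_lincomb:
 assumes "formL2 U V p u" "formL2 U V p v"
 shows "formL2 U V p (\<lambda>x l. u x l + c * v x l)"
 using assms unfolding formL2_def
 by (auto intro!: altform_lincomb L2F_add L2F_cmult borel_measurable_add borel_measurable_times)

lemma formL2_zero: "formL2 U V p (\<lambda>x l. 0)"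
 unfolding formL2_def by (auto simp: altform_zero L2F_def sqi_zero)

lemma dA_lincomb: "dA (\<lambda>x l. u x l + c * v x l) l j x = dA u l j x + c * dA v l j x"
proof -
 have "(if l ! s = j then (-1) ^ s * (u x m + c * v x m) else 0)
   = (if l ! s = j then (-1) ^ s * u x m else 0) + c * (if l ! s = j then (-1) ^ s * v x m else 0)" for s m
  by (simp add: algebra_simps)
 then show ?thesis by (simp only: dA_def sum.distrib sum_distrib_left)
qed

lemma pd_const: "pd j (\<lambda>x. c) x = 0"
 by (rule hpd_pd) simp

lemma dA_zero: "dA (\<lambda>x l. 0) l j x = 0"
 by (auto intro!: sum.neutral simp: dA_def)

lemma wd_lincomb:
 fixes u v f g :: "real^'n \<Rightarrow> 'n list \<Rightarrow> real"
 assumes U: "open U" and u: "\<And>l. loc2 U (\<lambda>x. u x l)" and v: "\<And>l. loc2 U (\<lambda>x. v x l)"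
  and f: "\<And>l. loc2 U (\<lambda>x. f x l)" and g: "\<And>l. loc2 U (\<lambda>x. g x l)"
  and wd: "wd q U u f" "wd q U v g"
 shows "wd q U (\<lambda>x l. u x l + c * v x l) (\<lambda>x l. f x l + c * g x l)"
 unfolding wd_def wdiv_def
proof (intro ballI allI impI)
 fix l :: "'n list" and h assume l: "l \<in> LL (Suc q)" and h: "C1c U h"
 have i1: "integrable lborel (\<lambda>x. dA u l j x * pd j h x)" "integrable lborel (\<lambda>x. dA v l j x * pd j h x)" for j
  by (intro loc2_integrable[OF loc2_dA _ U] u v C1c_pd_Cc h)+
 have i2: "integrable lborel (\<lambda>x. f x l * h x)" "integrable lborel (\<lambda>x. g x l * h x)"
  by (intro loc2_integrable[OF f _ U] loc2_integrable[OF g _ U] C1c_Cc h)+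
 have e: "(\<Sum>j\<in>UNIV. LBINT x. dA u l j x * pd j h x) = - (LBINT x. f x l * h x)"
  "(\<Sum>j\<in>UNIV. LBINT x. dA v l j x * pd j h x) = - (LBINT x. g x l * h x)"
  using wd l wdivD[OF _ h] by (auto simp: wd_def)
 have "(\<Sum>j\<in>UNIV. LBINT x. dA (\<lambda>x l. u x l + c * v x l) l j x * pd j h x)
   = (\<Sum>j\<in>UNIV. (LBINT x. dA u l j x * pd j h x) + c * (LBINT x. dA v l j x * pd j h x))"
  using i1 by (simp add: dA_lincomb distrib_right mult.assoc)
 also have "\<dots> = - (LBINT x. f x l * h x) + c * - (LBINT x. g x l * h x)"
  by (simp only: sum.distrib sum_distrib_left[symmetric] e)
 also have "\<dots> = - (LBINT x. (f x l + c * g x l) * h x)"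
  using i2 by (simp add: distrib_right mult.assoc)
 finally show "(\<Sum>j\<in>UNIV. LBINT x. dA (\<lambda>x l. u x l + c * v x l) l j x * pd j h x)
   = - (LBINT x. (f x l + c * g x l) * h x)" .
qed

lemma integral_dA:
 fixes u :: "real^'n \<Rightarrow> 'n list \<Rightarrow> real"
 assumes U: "open U" and u: "\<And>l. loc2 U (\<lambda>x. u x l)" and f: "Cc U f"
 shows "(LBINT x. dA u l j x * f x)
  = (\<Sum>s<length l. if l ! s = j then (-1) ^ s * (LBINT x. u x (take s l @ drop (Suc s) l) * f x) else 0)"
proof -
 have i: "integrable lborel (\<lambda>x. (if l ! s = j then (-1) ^ s * u x m else 0) * f x)" for s m
  using loc2_integrable[OF u f U, of m] by (cases "l ! s = j") (auto simp: mult.assoc)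
 have e: "(LBINT x. (if l ! s = j then (-1) ^ s * u x m else 0) * f x)
   = (if l ! s = j then (-1) ^ s * (LBINT x. u x m * f x) else 0)" for s m
  by (cases "l ! s = j") (auto simp: mult.assoc)
 show ?thesis unfolding dA_def sum_distrib_right using i by (simp add: e)
qed

lemma wd_limit:
 fixes a :: "nat \<Rightarrow> real^'n \<Rightarrow> 'n list \<Rightarrow> real"
 assumes U: "open U" and W: "continuous_on U W"
  and a: "\<And>n. formL2 U W p (a n)" and u: "formL2 U W p u"
  and lim: "(\<lambda>n. nrm2 (LL p) (wm U W) (\<lambda>x l. a n x l - u x l)) \<longlonglongrightarrow> 0"
  and wd: "\<And>n. wd p U (a n) f"
 shows "wd p U u f"
 unfolding wd_def wdiv_def
proof (intro ballI allI impI)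
 fix l :: "'n list" and h assume l: "l \<in> LL (Suc p)" and h: "C1c U h"
 have "(\<lambda>n. LBINT x. a n x m * k x) \<longlonglongrightarrow> (LBINT x. u x m * k x)" if "Cc U k" "m \<in> LL p" for k m
  by (rule L2_tendsto_pairing[OF U W finite_LL that(2) formL2D(4)[OF a] formL2D(4)[OF u] lim that(1)])
 note L = this
 have "(\<lambda>n. LBINT x. dA (a n) l j x * pd j h x) \<longlonglongrightarrow> (LBINT x. dA u l j x * pd j h x)" for j
  unfolding integral_dA[OF U formL2_loc2[OF U W a] C1c_pd_Cc[OF h]]
   integral_dA[OF U formL2_loc2[OF U W u] C1c_pd_Cc[OF h]]
 proof (rule tendsto_sum)
  fix s assume "s \<in> {..<length l}"
  then have "take s l @ drop (Suc s) l \<in> LL p" using l by (simp add: LL_def)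
  from L[OF C1c_pd_Cc[OF h] this]
  show "(\<lambda>n. if l ! s = j then (-1) ^ s * (LBINT x. a n x (take s l @ drop (Suc s) l) * pd j h x) else 0)
   \<longlonglongrightarrow> (if l ! s = j then (-1) ^ s * (LBINT x. u x (take s l @ drop (Suc s) l) * pd j h x) else 0)"
   by (cases "l ! s = j") (auto intro: tendsto_mult_left)
 qed
 then have "(\<lambda>n. \<Sum>j\<in>UNIV. LBINT x. dA (a n) l j x * pd j h x) \<longlonglongrightarrow> (\<Sum>j\<in>UNIV. LBINT x. dA u l j x * pd j h x)"
  by (intro tendsto_sum)
 moreover have "(\<Sum>j\<in>UNIV. LBINT x. dA (a n) l j x * pd j h x) = - (LBINT x. f x l * h x)" for n
  using wd[of n] l wdivD[OF _ h] by (simp add: wd_def)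
 ultimately show "(\<Sum>j\<in>UNIV. LBINT x. dA u l j x * pd j h x) = - (LBINT x. f x l * h x)"
  by (simp add: LIMSEQ_const_iff)
qed

text \<open>Alternation is inherited at each point from a pointwise limit along a subsequence, which
  may depend on the point; where there is none the value is 0.\<close>

lemma formL2_limit:
 fixes a :: "nat \<Rightarrow> real^'n \<Rightarrow> 'n list \<Rightarrow> real"
 assumes a: "\<And>n x. altform p (a n x)" and u: "L2F (LL p) (wm U W) u"
  and pt: "\<forall>x. (\<forall>l. u x l = 0) \<or> (\<exists>r. (\<forall>l\<in>LL p. (\<lambda>n. a (r n) x l) \<longlonglongrightarrow> u x l) \<and> (\<forall>l. l \<notin> LL p \<longrightarrow> u x l = 0))"
 shows "formL2 U W p u"
proof -
 have z: "u x l = 0" if "l \<notin> LL p" for x l using pt that by blast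
 have "alt (u x)" for x
 proof (cases "\<forall>l. u x l = 0")
  case True
  then have "u x = (\<lambda>l. 0)" by auto
  then show ?thesis by (simp add: alt_zero)
 next
  case False
  then obtain r where r: "\<And>l. l \<in> LL p \<Longrightarrow> (\<lambda>n. a (r n) x l) \<longlonglongrightarrow> u x l" using pt by blast
  show ?thesis
  proof (rule altI)
   fix xs ys :: "'n list" and b c
   let ?l = "xs @ b # c # ys" and ?m = "xs @ c # b # ys"
   show "u x ?l = - u x ?m"
   proof (cases "?l \<in> LL p")
    case True
    then have m: "?m \<in> LL p" by (simp add: LL_def)
    have "a (r n) x ?l = - a (r n) x ?m" for n by (rule altD[OF altform_alt[OF a]])
    then have "(\<lambda>n. - a (r n) x ?m) \<longlonglongrightarrow> u x ?l" using r[OF True] by simp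
    moreover have "(\<lambda>n. - a (r n) x ?m) \<longlonglongrightarrow> - u x ?m" by (intro tendsto_minus r m)
    ultimately show ?thesis using LIMSEQ_unique by blast
   next
    case False
    then have "?m \<notin> LL p" by (simp add: LL_def)
    then show ?thesis using z[OF False] z[of ?m] by simp
   qed
  qed
 qed
 moreover have "(\<lambda>x. u x l) \<in> borel_measurable borel" for l
 proof (cases "l \<in> LL p")
  case True
  then show ?thesis using sqi_wm_borel[OF L2FD[OF u]] by blast
 next
  case False
  then have "(\<lambda>x. u x l) = (\<lambda>x. 0)" using z by auto
  then show ?thesis by simp
 qed
 ultimately show ?thesis using u z by (simp add: formL2_def altform_iff LL_def)
qed

text \<open>This is the orthogonal projection onto closed forms, obtained by representing the
  functional k \<mapsto> (g, k) on them. The representing element is a limit of closed forms and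
  therefore closed itself.\<close>

lemma closed_projection:
 fixes g :: "real^'n \<Rightarrow> 'n list \<Rightarrow> real"
 assumes U: "open U" and W: "continuous_on U W" and g: "formL2 U W p g"
 shows "\<exists>g1. formL2 U W p g1 \<and> wd p U g1 (\<lambda>x l. 0) \<and>
  (\<forall>k. formL2 U W p k \<and> wd p U k (\<lambda>x l. 0) \<longrightarrow> ip (LL p) (wm U W) g1 k = ip (LL p) (wm U W) g k)"
proof -
 let ?M = "wm U W"
 let ?cl = "\<lambda>k. formL2 U W p k \<and> wd p U k (\<lambda>x l. 0)"
 define P where "P = {(k, ip (LL p) ?M g k) | k. ?cl k}"
 have zero: "?cl (\<lambda>x l. 0)"
  by (simp add: formL2_zero wd_def wdiv_def dA_zero)
 have comb: "?cl (\<lambda>x l. k x l + c * m x l)" if "?cl k" "?cl m" for k m c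
 proof
  show "formL2 U W p (\<lambda>x l. k x l + c * m x l)" using formL2_lincomb that by blast
  have k: "loc2 U (\<lambda>x. k x l)" and m: "loc2 U (\<lambda>x. m x l)" for l
   using that formL2_loc2[OF U W] by blast+
  have "wd p U (\<lambda>x l. k x l + c * m x l) (\<lambda>x l. (\<lambda>x l. 0) x l + c * (\<lambda>x l. 0) x l)"
   by (rule wd_lincomb[where f = "\<lambda>x l. 0" and g = "\<lambda>x l. 0", OF U k m])
    (use that loc2_zero in auto)
  then show "wd p U (\<lambda>x l. k x l + c * m x l) (\<lambda>x l. 0)" by simp
 qed
 have "\<exists>u a. L2F (LL p) ?M u \<and> nrm2 (LL p) ?M u \<le> (sqrt (nrm2 (LL p) ?M g))\<^sup>2 \<and> (\<forall>b s. (b, s) \<in> P \<longrightarrow> ip (LL p) ?M u b = s) \<and>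
  (\<forall>n. \<exists>t. (a n, t) \<in> P) \<and> (\<lambda>n. nrm2 (LL p) ?M (\<lambda>x l. a n x l - u x l)) \<longlonglongrightarrow> 0 \<and>
  (\<forall>x. (\<forall>l. u x l = 0) \<or> (\<exists>r. (\<forall>l\<in>LL p. (\<lambda>n. a (r n) x l) \<longlonglongrightarrow> u x l) \<and> (\<forall>l. l \<notin> LL p \<longrightarrow> u x l = 0)))"
 proof (rule Riesz_pairs)
  show "finite (LL p :: 'n list set)" by simp
  show "P \<noteq> {}" using zero unfolding P_def by blast
  show "0 \<le> sqrt (nrm2 (LL p) ?M g)" by (simp add: ip_nonneg)
  fix a t assume "(a, t) \<in> P"
  then have a: "?cl a" "t = ip (LL p) ?M g a" by (auto simp: P_def)
  show "L2F (LL p) ?M a" using a formL2D(4) by blast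
  then show "\<bar>t\<bar> \<le> sqrt (nrm2 (LL p) ?M g) * sqrt (nrm2 (LL p) ?M a)"
   unfolding a(2) by (rule ip_Cauchy_Schwarz_sqrt[OF formL2D(4)[OF g]])
 next
  fix a s b t assume "(a, s) \<in> P" "(b, t) \<in> P"
  then have a: "?cl a" "s = ip (LL p) ?M g a" and b: "?cl b" "t = ip (LL p) ?M g b" by (auto simp: P_def)
  have "ip (LL p) ?M g (\<lambda>x l. a x l + b x l) = s + t"
   using ip_add_left[OF formL2D(4)[OF conjunct1[OF a(1)]] formL2D(4)[OF conjunct1[OF b(1)]] formL2D(4)[OF g]] a b
   by (simp add: ip_commute[of _ _ g])
  moreover have "?cl (\<lambda>x l. a x l + b x l)" using comb[OF a(1) b(1), of 1] by simp
  ultimately show "(\<lambda>x l. a x l + b x l, s + t) \<in> P" unfolding P_def by force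
 next
  fix a s c assume "(a, s) \<in> P"
  then have a: "?cl a" "s = ip (LL p) ?M g a" by (auto simp: P_def)
  have "ip (LL p) ?M g (\<lambda>x l. c * a x l) = c * s"
   by (simp add: a(2) ip_commute[of _ _ g] ip_cmult_left)
  moreover have "?cl (\<lambda>x l. c * a x l)" using comb[OF zero a(1), of c] by simp
  ultimately show "(\<lambda>x l. c * a x l, c * s) \<in> P" unfolding P_def by force
 qed
 then obtain u a where u12: "L2F (LL p) ?M u" "nrm2 (LL p) ?M u \<le> (sqrt (nrm2 (LL p) ?M g))\<^sup>2"
  and u3: "\<forall>b s. (b, s) \<in> P \<longrightarrow> ip (LL p) ?M u b = s"
  and aP: "\<forall>n. \<exists>t. (a n, t) \<in> P" and lim: "(\<lambda>n. nrm2 (LL p) ?M (\<lambda>x l. a n x l - u x l)) \<longlonglongrightarrow> 0"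
  and pt: "\<forall>x. (\<forall>l. u x l = 0) \<or> (\<exists>r. (\<forall>l\<in>LL p. (\<lambda>n. a (r n) x l) \<longlonglongrightarrow> u x l) \<and> (\<forall>l. l \<notin> LL p \<longrightarrow> u x l = 0))"
  by (elim exE conjE) (rule that; assumption)
 note aP = aP[rule_format] and u = u12 u3[rule_format]
 have acl: "?cl (a n)" for n using aP[of n] by (auto simp: P_def)
 have fu: "formL2 U W p u"
  by (rule formL2_limit[OF _ u(1) pt]) (use acl formL2D(1) in blast)
 have "wd p U u (\<lambda>x l. 0)"
  by (rule wd_limit[OF U W _ fu lim]) (use acl in auto)
 moreover have "ip (LL p) ?M u k = ip (LL p) ?M g k" if "?cl k" for k
  by (rule u(3)) (use that in \<open>auto simp: P_def\<close>)
 ultimately show ?thesis using fu by blast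
qed

section \<open>Solvability from an a priori bound\<close>

lemma testform_lincomb:
 assumes g: "testform p U g" and h: "testform p U h"
 shows "testform p U (\<lambda>x l. g x l + c * h x l)"
 using assms unfolding testform_def by (auto intro!: altform_lincomb C1c_add C1c_cmult)

lemma dst_lincomb:
 assumes g: "testform p U g" and h: "testform p U h"
 shows "dst W (\<lambda>x l. g x l + c * h x l) x I = dst W g x I + c * dst W h x I"
proof -
 have C: "C1_on UNIV (\<lambda>x. g x l)" "C1_on UNIV (\<lambda>x. h x l)" for l
  using g h C1c_C1_on unfolding testform_def by blast+
 have "pd j (\<lambda>x. g x m + c * h x m) x = pd j (\<lambda>x. g x m) x + c * pd j (\<lambda>x. h x m) x" for j m
  using pd_add[OF C(1) C1_on_cmult[OF C(2)], of x j m c m] pd_cmult[OF C(2), of x j c m] by simp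
 then have e: "pd j (\<lambda>x. g x m + c * h x m) x - pd j W x * (g x m + c * h x m)
   = (pd j (\<lambda>x. g x m) x - pd j W x * g x m) + c * (pd j (\<lambda>x. h x m) x - pd j W x * h x m)" for j m
  by (simp add: algebra_simps)
 show ?thesis unfolding dst_def e sum.distrib sum_distrib_left[symmetric] by simp
qed

lemma formL2_dst:
 assumes U: "open U" and W: "C1_on U W" and g: "testform (Suc q) U g"
 shows "formL2 U W q (dst W g)"
proof -
 have c: "Cc U (\<lambda>x. dst W g x I)" for I by (rule Cc_dst[OF W g])
 have "(\<lambda>x. dst W g x I) \<in> borel_measurable borel" for I
  by (rule borel_measurable_continuous_onI[OF Cc_continuous_UNIV[OF c U]])
 then show ?thesis
  using altform_dst[OF g] Cc_sqi_wm[OF U C1_onD(1)[OF W] c] by (simp add: formL2_def L2F_def)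
qed

lemma formL2_testform:
 assumes U: "open U" and W: "C1_on U W" and g: "testform p U g"
 shows "formL2 U W p g"
proof -
 have c: "Cc U (\<lambda>x. g x l)" for l using g C1c_Cc by (auto simp: testform_def)
 have "(\<lambda>x. g x l) \<in> borel_measurable borel" for l
  by (rule borel_measurable_continuous_onI[OF Cc_continuous_UNIV[OF c U]])
 then show ?thesis
  using g Cc_sqi_wm[OF U C1_onD(1)[OF W] c] by (simp add: formL2_def L2F_def testform_def)
qed

text \<open>Duality: the bound says that the pairing of f with g, divided by \<open>Suc q\<close>,
  is a bounded functional of \<open>dst W g\<close>; its representing element solves du = f. Only
  local square integrability of f is assumed, since test forms have compact support.\<close>

lemma solve_from_bound:
 fixes f :: "real^'n \<Rightarrow> 'n list \<Rightarrow> real" and C :: real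
 assumes U: "open U" and W: "C1_on U W" and af: "\<And>x. alt (f x)" and f: "\<And>l. loc2 U (\<lambda>x. f x l)"
  and C: "0 \<le> C"
  and bound: "\<And>g. testform (Suc q) U g \<Longrightarrow>
   \<bar>\<Sum>l\<in>LL (Suc q). \<integral>x. f x l * g x l * exp (- W x) \<partial>lborel\<bar> \<le> Suc q * C * sqrt (nrm2 (LL q) (wm U W) (dst W g))"
 shows "\<exists>u. formL2 U W q u \<and> nrm2 (LL q) (wm U W) u \<le> C\<^sup>2 \<and> wd q U u f"
proof -
 let ?M = "wm U W"
 let ?t = "\<lambda>g. (\<Sum>l\<in>LL (Suc q). LBINT x. f x l * g x l * exp (- W x)) / Suc q"
 note Wc = C1_onD(1)[OF W]
 define P where "P = {(dst W g, ?t g) | g. testform (Suc q) U g}"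
 have fi: "integrable lborel (\<lambda>x. f x l * g x l * exp (- W x))" if "testform (Suc q) U g" for g l
 proof -
  have "Cc U (\<lambda>x. g x l * exp (- W x))"
   using that by (intro Cc_mult_right C1c_Cc continuous_on_exp_uminus Wc) (simp add: testform_def)
  from loc2_integrable[OF f this U, of l] show ?thesis by (simp add: mult.assoc)
 qed
 have comb: "(\<lambda>x I. a x I + c * b x I, s + c * t) \<in> P" if aP: "(a, s) \<in> P" and bP: "(b, t) \<in> P" for a b s t c
 proof -
  obtain g where g: "testform (Suc q) U g" "a = dst W g" "s = ?t g" using aP unfolding P_def by blast
  obtain h where h: "testform (Suc q) U h" "b = dst W h" "t = ?t h" using bP unfolding P_def by blast
  let ?k = "\<lambda>x l. g x l + c * h x l"
  have k: "testform (Suc q) U ?k" by (rule testform_lincomb[OF g(1) h(1)])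
  have "dst W ?k = (\<lambda>x I. a x I + c * b x I)"
   unfolding g(2) h(2) by (intro ext dst_lincomb[OF g(1) h(1)])
  moreover have "?t ?k = s + c * t"
  proof -
   have "f x l * ?k x l * exp (- W x) = f x l * g x l * exp (- W x) + c * (f x l * h x l * exp (- W x))" for x l
    by (simp add: algebra_simps)
   then have "(LBINT x. f x l * ?k x l * exp (- W x))
     = (LBINT x. f x l * g x l * exp (- W x)) + c * (LBINT x. f x l * h x l * exp (- W x))" for l
    using fi[OF g(1), of l] fi[OF h(1), of l] by simp
   then have "(\<Sum>l\<in>LL (Suc q). LBINT x. f x l * ?k x l * exp (- W x))
     = (\<Sum>l\<in>LL (Suc q). LBINT x. f x l * g x l * exp (- W x))
      + c * (\<Sum>l\<in>LL (Suc q). LBINT x. f x l * h x l * exp (- W x))"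
    by (simp only: sum.distrib sum_distrib_left)
   then show ?thesis unfolding g(3) h(3) by (simp only: add_divide_distrib times_divide_eq_right)
  qed
  ultimately show ?thesis using k unfolding P_def by force
 qed
 have zero: "(\<lambda>x I. 0, 0) \<in> P"
 proof -
  have "testform (Suc q) U (\<lambda>x l. 0)" by (simp add: testform_def altform_zero C1c_zero)
  moreover have "dst W (\<lambda>x l. 0) = (\<lambda>x (I :: 'n list). 0)"
   by (intro ext) (simp add: dst_def pd_const)
  ultimately show ?thesis unfolding P_def by force
 qed
 have "\<exists>u a. L2F (LL q) ?M u \<and> nrm2 (LL q) ?M u \<le> C\<^sup>2 \<and> (\<forall>b s. (b, s) \<in> P \<longrightarrow> ip (LL q) ?M u b = s) \<and>
  (\<forall>n. \<exists>t. (a n, t) \<in> P) \<and> (\<lambda>n. nrm2 (LL q) ?M (\<lambda>x l. a n x l - u x l)) \<longlonglongrightarrow> 0 \<and>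
  (\<forall>x. (\<forall>l. u x l = 0) \<or> (\<exists>r. (\<forall>l\<in>LL q. (\<lambda>n. a (r n) x l) \<longlonglongrightarrow> u x l) \<and> (\<forall>l. l \<notin> LL q \<longrightarrow> u x l = 0)))"
 proof (rule Riesz_pairs)
  show "0 \<le> C" by (rule C)
  show "finite (LL q :: 'n list set)" by simp
  show "P \<noteq> {}" using zero by blast
  fix a t assume "(a, t) \<in> P"
  then obtain g where g: "testform (Suc q) U g" "a = dst W g" "t = ?t g" by (auto simp: P_def)
  show "L2F (LL q) ?M a" unfolding g(2) by (rule formL2D(4)[OF formL2_dst[OF U W g(1)]])
  show "\<bar>t\<bar> \<le> C * sqrt (nrm2 (LL q) ?M a)"
   using bound[OF g(1)] unfolding g(2,3) by (simp add: abs_divide field_simps)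
 next
  fix a s b t assume "(a, s) \<in> P" "(b, t) \<in> P"
  then show "(\<lambda>x l. a x l + b x l, s + t) \<in> P" using comb[of a s b t 1] by simp
 next
  fix a s c assume "(a, s) \<in> P"
  then show "(\<lambda>x l. c * a x l, c * s) \<in> P" using comb[OF zero, of a s c] by simp
 qed
 then obtain u a where u12: "L2F (LL q) ?M u" "nrm2 (LL q) ?M u \<le> C\<^sup>2"
  and u3: "\<forall>b s. (b, s) \<in> P \<longrightarrow> ip (LL q) ?M u b = s"
  and aP: "\<forall>n. \<exists>t. (a n, t) \<in> P" and lim: "(\<lambda>n. nrm2 (LL q) ?M (\<lambda>x l. a n x l - u x l)) \<longlonglongrightarrow> 0"
  and pt: "\<forall>x. (\<forall>l. u x l = 0) \<or> (\<exists>r. (\<forall>l\<in>LL q. (\<lambda>n. a (r n) x l) \<longlonglongrightarrow> u x l) \<and> (\<forall>l. l \<notin> LL q \<longrightarrow> u x l = 0))"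
  by (elim exE conjE) (rule that; assumption)
 note aP = aP[rule_format] and u = u12 u3[rule_format]
 have "altform q (a n x)" for n x using aP[of n] altform_dst by (auto simp: P_def)
 then have fu: "formL2 U W q u" by (rule formL2_limit[OF _ u(1) pt])
 have "wd q U u f"
 proof (rule pairing_wd[OF U W formL2D(2)[OF fu] af formL2_loc2[OF U Wc fu] f])
  fix g :: "real^'n \<Rightarrow> 'n list \<Rightarrow> real" assume g: "testform (Suc q) U g"
  have "ip (LL q) ?M u (dst W g) = ?t g" by (rule u(3)) (use g in \<open>auto simp: P_def\<close>)
  moreover have "ip (LL q) ?M u (dst W g) = (\<Sum>I\<in>LL q. LBINT x. u x I * dst W g x I * exp (- W x))"
   unfolding ip_def by (intro sum.cong refl wm_integral_Cc[OF U Wc Cc_dst[OF W g] formL2D(3)[OF fu]])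
  ultimately show "(\<Sum>l\<in>LL (Suc q). LBINT x. f x l * g x l * exp (- W x))
   = Suc q * (\<Sum>I\<in>LL q. LBINT x. u x I * dst W g x I * exp (- W x))"
   by (simp add: field_simps)
 qed
 then show ?thesis using fu u(2) by blast
qed

lemma dA_scale: "dA (\<lambda>x J. r x * u x J) l j x = r x * dA u l j x"
proof -
 have "(if l ! s = j then (-1) ^ s * (r x * u x m) else 0) = r x * (if l ! s = j then (-1) ^ s * u x m else 0)" for s m
  by simp
 then show ?thesis by (simp only: dA_def sum_distrib_left)
qed

lemma Cc_loc2: "open U \<Longrightarrow> Cc U f \<Longrightarrow> loc2 U (f :: real^'n \<Rightarrow> real)"
proof (rule loc2I)
 assume U: "open U" and f: "Cc U f"
 show m: "f \<in> borel_measurable borel"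
  by (rule borel_measurable_continuous_onI[OF Cc_continuous_UNIV[OF f U]])
 fix K assume K: "compact K" "K \<subseteq> U"
 have "(\<lambda>x. indicator K x :: real) \<in> borel_measurable lborel"
  using K by (simp add: borel_closed compact_imp_closed)
 then show "sqi lborel (\<lambda>x. indicator K x * f x)"
  by (rule sqi_mult_bounded(1)[OF Cc_sqi[OF f U], where B = 1]) (simp add: indicator_def)
qed

text \<open>\<open>k\<close> is d(h dx^I). These are the compactly supported closed forms against
  which orthogonality to closed forms will be tested.\<close>

lemma exact_form_closed:
 fixes h :: "real^'n \<Rightarrow> real"
 assumes U: "open U" and V: "continuous_on U V" and h: "C1c U h" and I: "I \<in> LL q"
 defines "k \<equiv> \<lambda>x. wdg (\<lambda>j J. pd j h x * eps I J)"
 shows "formL2 U V (Suc q) k" "wd (Suc q) U k (\<lambda>x l. 0)" "Cc U (\<lambda>x. k x l)"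
proof -
 have kd: "k x l = (\<Sum>j\<in>UNIV. pd j h x * dA (\<lambda>x. eps I) l j x)" for x l
  unfolding k_def dA_wdg ..
 have dAc: "dA (\<lambda>x. eps I) l j x = dA (\<lambda>x. eps I) l j 0" for l j and x :: "real^'n"
  by (simp add: dA_def)
 have C: "Cc U (\<lambda>x. k x l)" for l
  unfolding k_def wdg_eq_sum by (intro Cc_sum Cc_cmult Cc_mult_right C1c_pd_Cc h) auto
 show "Cc U (\<lambda>x. k x l)" by (rule C)
 have alt: "alt (k x)" for x
  unfolding k_def
 proof (rule alt_wdg, rule altI)
  fix j xs a b ys
  show "pd j h x * eps I (xs @ a # b # ys) = - (pd j h x * eps I (xs @ b # a # ys))"
   using altD[OF alt_eps, of I xs a b ys] by simp
 qed
 have "k x l = 0" if "length l \<noteq> Suc q" for x l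
  unfolding k_def wdg_eq_sum
 proof (rule sum.neutral, rule ballI)
  fix s assume "s \<in> {..<length l}"
  then have "length (take s l @ drop (Suc s) l) \<noteq> length I" using that I by (auto simp: LL_def)
  then show "(-1) ^ s * (pd (l ! s) h x * eps I (take s l @ drop (Suc s) l)) = 0"
   by (simp add: eps_length)
 qed
 then have af: "altform (Suc q) (k x)" for x using alt by (simp add: altform_iff)
 have "(\<lambda>x. k x l) \<in> borel_measurable borel" for l
  by (rule borel_measurable_continuous_onI[OF Cc_continuous_UNIV[OF C U]])
 then show "formL2 U V (Suc q) k"
  using af Cc_sqi_wm[OF U V C] by (simp add: formL2_def L2F_def)
 define u where "u x J = h x * eps I J" for x J
 have uC: "Cc U (\<lambda>x. u x J)" for J unfolding u_def by (intro Cc_mult_right C1c_Cc h) auto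
 have "wd q U u k"
  unfolding wd_def wdiv_def
 proof (intro ballI allI impI)
  fix l :: "'n list" and f assume f: "C1c U f"
  have e: "dA u l j x = h x * dA (\<lambda>x. eps I) l j 0" for j x
   unfolding u_def dA_scale[of h "\<lambda>x. eps I"] by (simp only: dAc[of l j x])
  have i1: "integrable lborel (\<lambda>x. pd j h x * f x)" for j
   by (intro Cc_integrable[OF _ U] Cc_Cc_mult C1c_pd_Cc h C1c_Cc f)
  have "(\<Sum>j\<in>UNIV. LBINT x. dA u l j x * pd j f x)
    = (\<Sum>j\<in>UNIV. dA (\<lambda>x. eps I) l j 0 * (LBINT x. h x * pd j f x))"
   by (simp only: e mult.commute[of "h _"] mult.assoc integral_mult_right_zero)
  also have "\<dots> = (\<Sum>j\<in>UNIV. dA (\<lambda>x. eps I) l j 0 * - (LBINT x. pd j h x * f x))"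
   by (simp only: integral_by_parts[OF f C1c_C1_on[OF h] U])
  also have "\<dots> = - (LBINT x. (\<Sum>j\<in>UNIV. dA (\<lambda>x. eps I) l j 0 * (pd j h x * f x)))"
   using i1 by (simp add: sum_negf)
  also have "\<dots> = - (LBINT x. k x l * f x)"
   unfolding kd sum_distrib_right
   by (intro arg_cong[where f = uminus] Bochner_Integration.integral_cong refl sum.cong)
    (subst dAc, simp only: mult_ac)
  finally show "(\<Sum>j\<in>UNIV. LBINT x. dA u l j x * pd j f x) = - (LBINT x. k x l * f x)" .
 qed
 then show "wd (Suc q) U k (\<lambda>x l. 0)"
  by (rule wd_dd[OF U Cc_loc2[OF U uC] Cc_loc2[OF U C]])
qed

text \<open>g - g1 is orthogonal to closed forms, in particular to d(h dx^I), so its weighted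
  adjoint vanishes weakly. Hence g1 is closed and has the same adjoint as the test form g, although
  g1 has no compact support. The equation is written as a weak divergence of exp(-V) g1.\<close>

lemma coclosed:
 fixes g g1 :: "real^'n \<Rightarrow> 'n list \<Rightarrow> real"
 assumes U: "open U" and V: "C1_on U V" and g: "testform (Suc q) U g" and g1: "formL2 U V (Suc q) g1"
  and orth: "\<And>k. formL2 U V (Suc q) k \<Longrightarrow> wd (Suc q) U k (\<lambda>x l. 0) \<Longrightarrow>
   ip (LL (Suc q)) (wm U V) g1 k = ip (LL (Suc q)) (wm U V) g k"
  and I: "I \<in> LL q"
 shows "wdiv U (\<lambda>j x. (wt U V x) * g1 x (j # I)) (\<lambda>x. - ((wt U V x) * dst V g x I))"
 unfolding wdiv_def
proof (intro allI impI)
 fix h assume h: "C1c U h"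
 note Vc = C1_onD(1)[OF V]
 define k where "k = (\<lambda>x. wdg (\<lambda>j J. pd j h x * eps I J))"
 have kf: "formL2 U V (Suc q) k" and kcl: "wd (Suc q) U k (\<lambda>x l. 0)" and kC: "Cc U (\<lambda>x. k x l)" for l
  unfolding k_def by (rule exact_form_closed[OF U Vc h I])+
 have gf: "formL2 U V (Suc q) g" by (rule formL2_testform[OF U V g])
 have lI: "length I = q" using I by (simp add: LL_def)
 have pair: "ip (LL (Suc q)) (wm U V) m k
   = (Suc q * fact q) * (\<Sum>j\<in>UNIV. LBINT x. m x (j # I) * pd j h x * exp (- V x))"
  if m: "formL2 U V (Suc q) m" for m
 proof -
  have i1: "integrable lborel (\<lambda>x. m x l * (k x l * exp (- V x)))" for l
   by (intro loc2_integrable[OF formL2_loc2[OF U Vc m] _ U] Cc_mult_right kC continuous_on_exp_uminus Vc)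
  have i2: "integrable lborel (\<lambda>x. m x l * (pd j h x * exp (- V x)))" for j l
   by (intro loc2_integrable[OF formL2_loc2[OF U Vc m] _ U] Cc_mult_right C1c_pd_Cc h continuous_on_exp_uminus Vc)
  have "ip (LL (Suc q)) (wm U V) m k = (\<Sum>l\<in>LL (Suc q). LBINT x. m x l * (k x l * exp (- V x)))"
   unfolding ip_def wm_integral_Cc[OF U Vc kC formL2D(3)[OF m]] by (simp only: mult.assoc)
  also have "\<dots> = (LBINT x. (\<Sum>l\<in>LL (Suc q). m x l * (k x l * exp (- V x))))"
   using i1 by simp
  also have "\<dots> = (LBINT x. (Suc q * fact q) * (\<Sum>j\<in>UNIV. m x (j # I) * (pd j h x * exp (- V x))))"
  proof (intro Bochner_Integration.integral_cong refl)
   fix x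
   have am: "alt (m x)" by (rule formL2D(2)[OF m])
   have "(\<Sum>l\<in>LL (Suc q). k x l * m x l) = Suc q * (\<Sum>j\<in>UNIV. \<Sum>J\<in>LL q. pd j h x * eps I J * m x (j # J))"
    unfolding k_def by (rule wdg_adjoint[OF am])
   also have "(\<Sum>j\<in>UNIV. \<Sum>J\<in>LL q. pd j h x * eps I J * m x (j # J))
     = (\<Sum>j\<in>UNIV. pd j h x * (\<Sum>J\<in>LL (length I). eps I J * m x (j # J)))"
    by (simp add: sum_distrib_left lI mult.assoc)
   also have "\<dots> = (\<Sum>j\<in>UNIV. pd j h x * (fact (length I) * m x (j # I)))"
    by (intro sum.cong refl arg_cong[where f = "\<lambda>z. pd _ h x * z"] eps_pairing alt_Cons am)
   finally have "(\<Sum>l\<in>LL (Suc q). k x l * m x l) * exp (- V x)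
     = (Suc q * (\<Sum>j\<in>UNIV. pd j h x * (fact q * m x (j # I)))) * exp (- V x)" by (simp only: lI)
   then show "(\<Sum>l\<in>LL (Suc q). m x l * (k x l * exp (- V x)))
     = (Suc q * fact q) * (\<Sum>j\<in>UNIV. m x (j # I) * (pd j h x * exp (- V x)))"
    by (simp add: sum_distrib_left sum_distrib_right mult_ac del: of_nat_Suc mult_Suc mult_Suc_right)
  qed
  also have "\<dots> = (Suc q * fact q) * (\<Sum>j\<in>UNIV. LBINT x. m x (j # I) * (pd j h x * exp (- V x)))"
   using i2 by simp
  finally show ?thesis by (simp only: mult.assoc)
 qed
 have "(Suc q * fact q) * (\<Sum>j\<in>UNIV. LBINT x. g1 x (j # I) * pd j h x * exp (- V x))
   = (Suc q * fact q) * (\<Sum>j\<in>UNIV. LBINT x. g x (j # I) * pd j h x * exp (- V x))"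
  using orth[OF kf kcl] unfolding pair[OF g1] pair[OF gf] .
 then have eq: "(\<Sum>j\<in>UNIV. LBINT x. g1 x (j # I) * pd j h x * exp (- V x))
   = (\<Sum>j\<in>UNIV. LBINT x. g x (j # I) * pd j h x * exp (- V x))"
  by (simp only: mult_cancel_left of_nat_eq_0_iff mult_is_0 fact_nonzero nat.distinct simp_thms)
 have gC: "C1c U (\<lambda>x. g x l)" for l using g by (simp add: testform_def)
 have ig: "integrable lborel (\<lambda>x. (pd j (\<lambda>x. g x (j # I)) x - pd j V x * g x (j # I)) * h x * exp (- V x))" for j
  by (intro Cc_integrable[OF _ U] Cc_mult_right continuous_on_exp_uminus Vc Cc_Cc_mult Cc_diff C1c_pd_Cc gC
    Cc_mult C1_onD(2)[OF V] C1c_Cc[OF gC] C1c_Cc[OF h])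
 have "(\<Sum>j\<in>UNIV. LBINT x. g x (j # I) * pd j h x * exp (- V x))
   = (\<Sum>j\<in>UNIV. - (LBINT x. (pd j (\<lambda>x. g x (j # I)) x - pd j V x * g x (j # I)) * h x * exp (- V x)))"
  by (simp add: weighted_adjoint[OF gC h V U])
 also have "\<dots> = - (LBINT x. (\<Sum>j\<in>UNIV. (pd j (\<lambda>x. g x (j # I)) x - pd j V x * g x (j # I)) * h x * exp (- V x)))"
  using ig by (simp add: sum_negf)
 also have "\<dots> = (LBINT x. dst V g x I * h x * exp (- V x))"
  by (simp add: dst_def sum_distrib_right)
 finally have 1: "(\<Sum>j\<in>UNIV. LBINT x. g1 x (j # I) * pd j h x * exp (- V x))
   = (LBINT x. dst V g x I * h x * exp (- V x))" using eq by simp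
 obtain K where K: "K \<subseteq> U" "\<And>x. x \<notin> K \<Longrightarrow> h x = 0" "\<And>x j. x \<notin> K \<Longrightarrow> pd j h x = 0"
  using C1c_support[OF h] by metis
 have a: "wt U V x * g1 x (j # I) * pd j h x = g1 x (j # I) * pd j h x * exp (- V x)" for j x
  using K(1) K(3)[of x j] by (cases "x \<in> U") auto
 have b: "- (wt U V x * dst V g x I) * h x = - (dst V g x I * h x * exp (- V x))" for x
  using K(1) K(2)[of x] by (cases "x \<in> U") auto
 show "(\<Sum>j\<in>UNIV. LBINT x. (wt U V x) * g1 x (j # I) * pd j h x)
   = - (LBINT x. - ((wt U V x) * dst V g x I) * h x)"
  unfolding a b by (simp add: 1)
qed

section \<open>The Bochner inequality for cut-offs of closed forms\<close>

lemma sqi_Cc_loc2: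
 fixes a f :: "real^'n \<Rightarrow> real"
 assumes U: "open U" and f: "Cc U f" and a: "loc2 U a"
 shows "sqi lborel (\<lambda>x. f x * a x)"
proof -
 obtain K where K: "compact K" "K \<subseteq> U" "\<And>x. x \<notin> K \<Longrightarrow> f x = 0" using f by (auto simp: Cc_def)
 obtain B where B: "\<And>x. \<bar>indicator K x * f x\<bar> \<le> B"
  using indicator_compact_bounded(2)[OF Cc_continuous[OF f] K(1,2)] by blast
 have m: "(\<lambda>x. indicator K x * f x) \<in> borel_measurable lborel"
  using indicator_compact_bounded(1)[OF Cc_continuous[OF f] K(1,2)] by simp
 have "sqi lborel (\<lambda>x. (indicator K x * f x) * (indicator K x * a x))"
  by (rule sqi_mult_bounded(1)[OF loc2_sqi[OF a K(1,2)] m B])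
 moreover have "(\<lambda>x. (indicator K x * f x) * (indicator K x * a x)) = (\<lambda>x. f x * a x)"
  using K(3) by (auto simp: fun_eq_iff indicator_def)
 ultimately show ?thesis by simp
qed

lemma integrable_Cc_loc2_loc2:
 fixes a b f :: "real^'n \<Rightarrow> real"
 assumes U: "open U" and f: "Cc U f" and a: "loc2 U a" and b: "loc2 U b"
 shows "integrable lborel (\<lambda>x. f x * a x * b x)"
proof -
 obtain K where K: "compact K" "K \<subseteq> U" "\<And>x. x \<notin> K \<Longrightarrow> f x = 0" using f by (auto simp: Cc_def)
 have "integrable lborel (\<lambda>x. (f x * a x) * (indicator K x * b x))"
  by (rule sqi_mult_integrable[OF sqi_Cc_loc2[OF U f a] loc2_sqi[OF b K(1,2)]])
 moreover have "(\<lambda>x. (f x * a x) * (indicator K x * b x)) = (\<lambda>x. f x * a x * b x)"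
  using K(3) by (auto simp: fun_eq_iff indicator_def)
 ultimately show ?thesis by simp
qed

lemma integrable_sq_weight:
 fixes z c :: "real^'n \<Rightarrow> real"
 assumes z: "sqi lborel z" "compact K" "K \<subseteq> U" "\<And>x. x \<notin> K \<Longrightarrow> z x = 0" and c: "continuous_on U c"
 shows "integrable lborel (\<lambda>x. (z x)\<^sup>2 * c x)"
proof -
 obtain B where B: "\<And>x. \<bar>indicator K x * c x\<bar> \<le> B"
  using indicator_compact_bounded(2)[OF c z(2,3)] by blast
 have m: "(\<lambda>x. indicator K x * c x) \<in> borel_measurable lborel"
  using indicator_compact_bounded(1)[OF c z(2,3)] by simp
 have "integrable lborel (\<lambda>x. z x * ((indicator K x * c x) * z x))"
  by (rule sqi_mult_integrable[OF z(1) sqi_mult_bounded(1)[OF z(1) m B]])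
 moreover have "(\<lambda>x. z x * ((indicator K x * c x) * z x)) = (\<lambda>x. (z x)\<^sup>2 * c x)"
  using z(4) by (auto simp: fun_eq_iff indicator_def power2_eq_square)
 ultimately show ?thesis by simp
qed

lemma contraction_sq_le:
 fixes g :: "'n::finite list \<Rightarrow> real"
 shows "(\<Sum>I\<in>LL q. (\<Sum>j\<in>UNIV. v j * g (j # I))\<^sup>2) \<le> (\<Sum>j\<in>UNIV. (v j)\<^sup>2) * (nsq (Suc q) g)"
proof -
 have "(\<Sum>I\<in>LL q. (\<Sum>j\<in>UNIV. v j * g (j # I))\<^sup>2)
   \<le> (\<Sum>I\<in>LL q. (\<Sum>j\<in>UNIV. (v j)\<^sup>2) * (\<Sum>j\<in>UNIV. (g (j # I))\<^sup>2))"
  by (intro sum_mono Cauchy_Schwarz_ineq_sum)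
 also have "\<dots> = (\<Sum>j\<in>UNIV. (v j)\<^sup>2) * (nsq (Suc q) g)"
  unfolding sum_LL_Suc sum_distrib_left[symmetric] by (subst (2) sum.swap) (rule refl)
 finally show ?thesis .
qed

lemma sq_diff_le:
 fixes x y e :: real assumes "0 < e"
 shows "(x - y)\<^sup>2 \<le> (1 + e) * x\<^sup>2 + (1 + 1 / e) * y\<^sup>2"
proof -
 have "0 \<le> (e * x + y)\<^sup>2 / e" using assms by simp
 also have "\<dots> = e * x\<^sup>2 + 2 * x * y + y\<^sup>2 / e"
  using assms by (simp add: power2_eq_square field_simps)
 finally show ?thesis by (simp add: power2_eq_square algebra_simps)
qed

text \<open>\<open>Bochner_weak\<close> for r g1. Its adjoint is r times that of g1 minus the
  contraction of g1 with dr, and its exterior derivative is the wedge of dr with g1. Splitting the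
  square with a parameter e keeps the factor of the main term near 1; 1 + 1/e comes from the
  contraction and the squared degree from the wedge.\<close>

lemma cutoff_estimate:
 fixes g g1 :: "real^'n \<Rightarrow> 'n list \<Rightarrow> real" and r :: "real^'n \<Rightarrow> real"
 assumes U: "open U" and V: "C2_on U V" and g: "testform (Suc q) U g"
  and g1: "formL2 U V (Suc q) g1" and cl: "wd (Suc q) U g1 (\<lambda>x l. 0)"
  and co: "\<And>I. I \<in> LL q \<Longrightarrow> wdiv U (\<lambda>j x. (wt U V x) * g1 x (j # I))
    (\<lambda>x. - ((wt U V x) * dst V g x I))"
  and r: "C1c U r" "\<And>x. \<bar>r x\<bar> \<le> 1" and e: "0 < e"
 shows "integrable lborel (\<lambda>x. (r x)\<^sup>2 * Qf (hess V x) q (g1 x) * exp (- V x))"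
  "integrable lborel (\<lambda>x. (\<Sum>j\<in>UNIV. (pd j r x)\<^sup>2) * (nsq (Suc q) (g1 x)) * exp (- V x))"
  "(LBINT x. (r x)\<^sup>2 * Qf (hess V x) q (g1 x) * exp (- V x))
   \<le> (1 + e) * (\<Sum>I\<in>LL q. LBINT x. (dst V g x I)\<^sup>2 * exp (- V x))
   + (1 + 1 / e + (Suc (Suc q))\<^sup>2) *
    (LBINT x. (\<Sum>j\<in>UNIV. (pd j r x)\<^sup>2) * (nsq (Suc q) (g1 x)) * exp (- V x))"
proof -
 have V1: "C1_on U V" and V2: "\<And>k. C1_on U (pd k V)" using V by (auto simp: C2_on_def)
 note Vc = C1_onD(1)[OF V1]
 note ce = continuous_on_exp_uminus[OF Vc]
 have gl: "loc2 U (\<lambda>x. g1 x l)" for l by (rule formL2_loc2[OF U Vc g1])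
 have ag: "alt (g1 x)" for x by (rule formL2D(2)[OF g1])
 have aC: "Cc U (\<lambda>x. dst V g x I)" for I by (rule Cc_dst[OF V1 g])
 have rC: "Cc U r" and rdC: "Cc U (pd j r)" for j using r(1) by (auto intro: C1c_Cc C1c_pd_Cc)
 obtain K where K: "compact K" "K \<subseteq> U" "\<And>x. x \<notin> K \<Longrightarrow> r x = 0" "\<And>x j. x \<notin> K \<Longrightarrow> pd j r x = 0"
  using C1c_support[OF r(1)] by metis
 define h where "h x l = r x * g1 x l" for x l
 \<comment> \<open>\<open>z\<close> is the weighted adjoint of the cut-off form. Removing from it
   the contraction with dV leaves \<open>s\<close>, minus the plain divergence, as
   \<open>Bochner_weak\<close> asks.\<close>
 define z where "z x I = r x * dst V g x I - (\<Sum>j\<in>UNIV. pd j r x * g1 x (j # I))" for x I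
 define s where "s x I = z x I - (\<Sum>j\<in>UNIV. (r x * pd j V x) * g1 x (j # I))" for x I
 define b where "b x l = wdg (\<lambda>j J. pd j r x * g1 x J) l" for x l
 have zs: "sqi lborel (\<lambda>x. z x I)" for I
  unfolding z_def by (intro sqi_diff sqi_sum sqi_Cc_loc2[OF U rC Cc_loc2[OF U aC]] sqi_Cc_loc2[OF U rdC gl]) auto
 have zz: "z x I = 0" if "x \<notin> K" for x I using K(3,4) that by (simp add: z_def)
 have rV: "Cc U (\<lambda>x. r x * pd j V x)" for j by (intro Cc_mult_right rC C1_onD(2)[OF V1])
 have ss: "sqi lborel (\<lambda>x. s x I)" for I
  unfolding s_def by (intro sqi_diff zs sqi_sum sqi_Cc_loc2[OF U rV gl]) auto
 have sz: "s x I = 0" if "x \<notin> K" for x I using K(3) that by (simp add: s_def zz)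
 have bs: "sqi lborel (\<lambda>x. b x l)" for l
  unfolding b_def wdg_eq_sum by (intro sqi_sum sqi_cmult sqi_Cc_loc2[OF U rdC gl]) auto
 have bz: "b x l = 0" if "x \<notin> K" for x l using K(4) that by (simp add: b_def wdg_eq_sum)
 have hs: "sqi lborel (\<lambda>x. h x l)" for l unfolding h_def by (rule sqi_Cc_loc2[OF U rC gl])
 have hz: "h x l = 0" if "x \<notin> K" for x l using K(3) that by (simp add: h_def)
 have ah: "alt (h x)" for x
 proof (rule altI)
  fix xs a c ys
  show "h x (xs @ a # c # ys) = - h x (xs @ c # a # ys)"
   unfolding h_def using altD[OF ag, of x xs a c ys] by simp
 qed
 have wtm: "(\<lambda>x. wt U V x) \<in> borel_measurable borel" by (rule weight_measurable[OF U Vc])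
 have wtl: "loc2 U (\<lambda>x. (wt U V x) * a x)" if a: "loc2 U a" for a
 proof (rule loc2I)
  have [measurable]: "a \<in> borel_measurable borel" using a by (simp add: loc2_def)
  note [measurable] = wtm
  show "(\<lambda>x. (wt U V x) * a x) \<in> borel_measurable borel" by measurable
  fix L assume L: "compact L" "L \<subseteq> U"
  obtain B where B: "\<And>x. \<bar>indicator L x * exp (- V x)\<bar> \<le> B"
   using indicator_compact_bounded(2)[OF ce L] by blast
  have m: "(\<lambda>x. indicator L x * exp (- V x)) \<in> borel_measurable lborel"
   using indicator_compact_bounded(1)[OF ce L] by simp
  have "sqi lborel (\<lambda>x. (indicator L x * exp (- V x)) * (indicator L x * a x))"
   by (rule sqi_mult_bounded(1)[OF loc2_sqi[OF a L] m B])
  moreover have "(\<lambda>x. (indicator L x * exp (- V x)) * (indicator L x * a x))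
    = (\<lambda>x. indicator L x * ((wt U V x) * a x))"
   using L(2) by (auto simp: fun_eq_iff indicator_def)
  ultimately show "sqi lborel (\<lambda>x. indicator L x * ((wt U V x) * a x))" by simp
 qed
 have eV: "C1_on U (\<lambda>x. exp (V x))"
  by (rule C1_on_compose[OF V1]) (auto intro!: derivative_eq_intros continuous_intros)
 \<comment> \<open>The known divergence is that of exp(-V) g1. Multiplying by exp(V) r gives back r
   g1, and the derivative of exp V supplies the term with dV that is part of
   \<open>s\<close>.\<close>
 define reV where "reV x = exp (V x) * r x" for x
 have reV: "C1c U reV" unfolding reV_def[abs_def] by (rule C1c_mult[OF eV r(1) U])
 have dreV: "pd j reV x = exp (V x) * (pd j r x + r x * pd j V x)" if "x \<in> U" for j x
 proof -
  have "pd j (\<lambda>x. exp (V x)) x = exp (V x) * pd j V x"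
   by (rule pd_compose[OF V1 that]) (auto intro!: derivative_eq_intros)
  then show ?thesis
   using pd_mult[OF eV C1c_C1_on[OF r(1)] that, of j] by (simp add: reV_def[abs_def] algebra_simps)
 qed
 have dreV0: "pd j reV x = 0" if "x \<notin> K" for j x
 proof -
  have "hpd j reV 0 x"
   by (rule hpd_cong_open[OF hpd_const[of j 0 x], of "- K"])
    (use K that in \<open>auto simp: compact_imp_closed reV_def\<close>)
  then show ?thesis by (rule hpd_pd)
 qed
 have dv: "gdiv (\<lambda>j x. h x (j # I)) (\<lambda>x. - s x I)" if I: "I \<in> LL q" for I
 proof -
  have "gdiv (\<lambda>j x. reV x * ((wt U V x) * g1 x (j # I)))
    (\<lambda>x. reV x * (- ((wt U V x) * dst V g x I))
     + (\<Sum>j\<in>UNIV. pd j reV x * ((wt U V x) * g1 x (j # I))))"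
  proof (rule wdiv_cutoff[OF co[OF I] U wtl[OF gl] _ reV])
   show "loc2 U (\<lambda>x. - ((wt U V x) * dst V g x I))"
    using loc2_cmult[OF wtl[OF Cc_loc2[OF U aC]], of "-1"] by simp
  qed
  moreover have "reV x * ((wt U V x) * g1 x (j # I)) = h x (j # I)" for x j
   using K(2,3) by (cases "x \<in> U") (auto simp: reV_def h_def exp_minus)
  moreover have "reV x * (- ((wt U V x) * dst V g x I))
     + (\<Sum>j\<in>UNIV. pd j reV x * ((wt U V x) * g1 x (j # I))) = - s x I" for x
  proof (cases "x \<in> U")
   case True
   have "exp (V x) * exp (- V x) = 1" by (simp add: exp_minus)
   then have "pd j reV x * ((wt U V x) * g1 x (j # I))
     = pd j r x * g1 x (j # I) + (r x * pd j V x) * g1 x (j # I)" for j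
    using True by (simp add: dreV exp_minus field_simps)
   moreover have "reV x * (- ((wt U V x) * dst V g x I)) = - (r x * dst V g x I)"
    using True by (simp add: reV_def exp_minus)
   ultimately show ?thesis by (simp add: s_def z_def sum.distrib)
  next
   case False
   then have "x \<notin> K" using K(2) by blast
   then show ?thesis by (simp add: sz reV_def K(3) dreV0)
  qed
  ultimately show ?thesis by simp
 qed
 have clg: "gdiv (dA h l) (\<lambda>x. b x l)" if l: "l \<in> LL (Suc (Suc q))" for l
 proof -
  have "wdiv U (dA g1 l) (\<lambda>x. 0)" using cl l by (simp add: wd_def)
  from wdiv_cutoff[OF this U loc2_dA[OF gl] loc2_zero r(1)]
  have "gdiv (\<lambda>j x. r x * dA g1 l j x) (\<lambda>x. r x * 0 + (\<Sum>j\<in>UNIV. pd j r x * dA g1 l j x))" .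
  moreover have "(\<lambda>j x. r x * dA g1 l j x) = dA h l"
   unfolding h_def[abs_def] by (intro ext) (rule dA_scale[symmetric])
  moreover have "(\<lambda>x. r x * 0 + (\<Sum>j\<in>UNIV. pd j r x * dA g1 l j x)) = (\<lambda>x. b x l)"
   by (simp add: b_def dA_wdg)
  ultimately show ?thesis by simp
 qed
 note BW = Bochner_weak[OF U V ah K(1,2) hs hz ss sz bs bz dv clg]
 have iH: "integrable lborel (\<lambda>x. pd j (pd k V) x * h x l * h x m * exp (- V x))" for j k l m
 proof -
  have "integrable lborel (\<lambda>x. ((r x * r x) * (pd j (pd k V) x * exp (- V x))) * g1 x l * g1 x m)"
   by (intro integrable_Cc_loc2_loc2[OF U _ gl gl] Cc_mult_right Cc_Cc_mult rC continuous_on_mult ce C1_onD(2)[OF V2])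
  then show ?thesis by (simp add: h_def mult_ac)
 qed
 have eH: "(r x)\<^sup>2 * Qf (hess V x) q (g1 x) * exp (- V x)
   = (\<Sum>I\<in>LL q. \<Sum>j\<in>UNIV. \<Sum>k\<in>UNIV. pd j (pd k V) x * h x (j # I) * h x (k # I) * exp (- V x))" for x
  by (simp add: Qf_def hess_def h_def sum_distrib_left sum_distrib_right power2_eq_square mult_ac)
 show "integrable lborel (\<lambda>x. (r x)\<^sup>2 * Qf (hess V x) q (g1 x) * exp (- V x))"
  unfolding eH using iH by (intro Bochner_Integration.integrable_sum)
 have lhs: "(LBINT x. (r x)\<^sup>2 * Qf (hess V x) q (g1 x) * exp (- V x))
   = (\<Sum>I\<in>LL q. \<Sum>j\<in>UNIV. \<Sum>k\<in>UNIV. LBINT x. pd j (pd k V) x * h x (j # I) * h x (k # I) * exp (- V x))"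
  unfolding eH using iH by simp
 define G where "G x = (\<Sum>j\<in>UNIV. (pd j r x)\<^sup>2) * (nsq (Suc q) (g1 x))" for x
 have iG: "integrable lborel (\<lambda>x. G x * exp (- V x))"
 proof -
  have "integrable lborel (\<lambda>x. ((pd j r x * pd j r x) * exp (- V x)) * g1 x l * g1 x l)" for j l
   by (intro integrable_Cc_loc2_loc2[OF U _ gl gl] Cc_mult_right Cc_Cc_mult rdC ce)
  then have "integrable lborel (\<lambda>x. \<Sum>j\<in>UNIV. \<Sum>l\<in>LL (Suc q). ((pd j r x * pd j r x) * exp (- V x)) * g1 x l * g1 x l)"
   by (intro Bochner_Integration.integrable_sum)
  moreover have "G x * exp (- V x)
    = (\<Sum>j\<in>UNIV. \<Sum>l\<in>LL (Suc q). ((pd j r x * pd j r x) * exp (- V x)) * g1 x l * g1 x l)" for x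
   unfolding G_def sum_distrib_right
   by (intro sum.cong refl) (simp add: power2_eq_square sum_distrib_left sum_distrib_right mult_ac)
  ultimately show ?thesis by simp
 qed
 then show "integrable lborel (\<lambda>x. (\<Sum>j\<in>UNIV. (pd j r x)\<^sup>2) * (nsq (Suc q) (g1 x)) * exp (- V x))"
  by (simp add: G_def)
 have iz: "integrable lborel (\<lambda>x. (z x I)\<^sup>2 * exp (- V x))" for I
  by (rule integrable_sq_weight[OF zs K(1,2) zz ce])
 have ib: "integrable lborel (\<lambda>x. (b x l)\<^sup>2 * exp (- V x))" for l
  by (rule integrable_sq_weight[OF bs K(1,2) bz ce])
 have ia: "integrable lborel (\<lambda>x. (dst V g x I)\<^sup>2 * exp (- V x))" for I
  unfolding power2_eq_square by (intro Cc_integrable[OF _ U] Cc_mult_right Cc_Cc_mult aC ce)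
 have sv: "s x I + (\<Sum>j\<in>UNIV. pd j V x * h x (j # I)) = z x I" for x I
  by (simp add: s_def h_def mult_ac)
 have "(LBINT x. (r x)\<^sup>2 * Qf (hess V x) q (g1 x) * exp (- V x))
   \<le> (LBINT x. (\<Sum>I\<in>LL q. (z x I)\<^sup>2 * exp (- V x)) + (\<Sum>l\<in>LL (Suc (Suc q)). (b x l)\<^sup>2 * exp (- V x)))"
  using BW iz ib unfolding lhs sv by simp
 also have "\<dots> \<le> (LBINT x. (1 + e) * (\<Sum>I\<in>LL q. (dst V g x I)\<^sup>2 * exp (- V x))
   + (1 + 1 / e + (Suc (Suc q))\<^sup>2) * (G x * exp (- V x)))"
 proof (rule integral_mono)
  show "integrable lborel (\<lambda>x. (\<Sum>I\<in>LL q. (z x I)\<^sup>2 * exp (- V x)) + (\<Sum>l\<in>LL (Suc (Suc q)). (b x l)\<^sup>2 * exp (- V x)))"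
   using iz ib by (intro Bochner_Integration.integrable_add Bochner_Integration.integrable_sum)
  show "integrable lborel (\<lambda>x. (1 + e) * (\<Sum>I\<in>LL q. (dst V g x I)\<^sup>2 * exp (- V x))
   + (1 + 1 / e + (Suc (Suc q))\<^sup>2) * (G x * exp (- V x)))"
   using ia iG by (intro Bochner_Integration.integrable_add Bochner_Integration.integrable_sum integrable_mult_right)
  fix x
  have "(z x I)\<^sup>2 \<le> (1 + e) * (dst V g x I)\<^sup>2 + (1 + 1 / e) * (\<Sum>j\<in>UNIV. pd j r x * g1 x (j # I))\<^sup>2" for I
  proof -
   have "(r x * dst V g x I)\<^sup>2 \<le> 1 * (dst V g x I)\<^sup>2"
    unfolding power_mult_distrib using r(2)[of x] by (intro mult_right_mono) (auto simp: abs_square_le_1)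
   then have "(1 + e) * (r x * dst V g x I)\<^sup>2 \<le> (1 + e) * (dst V g x I)\<^sup>2"
    using e by (intro mult_left_mono) auto
   then show ?thesis
    using sq_diff_le[OF e, of "r x * dst V g x I" "\<Sum>j\<in>UNIV. pd j r x * g1 x (j # I)"]
    unfolding z_def by linarith
  qed
  then have "(nsq q (z x)) \<le> (\<Sum>I\<in>LL q. (1 + e) * (dst V g x I)\<^sup>2 + (1 + 1 / e) * (\<Sum>j\<in>UNIV. pd j r x * g1 x (j # I))\<^sup>2)"
   by (rule sum_mono)
  also have "\<dots> = (1 + e) * (\<Sum>I\<in>LL q. (dst V g x I)\<^sup>2) + (1 + 1 / e) * (\<Sum>I\<in>LL q. (\<Sum>j\<in>UNIV. pd j r x * g1 x (j # I))\<^sup>2)"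
   by (simp only: sum.distrib sum_distrib_left)
  also have "\<dots> \<le> (1 + e) * (\<Sum>I\<in>LL q. (dst V g x I)\<^sup>2) + (1 + 1 / e) * G x"
   unfolding G_def using e by (intro add_left_mono mult_left_mono contraction_sq_le) auto
  finally have 1: "(nsq q (z x)) \<le> (1 + e) * (\<Sum>I\<in>LL q. (dst V g x I)\<^sup>2) + (1 + 1 / e) * G x" .
  have 2: "(nsq (Suc (Suc q)) (b x)) \<le> (Suc (Suc q))\<^sup>2 * G x"
  proof -
   have "alt (\<lambda>J. pd j r x * g1 x J)" for j
   proof (rule altI)
    fix xs a c ys
    show "pd j r x * g1 x (xs @ a # c # ys) = - (pd j r x * g1 x (xs @ c # a # ys))"
     using altD[OF ag, of x xs a c ys] by simp
   qed
   from wdg_norm_le[of "\<lambda>j J. pd j r x * g1 x J", OF this, of "Suc q"]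
   have "(nsq (Suc (Suc q)) (b x)) \<le> (Suc (Suc q))\<^sup>2 * (\<Sum>j\<in>UNIV. \<Sum>I\<in>LL (Suc q). (pd j r x * g1 x I)\<^sup>2)"
    unfolding b_def .
   also have "(\<Sum>j\<in>UNIV. \<Sum>I\<in>LL (Suc q). (pd j r x * g1 x I)\<^sup>2) = G x"
    unfolding G_def sum_product by (simp only: power_mult_distrib)
   finally show ?thesis .
  qed
  have "((nsq q (z x)) + (nsq (Suc (Suc q)) (b x))) * exp (- V x)
    \<le> ((1 + e) * (\<Sum>I\<in>LL q. (dst V g x I)\<^sup>2) + (1 + 1 / e) * G x + (Suc (Suc q))\<^sup>2 * G x) * exp (- V x)"
   by (intro mult_right_mono add_mono 1 2) simp
  also have "\<dots> = (1 + e) * (\<Sum>I\<in>LL q. (dst V g x I)\<^sup>2 * exp (- V x)) + (1 + 1 / e + (Suc (Suc q))\<^sup>2) * (G x * exp (- V x))"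
   by (simp only: distrib_right sum_distrib_right[symmetric] mult.assoc)
  finally show "(\<Sum>I\<in>LL q. (z x I)\<^sup>2 * exp (- V x)) + (\<Sum>l\<in>LL (Suc (Suc q)). (b x l)\<^sup>2 * exp (- V x))
    \<le> (1 + e) * (\<Sum>I\<in>LL q. (dst V g x I)\<^sup>2 * exp (- V x)) + (1 + 1 / e + (Suc (Suc q))\<^sup>2) * (G x * exp (- V x))"
   by (simp only: distrib_right sum_distrib_right)
 qed
 also have "\<dots> = (1 + e) * (\<Sum>I\<in>LL q. LBINT x. (dst V g x I)\<^sup>2 * exp (- V x))
   + (1 + 1 / e + (Suc (Suc q))\<^sup>2) * (LBINT x. G x * exp (- V x))"
  using ia iG by (simp only: Bochner_Integration.integral_add Bochner_Integration.integral_sum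
    Bochner_Integration.integrable_sum integrable_mult_right integral_mult_right_zero)
 finally show "(LBINT x. (r x)\<^sup>2 * Qf (hess V x) q (g1 x) * exp (- V x))
   \<le> (1 + e) * (\<Sum>I\<in>LL q. LBINT x. (dst V g x I)\<^sup>2 * exp (- V x))
   + (1 + 1 / e + (Suc (Suc q))\<^sup>2) *
    (LBINT x. (\<Sum>j\<in>UNIV. (pd j r x)\<^sup>2) * (nsq (Suc q) (g1 x)) * exp (- V x))"
  unfolding G_def .
qed

subsection \<open>Solutions on sublevel sets\<close>

text \<open>An exponent of at least 2 makes powers of the positive part differentiable at 0, where
  the difference quotient is the positive part to the next lower power. The weight and the cut-offs
  are built from such powers so that they can be exactly constant near compact sets.\<close>

lemma DERIV_pos_part_power:
 fixes t :: real
 shows "((\<lambda>t. (max 0 t) ^ Suc (Suc m)) has_real_derivative real (Suc (Suc m)) * (max 0 t) ^ Suc m) (at t)"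
proof -
 consider "0 < t" | "t < 0" | "t = 0" by linarith
 then show ?thesis
 proof cases
  case 1
  have d: "((\<lambda>t. t ^ Suc (Suc m)) has_real_derivative real (Suc (Suc m)) * t ^ Suc m) (at t)"
   using DERIV_pow[of "Suc (Suc m)" t] by simp
  from has_field_derivative_transform_within_open[OF d, of "{0<..}" "\<lambda>t. (max 0 t) ^ Suc (Suc m)"] 1
  show ?thesis by (simp add: max_def)
 next
  case 2
  have d: "((\<lambda>t. 0 :: real) has_real_derivative 0) (at t)" by simp
  from has_field_derivative_transform_within_open[OF d, of "{..<0}" "\<lambda>t. (max 0 t) ^ Suc (Suc m)"] 2
  show ?thesis by (simp add: max_def)
 next
  case 3
  have "((\<lambda>h. (max 0 h) ^ Suc m) \<longlongrightarrow> (max 0 0) ^ Suc m) (at (0 :: real))"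
   by (intro tendsto_intros)
  then have "((\<lambda>h. (max 0 h) ^ Suc m) \<longlongrightarrow> 0) (at (0 :: real))" by simp
  then have "((\<lambda>h. ((max 0 (0 + h)) ^ Suc (Suc m) - (max 0 0) ^ Suc (Suc m)) / h) \<longlongrightarrow> 0) (at (0 :: real))"
  proof (rule Lim_transform_eventually)
   show "\<forall>\<^sub>F h in at (0 :: real). (max 0 h) ^ Suc m = ((max 0 (0 + h)) ^ Suc (Suc m) - (max 0 0) ^ Suc (Suc m)) / h"
    unfolding eventually_at_filter by (rule always_eventually) (auto simp: max_def)
  qed
  then show ?thesis using 3 by (simp add: DERIV_def)
 qed
qed

lemma hess_add:
 assumes U: "open U" and f: "C2_on U f" and g: "C2_on U g"
 shows "C2_on U (\<lambda>x. f x + g x)" "x \<in> U \<Longrightarrow> hess (\<lambda>x. f x + g x) x = hess f x + hess g x"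
proof -
 have 1: "C1_on U f" "C1_on U g" "\<And>j. C1_on U (pd j f)" "\<And>j. C1_on U (pd j g)"
  using f g by (auto simp: C2_on_def)
 have e: "pd j f x + pd j g x = pd j (\<lambda>x. f x + g x) x" if "x \<in> U" for j x
  by (rule pd_add[OF 1(1,2) that, symmetric])
 have s: "C1_on U (\<lambda>x. pd j f x + pd j g x)" for j by (rule C1_on_add[OF 1(3,4)])
 show "C2_on U (\<lambda>x. f x + g x)"
  unfolding C2_on_def by (intro conjI allI C1_on_add 1 C1_on_cong[OF s U e])
 assume x: "x \<in> U"
 have "pd i (pd j (\<lambda>x. f x + g x)) x = pd i (pd j f) x + pd i (pd j g) x" for i j
  using pd_cong_open[OF s U e x] pd_add[OF 1(3,4) x] by simp
 then show "hess (\<lambda>x. f x + g x) x = hess f x + hess g x" by (simp add: hess_def vec_eq_iff)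
qed

lemma hess_compose:
 assumes U: "open U" and f: "C2_on U f"
  and F: "\<And>x. x \<in> U \<Longrightarrow> (F has_real_derivative F' (f x)) (at (f x))"
   "\<And>x. x \<in> U \<Longrightarrow> (F' has_real_derivative F'' (f x)) (at (f x))" "continuous_on (f ` U) F''"
 shows "C2_on U (\<lambda>x. F (f x))" "x \<in> U \<Longrightarrow> pd j (\<lambda>x. F (f x)) x = F' (f x) * pd j f x"
  "x \<in> U \<Longrightarrow> hess (\<lambda>x. F (f x)) x = F' (f x) *\<^sub>R hess f x + F'' (f x) *\<^sub>R (\<chi> j k. pd j f x * pd k f x)"
proof -
 have 1: "C1_on U f" "\<And>j. C1_on U (pd j f)" using f by (auto simp: C2_on_def)
 have c': "continuous_on (f ` U) F'"
  by (rule continuous_at_imp_continuous_on) (use F(2) DERIV_isCont in blast)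
 have Ff: "C1_on U (\<lambda>x. F (f x))" by (rule C1_on_compose[OF 1(1) F(1) c'])
 have Ff': "C1_on U (\<lambda>x. F' (f x))" by (rule C1_on_compose[OF 1(1) F(2,3)])
 show e: "pd j (\<lambda>x. F (f x)) x = F' (f x) * pd j f x" if "x \<in> U" for x j
  by (rule pd_compose[OF 1(1) that F(1)[OF that]])
 have s: "C1_on U (\<lambda>x. F' (f x) * pd j f x)" for j by (intro C1_on_mult Ff' 1)
 show "C2_on U (\<lambda>x. F (f x))"
  unfolding C2_on_def by (intro conjI allI Ff C1_on_cong[OF s U e[symmetric]])
 assume x: "x \<in> U"
 have "pd i (pd j (\<lambda>x. F (f x))) x = F'' (f x) * (pd i f x * pd j f x) + F' (f x) * pd i (pd j f) x" for i j
  using pd_cong_open[OF s U e[symmetric] x, of i j] pd_mult[OF Ff' 1(2) x, of i j]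
   pd_compose[OF 1(1) x F(2)[OF x], of i] by simp
 then show "hess (\<lambda>x. F (f x)) x = F' (f x) *\<^sub>R hess f x + F'' (f x) *\<^sub>R (\<chi> j k. pd j f x * pd k f x)"
  by (simp add: hess_def vec_eq_iff)
qed

text \<open>What is used of U = {r < c}: below every lower level one stays in a compact set, the
  gradient of r is bounded up to the level c, and the Hessian of r is strictly positive on forms of
  degree \<open>Suc q\<close>, with the 2 coming from a summand |x|^2 of the exhaustion.\<close>

definition sublevel_domain :: "nat \<Rightarrow> (real^'n::finite) set \<Rightarrow> real \<Rightarrow> (real^'n \<Rightarrow> real) \<Rightarrow> bool" where
 "sublevel_domain q U c r \<longleftrightarrow> open U \<and> C2_on U r \<and> (\<forall>x\<in>U. r x < c) \<and> (\<forall>t<c. compact {x\<in>U. r x \<le> t}) \<and>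
  (\<exists>B\<ge>0. \<forall>x\<in>U. (\<Sum>j\<in>UNIV. (pd j r x)\<^sup>2) \<le> B) \<and>
  (\<forall>x\<in>U. \<forall>g. alt g \<longrightarrow> 2 * (nsq (Suc q) g) \<le> Qf (hess r x) q g)"

text \<open>The exponent 7 makes the derivative of the weight of order \<open>(1 / (c - t)) ^ 8\<close>, enough to absorb the gradient
 of a cut-off that is a function of \<open>1 / (c - t) / N\<close>.\<close>

lemma weight_derivatives:
 fixes c t \<tau>0 :: real
 assumes "t < c"
 shows "((\<lambda>t. (max 0 (1 / (c - t) - \<tau>0)) ^ 7) has_real_derivative
   7 * (max 0 (1 / (c - t) - \<tau>0)) ^ 6 * (1 / (c - t))\<^sup>2) (at t)"
  "((\<lambda>t. 7 * (max 0 (1 / (c - t) - \<tau>0)) ^ 6 * (1 / (c - t))\<^sup>2) has_real_derivative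
   42 * (max 0 (1 / (c - t) - \<tau>0)) ^ 5 * (1 / (c - t)) ^ 4 + 14 * (max 0 (1 / (c - t) - \<tau>0)) ^ 6 * (1 / (c - t)) ^ 3) (at t)"
proof -
 have d: "((\<lambda>t. 1 / (c - t)) has_real_derivative (1 / (c - t))\<^sup>2) (at t)"
  by (rule derivative_eq_intros refl | use assms in \<open>simp add: power2_eq_square divide_simps\<close>)+
 have d': "((\<lambda>t. 1 / (c - t) - \<tau>0) has_real_derivative (1 / (c - t))\<^sup>2) (at t)"
  using DERIV_diff[OF d DERIV_const[of \<tau>0]] by simp
 have p: "((\<lambda>t. (max 0 (1 / (c - t) - \<tau>0)) ^ Suc (Suc m)) has_real_derivative
   real (Suc (Suc m)) * (max 0 (1 / (c - t) - \<tau>0)) ^ Suc m * (1 / (c - t))\<^sup>2) (at t)" for m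
  by (rule DERIV_chain2[OF DERIV_pos_part_power d'])
 show "((\<lambda>t. (max 0 (1 / (c - t) - \<tau>0)) ^ 7) has_real_derivative
   7 * (max 0 (1 / (c - t) - \<tau>0)) ^ 6 * (1 / (c - t))\<^sup>2) (at t)"
  using p[of 5] by (simp add: eval_nat_numeral)
 have p6: "((\<lambda>t. (max 0 (1 / (c - t) - \<tau>0)) ^ 6) has_real_derivative
   6 * (max 0 (1 / (c - t) - \<tau>0)) ^ 5 * (1 / (c - t))\<^sup>2) (at t)"
  using p[of 4] by (simp add: eval_nat_numeral)
 have "((\<lambda>t. (1 / (c - t))\<^sup>2) has_real_derivative 2 * (1 / (c - t)) * (1 / (c - t))\<^sup>2) (at t)"
  using DERIV_power[OF d, of 2] by (simp add: mult_ac)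
 from DERIV_mult[OF DERIV_cmult[OF p6, of 7] this]
 show "((\<lambda>t. 7 * (max 0 (1 / (c - t) - \<tau>0)) ^ 6 * (1 / (c - t))\<^sup>2) has_real_derivative
   42 * (max 0 (1 / (c - t) - \<tau>0)) ^ 5 * (1 / (c - t)) ^ 4 + 14 * (max 0 (1 / (c - t) - \<tau>0)) ^ 6 * (1 / (c - t)) ^ 3) (at t)"
  by (rule DERIV_cong) (simp add: power2_eq_square power3_eq_cube power4_eq_xxxx algebra_simps)
qed

text \<open>In terms of \<tau> = 1/(c - t) this function is 1 for \<tau> \<le> N and 0 for \<tau>
  \<ge> 2 N; the inner and outer squares make it C^1 at both ends.\<close>

lemma cutoff_derivative:
 fixes c t N :: real
 assumes "t < c" "0 < N"
 shows "((\<lambda>t. (max 0 (1 - (max 0 (1 / (c - t) / N - 1))\<^sup>2))\<^sup>2) has_real_derivative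
  - (4 * max 0 (1 - (max 0 (1 / (c - t) / N - 1))\<^sup>2) * max 0 (1 / (c - t) / N - 1) * ((1 / (c - t))\<^sup>2 / N))) (at t)"
proof -
 have d: "((\<lambda>t. 1 / (c - t) / N - 1) has_real_derivative (1 / (c - t))\<^sup>2 / N) (at t)"
  by (rule derivative_eq_intros refl | use assms in \<open>simp add: power2_eq_square divide_simps\<close>)+
 have d1: "((\<lambda>t. (max 0 (1 / (c - t) / N - 1))\<^sup>2) has_real_derivative
   2 * max 0 (1 / (c - t) / N - 1) * ((1 / (c - t))\<^sup>2 / N)) (at t)"
  using DERIV_chain2[OF DERIV_pos_part_power[of 0] d] by (simp add: numeral_2_eq_2)
 have d2: "((\<lambda>t. 1 - (max 0 (1 / (c - t) / N - 1))\<^sup>2) has_real_derivative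
   0 - 2 * max 0 (1 / (c - t) / N - 1) * ((1 / (c - t))\<^sup>2 / N)) (at t)"
  by (rule DERIV_diff[OF DERIV_const d1])
 show ?thesis
  using DERIV_chain2[OF DERIV_pos_part_power[of 0] d2] by (simp add: numeral_2_eq_2 mult.assoc)
qed

text \<open>The outer square leaves a factor of the cut-off itself in the bound for its squared
  derivative. With this factor the gradient can be absorbed by a term that carries the square of the
  cut-off.\<close>

lemma cutoff_derivative_bound:
 fixes s t N :: real
 assumes "0 < N"
 shows "(4 * max 0 (1 - (max 0 s)\<^sup>2) * max 0 s * (t\<^sup>2 / N))\<^sup>2 \<le> 16 * (max 0 (1 - (max 0 s)\<^sup>2))\<^sup>2 * (t ^ 4 / N\<^sup>2)"
proof -
 have "(max 0 (1 - (max 0 s)\<^sup>2))\<^sup>2 * (max 0 s)\<^sup>2 \<le> (max 0 (1 - (max 0 s)\<^sup>2))\<^sup>2"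
  by (cases "(max 0 s)\<^sup>2 \<le> 1") (auto intro: mult_left_le)
 then have "16 * (t ^ 4 / N\<^sup>2) * ((max 0 (1 - (max 0 s)\<^sup>2))\<^sup>2 * (max 0 s)\<^sup>2)
   \<le> 16 * (t ^ 4 / N\<^sup>2) * (max 0 (1 - (max 0 s)\<^sup>2))\<^sup>2"
  by (intro mult_left_mono) auto
 then show ?thesis by (simp add: power_mult_distrib power_divide mult_ac power_mult[symmetric])
qed

lemma weight_lower_bound:
 fixes t \<tau>0 :: real
 assumes "2 * \<tau>0 \<le> t" "0 \<le> \<tau>0"
 shows "t ^ 8 / 8 \<le> 2 * (7 * (max 0 (t - \<tau>0)) ^ 6 * t\<^sup>2)"
proof -
 have "(t / 2) ^ 6 \<le> (max 0 (t - \<tau>0)) ^ 6" by (rule power_mono) (use assms in auto)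
 then have "14 * t\<^sup>2 * (t / 2) ^ 6 \<le> 14 * t\<^sup>2 * (max 0 (t - \<tau>0)) ^ 6" by (intro mult_left_mono) auto
 moreover have "14 * t\<^sup>2 * (t / 2) ^ 6 = 14 / 64 * t ^ 8" by (simp add: power_divide power_add[symmetric])
 moreover have "0 \<le> t ^ 8" by simp
 moreover have "2 * (7 * (max 0 (t - \<tau>0)) ^ 6 * t\<^sup>2) = 14 * t\<^sup>2 * (max 0 (t - \<tau>0)) ^ 6" by simp
 ultimately show ?thesis by linarith
qed

text \<open>Complete the square (t^4 h - 4 Y)^2. The remainder 2 Y^2 is free of t, and Y will tend
  to 0.\<close>

lemma absorb_gradient:
 fixes Y t h k :: real
 assumes "t ^ 8 / 8 \<le> k"
 shows "Y * (t ^ 4 * h) \<le> h\<^sup>2 * k + 2 * Y\<^sup>2"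
proof -
 have "h\<^sup>2 * (t ^ 8 / 8) \<le> h\<^sup>2 * k" by (intro mult_left_mono assms) simp
 moreover have "0 \<le> (t ^ 4 * h - 4 * Y)\<^sup>2 / 8" by simp
 then have "0 \<le> h\<^sup>2 * (t ^ 8 / 8) - Y * (t ^ 4 * h) + 2 * Y\<^sup>2"
  by (simp add: power2_diff power_mult_distrib power_mult[symmetric] field_simps)
 ultimately show ?thesis by linarith
qed

text \<open>The weight is k = F(r) with F an increasing convex function below the level
  \<open>c\<close> that vanishes near the values of \<open>r\<close> on \<open>K\<close>; its form
  dominates 2 F'(r) times the squared norm. The gradients of the cut-offs live where F' has order
  \<tau>^8, and their squares are of order \<tau>^4 times the cut-off, divided by the square of the
  cut-off level. Any multiple of them is therefore absorbed, up to a remainder that tends to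
  0.\<close>

lemma exhaustion_cutoffs:
 fixes r :: "real^'n \<Rightarrow> real"
 assumes sd: "sublevel_domain q U c r" and K: "compact K" "K \<subseteq> U"
 shows "\<exists>k \<eta>. C2_on U k \<and> (\<forall>x\<in>U. 0 \<le> k x) \<and> (\<forall>x\<in>K. k x = 0 \<and> (\<forall>j. pd j k x = 0)) \<and>
  (\<forall>x\<in>U. \<forall>g. alt g \<longrightarrow> 0 \<le> Qf (hess k x) q g) \<and>
  (\<forall>N :: nat. C1c U (\<eta> N) \<and> (\<forall>x. \<bar>\<eta> N x\<bar> \<le> 1)) \<and> (\<forall>x\<in>U. \<forall>\<^sub>F N in sequentially. \<eta> N x = 1) \<and>
  (\<forall>C\<ge>0. \<exists>d. d \<longlonglongrightarrow> 0 \<and> (\<forall>N. \<forall>x\<in>U. \<forall>g. alt g \<longrightarrow>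
   C * ((\<Sum>j\<in>UNIV. (pd j (\<eta> N) x)\<^sup>2) * (nsq (Suc q) g)) \<le> (\<eta> N x)\<^sup>2 * Qf (hess k x) q g + d N * (nsq (Suc q) g)))"
proof -
 have U: "open U" and r: "C2_on U r" "C1_on U r" and rc: "\<And>x. x \<in> U \<Longrightarrow> r x < c"
  and cpt: "\<And>t. t < c \<Longrightarrow> compact {x\<in>U. r x \<le> t}"
  and Qr: "\<And>x g. x \<in> U \<Longrightarrow> alt g \<Longrightarrow> 2 * (nsq (Suc q) g) \<le> Qf (hess r x) q g"
  using sd by (auto simp: sublevel_domain_def C2_on_def)
 obtain B where B: "0 \<le> B" "\<And>x. x \<in> U \<Longrightarrow> (\<Sum>j\<in>UNIV. (pd j r x)\<^sup>2) \<le> B"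
  using sd by (auto simp: sublevel_domain_def)
 define \<tau> where "\<tau> x = 1 / (c - r x)" for x
 have \<tau>0: "0 < \<tau> x" if "x \<in> U" for x using rc[OF that] by (simp add: \<tau>_def)
 have "continuous_on U \<tau>"
  unfolding \<tau>_def[abs_def] using rc by (intro continuous_intros C1_onD(1)[OF r(2)]) force
 then have "bounded (\<tau> ` K)"
  using K by (intro compact_imp_bounded compact_continuous_image) (auto intro: continuous_on_subset)
 \<comment> \<open>\<tau> stays below \<open>T\<close> on \<open>K\<close>, so the positive part of
   \<tau> - T, and with it k and its gradient, vanishes there.\<close>
 then obtain T where T: "1 \<le> T" "\<And>x. x \<in> K \<Longrightarrow> \<tau> x \<le> T"
  unfolding bounded_real by (metis abs_le_D1 image_eqI linorder_linear order_trans)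
 define F where "F t = (max 0 (1 / (c - t) - T)) ^ 7" for t
 define F' where "F' t = 7 * (max 0 (1 / (c - t) - T)) ^ 6 * (1 / (c - t))\<^sup>2" for t
 define F'' where "F'' t = 42 * (max 0 (1 / (c - t) - T)) ^ 5 * (1 / (c - t)) ^ 4
  + 14 * (max 0 (1 / (c - t) - T)) ^ 6 * (1 / (c - t)) ^ 3" for t
 have dF: "(F has_real_derivative F' (r x)) (at (r x))" "(F' has_real_derivative F'' (r x)) (at (r x))" if "x \<in> U" for x
  unfolding F_def[abs_def] F'_def[abs_def] F''_def by (rule weight_derivatives[OF rc[OF that]])+
 have cF: "continuous_on (r ` U) F''"
  unfolding F''_def[abs_def] using rc by (intro continuous_intros) (auto simp: less_imp_neq[THEN not_sym])
 define k where "k x = F (r x)" for x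
 have k1: "C2_on U k" and k2: "\<And>j x. x \<in> U \<Longrightarrow> pd j k x = F' (r x) * pd j r x"
  and k3: "\<And>x. x \<in> U \<Longrightarrow> hess k x = F' (r x) *\<^sub>R hess r x + F'' (r x) *\<^sub>R (\<chi> j k. pd j r x * pd k r x)"
  unfolding k_def[abs_def] by (rule hess_compose[of U r F F' F'', OF U r(1) dF cF]; assumption)+
 have pos: "0 \<le> F' (r x)" "0 \<le> F'' (r x)" if "x \<in> U" for x
  using rc[OF that] by (auto simp: F'_def F''_def intro!: add_nonneg_nonneg mult_nonneg_nonneg)
 have Qk: "F' (r x) * (2 * (nsq (Suc q) g)) \<le> Qf (hess k x) q g" if "x \<in> U" "alt g" for x g
 proof -
  have "F' (r x) * (2 * (nsq (Suc q) g)) \<le> F' (r x) * Qf (hess r x) q g"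
   by (intro mult_left_mono Qr that pos)
  moreover have "0 \<le> F'' (r x) * (\<Sum>I\<in>LL q. (\<Sum>j\<in>UNIV. pd j r x * g (j # I))\<^sup>2)"
   using pos(2)[OF that(1)] by (intro mult_nonneg_nonneg sum_nonneg) auto
  ultimately show ?thesis by (simp add: k3[OF that(1)] Qf_add Qf_scale Qf_rank1)
 qed
 have kK: "k x = 0 \<and> (\<forall>j. pd j k x = 0)" if "x \<in> K" for x
 proof -
  have "max 0 (1 / (c - r x) - T) = 0" using T(2)[OF that] by (simp add: \<tau>_def)
  then have "F (r x) = 0" "F' (r x) = 0" by (simp_all add: F_def F'_def)
  then show ?thesis using k2[of x] that K(2) by (auto simp: k_def)
 qed
 \<comment> \<open>The shift by 2 T puts the gradient of every cut-off into the region \<tau> \<ge>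
   2 T, where the lower bound for F' holds, and T \<ge> 1 makes the level at least N + 1.\<close>
 define M where "M N = real N + 2 * T" for N
 have M: "0 < M N" "2 * T \<le> M N" "real (Suc N) \<le> M N" for N using T(1) by (auto simp: M_def)
 define s where "s N x = \<tau> x / M N - 1" for N x
 define G where "G N t = (max 0 (1 - (max 0 (1 / (c - t) / M N - 1))\<^sup>2))\<^sup>2" for N t
 define G' where "G' N t = - (4 * max 0 (1 - (max 0 (1 / (c - t) / M N - 1))\<^sup>2) * max 0 (1 / (c - t) / M N - 1) * ((1 / (c - t))\<^sup>2 / M N))" for N t
 have dG: "(G N has_real_derivative G' N (r x)) (at (r x))" if "x \<in> U" for x N
  unfolding G_def[abs_def] G'_def by (rule cutoff_derivative[OF rc[OF that] M(1)])
 have cG: "continuous_on (r ` U) (G' N)" for N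
  unfolding G'_def[abs_def] using rc M(1)[of N]
  by (intro continuous_intros) (auto simp: less_imp_neq[THEN not_sym])
 define \<eta> where "\<eta> N x = (if x \<in> U then G N (r x) else 0)" for N x
 have GC: "C1_on U (\<lambda>x. G N (r x))" for N by (rule C1_on_compose[OF r(2) dG cG])
 have C1\<eta>: "C1_on U (\<eta> N)" for N by (rule C1_on_cong[OF GC U]) (simp add: \<eta>_def)
 have pd\<eta>: "pd j (\<eta> N) x = G' N (r x) * pd j r x" if "x \<in> U" for j N x
 proof -
  have "pd j (\<eta> N) x = pd j (\<lambda>x. G N (r x)) x"
   by (rule pd_cong_open[OF GC U _ that]) (simp add: \<eta>_def)
  then show ?thesis using pd_compose[OF r(2) that dG[OF that]] by simp
 qed
 have \<eta>c: "C1c U (\<eta> N)" for N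
 proof (rule C1c_extend[OF C1\<eta> U])
  \<comment> \<open>Points of \<open>U\<close> outside this set have \<tau> above twice the cut-off
    level, so the cut-off is 0 there.\<close>
  show "compact {x\<in>U. r x \<le> c - 1 / (2 * M N)}" by (rule cpt) (use M(1)[of N] in simp)
  show "\<eta> N x = 0" if "x \<notin> {x\<in>U. r x \<le> c - 1 / (2 * M N)}" for x
  proof (cases "x \<in> U")
   case True
   then have "c - r x < 1 / (2 * M N)" "0 < c - r x" using that rc by auto
   then have "2 * M N < 1 / (c - r x)" using M(1)[of N] by (simp add: field_simps)
   then have "2 \<le> 1 / (c - r x) / M N" by (subst pos_le_divide_eq[OF M(1)]) simp
   then have "1 \<le> (max 0 (1 / (c - r x) / M N - 1))\<^sup>2" by simp
   then show ?thesis by (simp add: \<eta>_def G_def)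
  qed (simp add: \<eta>_def)
 qed auto
 have G01: "0 \<le> G N t \<and> G N t \<le> 1" for N t
 proof -
  have "(max 0 (1 - (max 0 (1 / (c - t) / M N - 1))\<^sup>2))\<^sup>2 \<le> 1\<^sup>2"
   by (rule power_mono) auto
  then show ?thesis by (simp add: G_def)
 qed
 have \<eta>1: "\<bar>\<eta> N x\<bar> \<le> 1" for N x using G01[of N "r x"] by (simp add: \<eta>_def)
 have ev: "\<forall>\<^sub>F N in sequentially. \<eta> N x = 1" if "x \<in> U" for x
 proof (rule eventually_mono[OF eventually_ge_at_top[of "nat \<lceil>\<tau> x\<rceil>"]])
  fix N assume "nat \<lceil>\<tau> x\<rceil> \<le> N"
  then have "\<tau> x \<le> M N" using T(1) by (simp add: M_def)
  then have "1 / (c - r x) / M N \<le> 1" by (subst pos_divide_le_eq[OF M(1)]) (simp add: \<tau>_def)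
  then have "max 0 (1 / (c - r x) / M N - 1) = 0" by (intro max_absorb1) linarith
  then show "\<eta> N x = 1" using that by (simp add: \<eta>_def G_def)
 qed
 have grad: "(\<Sum>j\<in>UNIV. (pd j (\<eta> N) x)\<^sup>2) \<le> 16 * B / (M N)\<^sup>2 * (\<tau> x ^ 4 * \<eta> N x)"
  if x: "x \<in> U" for N x
 proof -
  have "(\<Sum>j\<in>UNIV. (pd j (\<eta> N) x)\<^sup>2) = (G' N (r x))\<^sup>2 * (\<Sum>j\<in>UNIV. (pd j r x)\<^sup>2)"
   by (simp add: pd\<eta>[OF x] power_mult_distrib sum_distrib_left)
  also have "\<dots> \<le> (16 * G N (r x) * (\<tau> x ^ 4 / (M N)\<^sup>2)) * B"
  proof (intro mult_mono B x)
   show "(G' N (r x))\<^sup>2 \<le> 16 * G N (r x) * (\<tau> x ^ 4 / (M N)\<^sup>2)"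
    unfolding G'_def G_def \<tau>_def power2_minus by (rule cutoff_derivative_bound[OF M(1)])
  qed (use G01 in \<open>auto intro!: sum_nonneg mult_nonneg_nonneg\<close>)
  finally show ?thesis using x by (simp add: \<eta>_def mult_ac)
 qed
 have grad0: "(\<Sum>j\<in>UNIV. (pd j (\<eta> N) x)\<^sup>2) = 0" if x: "x \<in> U" "\<tau> x < M N" for N x
 proof -
  have "1 / (c - r x) / M N \<le> 1" using x(2) by (subst pos_divide_le_eq[OF M(1)]) (simp add: \<tau>_def)
  then have "max 0 (1 / (c - r x) / M N - 1) = 0" by (intro max_absorb1) linarith
  then have "G' N (r x) = 0" by (simp add: G'_def)
  then show ?thesis by (simp add: pd\<eta>[OF x(1)])
 qed
 \<comment> \<open>Where \<tau> is below the level the gradient vanishes. Elsewhere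
   \<open>absorb_gradient\<close> applies with Y = 16 B C divided by the squared level; 2 Y^2 then
   has the fourth power of the level in its denominator, which is at least N + 1.\<close>
 have fin: "\<exists>d. d \<longlonglongrightarrow> 0 \<and> (\<forall>N. \<forall>x\<in>U. \<forall>g. alt g \<longrightarrow>
   C * ((\<Sum>j\<in>UNIV. (pd j (\<eta> N) x)\<^sup>2) * (nsq (Suc q) g)) \<le> (\<eta> N x)\<^sup>2 * Qf (hess k x) q g + d N * (nsq (Suc q) g))"
  if C: "0 \<le> C" for C
 proof (intro exI[of _ "\<lambda>N. 2 * (16 * B * C)\<^sup>2 * inverse (real (Suc N))"] conjI allI ballI impI)
  show "(\<lambda>N. 2 * (16 * B * C)\<^sup>2 * inverse (real (Suc N))) \<longlonglongrightarrow> 0"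
   using tendsto_mult_left[OF LIMSEQ_inverse_real_of_nat, of "2 * (16 * B * C)\<^sup>2"] by simp
  fix N x g assume x: "x \<in> U" and g: "alt (g :: 'n list \<Rightarrow> real)"
  let ?g = "\<Sum>l\<in>LL (Suc q). (g l)\<^sup>2" and ?d = "2 * (16 * B * C)\<^sup>2 * inverse (real (Suc N))"
  have g0: "0 \<le> ?g" by (intro sum_nonneg) simp
  have "C * (\<Sum>j\<in>UNIV. (pd j (\<eta> N) x)\<^sup>2) \<le> (\<eta> N x)\<^sup>2 * (2 * F' (r x)) + ?d"
  proof (cases "\<tau> x < M N")
   case True
   then show ?thesis using grad0[OF x True] pos(1)[OF x] by simp
  next
   case False
   define Y where "Y = C * (16 * B / (M N)\<^sup>2)"
   have "C * (\<Sum>j\<in>UNIV. (pd j (\<eta> N) x)\<^sup>2) \<le> Y * (\<tau> x ^ 4 * \<eta> N x)"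
    using mult_left_mono[OF grad[OF x] C, of N] by (simp only: Y_def mult.assoc)
   also have "\<dots> \<le> (\<eta> N x)\<^sup>2 * (2 * F' (r x)) + 2 * Y\<^sup>2"
   proof (rule absorb_gradient)
    have "\<tau> x ^ 8 / 8 \<le> 2 * (7 * (max 0 (\<tau> x - T)) ^ 6 * (\<tau> x)\<^sup>2)"
     by (rule weight_lower_bound) (use False M(2)[of N] T(1) in auto)
    then show "\<tau> x ^ 8 / 8 \<le> 2 * F' (r x)" by (simp add: F'_def \<tau>_def)
   qed
   also have "2 * Y\<^sup>2 \<le> ?d"
   proof -
    have "1 \<le> M N" using M(3)[of N] by simp
    then have "M N \<le> (M N) ^ 4" by (rule self_le_power) simp
    then have "real (Suc N) \<le> (M N) ^ 4" using M(3)[of N] by linarith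
    then have "inverse ((M N) ^ 4) \<le> inverse (real (Suc N))" by (intro le_imp_inverse_le) auto
    then have "2 * (16 * B * C)\<^sup>2 * inverse ((M N) ^ 4) \<le> ?d" by (intro mult_left_mono) auto
    moreover have "2 * Y\<^sup>2 = 2 * (16 * B * C)\<^sup>2 * inverse ((M N) ^ 4)"
     by (simp add: Y_def power_mult_distrib power_divide power_mult[symmetric] divide_inverse power_inverse mult_ac)
    ultimately show ?thesis by simp
   qed
   finally show ?thesis by simp
  qed
  from mult_right_mono[OF this g0, unfolded distrib_right]
  have "C * ((\<Sum>j\<in>UNIV. (pd j (\<eta> N) x)\<^sup>2) * ?g) \<le> (\<eta> N x)\<^sup>2 * (F' (r x) * (2 * ?g)) + ?d * ?g"
   by (simp only: mult_ac)
  also have "(\<eta> N x)\<^sup>2 * (F' (r x) * (2 * ?g)) \<le> (\<eta> N x)\<^sup>2 * Qf (hess k x) q g"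
   by (intro mult_left_mono Qk x g) simp
  finally show "C * ((\<Sum>j\<in>UNIV. (pd j (\<eta> N) x)\<^sup>2) * ?g) \<le> (\<eta> N x)\<^sup>2 * Qf (hess k x) q g + ?d * ?g" by simp
 qed
 have k0: "\<forall>x\<in>U. 0 \<le> k x" by (simp add: k_def F_def)
 have Qk0: "\<forall>x\<in>U. \<forall>g. alt g \<longrightarrow> 0 \<le> Qf (hess k x) q g"
 proof (intro ballI allI impI)
  fix x g assume "x \<in> U" "alt (g :: 'n list \<Rightarrow> real)"
  moreover have "0 \<le> F' (r x) * (2 * (nsq (Suc q) g))"
   using pos(1)[OF \<open>x \<in> U\<close>] by (intro mult_nonneg_nonneg) (auto intro: sum_nonneg)
  ultimately show "0 \<le> Qf (hess k x) q g" using Qk order_trans by blast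
 qed
 show ?thesis
  by (rule exI[of _ k], rule exI[of _ \<eta>]) (use k1 k0 kK Qk0 \<eta>c \<eta>1 ev fin in blast)
qed

section \<open>Energy of the closed part of a test form\<close>

lemma Qf_measurable:
 fixes W :: "real^'n \<Rightarrow> real"
 assumes U: "open U" and W: "C2_on U W" and g: "\<And>l. (\<lambda>x. g x l) \<in> borel_measurable borel" and V: "continuous_on U V"
 shows "(\<lambda>x. wt U V x * Qf (hess W x) q (g x)) \<in> borel_measurable borel"
proof -
 have [measurable]: "(\<lambda>x. g x l) \<in> borel_measurable borel" for l by (rule g)
 have [measurable]: "(\<lambda>x. indicator U x * (exp (- V x) * pd j (pd k W) x)) \<in> borel_measurable borel" for j k
 proof -
  have "continuous_on U (\<lambda>x. exp (- V x) * pd j (pd k W) x)"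
   using W by (intro continuous_on_mult continuous_on_exp_uminus V C1_onD(2)) (auto simp: C2_on_def)
  from borel_measurable_continuous_on_indicator[OF _ this] U show ?thesis by (simp add: borel_open)
 qed
 have "wt U V x * Qf (hess W x) q (g x)
   = (\<Sum>I\<in>LL q. \<Sum>j\<in>UNIV. \<Sum>k\<in>UNIV. (indicator U x * (exp (- V x) * pd j (pd k W) x)) * (g x (j # I) * g x (k # I)))" for x
  unfolding Qf_def hess_def sum_distrib_left by (intro sum.cong refl) simp
 then show ?thesis by simp
qed

text \<open>The energy of the closed part g1 of g, measured with the Hessian of the original weight
  W, is bounded by the adjoint of g alone. The extra weight in V depends on g, pays for the
  cut-offs, and leaves no trace in the right side because it vanishes on the support of g.\<close>

lemma closed_energy:
 fixes g :: "real^'n \<Rightarrow> 'n list \<Rightarrow> real"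
 assumes sd: "sublevel_domain q U c r" and W: "C2_on U W" and Qpos: "\<forall>x\<in>U. \<forall>g. alt g \<longrightarrow> 0 \<le> Qf (hess W x) q g"
  and g: "testform (Suc q) U g"
 shows "\<exists>V g1. C2_on U V \<and> (\<forall>x\<in>U. W x \<le> V x) \<and> (\<forall>x\<in>U. \<forall>l. g x l \<noteq> 0 \<longrightarrow> V x = W x) \<and> formL2 U V (Suc q) g1 \<and>
  (\<forall>k. formL2 U V (Suc q) k \<and> wd (Suc q) U k (\<lambda>x l. 0) \<longrightarrow> ip (LL (Suc q)) (wm U V) g1 k = ip (LL (Suc q)) (wm U V) g k) \<and>
  (\<integral>\<^sup>+x. ennreal (wt U V x * Qf (hess W x) q (g1 x)) \<partial>lborel) \<le> ennreal (nrm2 (LL q) (wm U W) (dst W g))"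
proof -
 have U: "open U" using sd by (simp add: sublevel_domain_def)
 have gC: "C1c U (\<lambda>x. g x l)" for l using g by (simp add: testform_def)
 obtain S where S: "\<And>l. compact (S l) \<and> S l \<subseteq> U \<and> (\<forall>x. x \<notin> S l \<longrightarrow> g x l = 0 \<and> (\<forall>j. pd j (\<lambda>x. g x l) x = 0))"
 proof -
  have "\<forall>l. \<exists>S. compact S \<and> S \<subseteq> U \<and> (\<forall>x. x \<notin> S \<longrightarrow> g x l = 0 \<and> (\<forall>j. pd j (\<lambda>x. g x l) x = 0))"
  proof
   fix l
   obtain K where "compact K" "K \<subseteq> U" "\<And>x. x \<notin> K \<Longrightarrow> g x l = 0" "\<And>x j. x \<notin> K \<Longrightarrow> pd j (\<lambda>x. g x l) x = 0"
    using C1c_support[OF gC] by metis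
   then show "\<exists>S. compact S \<and> S \<subseteq> U \<and> (\<forall>x. x \<notin> S \<longrightarrow> g x l = 0 \<and> (\<forall>j. pd j (\<lambda>x. g x l) x = 0))" by blast
  qed
  from choice[OF this] show thesis using that by blast
 qed
 define K where "K = (\<Union>l\<in>LL (Suc q). S l)"
 have K: "compact K" "K \<subseteq> U" unfolding K_def using S by (auto intro: compact_UN)
 have altg: "altform (Suc q) (g x)" for x using g by (simp add: testform_def)
 have g0: "g x l = 0" "pd j (\<lambda>x. g x l) x = 0" if "x \<notin> K" for x l j
 proof -
  have "g x l = 0 \<and> pd j (\<lambda>x. g x l) x = 0"
  proof (cases "l \<in> LL (Suc q)")
   case True
   then show ?thesis using S[of l] that by (auto simp: K_def)
  next
   case False
   then have "(\<lambda>x. g x l) = (\<lambda>x. 0)" using altg by (auto simp: altform_iff LL_def)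
   then show ?thesis by (metis pd_const)
  qed
  then show "g x l = 0" "pd j (\<lambda>x. g x l) x = 0" by auto
 qed
 obtain k \<eta> where k: "C2_on U k" "\<forall>x\<in>U. 0 \<le> k x" "\<forall>x\<in>K. k x = 0 \<and> (\<forall>j. pd j k x = 0)"
   and Qk: "\<forall>x\<in>U. \<forall>g. alt g \<longrightarrow> 0 \<le> Qf (hess k x) q g"
   and \<eta>: "\<forall>N :: nat. C1c U (\<eta> N) \<and> (\<forall>x. \<bar>\<eta> N x\<bar> \<le> 1)" and ev: "\<forall>x\<in>U. \<forall>\<^sub>F N in sequentially. \<eta> N x = 1"
   and est: "\<forall>C\<ge>0. \<exists>d. d \<longlonglongrightarrow> 0 \<and> (\<forall>N. \<forall>x\<in>U. \<forall>g. alt g \<longrightarrow>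
    C * ((\<Sum>j\<in>UNIV. (pd j (\<eta> N) x)\<^sup>2) * (nsq (Suc q) g)) \<le> (\<eta> N x)\<^sup>2 * Qf (hess k x) q g + d N * (nsq (Suc q) g))"
  using exhaustion_cutoffs[OF sd K] by (elim exE conjE) (rule that; assumption)
 define V where "V x = W x + k x" for x
 have V: "C2_on U V" unfolding V_def[abs_def] by (rule hess_add(1)[OF U W k(1)])
 have hV: "hess V x = hess W x + hess k x" if "x \<in> U" for x
  unfolding V_def[abs_def] by (rule hess_add(2)[OF U W k(1) that])
 have V1: "C1_on U V" and W1: "C1_on U W" and k1: "C1_on U k" using V W k(1) by (auto simp: C2_on_def)
 note Vc = C1_onD(1)[OF V1]
 have pdV: "pd j V x = pd j W x" if "x \<in> K" for j x
  unfolding V_def[abs_def] using pd_add[OF W1 k1, of x j] k(3) K(2) that by auto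
 \<comment> \<open>The extra weight and its gradient vanish on the set that carries g, so the
   adjoints of g for V and for W coincide; this step is why \<open>exhaustion_cutoffs\<close> takes
   a compact set.\<close>
 have dst: "dst V g x I = dst W g x I" for x I
 proof (cases "x \<in> K")
  case True
  then show ?thesis by (simp add: dst_def pdV)
 next
  case False
  then show ?thesis by (simp add: dst_def g0)
 qed
 obtain g1 where g1: "formL2 U V (Suc q) g1" and cl: "wd (Suc q) U g1 (\<lambda>x l. 0)"
  and orth: "\<forall>k. formL2 U V (Suc q) k \<and> wd (Suc q) U k (\<lambda>x l. 0) \<longrightarrow> ip (LL (Suc q)) (wm U V) g1 k = ip (LL (Suc q)) (wm U V) g k"
  using closed_projection[OF U Vc formL2_testform[OF U V1 g]] by blast
 have co: "wdiv U (\<lambda>j x. (wt U V x) * g1 x (j # I))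
    (\<lambda>x. - ((wt U V x) * dst V g x I))" if "I \<in> LL q" for I
  by (rule coclosed[OF U V1 g g1 _ that]) (use orth in blast)
 have g1s: "sqi (wm U V) (\<lambda>x. g1 x l)" if "l \<in> LL (Suc q)" for l by (rule L2FD[OF formL2D(4)[OF g1] that])
 have ig: "integrable lborel (\<lambda>x. wt U V x * (nsq (Suc q) (g1 x)))"
  using g1s wm_integrable[OF U Vc, of "\<lambda>x. (g1 x _)\<^sup>2"] formL2D(3)[OF g1]
  by (auto simp: sum_distrib_left sqi_def intro!: Bochner_Integration.integrable_sum)
 define A where "A = nrm2 (LL q) (wm U W) (dst W g)"
 have A: "A = (\<Sum>I\<in>LL q. LBINT x. (dst V g x I)\<^sup>2 * exp (- V x))"
 proof -
  have "(\<integral>x. dst W g x I * dst W g x I \<partial>wm U W) = (LBINT x. dst V g x I * dst V g x I * exp (- V x))" for I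
  proof -
   have m: "(\<lambda>x. dst W g x I) \<in> borel_measurable borel"
    by (rule borel_measurable_continuous_onI[OF Cc_continuous_UNIV[OF Cc_dst[OF W1 g] U]])
   have "(\<integral>x. dst W g x I * dst W g x I \<partial>wm U W) = (LBINT x. dst W g x I * dst W g x I * exp (- W x))"
    by (rule wm_integral_Cc[OF U C1_onD(1)[OF W1] Cc_dst[OF W1 g] m])
   also have "\<dots> = (LBINT x. dst V g x I * dst V g x I * exp (- V x))"
   proof (intro Bochner_Integration.integral_cong refl)
    fix x
    show "dst W g x I * dst W g x I * exp (- W x) = dst V g x I * dst V g x I * exp (- V x)"
    proof (cases "x \<in> K")
     case True
     then have "V x = W x" using k(3) by (simp add: V_def)
     then show ?thesis by (simp add: dst)
    next
     case False
     then have "dst W g x I = 0" by (simp add: dst_def g0)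
     then show ?thesis by (simp add: dst)
    qed
   qed
   finally show ?thesis .
  qed
  then show ?thesis by (simp add: A_def ip_def power2_eq_square)
 qed
 have A0: "0 \<le> A" unfolding A_def by (rule ip_nonneg)
 define B where "B = (LBINT x. wt U V x * (nsq (Suc q) (g1 x)))"
 let ?Q = "\<lambda>x. wt U V x * Qf (hess W x) q (g1 x)"
 have Qm: "?Q \<in> borel_measurable borel" by (rule Qf_measurable[OF U W formL2D(3)[OF g1] Vc])
 have ag: "alt (g1 x)" for x by (rule formL2D(2)[OF g1])
 have Q0: "0 \<le> ?Q x" for x using Qpos ag by (cases "x \<in> U") auto
 \<comment> \<open>For fixed \<open>e\<close> the cut-offs tend to 1, and Fatou passes to the limit;
   the remainder multiplies \<open>B\<close>, the finite squared norm of g1, and disappears.\<close>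
 have step: "(\<integral>\<^sup>+x. ennreal (?Q x) \<partial>lborel) \<le> ennreal ((1 + e) * A)" if e: "0 < e" for e
 proof -
  define C where "C = 1 + 1 / e + (Suc (Suc q))\<^sup>2"
  have "0 \<le> C" using e by (simp add: C_def)
  then obtain d where d: "d \<longlonglongrightarrow> 0" and dl: "\<And>N x g. x \<in> U \<Longrightarrow> alt g \<Longrightarrow>
    C * ((\<Sum>j\<in>UNIV. (pd j (\<eta> N) x)\<^sup>2) * (nsq (Suc q) g)) \<le> (\<eta> N x)\<^sup>2 * Qf (hess k x) q g + d N * (nsq (Suc q) g)"
   using est by blast
  have le: "(\<integral>\<^sup>+x. ennreal ((\<eta> N x)\<^sup>2 * ?Q x) \<partial>lborel) \<le> ennreal ((1 + e) * A + d N * B)" for N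
  proof -
   have \<eta>N: "C1c U (\<eta> N)" "\<And>x. \<bar>\<eta> N x\<bar> \<le> 1" using \<eta> by auto
   obtain L where L: "L \<subseteq> U" "\<And>x. x \<notin> L \<Longrightarrow> \<eta> N x = 0" "\<And>x j. x \<notin> L \<Longrightarrow> pd j (\<eta> N) x = 0"
    using C1c_support[OF \<eta>N(1)] by metis
   let ?E = "\<lambda>x. (\<Sum>j\<in>UNIV. (pd j (\<eta> N) x)\<^sup>2) * (nsq (Suc q) (g1 x)) * exp (- V x)"
   let ?H = "\<lambda>x. (\<eta> N x)\<^sup>2 * Qf (hess V x) q (g1 x) * exp (- V x)"
   let ?R = "\<lambda>x. ?H x + d N * (wt U V x * (nsq (Suc q) (g1 x))) - C * ?E x"
   have i1: "integrable lborel ?H" and i2: "integrable lborel ?E"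
    and i3: "(LBINT x. ?H x) \<le> (1 + e) * A + C * (LBINT x. ?E x)"
    unfolding A C_def by (rule cutoff_estimate[OF U V g g1 cl co \<eta>N e]; assumption)+
   \<comment> \<open>The Hessian of V is that of W plus that of the extra weight, and by the
     absorption estimate the latter covers C times the gradient term up to d N. The subtracted term
     is what \<open>cutoff_estimate\<close> produces on the right, so it cancels after
     integration.\<close>
   have pt: "(\<eta> N x)\<^sup>2 * ?Q x \<le> ?R x" for x
   proof (cases "x \<in> U")
    case True
    have "(\<eta> N x)\<^sup>2 * Qf (hess W x) q (g1 x) \<le> (\<eta> N x)\<^sup>2 * Qf (hess V x) q (g1 x) + d N * (nsq (Suc q) (g1 x))
      - C * ((\<Sum>j\<in>UNIV. (pd j (\<eta> N) x)\<^sup>2) * (nsq (Suc q) (g1 x)))"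
     using dl[OF True ag[of x], of N] by (simp add: hV[OF True] Qf_add distrib_left)
    from mult_right_mono[OF this, of "exp (- V x)"] show ?thesis
     using True by (simp add: algebra_simps)
   next
    case False
    then have "x \<notin> L" using L(1) by blast
    then show ?thesis using False by (simp add: L)
   qed
   have iR: "integrable lborel ?R" using i1 i2 ig by simp
   have "(\<integral>\<^sup>+x. ennreal ((\<eta> N x)\<^sup>2 * ?Q x) \<partial>lborel) \<le> (\<integral>\<^sup>+x. ennreal (?R x) \<partial>lborel)"
    by (intro nn_integral_mono ennreal_leI pt)
   also have "\<dots> = ennreal (LBINT x. ?R x)"
    by (rule nn_integral_eq_integral[OF iR]) (use order_trans[OF mult_nonneg_nonneg[OF zero_le_power2 Q0] pt] in blast)
   also have "(LBINT x. ?R x) = (LBINT x. ?H x) + d N * B - C * (LBINT x. ?E x)"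
    using i1 i2 ig by (simp add: B_def)
   also have "ennreal \<dots> \<le> ennreal ((1 + e) * A + d N * B)"
    using i3 by (intro ennreal_leI) linarith
   finally show ?thesis .
  qed
  have "(\<integral>\<^sup>+x. ennreal (?Q x) \<partial>lborel) = (\<integral>\<^sup>+x. liminf (\<lambda>N. ennreal ((\<eta> N x)\<^sup>2 * ?Q x)) \<partial>lborel)"
  proof (rule nn_integral_cong)
   fix x
   have "\<forall>\<^sub>F N in sequentially. ennreal (?Q x) = ennreal ((\<eta> N x)\<^sup>2 * ?Q x)"
   proof (cases "x \<in> U")
    case True
    show ?thesis by (rule eventually_mono[OF bspec[OF ev True]]) simp
   qed simp
   then have "(\<lambda>N. ennreal ((\<eta> N x)\<^sup>2 * ?Q x)) \<longlonglongrightarrow> ennreal (?Q x)"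
    by (rule Lim_transform_eventually[OF tendsto_const])
   then show "ennreal (?Q x) = liminf (\<lambda>N. ennreal ((\<eta> N x)\<^sup>2 * ?Q x))"
    by (simp add: lim_imp_Liminf)
  qed
  also have "\<dots> \<le> liminf (\<lambda>N. \<integral>\<^sup>+x. ennreal ((\<eta> N x)\<^sup>2 * ?Q x) \<partial>lborel)"
  proof (rule nn_integral_liminf)
   fix N
   have "\<eta> N \<in> borel_measurable borel"
    using \<eta> by (intro borel_measurable_continuous_onI Cc_continuous_UNIV[OF C1c_Cc U]) blast
   then show "(\<lambda>x. ennreal ((\<eta> N x)\<^sup>2 * ?Q x)) \<in> borel_measurable lborel" using Qm by simp
  qed
  also have "\<dots> \<le> liminf (\<lambda>N. ennreal ((1 + e) * A + d N * B))"
   by (intro Liminf_mono always_eventually allI le)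
  also have "\<dots> = ennreal ((1 + e) * A)"
  proof (rule lim_imp_Liminf)
   have "(\<lambda>N. (1 + e) * A + d N * B) \<longlonglongrightarrow> (1 + e) * A + 0 * B"
    by (intro tendsto_intros d)
   then show "(\<lambda>N. ennreal ((1 + e) * A + d N * B)) \<longlonglongrightarrow> ennreal ((1 + e) * A)"
    by (intro tendsto_ennrealI) simp
  qed simp
  finally show ?thesis .
 qed
 have "(\<integral>\<^sup>+x. ennreal (?Q x) \<partial>lborel) \<le> ennreal A"
 proof (rule ennreal_le_epsilon)
  fix e :: real assume e: "0 < e"
  \<comment> \<open>The denominator A + 1 keeps the choice of the parameter meaningful for A =
    0.\<close>
  have "(\<integral>\<^sup>+x. ennreal (?Q x) \<partial>lborel) \<le> ennreal ((1 + e / (A + 1)) * A)"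
   by (rule step) (use e A0 in simp)
  also have "(1 + e / (A + 1)) * A \<le> A + e" using e A0 by (simp add: field_simps)
  finally show "(\<integral>\<^sup>+x. ennreal (?Q x) \<partial>lborel) \<le> ennreal A + ennreal e"
   using e A0 by (simp add: ennreal_leI)
 qed
 moreover have "\<forall>x\<in>U. W x \<le> V x" using k(2) by (simp add: V_def)
 moreover have "\<forall>x\<in>U. \<forall>l. g x l \<noteq> 0 \<longrightarrow> V x = W x"
  using k(3) g0 by (auto simp: V_def)
 ultimately show ?thesis using V g1 orth unfolding A_def by blast
qed

lemma formL2_mono:
 fixes W V :: "real^'n \<Rightarrow> real"
 assumes U: "open U" and W: "continuous_on U W" and V: "continuous_on U V"
  and le: "\<And>x. x \<in> U \<Longrightarrow> W x \<le> V x + B" and k: "formL2 U W p k"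
 shows "formL2 U V p k"
proof -
 have "sqi (wm U V) (\<lambda>x. k x l)" if l: "l \<in> LL p" for l
 proof -
  have m: "(\<lambda>x. k x l) \<in> borel_measurable borel" by (rule formL2D(3)[OF k])
  have "sqi (wm U W) (\<lambda>x. k x l)" by (rule L2FD[OF formL2D(4)[OF k] l])
  then have "integrable lborel (\<lambda>x. wt U W x * (k x l)\<^sup>2)"
   using wm_integrable[OF U W, of "\<lambda>x. (k x l)\<^sup>2"] m by (simp add: sqi_def)
  then have "integrable lborel (\<lambda>x. exp B * (wt U W x * (k x l)\<^sup>2))" by simp
  then have "integrable lborel (\<lambda>x. wt U V x * (k x l)\<^sup>2)"
  proof (rule Bochner_Integration.integrable_bound)
   show "(\<lambda>x. wt U V x * (k x l)\<^sup>2) \<in> borel_measurable lborel"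
    using weight_measurable[OF U V] m by simp
   show "AE x in lborel. norm (wt U V x * (k x l)\<^sup>2)
     \<le> norm (exp B * (wt U W x * (k x l)\<^sup>2))"
   proof (rule AE_I2)
    fix x
    have "exp (- V x) * (k x l)\<^sup>2 \<le> (exp B * exp (- W x)) * (k x l)\<^sup>2" if "x \<in> U"
     using le[OF that] by (intro mult_right_mono) (simp_all add: exp_add[symmetric])
    then show "norm (wt U V x * (k x l)\<^sup>2) \<le> norm (exp B * (wt U W x * (k x l)\<^sup>2))"
     by (cases "x \<in> U") (auto simp: mult.assoc)
   qed
  qed
  then show ?thesis using wm_integrable[OF U V, of "\<lambda>x. (k x l)\<^sup>2"] m
   by (simp add: sqi_def cong: measurable_cong_sets)
 qed
 then show ?thesis using k by (simp add: formL2_def L2F_def)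
qed

text \<open>The majorant \<open>A\<close> need not be measurable; \<open>h\<^sup>2 / Q\<close> is a measurable minorant of it.\<close>

lemma Cauchy_Schwarz_majorant:
 fixes h Q A :: "'a \<Rightarrow> real"
 assumes m: "h \<in> borel_measurable M" "Q \<in> borel_measurable M"
  and nn: "\<And>x. 0 \<le> h x" "\<And>x. 0 \<le> Q x" "0 \<le> a" "0 \<le> b"
  and le: "AE x in M. (h x)\<^sup>2 \<le> A x * Q x"
  and A: "(\<integral>\<^sup>+x. ennreal (A x) \<partial>M) \<le> ennreal (a\<^sup>2)" and Q: "(\<integral>\<^sup>+x. ennreal (Q x) \<partial>M) \<le> ennreal (b\<^sup>2)"
 shows "(\<integral>\<^sup>+x. ennreal (h x) \<partial>M) \<le> ennreal (a * b)"
proof -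
 note [measurable] = m
 let ?r = "\<lambda>x. h x / sqrt (Q x)"
 have "(\<integral>\<^sup>+x. ennreal (h x) \<partial>M) = (\<integral>\<^sup>+x. ennreal (?r x) * ennreal (sqrt (Q x)) \<partial>M)"
 proof (rule nn_integral_cong_AE)
  show "AE x in M. ennreal (h x) = ennreal (?r x) * ennreal (sqrt (Q x))"
   using le
  proof eventually_elim
   case (elim x)
   show ?case
   proof (cases "Q x = 0")
    case True
    then have "h x = 0" using elim by simp
    then show ?thesis by simp
   next
    case False
    then have "?r x * sqrt (Q x) = h x" using nn(2)[of x] by simp
    then show ?thesis using nn by (simp add: ennreal_mult[symmetric])
   qed
  qed
 qed
 also have "\<dots> ^ 2 \<le> (\<integral>\<^sup>+x. (ennreal (?r x))\<^sup>2 \<partial>M) * (\<integral>\<^sup>+x. (ennreal (sqrt (Q x)))\<^sup>2 \<partial>M)"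
  by (rule Cauchy_Schwarz_nn_integral) measurable
 also have "(\<integral>\<^sup>+x. (ennreal (sqrt (Q x)))\<^sup>2 \<partial>M) = (\<integral>\<^sup>+x. ennreal (Q x) \<partial>M)"
  using nn by (simp add: ennreal_power)
 also have "(\<integral>\<^sup>+x. (ennreal (?r x))\<^sup>2 \<partial>M) \<le> (\<integral>\<^sup>+x. ennreal (A x) \<partial>M)"
 proof (rule nn_integral_mono_AE)
  show "AE x in M. (ennreal (?r x))\<^sup>2 \<le> ennreal (A x)"
   using le
  proof eventually_elim
   case (elim x)
   have "(?r x)\<^sup>2 \<le> A x" if "Q x \<noteq> 0"
    using elim that nn(2)[of x] by (simp add: power_divide divide_le_eq)
   then show ?case using nn by (cases "Q x = 0") (simp_all add: ennreal_power ennreal_leI)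
  qed
 qed
 also have "\<dots> \<le> ennreal (a\<^sup>2)" by (rule A)
 also note Q
 finally have "(\<integral>\<^sup>+x. ennreal (h x) \<partial>M) ^ 2 \<le> ennreal (a\<^sup>2) * ennreal (b\<^sup>2)"
  by (simp add: mult_left_mono mult_right_mono)
 also have "\<dots> = (ennreal (a * b))\<^sup>2"
  using nn by (simp add: ennreal_mult[symmetric] ennreal_power power_mult_distrib)
 finally have *: "(\<integral>\<^sup>+x. ennreal (h x) \<partial>M)\<^sup>2 \<le> (ennreal (a * b))\<^sup>2" .
 show ?thesis
 proof (cases "\<integral>\<^sup>+x. ennreal (h x) \<partial>M")
  case (real r)
  then have "r\<^sup>2 \<le> (a * b)\<^sup>2" using * nn by (simp add: ennreal_power)
  then have "r \<le> a * b" by (rule power2_le_imp_le) (use nn in simp)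
  then show ?thesis using real by (simp add: ennreal_leI)
 next
  case top
  then show ?thesis using * nn by (simp add: ennreal_power top_unique)
 qed
qed

text \<open>\<open>A\<close> bounds the dual size of f pointwise with respect to the form of the
  Hessian of W. Its integral is known for the weight W and only decreases for V \<ge> W, while the
  energy of g1 is known for V.\<close>

lemma integral_pairing_bound:
 fixes f g1 :: "real^'n \<Rightarrow> 'n list \<Rightarrow> real"
 assumes U: "open U" and V: "C1_on U V" and W: "C2_on U W" and WV: "\<And>x. x \<in> U \<Longrightarrow> W x \<le> V x"
  and Qpos: "\<forall>x\<in>U. \<forall>g. alt g \<longrightarrow> 0 \<le> Qf (hess W x) q g"
  and f: "formL2 U V (Suc q) f" and g1: "formL2 U V (Suc q) g1"
  and le: "AE x in lborel. x \<in> U \<longrightarrow> (\<forall>g. alt g \<longrightarrow> (\<Sum>l\<in>LL (Suc q). f x l * g l)\<^sup>2 \<le> A x * Qf (hess W x) q g)"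
  and a: "0 \<le> a" "(\<integral>\<^sup>+x. ennreal (wt U W x * A x) \<partial>lborel) \<le> ennreal (a\<^sup>2)"
  and b: "0 \<le> b" "(\<integral>\<^sup>+x. ennreal (wt U V x * Qf (hess W x) q (g1 x)) \<partial>lborel) \<le> ennreal (b\<^sup>2)"
 shows "\<bar>ip (LL (Suc q)) (wm U V) g1 f\<bar> \<le> a * b"
proof -
 note Vc = C1_onD(1)[OF V]
 let ?w = "\<lambda>x. wt U V x"
 let ?S = "\<lambda>x. ?w x * (\<Sum>l\<in>LL (Suc q). f x l * g1 x l)"
 have w: "?w \<in> borel_measurable borel" by (rule weight_measurable[OF U Vc])
 have fm: "(\<lambda>x. f x l) \<in> borel_measurable borel" and gm: "(\<lambda>x. g1 x l) \<in> borel_measurable borel" for l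
  by (rule formL2D(3)[OF f] formL2D(3)[OF g1])+
 have i: "integrable lborel (\<lambda>x. ?w x * (g1 x l * f x l))" if "l \<in> LL (Suc q)" for l
  using sqi_mult_integrable[OF L2FD[OF formL2D(4)[OF g1] that] L2FD[OF formL2D(4)[OF f] that]]
   wm_integrable[OF U Vc, of "\<lambda>x. g1 x l * f x l"] fm gm by simp
 have Sm: "?S \<in> borel_measurable borel" using w fm gm by measurable
 have "ip (LL (Suc q)) (wm U V) g1 f = (\<Sum>l\<in>LL (Suc q). LBINT x. ?w x * (g1 x l * f x l))"
  unfolding ip_def by (intro sum.cong refl wm_integral[OF U Vc] borel_measurable_times fm gm)
 also have "\<dots> = (LBINT x. (\<Sum>l\<in>LL (Suc q). ?w x * (g1 x l * f x l)))"
  using i by (intro Bochner_Integration.integral_sum[symmetric])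
 also have "\<dots> = (LBINT x. ?S x)"
  by (simp only: sum_distrib_left mult.commute[of "g1 _ _"])
 finally have ipS: "ip (LL (Suc q)) (wm U V) g1 f = (LBINT x. ?S x)" .
 have iS: "integrable lborel ?S"
  using Bochner_Integration.integrable_sum[OF i] by (simp only: sum_distrib_left mult.commute[of "f _ _"])
 have ag: "alt (g1 x)" for x by (rule formL2D(2)[OF g1])
 have "(\<integral>\<^sup>+x. ennreal \<bar>?S x\<bar> \<partial>lborel) \<le> ennreal (a * b)"
 proof (rule Cauchy_Schwarz_majorant[where A = "\<lambda>x. ?w x * A x" and Q = "\<lambda>x. ?w x * Qf (hess W x) q (g1 x)"])
  show "(\<lambda>x. \<bar>?S x\<bar>) \<in> borel_measurable lborel" using Sm by simp
  show "(\<lambda>x. ?w x * Qf (hess W x) q (g1 x)) \<in> borel_measurable lborel"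
   using Qf_measurable[OF U W gm Vc] by simp
  show "0 \<le> ?w x * Qf (hess W x) q (g1 x)" for x
   using Qpos ag by (cases "x \<in> U") auto
  show "AE x in lborel. \<bar>?S x\<bar>\<^sup>2 \<le> ?w x * A x * (?w x * Qf (hess W x) q (g1 x))"
   using le
  proof eventually_elim
   case (elim x)
   show ?case
   proof (cases "x \<in> U")
    case True
    then have "(\<Sum>l\<in>LL (Suc q). f x l * g1 x l)\<^sup>2 \<le> A x * Qf (hess W x) q (g1 x)" using elim ag by blast
    then have "(?w x)\<^sup>2 * (\<Sum>l\<in>LL (Suc q). f x l * g1 x l)\<^sup>2 \<le> (?w x)\<^sup>2 * (A x * Qf (hess W x) q (g1 x))"
     by (intro mult_left_mono) auto
    then show ?thesis by (simp add: power_mult_distrib power2_eq_square mult_ac)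
   qed simp
  qed
  have "ennreal (?w x * A x) \<le> ennreal (wt U W x * A x)" for x
  proof (cases "x \<in> U \<and> 0 \<le> A x")
   case True
   then show ?thesis using WV[of x] by (intro ennreal_leI mult_right_mono) auto
  next
   case False
   then have "?w x * A x \<le> 0" by (auto simp: mult_le_0_iff indicator_def)
   then show ?thesis by (simp add: ennreal_neg)
  qed
  then have "(\<integral>\<^sup>+x. ennreal (?w x * A x) \<partial>lborel) \<le> (\<integral>\<^sup>+x. ennreal (wt U W x * A x) \<partial>lborel)"
   by (intro nn_integral_mono)
  also note a(2)
  finally show "(\<integral>\<^sup>+x. ennreal (?w x * A x) \<partial>lborel) \<le> ennreal (a\<^sup>2)" .
 qed (use a b in auto)
 then have "ennreal (LBINT x. \<bar>?S x\<bar>) \<le> ennreal (a * b)"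
  using nn_integral_eq_integral[OF integrable_abs[OF iS]] by simp
 then have "(LBINT x. \<bar>?S x\<bar>) \<le> a * b" using a(1) b(1) by simp
 then show ?thesis unfolding ipS using integral_abs_bound[of lborel ?S] by linarith
qed

text \<open>The right side comes in two pieces with separate majorants because their dual norms add:
  the bound is (a1 + a2)^2, as in the triangle inequality, and this linear dependence is what lets a
  norm of the solution occurring in a2 be absorbed later. Only the sum has to be closed.\<close>

lemma solve_on_sublevel:
 fixes f1 f2 :: "real^'n \<Rightarrow> 'n list \<Rightarrow> real"
 assumes sd: "sublevel_domain q U c r" and W: "C2_on U W" and Qpos: "\<forall>x\<in>U. \<forall>g. alt g \<longrightarrow> 0 \<le> Qf (hess W x) q g"
  and f1: "formL2 U W (Suc q) f1" and f2: "formL2 U W (Suc q) f2"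
  and cl: "wd (Suc q) U (\<lambda>x l. f1 x l + f2 x l) (\<lambda>x l. 0)"
  and le1: "AE x in lborel. x \<in> U \<longrightarrow> (\<forall>g. alt g \<longrightarrow> (\<Sum>l\<in>LL (Suc q). f1 x l * g l)\<^sup>2 \<le> A1 x * Qf (hess W x) q g)"
  and le2: "AE x in lborel. x \<in> U \<longrightarrow> (\<forall>g. alt g \<longrightarrow> (\<Sum>l\<in>LL (Suc q). f2 x l * g l)\<^sup>2 \<le> A2 x * Qf (hess W x) q g)"
  and a1: "0 \<le> a1" "(\<integral>\<^sup>+x. ennreal (wt U W x * A1 x) \<partial>lborel) \<le> ennreal (a1\<^sup>2)"
  and a2: "0 \<le> a2" "(\<integral>\<^sup>+x. ennreal (wt U W x * A2 x) \<partial>lborel) \<le> ennreal (a2\<^sup>2)"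
 shows "\<exists>u. formL2 U W q u \<and> nrm2 (LL q) (wm U W) u \<le> ((a1 + a2) / Suc q)\<^sup>2 \<and> wd q U u (\<lambda>x l. f1 x l + f2 x l)"
proof -
 have U: "open U" using sd by (simp add: sublevel_domain_def)
 have W1: "C1_on U W" using W by (simp add: C2_on_def)
 note Wc = C1_onD(1)[OF W1]
 let ?f = "\<lambda>x l. f1 x l + f2 x l"
 have f: "formL2 U W (Suc q) ?f" using formL2_lincomb[OF f1 f2, of 1] by simp
 show ?thesis
 proof (rule solve_from_bound[OF U W1 formL2D(2)[OF f] formL2_loc2[OF U Wc f]])
  show "0 \<le> (a1 + a2) / real (Suc q)" using a1 a2 by simp
  fix g :: "real^'n \<Rightarrow> 'n list \<Rightarrow> real" assume g: "testform (Suc q) U g"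
  define b where "b = sqrt (nrm2 (LL q) (wm U W) (dst W g))"
  have b: "0 \<le> b" "b\<^sup>2 = nrm2 (LL q) (wm U W) (dst W g)" by (simp_all add: b_def ip_nonneg)
  obtain V g1 where V: "C2_on U V" "\<forall>x\<in>U. W x \<le> V x" "\<forall>x\<in>U. \<forall>l. g x l \<noteq> 0 \<longrightarrow> V x = W x"
   and g1: "formL2 U V (Suc q) g1"
   and orth: "\<forall>k. formL2 U V (Suc q) k \<and> wd (Suc q) U k (\<lambda>x l. 0) \<longrightarrow> ip (LL (Suc q)) (wm U V) g1 k = ip (LL (Suc q)) (wm U V) g k"
   and en: "(\<integral>\<^sup>+x. ennreal (wt U V x * Qf (hess W x) q (g1 x)) \<partial>lborel) \<le> ennreal (b\<^sup>2)"
   using closed_energy[OF sd W Qpos g, folded b(2)] by (elim exE conjE) (rule that; assumption)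
  have V1: "C1_on U V" using V by (simp add: C2_on_def)
  note Vc = C1_onD(1)[OF V1]
  have mono: "formL2 U V (Suc q) k" if "formL2 U W (Suc q) k" for k
   by (rule formL2_mono[OF U Wc Vc _ that, of 0]) (use V(2) in simp)
  have gC: "C1c U (\<lambda>x. g x l)" for l using g by (simp add: testform_def)
  have out: "g x l = 0" if "x \<notin> U" for x l using gC[of l] that by (auto simp: C1c_def)
  have "(\<Sum>l\<in>LL (Suc q). LBINT x. ?f x l * g x l * exp (- W x))
    = (\<Sum>l\<in>LL (Suc q). LBINT x. ?f x l * g x l * exp (- V x))"
  proof (intro sum.cong refl Bochner_Integration.integral_cong)
   fix l x
   show "?f x l * g x l * exp (- W x) = ?f x l * g x l * exp (- V x)"
    using V(3) out[of x l] by (cases "x \<in> U \<and> g x l \<noteq> 0") auto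
  qed
  also have "\<dots> = ip (LL (Suc q)) (wm U V) ?f g"
   unfolding ip_def by (intro sum.cong refl wm_integral_Cc[OF U Vc C1c_Cc[OF gC], symmetric] formL2D(3)[OF f])
  \<comment> \<open>The sum of the two pieces is itself a closed form of the larger weighted space,
    so g may be replaced by its projection g1 onto closed forms.\<close>
  also have "\<dots> = ip (LL (Suc q)) (wm U V) g1 ?f"
   using orth mono[OF f] cl by (simp add: ip_commute[of _ _ ?f])
  also have "\<dots> = ip (LL (Suc q)) (wm U V) g1 f1 + ip (LL (Suc q)) (wm U V) g1 f2"
   using ip_add_left[OF formL2D(4)[OF mono[OF f1]] formL2D(4)[OF mono[OF f2]] formL2D(4)[OF g1]]
   by (simp only: ip_commute[of _ _ g1])
  finally have e: "(\<Sum>l\<in>LL (Suc q). LBINT x. ?f x l * g x l * exp (- W x))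
    = ip (LL (Suc q)) (wm U V) g1 f1 + ip (LL (Suc q)) (wm U V) g1 f2" .
  have "\<bar>ip (LL (Suc q)) (wm U V) g1 f1\<bar> \<le> a1 * b"
   by (rule integral_pairing_bound[OF U V1 W _ Qpos mono[OF f1] g1 le1 a1 b(1) en]) (use V(2) in auto)
  moreover have "\<bar>ip (LL (Suc q)) (wm U V) g1 f2\<bar> \<le> a2 * b"
   by (rule integral_pairing_bound[OF U V1 W _ Qpos mono[OF f2] g1 le2 a2 b(1) en]) (use V(2) in auto)
  ultimately have "\<bar>ip (LL (Suc q)) (wm U V) g1 f1 + ip (LL (Suc q)) (wm U V) g1 f2\<bar> \<le> (a1 + a2) * b"
   by (simp add: distrib_right)
  then show "\<bar>\<Sum>l\<in>LL (Suc q). \<integral>x. ?f x l * g x l * exp (- W x) \<partial>lborel\<bar>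
    \<le> real (Suc q) * ((a1 + a2) / real (Suc q)) * sqrt (nrm2 (LL q) (wm U W) (dst W g))"
   unfolding e b_def[symmetric] by simp
 qed
qed

subsection \<open>The exponential twist and the theorem\<close>

lemma eps_self: "distinct l \<Longrightarrow> eps l l = 1"
proof (induction l)
 case (Cons i l)
 have "(if l ! s = i then eps l (i # take s l @ drop (Suc s) l) else 0) = 0" if "s < length l" for s
  using Cons.prems that by auto
 then have "wdg (\<lambda>k J. if k = i then eps l (i # J) else 0) l = 0"
  unfolding wdg_eq_sum by (intro sum.neutral ballI) simp
 then show ?case using Cons by simp
qed simp

text \<open>Positivity on p-forms is tested with the basis form that belongs to p distinct vectors
  of an eigenbasis: there the quadratic form is a positive multiple of the sum of their eigenvalues.
  As \<open>p_psd\<close> speaks of every eigenbasis, the basis is arbitrary.\<close>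

lemma p_psdI:
 fixes H :: "real^'n^'n"
 assumes sym: "transpose H = H" and nn: "\<And>g. alt g \<Longrightarrow> 0 \<le> Qf H q g"
 shows "p_psd (Suc q) H"
proof -
 have "0 \<le> sum lam S"
  if on: "\<And>i j. b i \<bullet> b j = (if i = j then 1 else 0)" and eig: "\<And>i. H *v b i = lam i *\<^sub>R b i"
   and S: "card S = Suc q" for b :: "'n \<Rightarrow> real^'n" and lam S
 proof -
  let ?b = "\<lambda>j. \<chi> i. b i $ j"
  obtain L where L: "set L = S" "distinct L" using finite_distinct_list[of S] by auto
  then have lL: "length L = Suc q" using S distinct_card by metis
  define w where "w M = sum_list (map lam M)" for M
  have on': "?b i \<bullet> ?b j = (if i = j then 1 else 0)" for i j
   using orthonormal_columns[OF on, of i j] by (simp add: inner_vec_def)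
  have bb: "(\<lambda>j. \<chi> i. ?b i $ j) = b" by (simp add: fun_eq_iff vec_eq_iff)
  \<comment> \<open>The transposed frame turns the coordinate form of \<open>L\<close> into the form
    whose coefficients in the frame \<open>b\<close> are \<open>eps L\<close>.\<close>
  define g where "g = tr ?b (eps L)"
  have ag: "alt g" unfolding g_def by (rule alt_tr[OF alt_eps])
  have trg: "tr b g M = eps L M" for M
   using tr_inverse[OF on', of "eps L" M] unfolding bb g_def .
  have "alt (\<lambda>M. w M * eps L M)"
  proof (rule altI)
   fix xs x y ys
   have "w (xs @ x # y # ys) = w (xs @ y # x # ys)" by (simp add: w_def)
   then show "w (xs @ x # y # ys) * eps L (xs @ x # y # ys) = - (w (xs @ y # x # ys) * eps L (xs @ y # x # ys))"
    using altD[OF alt_eps, of L xs x y ys] by simp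
  qed
  from eps_pairing[OF this, of L]
  have "(\<Sum>M\<in>LL (Suc q). eps L M * (w M * eps L M)) = fact (Suc q) * w L"
   by (simp only: lL eps_self[OF L(2)] mult_1_right)
  moreover have "(\<Sum>M\<in>LL (Suc q). tr b (Fop H g) M * tr b g M) = Suc q * Qf H q g"
   unfolding tr_parseval[OF on] by (rule Fop_Qf[OF ag])
  ultimately have "fact (Suc q) * w L = Suc q * Qf H q g"
   unfolding tr_Fop[OF sym eig] trg w_def[symmetric] by (simp only: mult_ac)
  moreover have "0 \<le> real (Suc q) * Qf H q g" by (intro mult_nonneg_nonneg nn ag) simp
  ultimately have "0 \<le> fact (Suc q) * w L" by (simp only:)
  then have "0 \<le> w L" by (metis fact_gt_zero zero_le_mult_iff not_less)
  moreover have "w L = sum lam S" unfolding w_def using L by (simp add: sum_list_distinct_conv_sum_set)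
  ultimately show ?thesis by simp
 qed
 then show ?thesis using sym unfolding p_psd_def by blast
qed

lemma hess_norm_sq:
 fixes U :: "(real^'n) set"
 assumes U: "open U"
 shows "C2_on U (\<lambda>x. \<Sum>j\<in>UNIV. (x $ j)\<^sup>2)" "hess (\<lambda>x :: real^'n. \<Sum>j\<in>UNIV. (x $ j)\<^sup>2) x = mat 2"
proof -
 let ?s = "\<lambda>x :: real^'n. \<Sum>j\<in>UNIV. (x $ j)\<^sup>2"
 have h: "hpd i ?s (2 * x $ i) x" for i x
 proof -
  have "hpd i (\<lambda>x. \<Sum>j\<in>UNIV. x $ j * x $ j) (\<Sum>j\<in>UNIV. (if i = j then 1 else 0) * x $ j + x $ j * (if i = j then 1 else 0)) x"
   by (intro hpd_sum hpd_mult hpd_coord)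
  then show ?thesis by (simp add: power2_eq_square sum.distrib if_distrib if_distribR cong: if_cong)
 qed
 have p: "pd i ?s = (\<lambda>x. 2 * x $ i)" for i by (rule ext) (rule hpd_pd[OF h])
 have "C1_on U ?s" by (intro C1_on_sum) (auto simp: power2_eq_square intro!: C1_on_mult C1_on_coord)
 then show "C2_on U ?s" unfolding C2_on_def p by (intro conjI allI C1_on_cmult C1_on_coord)
 have "pd i (\<lambda>x :: real^'n. 2 * x $ j) x = (if i = j then 2 else 0)" for i j
 proof -
  have "hpd i (\<lambda>x :: real^'n. 2 * x $ j) (2 * (if i = j then 1 else 0)) x" by (intro hpd_cmult hpd_coord)
  then show ?thesis using hpd_pd by fastforce
 qed
 then show "hess ?s x = mat 2" by (simp add: hess_def p mat_def vec_eq_iff)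
qed

text \<open>Adding |x|^2 makes the exhaustion strictly positive, its Hessian being 2 times the
  identity, and only shrinks the sublevel sets, to closed subsets of compact ones.\<close>

lemma p_convex_exhaustion:
 fixes \<Omega> :: "(real^'n) set"
 assumes "p_convex (Suc q) \<Omega>"
 shows "\<exists>r. C2_on \<Omega> r \<and> (\<forall>c. compact {x\<in>\<Omega>. r x \<le> c}) \<and>
  (\<forall>x g. x \<in> \<Omega> \<longrightarrow> alt g \<longrightarrow> 2 * (nsq (Suc q) g) \<le> Qf (hess r x) q g)"
proof -
 obtain r0 where O: "open \<Omega>" and r0: "smooth_on \<Omega> r0" "p_psh (Suc q) \<Omega> r0" "\<And>c. compact {x\<in>\<Omega>. r0 x \<le> c}"
  using assms by (auto simp: p_convex_def)
 let ?s = "\<lambda>x :: real^'n. \<Sum>j\<in>UNIV. (x $ j)\<^sup>2"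
 have C: "C2_on \<Omega> r0" using r0(2) Ck_on_2_C2_on by (auto simp: p_psh_def)
 note s = hess_norm_sq(1)[OF O]
 have r: "C2_on \<Omega> (\<lambda>x. r0 x + ?s x)" by (rule hess_add(1)[OF O C s])
 have rc: "continuous_on \<Omega> (\<lambda>x. r0 x + ?s x)" using r by (auto simp: C2_on_def C1_on_def)
 show ?thesis
 proof (intro exI conjI allI impI, rule r)
  fix c
  let ?K = "{x\<in>\<Omega>. r0 x \<le> c}"
  have "closed (?K \<inter> (\<lambda>x. r0 x + ?s x) -` {..c})"
   by (rule continuous_closed_preimage)
    (use r0(3) rc in \<open>auto intro: compact_imp_closed continuous_on_subset\<close>)
  then have "compact (?K \<inter> (?K \<inter> (\<lambda>x. r0 x + ?s x) -` {..c}))" by (intro compact_Int_closed r0)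
  moreover have "?K \<inter> (?K \<inter> (\<lambda>x. r0 x + ?s x) -` {..c}) = {x\<in>\<Omega>. r0 x + ?s x \<le> c}"
  proof -
   have s0: "0 \<le> ?s x" for x by (intro sum_nonneg) simp
   have "r0 x \<le> c" if "r0 x + ?s x \<le> c" for x using that s0[of x] by linarith
   then show ?thesis by auto
  qed
  ultimately show "compact {x\<in>\<Omega>. r0 x + ?s x \<le> c}" by simp
 next
  fix x g assume x: "x \<in> \<Omega>" and g: "alt (g :: 'n list \<Rightarrow> real)"
  have "0 \<le> Qf (hess r0 x) q g" using Qf_nonneg[OF _ g] r0(2) x by (auto simp: p_psh_def)
  then show "2 * (nsq (Suc q) g) \<le> Qf (hess (\<lambda>x. r0 x + ?s x) x) q g"
   by (simp add: hess_add(2)[OF O C s x] hess_norm_sq(2)[OF O] Qf_add Qf_mat)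
 qed
qed

text \<open>The gradient bound up to the level c comes from compactness of {r \<le> c} inside
  \<Omega>.\<close>

lemma sublevel_domainI:
 fixes \<Omega> :: "(real^'n) set"
 assumes O: "open \<Omega>" and r: "C2_on \<Omega> r" and K: "\<And>c. compact {x\<in>\<Omega>. r x \<le> c}"
  and Q: "\<And>x g. x \<in> \<Omega> \<Longrightarrow> alt g \<Longrightarrow> 2 * (nsq (Suc q) g) \<le> Qf (hess r x) q g"
 shows "sublevel_domain q {x\<in>\<Omega>. r x < c} c r"
proof -
 let ?U = "{x\<in>\<Omega>. r x < c}"
 have r1: "C1_on \<Omega> r" using r by (simp add: C2_on_def)
 have "open (\<Omega> \<inter> r -` {..<c})" by (rule continuous_open_preimage[OF C1_onD(1)[OF r1] O open_lessThan])
 moreover have "\<Omega> \<inter> r -` {..<c} = ?U" by auto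
 ultimately have "open ?U" by simp
 moreover have "C2_on ?U r" by (rule C2_on_subset[OF r]) auto
 moreover have "compact {x \<in> ?U. r x \<le> t}" if "t < c" for t
 proof -
  have "{x \<in> ?U. r x \<le> t} = {x\<in>\<Omega>. r x \<le> t}" using that by auto
  then show ?thesis using K by simp
 qed
 moreover have "\<exists>B\<ge>0. \<forall>x\<in>?U. (\<Sum>j\<in>UNIV. (pd j r x)\<^sup>2) \<le> B"
 proof -
  have "continuous_on \<Omega> (\<lambda>x. \<Sum>j\<in>UNIV. (pd j r x)\<^sup>2)"
   by (intro continuous_intros C1_onD(2)[OF r1])
  then have "bounded ((\<lambda>x. \<Sum>j\<in>UNIV. (pd j r x)\<^sup>2) ` {x\<in>\<Omega>. r x \<le> c})"
   by (intro compact_imp_bounded compact_continuous_image K) (auto intro: continuous_on_subset)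
  then obtain B where "\<And>x. x \<in> {x\<in>\<Omega>. r x \<le> c} \<Longrightarrow> \<bar>\<Sum>j\<in>UNIV. (pd j r x)\<^sup>2\<bar> \<le> B"
   unfolding bounded_real by blast
  then have "\<forall>x\<in>?U. (\<Sum>j\<in>UNIV. (pd j r x)\<^sup>2) \<le> max B 0" by force
  then show ?thesis by (intro exI[of _ "max B 0"]) simp
 qed
 ultimately show ?thesis using Q unfolding sublevel_domain_def by blast
qed

section \<open>Weights on relatively compact sets, and multiplication by exponentials\<close>

lemma formL2_relatively_compact:
 fixes W :: "real^'n \<Rightarrow> real"
 assumes U: "open U" and K: "compact K" "U \<subseteq> K" "K \<subseteq> \<Omega>" and W: "continuous_on \<Omega> W"
  and k: "\<And>x. altform p (k x)" "\<And>l. loc2 \<Omega> (\<lambda>x. k x l)"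
 shows "formL2 U W p k"
proof -
 have Wc: "continuous_on U W" using W K by (auto intro: continuous_on_subset)
 obtain B where B: "\<And>x. \<bar>indicator K x * exp (- W x)\<bar> \<le> B"
  using indicator_compact_bounded(2)[OF continuous_on_exp_uminus[OF W] K(1,3)] by blast
 have m: "(\<lambda>x. k x l) \<in> borel_measurable borel" for l using k(2) by (simp add: loc2_def)
 have "sqi (wm U W) (\<lambda>x. k x l)" for l
 proof -
  have "integrable lborel (\<lambda>x. B * (indicator K x * (k x l)\<^sup>2))" using k(2)[of l] K by (simp add: loc2_def)
  then have "integrable lborel (\<lambda>x. wt U W x * (k x l)\<^sup>2)"
  proof (rule Bochner_Integration.integrable_bound)
   show "(\<lambda>x. wt U W x * (k x l)\<^sup>2) \<in> borel_measurable lborel"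
    using weight_measurable[OF U Wc] m by simp
   show "AE x in lborel. norm (wt U W x * (k x l)\<^sup>2) \<le> norm (B * (indicator K x * (k x l)\<^sup>2))"
   proof (rule AE_I2)
    fix x
    have "exp (- W x) * (k x l)\<^sup>2 \<le> B * (k x l)\<^sup>2" "0 \<le> B" if "x \<in> U"
     using B[of x] order_trans[OF abs_ge_zero B[of x]] that K(2) by (auto intro!: mult_right_mono)
    then show "norm (wt U W x * (k x l)\<^sup>2) \<le> norm (B * (indicator K x * (k x l)\<^sup>2))"
     using K(2) by (cases "x \<in> U") (auto simp: abs_mult)
   qed
  qed
  then show ?thesis using wm_integrable[OF U Wc, of "\<lambda>x. (k x l)\<^sup>2"] m
   by (simp add: sqi_def cong: measurable_cong_sets)
 qed
 then show ?thesis using k m by (simp add: formL2_def L2F_def)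
qed

lemma formL2_change_weight:
 fixes W V :: "real^'n \<Rightarrow> real"
 assumes U: "open U" and K: "compact K" "U \<subseteq> K" "K \<subseteq> \<Omega>" and W: "continuous_on \<Omega> W" "continuous_on \<Omega> V"
  and k: "formL2 U W p k"
 shows "formL2 U V p k"
proof -
 have "continuous_on \<Omega> (\<lambda>x. W x - V x)" by (intro continuous_intros W)
 then have "bounded ((\<lambda>x. W x - V x) ` K)"
  using K by (intro compact_imp_bounded compact_continuous_image) (auto intro: continuous_on_subset)
 then obtain B where "\<And>x. x \<in> K \<Longrightarrow> \<bar>W x - V x\<bar> \<le> B" unfolding bounded_real by blast
 then have le: "W x \<le> V x + B" if "x \<in> U" for x using K(2) that by fastforce
 show ?thesis
  by (rule formL2_mono[OF U _ _ le k]) (use W K in \<open>auto intro: continuous_on_subset\<close>)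
qed

lemma altform_cmult: "altform p u \<Longrightarrow> altform p (\<lambda>l. c * u l)"
 using altform_lincomb[OF altform_zero, of p u c] by simp

lemma altform_wdg:
 assumes "\<And>j. altform q (a j)" shows "altform (Suc q) (wdg a)"
proof -
 have "wdg a l = 0" if "length l \<noteq> Suc q" for l
  unfolding wdg_eq_sum
 proof (intro sum.neutral ballI)
  fix s assume "s \<in> {..<length l}"
  then have "length (take s l @ drop (Suc s) l) \<noteq> q" using that by auto
  then show "(-1) ^ s * a (l ! s) (take s l @ drop (Suc s) l) = 0" using assms by (simp add: altform_iff)
 qed
 moreover have "alt (wdg a)" using assms by (intro alt_wdg) (simp add: altform_iff)
 ultimately show ?thesis by (simp add: altform_iff)
qed

lemma formL2_mult:
 assumes k: "formL2 U W p k" and E: "E \<in> borel_measurable borel" "\<And>x. \<bar>E x\<bar> \<le> B"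
 shows "formL2 U W p (\<lambda>x l. E x * k x l)"
 using k E sqi_mult_bounded(1)[of "wm U W" _ E B]
 unfolding formL2_def L2F_def by (auto intro!: altform_cmult borel_measurable_times cong: measurable_cong_sets)

lemma formL2_wdg:
 fixes P :: "'n::finite \<Rightarrow> real^'n \<Rightarrow> real"
 assumes k: "formL2 U W q k" and P: "\<And>j. P j \<in> borel_measurable borel" "\<And>j x. \<bar>P j x\<bar> \<le> B"
 shows "formL2 U W (Suc q) (\<lambda>x. wdg (\<lambda>j J. P j x * k x J))"
proof -
 have Pk: "formL2 U W q (\<lambda>x J. P j x * k x J)" for j by (rule formL2_mult[OF k P])
 have s: "sqi (wm U W) (\<lambda>x. P j x * k x J)" for j J
  using L2FD[OF formL2D(4)[OF Pk]] formL2D(5)[OF k] sqi_zero by (cases "J \<in> LL q") auto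
 have "sqi (wm U W) (\<lambda>x. wdg (\<lambda>j J. P j x * k x J) l)" for l
  unfolding wdg_eq_sum by (intro sqi_sum sqi_cmult s) simp
 moreover from this have "(\<lambda>x. wdg (\<lambda>j J. P j x * k x J) l) \<in> borel_measurable borel" for l
  by (rule sqi_wm_borel)
 ultimately show ?thesis
  using altform_wdg[of q "\<lambda>j J. P j x * k x J" for x] formL2D(1)[OF k] altform_cmult
  unfolding formL2_def L2F_def by blast
qed

text \<open>The Leibniz rule d(e^{c psi} u) = e^{c psi} du + c d psi wedge e^{c psi} u. The
  functions \<open>E\<close> and \<open>P\<close> are only required to agree on \<open>U\<close>
  with the exponential and the derivatives, so that they can be extended by zero to globally bounded
  Borel functions.\<close>

lemma wd_exp_mult:
 fixes u f :: "real^'n \<Rightarrow> 'n list \<Rightarrow> real"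
 assumes U: "open U" and u: "\<And>l. loc2 U (\<lambda>x. u x l)" and f: "\<And>l. loc2 U (\<lambda>x. f x l)" and wd: "wd q U u f"
  and \<psi>: "C1_on U \<psi>"
  and E: "\<And>x. x \<in> U \<Longrightarrow> E x = exp (c * \<psi> x)" and P: "\<And>x j. x \<in> U \<Longrightarrow> P j x = pd j \<psi> x"
 shows "wd q U (\<lambda>x l. E x * u x l) (\<lambda>x l. E x * f x l + c * wdg (\<lambda>j J. P j x * (E x * u x J)) l)"
 unfolding wd_def wdiv_def
proof (intro ballI allI impI)
 fix l :: "'n list" and h assume l: "l \<in> LL (Suc q)" and h: "C1c U h"
 let ?e = "\<lambda>x. exp (c * \<psi> x)"
 have e: "C1_on U ?e"
  by (rule C1_on_compose[OF C1_on_cmult[OF \<psi>], of exp exp]) (auto intro!: continuous_intros)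
 have pe: "pd j ?e x = ?e x * (c * pd j \<psi> x)" if "x \<in> U" for j x
  using pd_compose[OF C1_on_cmult[OF \<psi>] that, of exp "exp (c * \<psi> x)" c j] pd_cmult[OF \<psi> that, of j c] by simp
 obtain K where K: "K \<subseteq> U" "\<And>x. x \<notin> K \<Longrightarrow> h x = 0" "\<And>x j. x \<notin> K \<Longrightarrow> pd j h x = 0"
  using C1c_support[OF h] by metis
 have w: "wdiv U (dA u l) (\<lambda>x. f x l)" using wd l by (simp add: wd_def)
 have 1: "dA (\<lambda>x l. E x * u x l) l j x * pd j h x = ?e x * dA u l j x * pd j h x" for j x
  using K(1) K(3)[of x j] E[of x] by (cases "x \<in> K") (auto simp: dA_scale)
 have 2: "(E x * f x l + c * wdg (\<lambda>j J. P j x * (E x * u x J)) l) * h x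
   = (?e x * f x l + (\<Sum>j\<in>UNIV. pd j ?e x * dA u l j x)) * h x" for x
 proof (cases "x \<in> K")
  case True
  then have x: "x \<in> U" using K(1) by blast
  have "(\<Sum>j\<in>UNIV. pd j ?e x * dA u l j x) = (\<Sum>j\<in>UNIV. (c * pd j \<psi> x) * dA (\<lambda>x l. E x * u x l) l j x)"
   by (simp add: dA_scale pe[OF x] E[OF x] mult_ac)
  also have "\<dots> = c * (\<Sum>j\<in>UNIV. P j x * dA (\<lambda>x l. E x * u x l) l j x)"
   by (simp add: sum_distrib_left P[OF x] mult.assoc)
  also have "\<dots> = c * wdg (\<lambda>j J. P j x * (E x * u x J)) l" unfolding dA_wdg ..
  finally show ?thesis by (simp add: E[OF x])
 qed (simp add: K)
 show "(\<Sum>j\<in>UNIV. LBINT x. dA (\<lambda>x l. E x * u x l) l j x * pd j h x)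
   = - (LBINT x. (E x * f x l + c * wdg (\<lambda>j J. P j x * (E x * u x J)) l) * h x)"
  unfolding 1 2 by (rule wdiv_mult[OF w U loc2_dA[OF u] f e h])
qed

lemma wd_subset: "wd q V u f \<Longrightarrow> U \<subseteq> V \<Longrightarrow> wd q U u f"
 unfolding wd_def wdiv_def using C1c_mono by blast

lemma nrm2_lborel:
 assumes U: "open U" and W: "continuous_on U W" and v: "formL2 U W q v"
 shows "integrable lborel (\<lambda>x. wt U W x * (nsq q (v x)))"
  "(LBINT x. wt U W x * (nsq q (v x))) = nrm2 (LL q) (wm U W) v"
proof -
 have m: "(\<lambda>x. (v x l)\<^sup>2) \<in> borel_measurable borel" for l using formL2D(3)[OF v] by simp
 have i: "integrable lborel (\<lambda>x. wt U W x * (v x l)\<^sup>2)" if "l \<in> LL q" for l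
  using L2FD[OF formL2D(4)[OF v] that] wm_integrable[OF U W m] by (simp add: sqi_def)
 show "integrable lborel (\<lambda>x. wt U W x * (nsq q (v x)))"
  unfolding sum_distrib_left using i by (intro Bochner_Integration.integrable_sum)
 have "(LBINT x. wt U W x * (nsq q (v x)))
   = (\<Sum>l\<in>LL q. LBINT x. wt U W x * (v x l)\<^sup>2)"
  unfolding sum_distrib_left using i by (intro Bochner_Integration.integral_sum)
 also have "\<dots> = nrm2 (LL q) (wm U W) v"
  unfolding ip_def using wm_integral[OF U W m] by (intro sum.cong refl) (simp add: power2_eq_square)
 finally show "(LBINT x. wt U W x * (nsq q (v x))) = nrm2 (LL q) (wm U W) v" .
qed

lemma nrm2_nn_lborel:
 assumes U: "open U" and W: "continuous_on U W" and v: "formL2 U W q v" and c: "0 \<le> c"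
 shows "(\<integral>\<^sup>+x. ennreal (wt U W x * (c * (nsq q (v x)))) \<partial>lborel) = ennreal (c * nrm2 (LL q) (wm U W) v)"
proof -
 have e: "wt U W x * (c * (nsq q (v x))) = c * (wt U W x * (nsq q (v x)))" for x
  by simp
 have "integrable lborel (\<lambda>x. c * (wt U W x * (nsq q (v x))))"
  using nrm2_lborel(1)[OF U W v] by simp
 from nn_integral_eq_integral[OF this] show ?thesis
  unfolding e integral_mult_right_zero nrm2_lborel(2)[OF U W v]
  using c by (simp add: sum_nonneg)
qed

text \<open>Existence is obtained without regard to constants: the weight |x|^2 has the Hessian 2
  times the identity and solves the equation for every closed square integrable form on
  \<open>U\<close>. On a relatively compact set the weights are comparable, so the solution may be
  projected in the weight W.\<close>

lemma minimal_solution: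
 fixes f :: "real^'n \<Rightarrow> 'n list \<Rightarrow> real"
 assumes sd: "sublevel_domain q U c r" and K: "compact K" "U \<subseteq> K" "K \<subseteq> \<Omega>" and W: "continuous_on \<Omega> W"
  and f: "\<And>x. altform (Suc q) (f x)" "\<And>l. loc2 \<Omega> (\<lambda>x. f x l)" and cl: "wd (Suc q) \<Omega> f (\<lambda>x l. 0)"
 shows "\<exists>u. formL2 U W q u \<and> wd q U u f \<and>
  (\<forall>k. formL2 U W q k \<and> wd q U k (\<lambda>x l. 0) \<longrightarrow> ip (LL q) (wm U W) u k = 0)"
proof -
 have U: "open U" using sd by (simp add: sublevel_domain_def)
 have UO: "U \<subseteq> \<Omega>" using K by blast
 define S :: "real^'n \<Rightarrow> real" where "S x = (\<Sum>j\<in>UNIV. (x $ j)\<^sup>2)" for x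
 have S: "C2_on X S" "hess S x = mat 2" if "open X" for X x
  unfolding S_def[abs_def] using hess_norm_sq[OF that] by auto
 have Sc: "continuous_on X S" if "open X" for X using S(1)[OF that] by (simp add: C2_on_def C1_on_def)
 have SO: "continuous_on \<Omega> S" using Sc[OF open_UNIV] continuous_on_subset by blast
 have fU: "formL2 U V (Suc q) f" if "continuous_on \<Omega> V" for V
  by (rule formL2_relatively_compact[OF U K that f])
 define a where "a = sqrt (1 / 2 * nrm2 (LL (Suc q)) (wm U S) f)"
 have "\<exists>u. formL2 U S q u \<and> nrm2 (LL q) (wm U S) u \<le> ((a + 0) / real (Suc q))\<^sup>2 \<and> wd q U u (\<lambda>x l. f x l + 0)"
 proof (rule solve_on_sublevel[OF sd S(1)[OF U] _ fU[OF SO] formL2_zero,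
    where ?A1.0 = "\<lambda>x. 1 / 2 * (nsq (Suc q) (f x))" and ?A2.0 = "\<lambda>x. 0"])
  show "\<forall>x\<in>U. \<forall>g. alt g \<longrightarrow> 0 \<le> Qf (hess S x) q g"
   by (simp add: S(2)[OF U] Qf_mat sum_nonneg)
  show "wd (Suc q) U (\<lambda>x l. f x l + 0) (\<lambda>x l. 0)" using wd_subset[OF cl UO] by simp
  have "(\<Sum>l\<in>LL (Suc q). f x l * g l)\<^sup>2 \<le> 1 / 2 * (nsq (Suc q) (f x)) * Qf (hess S x) q g" for x g
   using Cauchy_Schwarz_ineq_sum[of "f x" g "LL (Suc q)"] by (simp add: S(2)[OF U] Qf_mat)
  then show "AE x in lborel. x \<in> U \<longrightarrow> (\<forall>g. alt g \<longrightarrow>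
    (\<Sum>l\<in>LL (Suc q). f x l * g l)\<^sup>2 \<le> 1 / 2 * (nsq (Suc q) (f x)) * Qf (hess S x) q g)"
   by (intro AE_I2 impI allI)
  show "0 \<le> a" by (simp add: a_def ip_nonneg)
  show "(\<integral>\<^sup>+x. ennreal (wt U S x * (1 / 2 * (nsq (Suc q) (f x)))) \<partial>lborel) \<le> ennreal (a\<^sup>2)"
   unfolding nrm2_nn_lborel[OF U Sc[OF U] fU[OF SO], of "1 / 2", simplified zero_le_divide_1_iff, OF zero_le_numeral]
   by (simp add: a_def ip_nonneg)
 qed auto
 then obtain u0 where u0: "formL2 U S q u0" "wd q U u0 f" by auto
 have Wc: "continuous_on U W" using W UO by (rule continuous_on_subset)
 have u1: "formL2 U W q u0" by (rule formL2_change_weight[OF U K SO W u0(1)])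
 obtain g1 where g1: "formL2 U W q g1" "wd q U g1 (\<lambda>x l. 0)"
  and orth: "\<forall>k. formL2 U W q k \<and> wd q U k (\<lambda>x l. 0) \<longrightarrow> ip (LL q) (wm U W) g1 k = ip (LL q) (wm U W) u0 k"
  using closed_projection[OF U Wc u1] by blast
 \<comment> \<open>Subtracting the projection onto closed forms does not change du and makes u
   orthogonal to all of them, which is minimality.\<close>
 define u where "u x l = u0 x l + (-1) * g1 x l" for x l
 have fu: "formL2 U W q u" unfolding u_def[abs_def] by (rule formL2_lincomb[OF u1 g1(1)])
 have "wd q U u (\<lambda>x l. f x l + (-1) * (\<lambda>x l. 0) x l)"
  unfolding u_def[abs_def]
  by (rule wd_lincomb[OF U formL2_loc2[OF U Wc u1] formL2_loc2[OF U Wc g1(1)] formL2_loc2[OF U Wc fU[OF W]] _ u0(2) g1(2)])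
   (rule loc2_zero)
 then have "wd q U u f" by simp
 moreover have "ip (LL q) (wm U W) u k = 0" if k: "formL2 U W q k" "wd q U k (\<lambda>x l. 0)" for k
 proof -
  have "ip (LL q) (wm U W) u k = ip (LL q) (wm U W) u0 k - ip (LL q) (wm U W) g1 k"
   unfolding u_def[abs_def] using ip_diff_left[OF formL2D(4)[OF u1] formL2D(4)[OF g1(1)] formL2D(4)[OF k(1)]] by simp
  then show ?thesis using orth k by simp
 qed
 ultimately show ?thesis using fu by blast
qed

text \<open>By adjointness the wedge with \<open>P\<close> moves to a contraction of
  \<open>g\<close> with \<open>P\<close>, and Cauchy-Schwarz separates \<open>v\<close> from it. For
  P the gradient of psi the last factor is what the Hessian form of psi dominates.\<close>

lemma wedge_pairing_bound:
 fixes g v :: "'n::finite list \<Rightarrow> real" and P :: "'n \<Rightarrow> real"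
 assumes g: "alt g"
 shows "(\<Sum>l\<in>LL (Suc q). wdg (\<lambda>j J. P j * v J) l * g l)\<^sup>2
  \<le> (Suc q)\<^sup>2 * (nsq q v) * (\<Sum>I\<in>LL q. (\<Sum>j\<in>UNIV. P j * g (j # I))\<^sup>2)"
proof -
 have "(\<Sum>j\<in>UNIV. \<Sum>I\<in>LL q. P j * v I * g (j # I)) = (\<Sum>I\<in>LL q. v I * (\<Sum>j\<in>UNIV. P j * g (j # I)))"
  by (subst sum.swap) (simp add: sum_distrib_left mult_ac)
 then have "(\<Sum>l\<in>LL (Suc q). wdg (\<lambda>j J. P j * v J) l * g l) = Suc q * (\<Sum>I\<in>LL q. v I * (\<Sum>j\<in>UNIV. P j * g (j # I)))"
  unfolding wdg_adjoint[OF g] by simp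
 moreover have "(\<Sum>I\<in>LL q. v I * (\<Sum>j\<in>UNIV. P j * g (j # I)))\<^sup>2
   \<le> (nsq q v) * (\<Sum>I\<in>LL q. (\<Sum>j\<in>UNIV. P j * g (j # I))\<^sup>2)"
  by (rule Cauchy_Schwarz_ineq_sum)
 then have "(Suc q)\<^sup>2 * (\<Sum>I\<in>LL q. v I * (\<Sum>j\<in>UNIV. P j * g (j # I)))\<^sup>2
   \<le> (Suc q)\<^sup>2 * ((nsq q v) * (\<Sum>I\<in>LL q. (\<Sum>j\<in>UNIV. P j * g (j # I))\<^sup>2))"
  by (rule mult_left_mono) simp
 ultimately show ?thesis by (simp add: power_mult_distrib mult.assoc del: of_nat_Suc)
qed

text \<open>The two assumptions amount to X \<le> a/n + c X, which can be solved for X as c <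
  1.\<close>

lemma bound_from_self_bound:
 fixes X Y a n c :: real
 assumes "0 \<le> X" "0 \<le> a" "0 < n" "c < 1" "0 \<le> c" and 1: "X\<^sup>2 \<le> X * sqrt Y" and 2: "Y \<le> ((a + c * n * X) / n)\<^sup>2"
 shows "X \<le> (a / n) / (1 - c)"
proof (cases "X = 0")
 case True
 then show ?thesis using assms by simp
next
 case False
 then have X: "0 < X" using assms by simp
 have "sqrt Y \<le> (a + c * n * X) / n"
  using real_sqrt_le_mono[OF 2] assms by simp
 moreover have "X \<le> sqrt Y" using 1 X by (simp add: power2_eq_square)
 ultimately have "X \<le> a / n + c * X" using assms(3) by (simp add: add_divide_distrib)
 then have "X * (1 - c) \<le> a / n" by (simp add: algebra_simps)
 then show ?thesis using assms(4) by (subst pos_le_divide_eq) simp_all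
qed

text \<open>The twisted right side contains the unknown solution itself through the term with d psi;
  its contribution to the estimate is c times the norm of the twisted solution and is absorbed. The
  final bound depends on neither \<open>U\<close> nor its level, as the passage to \<Omega>
  requires.\<close>

lemma local_solution:
 fixes f :: "real^'n \<Rightarrow> 'n list \<Rightarrow> real" and \<alpha> :: real
 assumes sd: "sublevel_domain q U c0 r" and K: "compact K" "U \<subseteq> K" "K \<subseteq> \<Omega>"
  and \<phi>: "C2_on \<Omega> \<phi>" and \<psi>: "C2_on \<Omega> \<psi>"
  and Q\<phi>: "\<And>x g. x \<in> \<Omega> \<Longrightarrow> alt g \<Longrightarrow> 0 \<le> Qf (hess \<phi> x) q g"
  and Q\<psi>: "\<And>x g. x \<in> \<Omega> \<Longrightarrow> alt g \<Longrightarrow> (\<Sum>I\<in>LL q. (\<Sum>j\<in>UNIV. pd j \<psi> x * g (j # I))\<^sup>2) \<le> Qf (hess \<psi> x) q g"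
  and f: "\<And>x. altform (Suc q) (f x)" "\<And>l. loc2 \<Omega> (\<lambda>x. f x l)" and cl: "wd (Suc q) \<Omega> f (\<lambda>x l. 0)"
  and A: "\<And>x. 0 \<le> A x"
  and le: "AE x in lborel. x \<in> \<Omega> \<longrightarrow> (\<forall>g. alt g \<longrightarrow> (\<Sum>l\<in>LL (Suc q). f x l * g l)\<^sup>2 \<le> A x * Qf (hess \<psi> x) q g)"
  and a: "0 \<le> a" "(\<integral>\<^sup>+x. ennreal (indicator \<Omega> x * exp (- (\<phi> x - \<alpha> * \<psi> x)) * A x) \<partial>lborel) \<le> ennreal (a\<^sup>2)"
  and \<alpha>: "0 \<le> \<alpha>" "\<alpha> < 1"
 shows "\<exists>u. formL2 U (\<lambda>x. \<phi> x - \<alpha> * \<psi> x) q u \<and> wd q U u f \<and>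
  sqrt (nrm2 (LL q) (wm U (\<lambda>x. \<phi> x - \<alpha> * \<psi> x)) u) \<le> 2 / (1 - \<alpha>) * (a / Suc q)"
proof -
 have U: "open U" using sd by (simp add: sublevel_domain_def)
 have UO: "U \<subseteq> \<Omega>" using K by blast
 have \<phi>1: "C1_on \<Omega> \<phi>" and \<psi>1: "C1_on \<Omega> \<psi>" using \<phi> \<psi> by (auto simp: C2_on_def)
 note \<phi>c = C1_onD(1)[OF \<phi>1] and \<psi>c = C1_onD(1)[OF \<psi>1]
 have \<psi>U: "C1_on U \<psi>" using \<psi>1 UO by (rule C1_on_subset)
 \<comment> \<open>Two requirements fix c: the weight psi combined with twice the exponent must
   leave psi to the power 2c - 1 = \<alpha> in the exponent, and c < 1 is needed for absorption;
   then 1/(1 - c) = 2/(1 - \<alpha>).\<close>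
 define c where "c = (1 + \<alpha>) / 2"
 define W where "W x = \<phi> x + \<psi> x" for x
 define W1 where "W1 x = \<phi> x + (1 - c) * \<psi> x" for x
 let ?w = "\<lambda>x. \<phi> x - \<alpha> * \<psi> x"
 have WO: "continuous_on \<Omega> W" and W1O: "continuous_on \<Omega> W1" and wO: "continuous_on \<Omega> ?w"
  unfolding W_def[abs_def] W1_def[abs_def] by (intro continuous_intros \<phi>c \<psi>c)+
 have Wc: "continuous_on U W" and W1c: "continuous_on U W1" and wc: "continuous_on U ?w"
  using WO W1O wO UO continuous_on_subset by blast+
 obtain u where u: "formL2 U W1 q u" "wd q U u f"
  and orth: "\<And>k. formL2 U W1 q k \<Longrightarrow> wd q U k (\<lambda>x l. 0) \<Longrightarrow> ip (LL q) (wm U W1) u k = 0"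
  using minimal_solution[OF sd K W1O f cl] by blast
 have uw: "formL2 U ?w q u" by (rule formL2_change_weight[OF U K W1O wO u(1)])
 have uW: "formL2 U W q u" by (rule formL2_change_weight[OF U K W1O WO u(1)])
 have fW: "formL2 U W (Suc q) f" by (rule formL2_relatively_compact[OF U K WO f])
 \<comment> \<open>Both multipliers are cut to \<open>U\<close>. They come from functions continuous
   on \<Omega>, so they are bounded on the compact set \<open>K\<close> and hence
   everywhere.\<close>
 define E where "E x = indicator U x * exp (c * \<psi> x)" for x
 define P where "P j x = indicator U x * pd j \<psi> x" for j x
 have Em: "E \<in> borel_measurable borel"
  unfolding E_def[abs_def] using weight_measurable[OF U, of "\<lambda>x. - (c * \<psi> x)"] C1_onD(1)[OF \<psi>U]
  by (simp add: continuous_intros)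
 have Pm: "P j \<in> borel_measurable borel" for j
  unfolding P_def[abs_def] using borel_measurable_continuous_on_indicator[OF _ C1_onD(2)[OF \<psi>U]] U by (simp add: borel_open)
 have "continuous_on \<Omega> (\<lambda>x. exp (c * \<psi> x))" by (intro continuous_intros \<psi>c)
 from indicator_compact_bounded(2)[OF this K(1,3)]
 obtain B where B: "\<And>x. \<bar>indicator K x * exp (c * \<psi> x)\<bar> \<le> B" by blast
 have EB: "\<bar>E x\<bar> \<le> B" for x
  using B[of x] K(2) order_trans[OF abs_ge_zero B[of x]] by (cases "x \<in> U") (auto simp: E_def)
 have "continuous_on \<Omega> (\<lambda>x. \<Sum>j\<in>UNIV. \<bar>pd j \<psi> x\<bar>)" by (intro continuous_intros C1_onD(2)[OF \<psi>1])
 from indicator_compact_bounded(2)[OF this K(1,3)]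
 obtain B' where B': "\<And>x. \<bar>indicator K x * (\<Sum>j\<in>UNIV. \<bar>pd j \<psi> x\<bar>)\<bar> \<le> B'" by blast
 have PB: "\<bar>P j x\<bar> \<le> B'" for j x
 proof (cases "x \<in> U")
  case True
  have "\<bar>pd j \<psi> x\<bar> \<le> (\<Sum>j\<in>UNIV. \<bar>pd j \<psi> x\<bar>)" by (rule member_le_sum) auto
  then show ?thesis using B'[of x] True K(2) by (auto simp: P_def)
 next
  case False
  then show ?thesis using order_trans[OF abs_ge_zero B'[of x]] by (simp add: P_def)
 qed
 define v where "v x l = E x * u x l" for x l
 define f1 where "f1 x l = E x * f x l" for x l
 define f2 where "f2 x l = c * wdg (\<lambda>j J. P j x * v x J) l" for x l
 have v: "formL2 U W q v" unfolding v_def[abs_def] by (rule formL2_mult[OF uW Em EB])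
 have f1: "formL2 U W (Suc q) f1" unfolding f1_def[abs_def] by (rule formL2_mult[OF fW Em EB])
 have f2: "formL2 U W (Suc q) f2"
  unfolding f2_def[abs_def]
  using formL2_mult[OF formL2_wdg[OF v Pm PB], of "\<lambda>x. c" "\<bar>c\<bar>"] by simp
 have dv: "wd q U v (\<lambda>x l. f1 x l + f2 x l)"
  unfolding v_def f1_def f2_def
  by (rule wd_exp_mult[OF U formL2_loc2[OF U Wc uW] formL2_loc2[OF U Wc fW] u(2) \<psi>U]) (simp_all add: E_def P_def)
 have f12: "formL2 U W (Suc q) (\<lambda>x l. f1 x l + f2 x l)" using formL2_lincomb[OF f1 f2, of 1] by simp
 have cl12: "wd (Suc q) U (\<lambda>x l. f1 x l + f2 x l) (\<lambda>x l. 0)"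
  by (rule wd_dd[OF U formL2_loc2[OF U Wc v] formL2_loc2[OF U Wc f12] dv])
 define X where "X = sqrt (nrm2 (LL q) (wm U W) v)"
 have X: "0 \<le> X" "X\<^sup>2 = nrm2 (LL q) (wm U W) v" by (simp_all add: X_def ip_nonneg)
 have hW: "hess W x = hess \<phi> x + hess \<psi> x" if "x \<in> U" for x
  unfolding W_def[abs_def] by (rule hess_add(2)[OF U C2_on_subset[OF \<phi> UO] C2_on_subset[OF \<psi> UO] that])
 have W2: "C2_on U W"
  unfolding W_def[abs_def] by (rule hess_add(1)[OF U C2_on_subset[OF \<phi> UO] C2_on_subset[OF \<psi> UO]])
 have Q\<psi>0: "0 \<le> Qf (hess \<psi> x) q g" if "x \<in> \<Omega>" "alt g" for x g
  by (rule order_trans[OF _ Q\<psi>[OF that]]) (simp add: sum_nonneg)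
 have QW: "Qf (hess \<psi> x) q g \<le> Qf (hess W x) q g" if "x \<in> U" "alt g" for x g
  using Q\<phi>[OF _ that(2), of x] that(1) UO by (simp add: hW Qf_add subset_iff)
 have c01: "0 \<le> c" "c < 1" using \<alpha> by (auto simp: c_def)
 have "\<exists>v'. formL2 U W q v' \<and> nrm2 (LL q) (wm U W) v' \<le> ((a + c * Suc q * X) / Suc q)\<^sup>2 \<and>
   wd q U v' (\<lambda>x l. f1 x l + f2 x l)"
 \<comment> \<open>The first majorant is that of f, scaled by the square of the exponential. The
   second comes from \<open>wedge_pairing_bound\<close> and from the domination of the squared
   contraction with the gradient by the Hessian form of psi; its integral is the square of c (q + 1)
   X with X the norm of v.\<close>
 proof (rule solve_on_sublevel[OF sd W2 _ f1 f2 cl12, where ?A1.0 = "\<lambda>x. (E x)\<^sup>2 * A x"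
    and ?A2.0 = "\<lambda>x. (c * Suc q)\<^sup>2 * (nsq q (v x))"])
  show "\<forall>x\<in>U. \<forall>g. alt g \<longrightarrow> 0 \<le> Qf (hess W x) q g"
   using QW Q\<psi>0 UO order_trans by blast
  show "AE x in lborel. x \<in> U \<longrightarrow> (\<forall>g. alt g \<longrightarrow> (\<Sum>l\<in>LL (Suc q). f1 x l * g l)\<^sup>2 \<le> (E x)\<^sup>2 * A x * Qf (hess W x) q g)"
   using le
  proof eventually_elim
   case (elim x)
   show ?case
   proof (intro impI allI)
    fix g assume x: "x \<in> U" and g: "alt (g :: 'n list \<Rightarrow> real)"
    have "(\<Sum>l\<in>LL (Suc q). f1 x l * g l)\<^sup>2 = (E x)\<^sup>2 * (\<Sum>l\<in>LL (Suc q). f x l * g l)\<^sup>2"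
     by (simp add: f1_def sum_distrib_left[symmetric] mult.assoc power_mult_distrib)
    also have "\<dots> \<le> (E x)\<^sup>2 * (A x * Qf (hess \<psi> x) q g)"
     using elim x g UO by (intro mult_left_mono) auto
    also have "\<dots> \<le> (E x)\<^sup>2 * (A x * Qf (hess W x) q g)"
     by (intro mult_left_mono QW x g A) simp
    finally show "(\<Sum>l\<in>LL (Suc q). f1 x l * g l)\<^sup>2 \<le> (E x)\<^sup>2 * A x * Qf (hess W x) q g" by (simp add: mult.assoc)
   qed
  qed
  show "AE x in lborel. x \<in> U \<longrightarrow> (\<forall>g. alt g \<longrightarrow> (\<Sum>l\<in>LL (Suc q). f2 x l * g l)\<^sup>2
    \<le> (c * Suc q)\<^sup>2 * (nsq q (v x)) * Qf (hess W x) q g)"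
  proof (intro AE_I2 impI allI)
   fix x g assume x: "x \<in> U" and g: "alt (g :: 'n list \<Rightarrow> real)"
   have "(\<Sum>l\<in>LL (Suc q). f2 x l * g l)\<^sup>2 = c\<^sup>2 * (\<Sum>l\<in>LL (Suc q). wdg (\<lambda>j J. P j x * v x J) l * g l)\<^sup>2"
    by (simp add: f2_def sum_distrib_left[symmetric] mult.assoc power_mult_distrib)
   also have "\<dots> \<le> c\<^sup>2 * ((Suc q)\<^sup>2 * (nsq q (v x)) * (\<Sum>I\<in>LL q. (\<Sum>j\<in>UNIV. P j x * g (j # I))\<^sup>2))"
    by (intro mult_left_mono wedge_pairing_bound g) simp
   also have "\<dots> = (c * Suc q)\<^sup>2 * (nsq q (v x)) * (\<Sum>I\<in>LL q. (\<Sum>j\<in>UNIV. P j x * g (j # I))\<^sup>2)"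
    by (simp only: power_mult_distrib mult.assoc of_nat_power)
   also have "\<dots> \<le> (c * Suc q)\<^sup>2 * (nsq q (v x)) * Qf (hess W x) q g"
   proof (rule mult_left_mono)
    have "(\<Sum>I\<in>LL q. (\<Sum>j\<in>UNIV. P j x * g (j # I))\<^sup>2) \<le> Qf (hess \<psi> x) q g"
     using Q\<psi>[OF _ g, of x] x UO by (auto simp: P_def)
    then show "(\<Sum>I\<in>LL q. (\<Sum>j\<in>UNIV. P j x * g (j # I))\<^sup>2) \<le> Qf (hess W x) q g"
     using QW[OF x g] by linarith
    show "0 \<le> (c * Suc q)\<^sup>2 * (nsq q (v x))" by (intro mult_nonneg_nonneg sum_nonneg) auto
   qed
   finally show "(\<Sum>l\<in>LL (Suc q). f2 x l * g l)\<^sup>2 \<le> (c * Suc q)\<^sup>2 * (nsq q (v x)) * Qf (hess W x) q g" .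
  qed
  show "0 \<le> c * Suc q * X" using c01 X(1) by simp
  have "(\<integral>\<^sup>+x. ennreal (wt U W x * ((c * Suc q)\<^sup>2 * (nsq q (v x)))) \<partial>lborel)
    = ennreal ((c * Suc q)\<^sup>2 * X\<^sup>2)"
   unfolding X(2) by (rule nrm2_nn_lborel[OF U Wc v]) simp
  then show "(\<integral>\<^sup>+x. ennreal (wt U W x * ((c * Suc q)\<^sup>2 * (nsq q (v x)))) \<partial>lborel)
    \<le> ennreal ((c * Suc q * X)\<^sup>2)"
   by (simp only: power_mult_distrib order_refl)
  \<comment> \<open>The exponents add up to -(\<phi> + \<psi>) + 2 c \<psi> = -(\<phi> - \<alpha>
    \<psi>), so the first majorant has the integral given by hypothesis.\<close>
  have "wt U W x * ((E x)\<^sup>2 * A x) \<le> wt \<Omega> ?w x * A x" for x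
  proof (cases "x \<in> U")
   case True
   have "exp (- W x) * (exp (c * \<psi> x))\<^sup>2 = exp (- ?w x)"
    unfolding W_def c_def power2_eq_square exp_add[symmetric] by (simp add: field_simps)
   then have e: "exp (- W x) * ((exp (c * \<psi> x))\<^sup>2 * A x) = exp (- ?w x) * A x"
    by (simp only: mult.assoc[symmetric])
   have "x \<in> \<Omega>" using True UO by blast
   then have "wt U W x * ((E x)\<^sup>2 * A x) = exp (- W x) * ((exp (c * \<psi> x))\<^sup>2 * A x)"
    "wt \<Omega> ?w x * A x = exp (- ?w x) * A x"
    using True by (simp_all add: E_def)
   then show ?thesis by (simp only: e order_refl)
  next
   case False
   then show ?thesis using A by simp
  qed
  then have "(\<integral>\<^sup>+x. ennreal (wt U W x * ((E x)\<^sup>2 * A x)) \<partial>lborel)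
    \<le> (\<integral>\<^sup>+x. ennreal (wt \<Omega> ?w x * A x) \<partial>lborel)"
   by (intro nn_integral_mono ennreal_leI)
  also note a(2)
  finally show "(\<integral>\<^sup>+x. ennreal (wt U W x * ((E x)\<^sup>2 * A x)) \<partial>lborel) \<le> ennreal (a\<^sup>2)" .
 qed (rule a)
 then obtain v' where v': "formL2 U W q v'" "nrm2 (LL q) (wm U W) v' \<le> ((a + c * Suc q * X) / Suc q)\<^sup>2"
  and dv': "wd q U v' (\<lambda>x l. f1 x l + f2 x l)" by blast
 \<comment> \<open>One factor e^{c psi} turns the weight of \<open>W\<close> into that of
   \<open>W1\<close>, so the inner product of v with k for \<open>W\<close> is that of u with k for
   \<open>W1\<close>; v inherits from u the orthogonality to closed forms.\<close>
 have vk: "ip (LL q) (wm U W) v k = 0" if k: "formL2 U W q k" "wd q U k (\<lambda>x l. 0)" for k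
 proof -
  have "(\<integral>x. v x l * k x l \<partial>wm U W) = (\<integral>x. u x l * k x l \<partial>wm U W1)" for l
  proof -
   have m: "(\<lambda>x. v x l * k x l) \<in> borel_measurable borel" "(\<lambda>x. u x l * k x l) \<in> borel_measurable borel"
    using formL2D(3)[OF v, of l] formL2D(3)[OF k(1), of l] formL2D(3)[OF u(1), of l] by auto
   have "wt U W x * (v x l * k x l) = wt U W1 x * (u x l * k x l)" for x
   proof (cases "x \<in> U")
    case True
    have "exp (- W x) * exp (c * \<psi> x) = exp (- W1 x)"
     unfolding W_def W1_def exp_add[symmetric] by (simp add: algebra_simps)
    then have "exp (- W x) * (exp (c * \<psi> x) * (u x l * k x l)) = exp (- W1 x) * (u x l * k x l)"
     by (simp only: mult.assoc[symmetric])
    then show ?thesis using True by (simp add: v_def E_def mult.assoc)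
   qed simp
   then show ?thesis unfolding wm_integral[OF U Wc m(1)] wm_integral[OF U W1c m(2)] by (intro Bochner_Integration.integral_cong refl)
  qed
  then have "ip (LL q) (wm U W) v k = ip (LL q) (wm U W1) u k" unfolding ip_def by simp
  then show ?thesis using orth[OF formL2_change_weight[OF U K WO W1O k(1)] k(2)] by simp
 qed
 \<comment> \<open>v and the estimated solution v' have the same derivative, so their difference is
   closed and orthogonal to v. Hence the squared norm of v is its inner product with v', and v is no
   longer than v'.\<close>
 define k where "k x l = v x l + (-1) * v' x l" for x l
 have k: "formL2 U W q k" unfolding k_def[abs_def] by (rule formL2_lincomb[OF v v'(1)])
 have "wd q U k (\<lambda>x l. (f1 x l + f2 x l) + (-1) * (f1 x l + f2 x l))"
  unfolding k_def[abs_def]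
  by (rule wd_lincomb[OF U formL2_loc2[OF U Wc v] formL2_loc2[OF U Wc v'(1)]
     formL2_loc2[OF U Wc f12] formL2_loc2[OF U Wc f12] dv dv'])
 then have "wd q U k (\<lambda>x l. 0)" by simp
 then have "ip (LL q) (wm U W) v k = 0" by (rule vk[OF k])
 then have "ip (LL q) (wm U W) k v = 0" by (simp only: ip_commute[of _ _ k])
 then have "nrm2 (LL q) (wm U W) v - ip (LL q) (wm U W) v' v = 0"
  unfolding k_def[abs_def] using ip_diff_left[OF formL2D(4)[OF v] formL2D(4)[OF v'(1)] formL2D(4)[OF v]] by simp
 then have "X\<^sup>2 = ip (LL q) (wm U W) v v'" by (simp add: X(2) ip_commute[of _ _ v'])
 also have "\<dots> \<le> X * sqrt (nrm2 (LL q) (wm U W) v')"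
  using ip_Cauchy_Schwarz_sqrt[OF formL2D(4)[OF v] formL2D(4)[OF v'(1)]] unfolding X_def by linarith
 finally have XX: "X\<^sup>2 \<le> X * sqrt (nrm2 (LL q) (wm U W) v')" .
 have "X \<le> (a / Suc q) / (1 - c)"
  by (rule bound_from_self_bound[OF X(1) a(1) _ c01(2,1) XX v'(2)]) simp
 also have "\<dots> = 2 / (1 - \<alpha>) * (a / Suc q)"
  using \<alpha> by (simp add: c_def field_simps)
 finally have XB: "X \<le> 2 / (1 - \<alpha>) * (a / Suc q)" .
 \<comment> \<open>The same count of exponents, 2c - 1 = \<alpha>, turns the norm of v into the norm
   of u in the statement.\<close>
 have "nrm2 (LL q) (wm U ?w) u = nrm2 (LL q) (wm U W) v"
 proof -
  have "(\<integral>x. u x l * u x l \<partial>wm U ?w) = (\<integral>x. v x l * v x l \<partial>wm U W)" for l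
  proof -
   have m: "(\<lambda>x. v x l * v x l) \<in> borel_measurable borel" "(\<lambda>x. u x l * u x l) \<in> borel_measurable borel"
    using formL2D(3)[OF v, of l] formL2D(3)[OF u(1), of l] by auto
   have "wt U ?w x * (u x l * u x l) = wt U W x * (v x l * v x l)" for x
   proof (cases "x \<in> U")
    case True
    have e: "exp (- W x) * (exp (c * \<psi> x) * exp (c * \<psi> x)) = exp (- ?w x)"
     unfolding W_def c_def exp_add[symmetric] by (simp add: field_simps)
    show ?thesis using True e[symmetric] by (simp add: v_def E_def)
   qed simp
   then show ?thesis unfolding wm_integral[OF U Wc m(1)] wm_integral[OF U wc m(2)] by (intro Bochner_Integration.integral_cong refl)
  qed
  then show ?thesis unfolding ip_def by simp
 qed
 then have "sqrt (nrm2 (LL q) (wm U ?w) u) \<le> 2 / (1 - \<alpha>) * (a / Suc q)" using XB by (simp add: X_def)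
 then show ?thesis using uw u(2) by blast
qed

section \<open>From Lebesgue measurable forms on \<Omega> to Borel forms on the whole space and
  back\<close>

lemma borel_lebesgue: "f \<in> borel_measurable borel \<Longrightarrow> f \<in> borel_measurable (completion lborel)"
 by (rule measurable_completion) simp

text \<open>Each coefficient has a Borel version, but the versions need not alternate together.
  Setting the form to 0 on a Borel null set that contains all points of disagreement restores
  alternation everywhere.\<close>

lemma borel_version:
 fixes f :: "real^'n \<Rightarrow> 'n list \<Rightarrow> real"
 assumes O: "open \<Omega>" and f: "measurable_form p \<Omega> f"
 obtains h where "\<And>x. altform p (h x)" "\<And>l. (\<lambda>x. h x l) \<in> borel_measurable borel"
  "AE x in lborel. x \<in> \<Omega> \<longrightarrow> h x = f x"
proof -
 have O': "\<Omega> \<inter> space lebesgue \<in> sets lebesgue" using O by simp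
 have "\<exists>b. b \<in> borel_measurable lborel \<and> (AE x in lborel. indicator \<Omega> x *\<^sub>R f x l = b x)" for l
 proof -
  have "(\<lambda>x. indicator \<Omega> x *\<^sub>R f x l) \<in> borel_measurable lebesgue"
   using f borel_measurable_restrict_space_iff[OF O', THEN iffD1] unfolding measurable_form_def by blast
  then show ?thesis using completion_ex_borel_measurable_real by blast
 qed
 then obtain b where b: "\<And>l. b l \<in> borel_measurable lborel"
  "\<And>l. AE x in lborel. indicator \<Omega> x *\<^sub>R f x l = b l x" by metis
 have "AE x in lborel. \<forall>l\<in>LL p. indicator \<Omega> x *\<^sub>R f x l = b l x"
  using b(2) by (intro AE_finite_allI) auto
 from AE_E[OF this] obtain N where N: "{x\<in>space lborel. \<not> (\<forall>l\<in>LL p. indicator \<Omega> x *\<^sub>R f x l = b l x)} \<subseteq> N"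
  "emeasure lborel N = 0" "N \<in> sets lborel" .
 define h where "h x l = indicator (\<Omega> - N) x * (if l \<in> LL p then b l x else 0)" for x l
 have h: "h x = (if x \<in> \<Omega> - N then f x else (\<lambda>l. 0))" for x
 proof (cases "x \<in> \<Omega> - N")
  case True
  then have af: "altform p (f x)" using f by (simp add: measurable_form_def)
  have e: "\<forall>l\<in>LL p. indicator \<Omega> x *\<^sub>R f x l = b l x"
  proof (rule ccontr)
   assume "\<not> ?thesis"
   then have "x \<in> N" using N(1) unfolding space_lborel space_borel by blast
   then show False using True by blast
  qed
  have "h x l = f x l" for l
  proof (cases "l \<in> LL p")
   case l: True
   then show ?thesis using bspec[OF e l] True by (simp add: h_def)
  next
   case False
   then show ?thesis using af by (simp add: h_def altform_iff LL_def)
  qed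
  then show ?thesis using True by auto
 qed (auto simp: h_def)
 show thesis
 proof
  show "altform p (h x)" for x using f altform_zero by (auto simp: h measurable_form_def)
  show "(\<lambda>x. h x l) \<in> borel_measurable borel" for l
   unfolding h_def using b(1)[of l] O N(3) by (cases "l \<in> LL p") (auto simp: borel_open intro!: borel_measurable_times borel_measurable_indicator sets.Diff)
  have "AE x in lborel. x \<notin> N" using N by (intro AE_not_in) (simp add: null_sets_def)
  then show "AE x in lborel. x \<in> \<Omega> \<longrightarrow> h x = f x" by eventually_elim (simp add: h)
 qed
qed

lemma lebesgue_on_pairing:
 fixes f h :: "real^'n \<Rightarrow> 'n list \<Rightarrow> real"
 assumes O: "open \<Omega>" and f: "(\<lambda>x. f x l) \<in> borel_measurable (lebesgue_on \<Omega>)"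
  and h: "(\<lambda>x. h x l) \<in> borel_measurable borel" "AE x in lborel. x \<in> \<Omega> \<longrightarrow> h x = f x"
  and k: "k \<in> borel_measurable borel" "\<And>x. x \<notin> \<Omega> \<Longrightarrow> k x = 0"
 shows "(LINT x|lebesgue_on \<Omega>. f x l * k x) = (LBINT x. h x l * k x)"
proof -
 have O': "\<Omega> \<inter> space lebesgue \<in> sets lebesgue" using O by simp
 have m: "(\<lambda>x. f x l * k x) \<in> borel_measurable (lebesgue_on \<Omega>)"
  by (intro borel_measurable_times f measurable_restrict_space1 borel_lebesgue k)
 have "(LINT x|lebesgue_on \<Omega>. f x l * k x) = (LINT x|lebesgue. indicator \<Omega> x *\<^sub>R (f x l * k x))"
  by (rule integral_restrict_space[OF O'])
 also have "\<dots> = (LINT x|lebesgue. h x l * k x)"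
 proof (rule integral_cong_AE)
  show "(\<lambda>x. indicator \<Omega> x *\<^sub>R (f x l * k x)) \<in> borel_measurable lebesgue"
   using m unfolding borel_measurable_restrict_space_iff[OF O'] .
  show "(\<lambda>x. h x l * k x) \<in> borel_measurable lebesgue"
   by (intro borel_lebesgue borel_measurable_times h k)
  show "AE x in lebesgue. indicator \<Omega> x *\<^sub>R (f x l * k x) = h x l * k x"
   unfolding AE_completion_iff using h(2)
  proof eventually_elim
   case (elim x)
   then show ?case using k(2)[of x] by (cases "x \<in> \<Omega>") auto
  qed
 qed
 also have "\<dots> = (LBINT x. h x l * k x)"
  by (rule integral_completion) (use h k in simp)
 finally show ?thesis .
qed

lemma test_fun_C1c: "test_fun \<Omega> g \<Longrightarrow> C1c \<Omega> g"
 using smooth_on_C2 by (auto simp: test_fun_def C1c_def C2_on_def)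

lemma wdiv_expand:
 fixes u :: "real^'n \<Rightarrow> 'n list \<Rightarrow> real"
 assumes U: "open U" and u: "\<And>l. loc2 U (\<lambda>x. u x l)" and g: "C1c U g"
 shows "(\<Sum>j\<in>UNIV. LBINT x. dA u l j x * pd j g x)
  = (\<Sum>s<length l. (-1) ^ s * (LBINT x. u x (take s l @ drop (Suc s) l) * pd (l ! s) g x))"
 unfolding integral_dA[OF U u C1c_pd_Cc[OF g]] by (subst sum.swap) simp

lemma fnorm2_LL: "fnorm2 p c = (nsq p c) / fact p"
 by (simp add: fnorm2_def finner_def LL_def power2_eq_square)

lemma L2loc_loc2:
 fixes f h :: "real^'n \<Rightarrow> 'n list \<Rightarrow> real"
 assumes f: "L2loc p \<Omega> f" and h: "\<And>x. altform p (h x)" "\<And>l. (\<lambda>x. h x l) \<in> borel_measurable borel"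
  "AE x in lborel. x \<in> \<Omega> \<longrightarrow> h x = f x"
 shows "loc2 \<Omega> (\<lambda>x. h x l)"
proof (cases "l \<in> LL p")
 case True
 have [measurable]: "(\<lambda>x. h x l) \<in> borel_measurable borel" for l by (rule h)
 have "integrable lborel (\<lambda>x. indicator K x * (h x l)\<^sup>2)" if K: "compact K" "K \<subseteq> \<Omega>" for K
 proof (rule integrableI_bounded)
  have [measurable]: "K \<in> sets borel" using K by (simp add: borel_closed compact_imp_closed)
  show "(\<lambda>x. indicator K x * (h x l)\<^sup>2) \<in> borel_measurable lborel" by simp
  have "(\<integral>\<^sup>+ x\<in>K. ennreal (fnorm2 p (f x)) \<partial>lebesgue) = (\<integral>\<^sup>+ x. ennreal (fnorm2 p (h x)) * indicator K x \<partial>lborel)"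
   unfolding nn_integral_completion
  proof (rule nn_integral_cong_AE)
   show "AE x in lborel. ennreal (fnorm2 p (f x)) * indicator K x = ennreal (fnorm2 p (h x)) * indicator K x"
    using h(3) by eventually_elim (use K in \<open>auto simp: indicator_def\<close>)
  qed
  moreover have "(\<integral>\<^sup>+ x\<in>K. ennreal (fnorm2 p (f x)) \<partial>lebesgue) < \<infinity>"
   using f K unfolding L2loc_def by blast
  ultimately have fin: "(\<integral>\<^sup>+ x. ennreal (fnorm2 p (h x)) * indicator K x \<partial>lborel) < \<infinity>"
   by (simp only:)
  have "(\<integral>\<^sup>+x. ennreal (norm (indicator K x * (h x l)\<^sup>2)) \<partial>lborel)
    \<le> (\<integral>\<^sup>+ x. ennreal (fact p) * (ennreal (fnorm2 p (h x)) * indicator K x) \<partial>lborel)"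
  proof (rule nn_integral_mono)
   fix x
   have "(h x l)\<^sup>2 \<le> (nsq p (h x))" by (rule member_le_sum[OF True]) auto
   also have "\<dots> = fact p * fnorm2 p (h x)" by (simp add: fnorm2_LL)
   finally have "ennreal ((h x l)\<^sup>2) \<le> ennreal (fact p) * ennreal (fnorm2 p (h x))"
    by (simp add: ennreal_mult[symmetric] ennreal_leI fnorm2_LL sum_nonneg)
   then show "ennreal (norm (indicator K x * (h x l)\<^sup>2)) \<le> ennreal (fact p) * (ennreal (fnorm2 p (h x)) * indicator K x)"
    by (cases "x \<in> K") auto
  qed
  also have "\<dots> = ennreal (fact p) * (\<integral>\<^sup>+ x. ennreal (fnorm2 p (h x)) * indicator K x \<partial>lborel)"
   unfolding fnorm2_LL by (rule nn_integral_cmult) measurable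
  also have "\<dots> < \<infinity>" using fin by (simp add: ennreal_mult_less_top)
  finally show "(\<integral>\<^sup>+x. ennreal (norm (indicator K x * (h x l)\<^sup>2)) \<partial>lborel) < \<infinity>" .
 qed
 then show ?thesis using h(2) by (simp add: loc2_def)
next
 case False
 then have "(\<lambda>x. h x l) = (\<lambda>x. 0)" using h(1) by (auto simp: altform_iff LL_def)
 then show ?thesis by (simp add: loc2_zero)
qed

lemma weakly_closed_wd:
 fixes f h :: "real^'n \<Rightarrow> 'n list \<Rightarrow> real"
 assumes O: "open \<Omega>" and f: "measurable_form p \<Omega> f" "weakly_closed p \<Omega> f"
  and h: "\<And>l. loc2 \<Omega> (\<lambda>x. h x l)" "AE x in lborel. x \<in> \<Omega> \<longrightarrow> h x = f x"
 shows "wd p \<Omega> h (\<lambda>x l. 0)"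
 unfolding wd_def
proof
 fix l :: "'n list" assume l: "l \<in> LL (Suc p)"
 show "wdiv \<Omega> (dA h l) (\<lambda>x. 0)"
 proof (rule wdivI_test[OF O loc2_dA[OF h(1)] loc2_zero])
  fix g assume g: "test_fun \<Omega> g" and gC: "C1c \<Omega> g"
  have "(LINT x|lebesgue_on \<Omega>. f x m * pd j g x) = (LBINT x. h x m * pd j g x)" for j m
  proof (rule lebesgue_on_pairing[OF O _ _ h(2)])
   show "(\<lambda>x. f x m) \<in> borel_measurable (lebesgue_on \<Omega>)" using f by (simp add: measurable_form_def)
   show "(\<lambda>x. h x m) \<in> borel_measurable borel" using h(1) by (simp add: loc2_def)
   show "pd j g \<in> borel_measurable borel"
    by (rule borel_measurable_continuous_onI[OF Cc_continuous_UNIV[OF C1c_pd_Cc[OF gC] O]])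
   show "pd j g x = 0" if "x \<notin> \<Omega>" for x
    using C1c_pd_Cc[OF gC, of j] that by (auto simp: Cc_def)
  qed
  note e = this
  have "(LINT x|lebesgue_on \<Omega>. 0 * g x) =
    - (\<Sum>s<Suc p. (-1) ^ s * (LINT x|lebesgue_on \<Omega>. f x (take s l @ drop (Suc s) l) * pd (l ! s) g x))"
   using f(2) g l unfolding weakly_closed_def weak_d_def LL_def by blast
  then have "(\<Sum>s<length l. (-1) ^ s * (LBINT x. h x (take s l @ drop (Suc s) l) * pd (l ! s) g x)) = 0"
   using l by (simp add: e LL_def del: sum.lessThan_Suc)
  then show "(\<Sum>j\<in>UNIV. LBINT x. dA h l j x * pd j g x) = - (LBINT x. 0 * g x)"
   by (simp add: wdiv_expand[OF O h(1) gC])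
 qed
qed

lemma wd_weak_d:
 fixes u f h :: "real^'n \<Rightarrow> 'n list \<Rightarrow> real"
 assumes O: "open \<Omega>" and u: "\<And>l. loc2 \<Omega> (\<lambda>x. u x l)" and wd: "wd q \<Omega> u h"
  and f: "measurable_form (Suc q) \<Omega> f" and h: "\<And>l. loc2 \<Omega> (\<lambda>x. h x l)" "AE x in lborel. x \<in> \<Omega> \<longrightarrow> h x = f x"
 shows "weak_d q \<Omega> u f"
 unfolding weak_d_def
proof (intro allI impI)
 fix g and l :: "'n list" assume g: "test_fun \<Omega> g" and l: "length l = Suc q"
 have gC: "C1c \<Omega> g" by (rule test_fun_C1c[OF g])
 have um: "(\<lambda>x. u x m) \<in> borel_measurable borel" for m using u by (simp add: loc2_def)
 have "(LINT x|lebesgue_on \<Omega>. f x l * g x) = (LBINT x. h x l * g x)"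
 proof (rule lebesgue_on_pairing[OF O _ _ h(2)])
  show "(\<lambda>x. f x l) \<in> borel_measurable (lebesgue_on \<Omega>)" using f by (simp add: measurable_form_def)
  show "(\<lambda>x. h x l) \<in> borel_measurable borel" using h(1) by (simp add: loc2_def)
  show "g \<in> borel_measurable borel"
   by (rule borel_measurable_continuous_onI[OF Cc_continuous_UNIV[OF C1c_Cc[OF gC] O]])
  show "g x = 0" if "x \<notin> \<Omega>" for x using gC that by (auto simp: C1c_def)
 qed
 moreover have "(LINT x|lebesgue_on \<Omega>. u x m * pd j g x) = (LBINT x. u x m * pd j g x)" for j m
 proof (rule lebesgue_on_pairing[OF O _ um])
  show "(\<lambda>x. u x m) \<in> borel_measurable (lebesgue_on \<Omega>)"
   by (intro measurable_restrict_space1 borel_lebesgue um)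
  show "pd j g \<in> borel_measurable borel"
   by (rule borel_measurable_continuous_onI[OF Cc_continuous_UNIV[OF C1c_pd_Cc[OF gC] O]])
  show "pd j g x = 0" if "x \<notin> \<Omega>" for x
   using C1c_pd_Cc[OF gC, of j] that by (auto simp: Cc_def)
 qed simp
 moreover have "(\<Sum>j\<in>UNIV. LBINT x. dA u l j x * pd j g x) = - (LBINT x. h x l * g x)"
  using wd wdivD[OF _ gC] l by (simp add: wd_def LL_def)
 ultimately show "(LINT x|lebesgue_on \<Omega>. f x l * g x) =
   - (\<Sum>s<Suc q. (-1) ^ s * (LINT x|lebesgue_on \<Omega>. u x (take s l @ drop (Suc s) l) * pd (l ! s) g x))"
  unfolding wdiv_expand[OF O u gC] l by simp
qed

text \<open>\<open>F\<close> is not assumed measurable, so the integral is a supremum over simple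
  functions below it: dividing a simple function below c F by c gives one below F. The inequality is
  used for the integrand with the inverse of F, about whose measurability nothing is shown.\<close>

lemma nn_integral_cmult_le:
 assumes c: "0 < (c :: real)"
 shows "(\<integral>\<^sup>+x. ennreal c * F x \<partial>M) \<le> ennreal c * (\<integral>\<^sup>+x. F x \<partial>M)"
 unfolding nn_integral_def[of M "\<lambda>x. ennreal c * F x"]
proof (rule SUP_least)
 fix g assume "g \<in> {g. simple_function M g \<and> g \<le> (\<lambda>x. ennreal c * F x)}"
 then have g: "simple_function M g" "\<And>x. g x \<le> ennreal c * F x" by (auto simp: le_fun_def)
 have cc: "ennreal c * ennreal (1 / c) = 1" "ennreal (1 / c) * ennreal c = 1"
  using c by (simp_all add: ennreal_mult[symmetric])
 have gm: "g \<in> borel_measurable M" by (rule borel_measurable_simple_function[OF g(1)])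
 have "integral\<^sup>S M g = (\<integral>\<^sup>+x. g x \<partial>M)" by (rule nn_integral_eq_simple_integral[OF g(1), symmetric])
 also have "\<dots> = (\<integral>\<^sup>+x. ennreal c * (ennreal (1 / c) * g x) \<partial>M)"
  by (simp only: mult.assoc[symmetric] cc mult_1_left)
 also have "\<dots> = ennreal c * (\<integral>\<^sup>+x. ennreal (1 / c) * g x \<partial>M)"
  using gm by (intro nn_integral_cmult) measurable
 also have "\<dots> \<le> ennreal c * (\<integral>\<^sup>+x. F x \<partial>M)"
 proof (intro mult_left_mono nn_integral_mono)
  fix x
  have "ennreal (1 / c) * g x \<le> ennreal (1 / c) * (ennreal c * F x)" by (intro mult_left_mono g) simp
  then show "ennreal (1 / c) * g x \<le> F x" by (simp only: mult.assoc[symmetric] cc mult_1_left)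
 qed simp
 finally show "integral\<^sup>S M g \<le> ennreal c * (\<integral>\<^sup>+x. F x \<partial>M)" .
qed

text \<open>The Hessian of -exp(-psi) is exp(-psi) times the Hessian of psi minus the square of the
  gradient. Its positivity on forms says that the Hessian form of psi dominates the squared
  contraction with the gradient, and in particular is nonnegative.\<close>

lemma exp_psh_weight:
 fixes \<psi> :: "real^'n \<Rightarrow> real"
 assumes O: "open \<Omega>" and \<psi>: "C2_on \<Omega> \<psi>" and psh: "p_psh (Suc q) \<Omega> (\<lambda>x. - exp (- \<psi> x))" and x: "x \<in> \<Omega>"
 shows "p_psd (Suc q) (hess \<psi> x)"
  "alt g \<Longrightarrow> (\<Sum>I\<in>LL q. (\<Sum>j\<in>UNIV. pd j \<psi> x * g (j # I))\<^sup>2) \<le> Qf (hess \<psi> x) q g"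
proof -
 let ?E = "\<lambda>x. - exp (- \<psi> x)"
 have "hess (\<lambda>x. (\<lambda>t. - exp (- t)) (\<psi> x)) x = (\<lambda>t. exp (- t)) (\<psi> x) *\<^sub>R hess \<psi> x
   + (\<lambda>t. - exp (- t)) (\<psi> x) *\<^sub>R (\<chi> j k. pd j \<psi> x * pd k \<psi> x)"
  by (rule hess_compose(3)[OF O \<psi> _ _ _ x]) (auto intro!: derivative_eq_intros continuous_intros)
 then have hE: "hess ?E x = exp (- \<psi> x) *\<^sub>R hess \<psi> x + (- exp (- \<psi> x)) *\<^sub>R (\<chi> j k. pd j \<psi> x * pd k \<psi> x)" by simp
 have E: "p_psd (Suc q) (hess ?E x)" using psh x by (simp add: p_psh_def)
 have Q: "(\<Sum>I\<in>LL q. (\<Sum>j\<in>UNIV. pd j \<psi> x * g (j # I))\<^sup>2) \<le> Qf (hess \<psi> x) q g" if "alt g" for g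
 proof -
  have "0 \<le> exp (- \<psi> x) * (Qf (hess \<psi> x) q g - (\<Sum>I\<in>LL q. (\<Sum>j\<in>UNIV. pd j \<psi> x * g (j # I))\<^sup>2))"
   using Qf_nonneg[OF E that] unfolding hE Qf_add Qf_scale Qf_rank1 by (simp add: algebra_simps)
  then show ?thesis by (simp add: zero_le_mult_iff)
 qed
 then show "alt g \<Longrightarrow> (\<Sum>I\<in>LL q. (\<Sum>j\<in>UNIV. pd j \<psi> x * g (j # I))\<^sup>2) \<le> Qf (hess \<psi> x) q g" .
 show "p_psd (Suc q) (hess \<psi> x)"
 proof (rule p_psdI)
  \<comment> \<open>Symmetry is part of \<open>p_psd\<close>; since the rank one term is symmetric,
    it passes from the Hessian of -exp(-psi) to that of psi.\<close>
  have "hess ?E x $ k $ j = hess ?E x $ j $ k" for j k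
   using arg_cong[OF p_psd_transpose[OF E], of "\<lambda>M. M $ j $ k"] unfolding transpose_def vec_lambda_beta .
  then have "hess \<psi> x $ k $ j = hess \<psi> x $ j $ k" for j k
   unfolding hE by (simp add: mult.commute[of "pd k \<psi> x"])
  then show "transpose (hess \<psi> x) = hess \<psi> x" by (simp add: transpose_def vec_eq_iff)
  show "0 \<le> Qf (hess \<psi> x) q g" if "alt g" for g
   by (rule order_trans[OF _ Q[OF that]]) (simp add: sum_nonneg)
 qed
qed

theorem theorem4p1:
 fixes \<Omega> :: "(real^'n) set" and p :: nat and \<phi> \<psi> :: "real^'n \<Rightarrow> real"
  and \<alpha> :: real and f :: "real^'n \<Rightarrow> 'n list \<Rightarrow> real"
 assumes "1 \<le> p" and "p \<le> CARD('n)"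
  and "p_convex p \<Omega>" and "connected \<Omega>"
  and "p_psh p \<Omega> \<phi>"
  and "Ck_on 2 \<Omega> \<psi>" and "p_psh p \<Omega> (\<lambda>x. - exp (- \<psi> x))"
  and "0 \<le> \<alpha>" and "\<alpha> < 1"
  and "L2loc p \<Omega> f" and "weakly_closed p \<Omega> f"
  and "AE x in lebesgue_on \<Omega>. f x \<in> Fim p (hess \<psi> x)"
  and "(\<integral>\<^sup>+ x\<in>\<Omega>. ennreal (finner p (Finv p (hess \<psi> x) (f x)) (f x) * exp (- \<phi> x + \<alpha> * \<psi> x)) \<partial>lebesgue) < \<infinity>"
 shows "\<exists>u. L2w (p - 1) \<Omega> (\<lambda>x. \<phi> x - \<alpha> * \<psi> x) u \<and> weak_d (p - 1) \<Omega> u f \<and>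
     wnorm2 (p - 1) \<Omega> (\<lambda>x. \<phi> x - \<alpha> * \<psi> x) u
      \<le> ennreal (4 / (1 - \<alpha>)^2) *
       (\<integral>\<^sup>+ x\<in>\<Omega>. ennreal (finner p (Finv p (hess \<psi> x) (f x)) (f x) * exp (- \<phi> x + \<alpha> * \<psi> x)) \<partial>lebesgue)"
proof -
 obtain q where p: "p = Suc q" using assms(1) by (cases p) auto
 define w where "w x = \<phi> x - \<alpha> * \<psi> x" for x
 define F where "F x = finner (Suc q) (Finv (Suc q) (hess \<psi> x) (f x)) (f x)" for x
 define J where "J = (\<integral>\<^sup>+ x\<in>\<Omega>. ennreal (F x * exp (- \<phi> x + \<alpha> * \<psi> x)) \<partial>lebesgue)"
 have Jfin: "J < \<infinity>" using assms(13) by (simp add: J_def F_def p)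
 have O: "open \<Omega>" using assms(3) by (simp add: p_convex_def)
 have \<phi>: "C2_on \<Omega> \<phi>" using assms(5) Ck_on_2_C2_on by (auto simp: p_psh_def)
 have \<psi>: "C2_on \<Omega> \<psi>" using assms(6) by (rule Ck_on_2_C2_on)
 note psd\<psi> = exp_psh_weight(1)[OF O \<psi> assms(7)[unfolded p]]
  and Q\<psi> = exp_psh_weight(2)[OF O \<psi> assms(7)[unfolded p]]
 have Q\<phi>: "0 \<le> Qf (hess \<phi> x) q g" if "x \<in> \<Omega>" "alt g" for x g
  using Qf_nonneg[OF _ that(2)] assms(5) that(1) by (simp add: p_psh_def p)
 have w1: "C1_on \<Omega> w"
 proof -
  have "C1_on \<Omega> (\<lambda>x. \<phi> x + (- \<alpha>) * \<psi> x)" using \<phi> \<psi> by (intro C1_on_add C1_on_cmult) (auto simp: C2_on_def)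
  then show ?thesis by (simp add: w_def[abs_def])
 qed
 note wc = C1_onD(1)[OF w1]
 have fm: "measurable_form (Suc q) \<Omega> f" and fL: "L2loc (Suc q) \<Omega> f" using assms(10) by (auto simp: L2loc_def p)
 obtain h where h: "\<And>x. altform (Suc q) (h x)" "\<And>l. (\<lambda>x. h x l) \<in> borel_measurable borel"
  and hf: "AE x in lborel. x \<in> \<Omega> \<longrightarrow> h x = f x"
  using borel_version[OF O fm] by blast
 have hl: "loc2 \<Omega> (\<lambda>x. h x l)" for l by (rule L2loc_loc2[OF fL h hf])
 have hcl: "wd (Suc q) \<Omega> h (\<lambda>x l. 0)"
  by (rule weakly_closed_wd[OF O fm _ hl hf]) (use assms(11) in \<open>simp add: p\<close>)
 have Fim: "AE x in lborel. x \<in> \<Omega> \<longrightarrow> f x \<in> Fim (Suc q) (hess \<psi> x)"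
  using assms(12) AE_restrict_space_iff[of \<Omega> lebesgue] O by (simp add: AE_completion_iff p)
 \<comment> \<open>The two factors of \<open>Finv_bound\<close>: (q + 1)! from the normalisation of
   \<open>finner\<close> and q + 1 from passing between F and \<open>Qf\<close>.\<close>
 define m :: real where "m = fact (Suc q) * real (Suc q)"
 have m: "0 < m" unfolding m_def by (intro mult_pos_pos fact_gt_zero) simp
 \<comment> \<open>The value 0 is taken where f is outside the image of F. This happens on a null
   set only, and it makes the majorant nonnegative everywhere, whatever the definite description
   yields there.\<close>
 define A where "A x = (if x \<in> \<Omega> \<and> f x \<in> Fim (Suc q) (hess \<psi> x) then m * F x else 0)" for x
 have F0: "0 \<le> F x" if "x \<in> \<Omega>" "f x \<in> Fim (Suc q) (hess \<psi> x)" for x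
  unfolding F_def by (rule Finv_bound(1)[OF psd\<psi>[OF that(1)] that(2) alt_zero])
 have A0: "0 \<le> A x" for x using F0[of x] m by (simp add: A_def)
 have le: "AE x in lborel. x \<in> \<Omega> \<longrightarrow> (\<forall>g. alt g \<longrightarrow> (\<Sum>l\<in>LL (Suc q). h x l * g l)\<^sup>2 \<le> A x * Qf (hess \<psi> x) q g)"
  using hf Fim
 proof eventually_elim
  case (elim x)
  show ?case
  proof (intro impI allI)
   fix g assume x: "x \<in> \<Omega>" and g: "alt (g :: 'n list \<Rightarrow> real)"
   from Finv_bound(2)[OF psd\<psi>[OF x] _ g, of "f x"]
   show "(\<Sum>l\<in>LL (Suc q). h x l * g l)\<^sup>2 \<le> A x * Qf (hess \<psi> x) q g"
    using elim x by (simp add: A_def m_def F_def mult_ac del: of_nat_Suc fact_Suc)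
  qed
 qed
 define a where "a = sqrt (m * enn2real J)"
 have a: "0 \<le> a" "a\<^sup>2 = m * enn2real J" using m by (simp_all add: a_def)
 have aA: "(\<integral>\<^sup>+x. ennreal (wt \<Omega> w x * A x) \<partial>lborel) \<le> ennreal (a\<^sup>2)"
 proof -
  have "(\<integral>\<^sup>+x. ennreal (wt \<Omega> w x * A x) \<partial>lborel)
    \<le> (\<integral>\<^sup>+x. ennreal m * (ennreal (F x * exp (- \<phi> x + \<alpha> * \<psi> x)) * indicator \<Omega> x) \<partial>lborel)"
  proof (rule nn_integral_mono)
   fix x
   show "ennreal (wt \<Omega> w x * A x) \<le> ennreal m * (ennreal (F x * exp (- \<phi> x + \<alpha> * \<psi> x)) * indicator \<Omega> x)"
   proof (cases "x \<in> \<Omega> \<and> f x \<in> Fim (Suc q) (hess \<psi> x)")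
    case True
    then have "wt \<Omega> w x * A x = m * (F x * exp (- \<phi> x + \<alpha> * \<psi> x))"
     by (simp add: A_def w_def)
    then show ?thesis using True F0[of x] m by (simp add: ennreal_mult)
   next
    case False
    then have "A x = 0" unfolding A_def by (rule if_not_P)
    then show ?thesis by simp
   qed
  qed
  also have "\<dots> \<le> ennreal m * (\<integral>\<^sup>+x. ennreal (F x * exp (- \<phi> x + \<alpha> * \<psi> x)) * indicator \<Omega> x \<partial>lborel)"
   by (rule nn_integral_cmult_le[OF m])
  also have "(\<integral>\<^sup>+x. ennreal (F x * exp (- \<phi> x + \<alpha> * \<psi> x)) * indicator \<Omega> x \<partial>lborel) = J"
   by (simp add: J_def nn_integral_completion)
  also have "ennreal m * J = ennreal (a\<^sup>2)"
   using Jfin m by (simp add: a(2) ennreal_mult)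
  finally show ?thesis .
 qed
 obtain r where r1: "C2_on \<Omega> r" and r2: "\<forall>c. compact {x\<in>\<Omega>. r x \<le> c}"
  and r3: "\<forall>x g. x \<in> \<Omega> \<longrightarrow> alt g \<longrightarrow> 2 * (nsq (Suc q) g) \<le> Qf (hess r x) q g"
  using p_convex_exhaustion[OF assms(3)[unfolded p]] by (elim exE conjE) (rule that; assumption)
 note r = r1 r2[rule_format] r3[rule_format]
 \<comment> \<open>This is the bound that \<open>local_solution\<close> gives on every sublevel
   set.\<close>
 define C where "C = 2 / (1 - \<alpha>) * (a / Suc q)"
 have C: "0 \<le> C" using a assms(9) by (simp add: C_def)
 have "\<exists>u. formL2 \<Omega> w q u \<and> nrm2 (LL q) (wm \<Omega> w) u \<le> C\<^sup>2 \<and> wd q \<Omega> u h"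
 proof (rule solve_from_bound[OF O w1 altform_alt[OF h(1)] hl C])
  fix g :: "real^'n \<Rightarrow> 'n list \<Rightarrow> real" assume g: "testform (Suc q) \<Omega> g"
  have gC: "C1c \<Omega> (\<lambda>x. g x l)" for l using g by (simp add: testform_def)
  have "\<exists>c. C1c {x\<in>\<Omega>. r x < c} (\<lambda>x. g x l)" for l
  proof -
   obtain S where S: "compact S" "S \<subseteq> \<Omega>" "\<And>x. x \<notin> S \<Longrightarrow> g x l = 0" using gC[of l] by (auto simp: C1c_def)
   have "continuous_on S r" using r(1) S(2) by (auto simp: C2_on_def C1_on_def intro: continuous_on_subset)
   then have "bounded (r ` S)" using S(1) by (intro compact_imp_bounded compact_continuous_image)
   then obtain B where "\<And>x. x \<in> S \<Longrightarrow> \<bar>r x\<bar> \<le> B" unfolding bounded_real by blast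
   then have "S \<subseteq> {x\<in>\<Omega>. r x < B + 1}" using S(2) by force
   then show ?thesis using S gC[of l] unfolding C1c_def by blast
  qed
  then obtain c where c: "\<And>l. C1c {x\<in>\<Omega>. r x < c l} (\<lambda>x. g x l)" by metis
  \<comment> \<open>Coefficients whose list has a length other than q + 1 vanish, so finitely many
    compact supports are involved and one sublevel set contains them all.\<close>
  define b where "b = Max (c ` LL (Suc q))"
  let ?U = "{x\<in>\<Omega>. r x < b}"
  have gU: "testform (Suc q) ?U g"
  proof -
   have "C1c ?U (\<lambda>x. g x l)" for l
   proof (cases "l \<in> LL (Suc q)")
    case True
    then have "c l \<le> b" unfolding b_def by (intro Max_ge) auto
    then show ?thesis by (intro C1c_mono[OF c[of l]]) auto
   next
    case False
    then have "(\<lambda>x. g x l) = (\<lambda>x. 0)" using g by (auto simp: testform_def altform_iff LL_def)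
    then show ?thesis by (simp add: C1c_zero)
   qed
   then show ?thesis using g by (simp add: testform_def)
  qed
  have sd: "sublevel_domain q ?U b r" by (rule sublevel_domainI[OF O r])
  then have U: "open ?U" by (simp add: sublevel_domain_def)
  have UO: "?U \<subseteq> \<Omega>" by auto
  have wU: "C1_on ?U w" by (rule C1_on_subset[OF w1 UO])
  note wUc = C1_onD(1)[OF wU]
  have UK: "?U \<subseteq> {x\<in>\<Omega>. r x \<le> b}" and KO: "{x\<in>\<Omega>. r x \<le> b} \<subseteq> \<Omega>" by auto
  obtain u where u: "formL2 ?U w q u" "wd q ?U u h" "sqrt (nrm2 (LL q) (wm ?U w) u) \<le> C"
   using local_solution[OF sd r(2)[of b] UK KO \<phi> \<psi> Q\<phi> Q\<psi> h(1) hl hcl A0 le a(1) aA[unfolded w_def] assms(8,9)]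
   unfolding w_def[symmetric] C_def[symmetric] by blast
  have dm: "(\<lambda>x. dst w g x I) \<in> borel_measurable borel" for I
   by (rule borel_measurable_continuous_onI[OF Cc_continuous_UNIV[OF Cc_dst[OF w1 g] O]])
  have nd: "nrm2 (LL q) (wm ?U w) (dst w g) = nrm2 (LL q) (wm \<Omega> w) (dst w g)"
   unfolding ip_def wm_integral_Cc[OF U wUc Cc_dst[OF wU gU] dm] wm_integral_Cc[OF O wc Cc_dst[OF w1 g] dm] ..
  \<comment> \<open>The local solution is used only here: it expresses the pairing of f with g by
    the adjoint of g, so its norm bounds the functional by C.\<close>
  have "(\<Sum>l\<in>LL (Suc q). LBINT x. h x l * g x l * exp (- w x))
    = Suc q * (\<Sum>I\<in>LL q. LBINT x. u x I * dst w g x I * exp (- w x))"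
   by (rule wd_pairing[OF U wU gU formL2_loc2[OF U wUc u(1)] u(2)])
  also have "\<dots> = Suc q * ip (LL q) (wm ?U w) u (dst w g)"
   unfolding ip_def wm_integral_Cc[OF U wUc Cc_dst[OF wU gU] formL2D(3)[OF u(1)]] ..
  finally have e: "(\<Sum>l\<in>LL (Suc q). LBINT x. h x l * g x l * exp (- w x)) = Suc q * ip (LL q) (wm ?U w) u (dst w g)" .
  have "\<bar>ip (LL q) (wm ?U w) u (dst w g)\<bar> \<le> sqrt (nrm2 (LL q) (wm ?U w) u) * sqrt (nrm2 (LL q) (wm ?U w) (dst w g))"
   by (rule ip_Cauchy_Schwarz_sqrt[OF formL2D(4)[OF u(1)] formL2D(4)[OF formL2_dst[OF U wU gU]]])
  also have "\<dots> \<le> C * sqrt (nrm2 (LL q) (wm \<Omega> w) (dst w g))"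
   unfolding nd by (intro mult_right_mono u) (simp add: ip_nonneg)
  finally have "Suc q * \<bar>ip (LL q) (wm ?U w) u (dst w g)\<bar> \<le> Suc q * (C * sqrt (nrm2 (LL q) (wm \<Omega> w) (dst w g)))"
   by (rule mult_left_mono) simp
  then show "\<bar>\<Sum>l\<in>LL (Suc q). \<integral>x. h x l * g x l * exp (- w x) \<partial>lborel\<bar>
    \<le> Suc q * C * sqrt (nrm2 (LL q) (wm \<Omega> w) (dst w g))"
   unfolding e abs_mult by (simp add: mult.assoc del: of_nat_Suc)
 qed
 then obtain u where u: "formL2 \<Omega> w q u" "nrm2 (LL q) (wm \<Omega> w) u \<le> C\<^sup>2" "wd q \<Omega> u h" by blast
 have ul: "loc2 \<Omega> (\<lambda>x. u x l)" for l by (rule formL2_loc2[OF O wc u(1)])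
 have umf: "measurable_form q \<Omega> u"
  unfolding measurable_form_def
  using formL2D(1)[OF u(1)] formL2D(3)[OF u(1)] by (auto intro!: measurable_restrict_space1 borel_lebesgue)
 have "wnorm2 q \<Omega> w u = (\<integral>\<^sup>+x. ennreal (wt \<Omega> w x * (1 / fact q * (nsq q (u x)))) \<partial>lborel)"
  unfolding wnorm2_def nn_integral_completion by (intro nn_integral_cong) (simp add: fnorm2_LL indicator_def mult_ac)
 also have "\<dots> = ennreal (1 / fact q * nrm2 (LL q) (wm \<Omega> w) u)"
  by (rule nrm2_nn_lborel[OF O wc u(1)]) simp
 also have "\<dots> \<le> ennreal (1 / fact q * C\<^sup>2)" by (intro ennreal_leI mult_left_mono u) simp
 \<comment> \<open>The combinatorial factors cancel: m / (q + 1)^2 = q!, and dividing by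
   \<open>fact q\<close> returns from sums over all lists to the norm of the statement.\<close>
 also have "1 / fact q * C\<^sup>2 = 4 / (1 - \<alpha>)\<^sup>2 * enn2real J"
 proof -
  have "C\<^sup>2 = 4 / (1 - \<alpha>)\<^sup>2 * (m * enn2real J / (real (Suc q))\<^sup>2)"
   by (simp only: C_def power_mult_distrib power_divide a(2)) simp
  moreover have "m / (real (Suc q))\<^sup>2 = fact q"
   by (simp add: m_def power2_eq_square del: of_nat_Suc)
  ultimately show ?thesis by (simp del: of_nat_Suc add: field_simps)
 qed
 also have "ennreal \<dots> = ennreal (4 / (1 - \<alpha>)\<^sup>2) * J"
  using Jfin by (subst ennreal_mult) simp_all
 finally have wn: "wnorm2 q \<Omega> w u \<le> ennreal (4 / (1 - \<alpha>)\<^sup>2) * J" .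
 also have "\<dots> < \<infinity>" using Jfin by (simp add: ennreal_mult_less_top)
 finally have "L2w q \<Omega> w u" using umf by (simp add: L2w_def)
 moreover have "weak_d q \<Omega> u f" by (rule wd_weak_d[OF O ul u(3) fm hl hf])
 ultimately show ?thesis using wn unfolding w_def[abs_def] J_def F_def p by auto
qed

end
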